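(* Let $e\ge 3$, let $h=(1,3,\dots,3,2)$ be a level $h$-vector of socle degree $e$ (so $h_0=1$, $h_1=h_{e-1}=3$, $h_e=2$), let $R=k[x_1,x_2,x_3]$, and let $j=h_{\lfloor e/2\rfloor}$. If $j>3$, then there is exactly one minimal free resolution $\mathbf{F}$ associated to $h$. It has $$F_1=R^2(-2)\oplus R(-(j-1))\oplus R(-(e-j+3))\oplus R(-(e+1)).$$ If $j=3$ (i.e. if $h=(1,3,3,\dots,3,3,2)$), then there are exactly two minimal free resolutions $\mathbf{F}$ associated to $h$. They have $$F_1=R^3(-2)\oplus R(-e)\oplus R^{\gamma}(-(e+1)),$$ with $\gamma=0$ or $\gamma=1$.
   Context: Let $k$ be a field of characteristic zero. Algebras $A=R/I$ are standard graded artinian quotients of $R=k[x_1,x_2,x_3]$ by a homogeneous ideal $I$ containing no nonzero linear forms. The $h$-vector of $A$ is $(h_0,h_1,\dots,h_e)$, $h_i=\dim_k A_i$, where $e$ (the socle degree) is the last index with $\dim_k A_e>0$. The socle of $A$ is the annihilator of the maximal homogeneous ideal of $A$, and $s_i=\dim_k\mathrm{soc}(A)_i$. $A$ is level if $s_i=0$ for all $i<e$; its type is then $s_e=h_e$. A vector is a level $h$-vector if it is the $h$-vector of some level algebra. The (graded) minimal free resolution of $A$ has the form $$0\to F_3\to F_2\to F_1\to R\to R/I\to 0,\qquad F_i=\bigoplus_{l}R^{\beta_{i,l}}(-l),$$ with all maps of degree $0$, the $\beta_{i,l}$ being the graded Betti numbers of $A$; $\beta_{1,l}$ is the number of minimal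 generators of $I$ in degree $l$. The minimal free resolutions associated to a level $h$-vector $h$ are those of the level algebras having $h$-vector $h$, where two resolutions are identified if they have the same graded Betti numbers (i.e. the same graded free modules $F_1,F_2,F_3$). *)

theory Defs
  imports
    "HOL-Library.Poly_Mapping"
    "HOL-Library.Numeral_Type"
    "HOL-Library.Multiset"
    "Jordan_Normal_Form.Matrix_Kernel"
begin

section \<open>The polynomial ring in three variables\<close>

text \<open>Monomials are exponent vectors, indexed by the three-element type \<open>3\<close>; a polynomial is a
  finitely supported map from monomials to coefficients.\<close>

type_synonym 'k poly3 = "(3 \<Rightarrow>\<^sub>0 nat) \<Rightarrow>\<^sub>0 'k"

definition const3 :: "'k::field_char_0 \<Rightarrow> 'k poly3" where
  "const3 c = Poly_Mapping.single 0 c"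

definition X :: "3 \<Rightarrow> 'k::field_char_0 poly3" where
  "X i = Poly_Mapping.single (Poly_Mapping.single i 1) 1"

definition mdeg :: "(3 \<Rightarrow>\<^sub>0 nat) \<Rightarrow> nat" where
  "mdeg m = (\<Sum>i\<in>UNIV. Poly_Mapping.lookup m i)"

text \<open>The graded piece of degree \<open>d\<close>, which is zero for negative \<open>d\<close>. Degrees are integers because
  entries of graded matrices have degrees that are differences of shifts.\<close>

definition hom_part :: "int \<Rightarrow> 'k::field_char_0 poly3 set" where
  "hom_part d = {f. \<forall>m\<in>Poly_Mapping.keys f. int (mdeg m) = d}"

text \<open>As a module over itself, whose submodules are the ideals and whose spans are the generated
  ideals, and as a vector space over the ground field.\<close>

interpretation ideal: module "(*) :: 'k::field_char_0 poly3 \<Rightarrow> 'k poly3 \<Rightarrow> 'k poly3"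
  by unfold_locales (simp_all add: algebra_simps)

interpretation kspace: vector_space "\<lambda>c (f :: 'k::field_char_0 poly3). const3 c * f"
  by unfold_locales
    (simp_all add: const3_def distrib_left distrib_right single_add mult_single flip: mult.assoc)

definition homogeneous_ideal :: "'k::field_char_0 poly3 set \<Rightarrow> bool" where
  "homogeneous_ideal I \<longleftrightarrow> (\<exists>S. S \<subseteq> (\<Union>d. hom_part d) \<and> I = ideal.span S)"

definition max_ideal :: "'k::field_char_0 poly3 set" where
  "max_ideal = ideal.span (range X)"


section \<open>Graded artinian quotients\<close>

text \<open>The algebra \<open>A = R/I\<close> is handled through the ideal \<open>I\<close>. For \<open>k\<close>-subspaces \<open>W \<subseteq> V\<close> of \<open>R\<close>, the
  set \<open>B\<close> below is a set of representatives of a basis of \<open>V/W\<close>. In particular distinct members of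
  \<open>B\<close> have distinct classes.\<close>

definition quot_basis :: "'k::field_char_0 poly3 set \<Rightarrow> 'k poly3 set \<Rightarrow> 'k poly3 set \<Rightarrow> bool" where
  "quot_basis V W B \<longleftrightarrow> B \<subseteq> V \<and> V \<subseteq> kspace.span (B \<union> W) \<and>
     (\<forall>c. (\<Sum>b\<in>B. const3 (c b) * b) \<in> W \<longrightarrow> (\<forall>b\<in>B. c b = 0))"

definition quot_dim :: "'k::field_char_0 poly3 set \<Rightarrow> 'k poly3 set \<Rightarrow> nat" where
  "quot_dim V W = (THE n. \<exists>B. finite B \<and> card B = n \<and> quot_basis V W B)"

text \<open>The descending chain condition for ideals of \<open>R/I\<close>, which correspond to the ideals of \<open>R\<close>
  containing \<open>I\<close>.\<close>

definition artinian_quotient :: "'k::field_char_0 poly3 set \<Rightarrow> bool" where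
  "artinian_quotient I \<longleftrightarrow>
     (\<forall>J :: nat \<Rightarrow> 'k poly3 set.
        (\<forall>n. ideal.subspace (J n) \<and> I \<subseteq> J n \<and> J (Suc n) \<subseteq> J n) \<longrightarrow>
        (\<exists>N. \<forall>n\<ge>N. J n = J N))"

definition artinian_algebra :: "'k::field_char_0 poly3 set \<Rightarrow> bool" where
  "artinian_algebra I \<longleftrightarrow>
     homogeneous_ideal I \<and> I \<inter> hom_part 1 = {0} \<and> artinian_quotient I"

definition hilb :: "'k::field_char_0 poly3 set \<Rightarrow> nat \<Rightarrow> nat" where
  "hilb I i = quot_dim (hom_part (int i)) (I \<inter> hom_part (int i))"

definition socle_degree :: "'k::field_char_0 poly3 set \<Rightarrow> nat" where
  "socle_degree I = (GREATEST i. hilb I i > 0)"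

definition h_vector :: "'k::field_char_0 poly3 set \<Rightarrow> nat list" where
  "h_vector I = map (hilb I) [0..<Suc (socle_degree I)]"

text \<open>The preimage in \<open>R\<close> of the socle of \<open>R/I\<close>.\<close>

definition socle :: "'k::field_char_0 poly3 set \<Rightarrow> 'k poly3 set" where
  "socle I = {f. \<forall>g\<in>max_ideal. g * f \<in> I}"

definition socle_dim :: "'k::field_char_0 poly3 set \<Rightarrow> nat \<Rightarrow> nat" where
  "socle_dim I i = quot_dim (socle I \<inter> hom_part (int i)) (I \<inter> hom_part (int i))"

definition level_algebra :: "'k::field_char_0 poly3 set \<Rightarrow> bool" where
  "level_algebra I \<longleftrightarrow> artinian_algebra I \<and> (\<forall>i < socle_degree I. socle_dim I i = 0)"

definition level_h_vector :: "'k::field_char_0 itself \<Rightarrow> nat list \<Rightarrow> bool" where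
  "level_h_vector _ h \<longleftrightarrow> (\<exists>I :: 'k poly3 set. level_algebra I \<and> h_vector I = h)"


section \<open>Minimal free resolutions\<close>

text \<open>A list \<open>a\<close> of integers stands for the graded free module that is the direct sum of the
  \<open>R(-a ! i)\<close>, \<open>i < length a\<close>; its elements are the vectors in \<open>carrier_vec (length a)\<close>. The matrices
  below are those of the degree 0 maps from the module of \<open>b\<close> to that of \<open>a\<close>: the \<open>c\<close>-th basis
  element, of degree \<open>b ! c\<close>, has to be sent to an element of the same degree.\<close>

definition graded_map :: "int list \<Rightarrow> int list \<Rightarrow> 'k::field_char_0 poly3 mat \<Rightarrow> bool" where
  "graded_map a b M \<longleftrightarrow> M \<in> carrier_mat (length a) (length b) \<and>
     (\<forall>r < length a. \<forall>c < length b. M $$ (r, c) \<in> hom_part (b ! c - a ! r))"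

definition mat_image :: "'k::field_char_0 poly3 mat \<Rightarrow> 'k poly3 vec set" where
  "mat_image M = {M *\<^sub>v v | v. v \<in> carrier_vec (dim_col M)}"

text \<open>Minimality of a resolution: the image of \<open>M\<close> lies in the maximal ideal times the target.\<close>

definition minimal_map :: "'k::field_char_0 poly3 mat \<Rightarrow> bool" where
  "minimal_map M \<longleftrightarrow> elements_mat M \<subseteq> max_ideal"

definition minimal_free_resolution ::
  "'k::field_char_0 poly3 set \<Rightarrow> int list \<Rightarrow> int list \<Rightarrow> int list \<Rightarrow>
   'k poly3 mat \<Rightarrow> 'k poly3 mat \<Rightarrow> 'k poly3 mat \<Rightarrow> bool" where
  "minimal_free_resolution I a1 a2 a3 D1 D2 D3 \<longleftrightarrow>
     graded_map [0] a1 D1 \<and> graded_map a1 a2 D2 \<and> graded_map a2 a3 D3 \<and>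
     mat_image D1 = {v \<in> carrier_vec 1. v $ 0 \<in> I} \<and>
     mat_image D2 = mat_kernel D1 \<and>
     mat_image D3 = mat_kernel D2 \<and>
     mat_kernel D3 = {0\<^sub>v (length a3)} \<and>
     minimal_map D1 \<and> minimal_map D2 \<and> minimal_map D3"

text \<open>Resolutions are identified if they have the same graded Betti numbers, so each one is
  represented by three multisets of integers: the multiplicity of \<open>l\<close> in the \<open>i\<close>-th multiset is
  \<open>\<beta>\<^bsub>i,l\<^esub>\<close>, that is, the multiset stands for the graded free module \<open>F\<^sub>i\<close>.\<close>

definition level_resolutions ::
  "'k::field_char_0 itself \<Rightarrow> nat list \<Rightarrow> (int multiset \<times> int multiset \<times> int multiset) set" where
  "level_resolutions _ h = {(mset a1, mset a2, mset a3) | a1 a2 a3.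
     \<exists>(I :: 'k poly3 set) D1 D2 D3. level_algebra I \<and> h_vector I = h \<and>
       minimal_free_resolution I a1 a2 a3 D1 D2 D3}"

end

theory Submission
  imports Defs "HOL-Library.Function_Algebras"
begin

text \<open>Let \<open>F\<close>, \<open>G\<close> be functionals on \<open>R\<^sub>e\<close> whose common kernel is \<open>I\<^sub>e\<close>. If two independent linear
  forms annihilate a member of the pencil spanned by \<open>F\<close> and \<open>G\<close>, there is a linear form \<open>w\<close> such
  that for \<open>3 \<le> d \<le> e\<close> the number of generators of \<open>I\<close> of degree \<open>d\<close> is minus the second difference at
  \<open>d\<close> of the Hilbert function of \<open>R/(I + (w))\<close>. That function is therefore concave, and since it starts
  with \<open>1, 2\<close> and ends with \<open>2, 1\<close>, it is determined by its middle value \<open>j - 1\<close>. Otherwise \<open>I\<close> contains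
  three quadrics that behave like the minors of a \<open>2 \<times> 3\<close> matrix of linear forms, and this forces
  \<open>h = (1, 3, ..., 3, 2)\<close>. There is at most one generator of degree \<open>e + 1\<close>, since a functional on
  \<open>R\<^bsub>e+1\<^esub>\<close> that vanishes on \<open>R\<^sub>1 I\<^sub>e\<close> is a power of a linear form in the inverse system.

  Levelness gives \<open>F\<^sub>3 = R\<^sup>2(-(e + 3))\<close>, and then \<open>F\<^sub>2\<close> is determined by \<open>h\<close> and \<open>F\<^sub>1\<close> through Euler
  characteristics. The monomial ideals \<open>(xy, xz, y\<^bsup>j-1\<^esup>, z\<^bsup>e-j+3\<^esup>, x\<^bsup>e+1\<^esup>)\<close> and, for \<open>j = 3\<close>,
  \<open>(x\<^sup>2, xy, y\<^sup>2, z\<^sup>e)\<close> realize all the resolutions.\<close>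

section \<open>Dimensions of finite-dimensional subspaces\<close>

text \<open>The field need not be algebraically closed, so an eigenvalue of the pencil cannot simply
  be chosen. If some member of the pencil is annihilated by no nonzero linear form, it turns the
  pencil into an operator \<open>T\<close> on the three-dimensional space of linear forms. The
  alternative is then whether \<open>T\<close> has a cyclic vector or a plane of eigenvectors; in
  the second case the eigenvalue is found rationally.

  This yields both \<open>T\<close> and the form \<open>w\<close>.

  Modulo \<open>w\<close> the algebra has the Hilbert function of a complete intersection in two
  variables with generators of degrees \<open>p + 1\<close> and \<open>e - p + 1\<close>, a
  trapezoid of height \<open>p + 1\<close>; hence \<open>j = p + 2\<close>. For \<open>p = 1\<close>
  it gives the same \<open>h\<close> as the three quadrics, which is why two resolutions occur
  exactly for \<open>j = 3\<close>.\<close>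

locale fd_space = vector_space
begin

text \<open>\<open>dim\<close> is 0 for a space without a finite basis, so finiteness is carried
  separately. Containment in a finite span, rather than equality with it, passes to arbitrary
  subsets.\<close>

definition fin_dim :: "'b set \<Rightarrow> bool" where
  "fin_dim V \<longleftrightarrow> (\<exists>B. finite B \<and> V \<subseteq> span B)"

lemma fin_dimI: "finite B \<Longrightarrow> V \<subseteq> span B \<Longrightarrow> fin_dim V"
  by (auto simp: fin_dim_def)

lemma fin_dim_subset: "fin_dim W \<Longrightarrow> V \<subseteq> W \<Longrightarrow> fin_dim V"
  unfolding fin_dim_def by blast

lemma independent_imp_finite_fin_dim:
  assumes "independent C" "C \<subseteq> V" "fin_dim V"
  shows "finite C"
proof -
  obtain B where "finite B" "V \<subseteq> span B" using assms by (auto simp: fin_dim_def)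
  then show ?thesis using independent_span_bound[of B C] assms by auto
qed

lemma fin_dim_basis_extend:
  assumes "subspace V" "fin_dim V" "C \<subseteq> V" "independent C"
  obtains B where "C \<subseteq> B" "B \<subseteq> V" "independent B" "span B = V" "finite B" "card B = dim V"
proof -
  obtain B where B: "C \<subseteq> B" "B \<subseteq> V" "independent B" "V \<subseteq> span B"
    using maximal_independent_subset_extend[OF assms(3,4)] .
  moreover have "span B = V"
    using B span_minimal[OF B(2) assms(1)] by auto
  moreover have "finite B"
    using independent_imp_finite_fin_dim[OF B(3,2) assms(2)] .
  ultimately show thesis
    using that basis_card_eq_dim by blast
qed

lemma fin_dim_basis:
  assumes "subspace V" "fin_dim V"
  obtains B where "B \<subseteq> V" "independent B" "span B = V" "finite B" "card B = dim V"
  using fin_dim_basis_extend[OF assms, of "{}"] by (auto simp: independent_empty)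

lemma card_le_dim_fin_dim:
  assumes "subspace V" "fin_dim V" "C \<subseteq> V" "independent C"
  shows "card C \<le> dim V"
  by (rule fin_dim_basis_extend[OF assms]) (metis card_mono)

lemma dim_mono_fin_dim:
  assumes "subspace V" "fin_dim W" "subspace W" "V \<subseteq> W"
  shows "dim V \<le> dim W"
proof -
  obtain B where B: "B \<subseteq> V" "independent B" "span B = V" "finite B" "card B = dim V"
    using fin_dim_basis[OF assms(1) fin_dim_subset[OF assms(2,4)]] .
  then show ?thesis using card_le_dim_fin_dim[of W B] assms by auto
qed

lemma subspace_eqI_dim:
  assumes "subspace V" "fin_dim W" "subspace W" "V \<subseteq> W" "dim W \<le> dim V"
  shows "V = W"
proof -
  obtain B where B: "B \<subseteq> V" "independent B" "span B = V" "finite B" "card B = dim V"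
    using fin_dim_basis[OF assms(1) fin_dim_subset[OF assms(2,4)]] .
  obtain C where C: "B \<subseteq> C" "C \<subseteq> W" "independent C" "span C = W" "finite C" "card C = dim W"
    using fin_dim_basis_extend[OF assms(3,2) order_trans[OF B(1) assms(4)] B(2)] .
  have "B = C" using B C assms by (metis card_seteq)
  then show ?thesis using B C by simp
qed

text \<open>The coordinates of \<open>v\<close> with respect to \<open>B \<union> C\<close> are
  supported in \<open>B\<close> and also in \<open>C\<close>.\<close>

lemma span_Int_independent:
  assumes "independent (B \<union> C)" "B \<inter> C = {}" "v \<in> span B" "v \<in> span C"
  shows "v = 0"
proof -
  let ?r = "representation (B \<union> C) v"
  have "?r = representation B v" "?r = representation C v"
    using representation_extend[OF assms(1) assms(3)] representation_extend[OF assms(1) assms(4)] by auto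
  then have "?r b = 0" for b
    using representation_ne_zero[of B v b] representation_ne_zero[of C v b] assms(2) by (metis disjoint_iff)
  moreover have "(\<Sum>b | ?r b \<noteq> 0. scale (?r b) b) = v"
    using sum_nonzero_representation_eq[OF assms(1)] assms(3) by (meson Un_upper1 span_mono subsetD)
  ultimately show ?thesis by simp
qed

end

definition set_add :: "'a::ab_group_add set \<Rightarrow> 'a set \<Rightarrow> 'a set" (infixl "\<oplus>\<^sub>s" 65) where
  "A \<oplus>\<^sub>s B = {x + y | x y. x \<in> A \<and> y \<in> B}"

lemma set_addI: "x \<in> A \<Longrightarrow> y \<in> B \<Longrightarrow> x + y \<in> A \<oplus>\<^sub>s B"
  by (auto simp: set_add_def)

lemma set_addE:
  assumes "z \<in> A \<oplus>\<^sub>s B"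
  obtains x y where "x \<in> A" "y \<in> B" "z = x + y"
  using assms by (auto simp: set_add_def)

locale fd_space_pair = vs1: fd_space s1 + vs2: fd_space s2
  for s1 :: "'a::field \<Rightarrow> 'b::ab_group_add \<Rightarrow> 'b" and s2 :: "'a \<Rightarrow> 'c::ab_group_add \<Rightarrow> 'c"
begin

sublocale vector_space_pair s1 s2 ..

text \<open>A basis of the kernel is extended to one of \<open>V\<close>; on the span of the added
  vectors \<open>f\<close> is injective, so their images form a basis of the image. The lemma speaks
  of a subspace \<open>V\<close> because the polynomial ring around it has infinite
  dimension.\<close>

lemma rank_nullity:
  assumes f: "Vector_Spaces.linear s1 s2 f" and V: "vs1.subspace V" "vs1.fin_dim V"
  shows "vs1.dim V = vs2.dim (f ` V) + vs1.dim {v\<in>V. f v = 0}"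
    and "vs2.fin_dim (f ` V)" and "vs2.subspace (f ` V)" and "vs1.subspace {v\<in>V. f v = 0}"
proof -
  interpret f: Vector_Spaces.linear s1 s2 f by fact
  show K: "vs1.subspace {v\<in>V. f v = 0}"
    using V by (auto simp: vs1.subspace_def f.add f.scale f.zero)
  obtain C where C: "C \<subseteq> {v\<in>V. f v = 0}" "vs1.independent C" "vs1.span C = {v\<in>V. f v = 0}"
    "finite C" "card C = vs1.dim {v\<in>V. f v = 0}"
    using vs1.fin_dim_basis[OF K vs1.fin_dim_subset[OF V(2)]] by auto
  obtain B where B: "C \<subseteq> B" "B \<subseteq> V" "vs1.independent B" "vs1.span B = V" "finite B" "card B = vs1.dim V"
    using vs1.fin_dim_basis_extend[OF V _ C(2)] C(1) by auto
  let ?D = "B - C"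
  have ker: "v = 0" if "v \<in> vs1.span ?D" "f v = 0" for v
  proof -
    have "v \<in> V" using that B by (metis Diff_subset subsetD vs1.span_mono)
    then have "v \<in> vs1.span C" using C that by auto
    then show ?thesis
      using that B(1,3) vs1.span_Int_independent[of C ?D v] by (simp add: Un_absorb1)
  qed
  have inj: "inj_on f (vs1.span ?D)"
    using ker by (subst f.inj_on_iff_eq_0) auto
  have ind: "vs2.independent (f ` ?D)"
    using inj B(3) by (meson Diff_subset f.independent_injective_image vs1.independent_mono)
  have fV: "f ` V = vs2.span (f ` B)"
    using B by (simp add: f.span_image)
  have "vs2.span (f ` B) = vs2.span (f ` ?D)"
  proof
    have "f ` B \<subseteq> insert 0 (f ` ?D)" using C(1) by blast
    then show "vs2.span (f ` B) \<subseteq> vs2.span (f ` ?D)"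
      by (metis vs2.span_insert_0 vs2.span_mono)
  qed (auto intro!: vs2.span_mono)
  then have span: "f ` V = vs2.span (f ` ?D)" using fV by simp
  then show "vs2.subspace (f ` V)" by simp
  show "vs2.fin_dim (f ` V)" using span B(5) by (auto intro: vs2.fin_dimI[of "f ` ?D"])
  have "vs2.dim (f ` V) = card ?D"
    using span ind card_image[OF inj_on_subset[OF inj vs1.span_superset]]
    by (simp add: vs2.dim_eq_card_independent)
  moreover have "card B = card ?D + card C"
    using B(1,5) C(4) card_mono[of B C] by (simp add: card_Diff_subset)
  ultimately show "vs1.dim V = vs2.dim (f ` V) + vs1.dim {v\<in>V. f v = 0}"
    using B(6) C(5) by simp
qed

end

context fd_space begin

text \<open>\<open>f\<close> is the projection along \<open>A\<close> onto a complement. It plays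
  the role of the quotient map by \<open>A\<close>, so that \<open>dim_set_add\<close> follows from
  \<open>rank_nullity\<close> without forming a quotient space.\<close>

lemma linear_with_kernel:
  assumes "subspace A"
  shows "\<exists>f. Vector_Spaces.linear scale scale f \<and> (\<forall>x. f x = 0 \<longleftrightarrow> x \<in> A)"
proof -
  interpret p: fd_space_pair scale scale ..
  obtain C where C: "C \<subseteq> A" "independent C" "A \<subseteq> span C"
    using maximal_independent_subset .
  obtain B where B: "C \<subseteq> B" "B \<subseteq> UNIV" "independent B" "UNIV \<subseteq> span B"
    using maximal_independent_subset_extend[OF subset_UNIV C(2)] .
  define f where "f = p.construct B (\<lambda>b. if b \<in> C then 0 else b)"
  have lin: "Vector_Spaces.linear scale scale f"
    unfolding f_def using B(3) by (rule p.linear_construct)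
  interpret f: Vector_Spaces.linear scale scale f by fact
  have fb: "f b = (if b \<in> C then 0 else b)" if "b \<in> B" for b
    unfolding f_def using that by (simp add: p.construct_basis[OF B(3)])
  have 1: "x - f x \<in> A" for x
  proof -
    have "x \<in> span B" using B by auto
    then show ?thesis
    proof (induction rule: span_induct_alt)
      case base show ?case using assms by (simp add: f.zero subspace_0)
    next
      case (step c x y)
      have "x - f x \<in> A" using step fb C assms by (auto simp: subspace_0)
      then have "scale c (x - f x) + (y - f y) \<in> A"
        using step assms by (meson subspace_add subspace_scale)
      then show ?case by (simp add: f.add f.scale scale_right_diff_distrib algebra_simps)
    qed
  qed
  have 2: "f x = 0" if "x \<in> A" for x
  proof -
    have "x \<in> span C" using that C by auto
    then show ?thesis
      by (induction rule: span_induct_alt) (use B fb in \<open>auto simp: f.zero f.add f.scale\<close>)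
  qed
  have "f x = 0 \<longleftrightarrow> x \<in> A" for x using 1[of x] 2[of x] by auto
  then show ?thesis using lin by blast
qed

lemma subspace_set_add: "subspace A \<Longrightarrow> subspace B \<Longrightarrow> subspace (A \<oplus>\<^sub>s B)"
  unfolding set_add_def by (rule subspace_sums)

lemma set_add_upper1: "subspace B \<Longrightarrow> A \<subseteq> A \<oplus>\<^sub>s B"
  using set_addI[of _ A 0 B] by (auto dest: subspace_0)

lemma set_add_upper2: "subspace A \<Longrightarrow> B \<subseteq> A \<oplus>\<^sub>s B"
  using set_addI[of 0 A _ B] by (auto dest: subspace_0)

lemma set_add_least: "subspace C \<Longrightarrow> A \<subseteq> C \<Longrightarrow> B \<subseteq> C \<Longrightarrow> A \<oplus>\<^sub>s B \<subseteq> C"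
  unfolding set_add_def using subspace_add by blast

lemma fin_dim_set_add:
  assumes "fin_dim A" "fin_dim B" shows "fin_dim (A \<oplus>\<^sub>s B)"
proof -
  obtain S T where "finite S" "finite T" "A \<subseteq> span S" "B \<subseteq> span T"
    using assms by (auto simp: fin_dim_def)
  then have "finite (S \<union> T)" "A \<oplus>\<^sub>s B \<subseteq> span (S \<union> T)"
    by (auto simp: set_add_def span_Un)
  then show ?thesis by (rule fin_dimI)
qed

text \<open>Under a map with kernel \<open>A\<close>, the spaces \<open>A \<oplus>\<^sub>s B\<close>
  and \<open>B\<close> have the same image, while the kernels on them are \<open>A\<close> and
  \<open>A \<inter> B\<close>.\<close>

lemma dim_set_add:
  assumes A: "subspace A" "fin_dim A" and B: "subspace B" "fin_dim B"
  shows "dim (A \<oplus>\<^sub>s B) + dim (A \<inter> B) = dim A + dim B"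
proof -
  interpret p: fd_space_pair scale scale ..
  obtain f where f: "Vector_Spaces.linear scale scale f" "\<And>x. f x = 0 \<longleftrightarrow> x \<in> A"
    using linear_with_kernel[OF A(1)] by auto
  interpret f: Vector_Spaces.linear scale scale f by (rule f)
  have "{v \<in> A \<oplus>\<^sub>s B. f v = 0} = A" "{v \<in> B. f v = 0} = A \<inter> B"
    using f set_add_upper1[OF B(1)] by auto
  moreover have "f ` (A \<oplus>\<^sub>s B) = f ` B"
  proof
    have "f (x + y) = f y" if "x \<in> A" for x y using f(2) that by (simp add: f.add)
    then show "f ` (A \<oplus>\<^sub>s B) \<subseteq> f ` B" by (auto simp: set_add_def)
    show "f ` B \<subseteq> f ` (A \<oplus>\<^sub>s B)" using set_add_upper2[OF A(1)] by blast
  qed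
  ultimately show ?thesis
    using p.rank_nullity(1)[OF f(1) subspace_set_add[OF A(1) B(1)] fin_dim_set_add[OF A(2) B(2)]]
      p.rank_nullity(1)[OF f(1) B] by simp
qed

lemma dim_inj_image:
  assumes f: "Vector_Spaces.linear scale scale f" "\<And>x. x \<in> A \<Longrightarrow> f x = 0 \<Longrightarrow> x = 0" and A: "subspace A" "fin_dim A"
  shows "dim (f ` A) = dim A"
proof -
  interpret p: fd_space_pair scale scale ..
  interpret f: Vector_Spaces.linear scale scale f by (rule f)
  have "{v\<in>A. f v = 0} = {0}"
    using f(2) A(1) by (auto simp: subspace_0 f.zero)
  then show ?thesis using p.rank_nullity(1)[OF f(1) A] dim_le_card[of "{0}" "{}"] by simp
qed

text \<open>The \<open>c i\<close> are coordinates on \<open>V / W\<close> and the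
  \<open>b i\<close> represent the dual basis. The basis of \<open>V\<close> is extended to a basis
  \<open>E\<close> of the whole space, so that each \<open>c i\<close> is linear everywhere and not
  only on \<open>V\<close>.\<close>

lemma quotient_coordinates:
  assumes V: "subspace V" "fin_dim V" and W: "subspace W" "W \<subseteq> V" and n: "dim V = dim W + n"
  obtains b :: "nat \<Rightarrow> 'b" and c :: "nat \<Rightarrow> 'b \<Rightarrow> 'a" where
    "\<And>i. i < n \<Longrightarrow> b i \<in> V" "\<And>i x y. c i (x + y) = c i x + c i y" "\<And>i r x. c i (scale r x) = r * c i x"
    "\<And>i j. i < n \<Longrightarrow> j < n \<Longrightarrow> c i (b j) = (if i = j then 1 else 0)"
    "\<And>x. x \<in> V \<Longrightarrow> x \<in> W \<longleftrightarrow> (\<forall>i<n. c i x = 0)"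
    "\<And>x. x \<in> V \<Longrightarrow> x - (\<Sum>i<n. scale (c i x) (b i)) \<in> W"
proof -
  obtain C where C: "C \<subseteq> W" "independent C" "span C = W" "finite C" "card C = dim W"
    using fin_dim_basis[OF W(1) fin_dim_subset[OF V(2) W(2)]] .
  obtain B where B: "C \<subseteq> B" "B \<subseteq> V" "independent B" "span B = V" "finite B" "card B = dim V"
    using fin_dim_basis_extend[OF V order_trans[OF C(1) W(2)] C(2)] .
  obtain E where E': "B \<subseteq> E" "E \<subseteq> UNIV" "independent E" "UNIV \<subseteq> span E"
    using maximal_independent_subset_extend[OF subset_UNIV B(3)] .
  note E = E'(1,3,4)
  have "card (B - C) = n" using B C n by (simp add: card_Diff_subset)
  then obtain b where b: "bij_betw b {..<n} (B - C)"
    using ex_bij_betw_nat_finite[of "B - C"] B(5) by (auto simp: atLeast0LessThan)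
  define c where "c i x = representation E x (b i)" for i x
  have spE: "x \<in> span E" for x using E by auto
  have bB: "b i \<in> B - C" if "i < n" for i using b that by (auto simp: bij_betw_def)
  have add: "c i (x + y) = c i x + c i y" for i x y
    by (simp add: c_def representation_add[OF E(2) spE spE])
  have scl: "c i (scale r x) = r * c i x" for i r x
    by (simp add: c_def representation_scale[OF E(2) spE])
  have repB: "representation E x = representation B x" if "x \<in> V" for x
    using representation_extend[OF E(2)] that B(4) E(1) by auto
  have eq: "x - (\<Sum>i<n. scale (c i x) (b i)) = (\<Sum>v\<in>C. scale (representation B x v) v)" if "x \<in> V" for x
  proof -
    have "x = (\<Sum>v\<in>B. scale (representation B x v) v)"
      using sum_representation_eq[OF B(3)] that B by auto
    also have "\<dots> = (\<Sum>v\<in>B-C. scale (representation B x v) v) + (\<Sum>v\<in>C. scale (representation B x v) v)"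
      using B C by (simp add: sum.subset_diff)
    also have "(\<Sum>v\<in>B-C. scale (representation B x v) v) = (\<Sum>i<n. scale (c i x) (b i))"
      using sum.reindex_bij_betw[OF b, of "\<lambda>v. scale (representation B x v) v"] repB[OF that]
      by (simp add: c_def)
    finally show ?thesis by (simp add: algebra_simps)
  qed
  have inW: "x - (\<Sum>i<n. scale (c i x) (b i)) \<in> W" if "x \<in> V" for x
  proof -
    have "(\<Sum>v\<in>C. scale (representation B x v) v) \<in> span C"
      by (intro span_sum span_scale span_base)
    then show ?thesis unfolding eq[OF that] C(3) .
  qed
  show thesis
  proof (rule that[of b c])
    show "b i \<in> V" if "i < n" for i using bB[OF that] B by auto
    show "c i (b j) = (if i = j then 1 else 0)" if "i < n" "j < n" for i j
    proof -
      have "representation E (b j) = (\<lambda>v. if v = b j then 1 else 0)"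
        using bB[OF that(2)] E by (intro representation_basis) auto
      moreover have "b i = b j \<longleftrightarrow> i = j" using b that by (auto simp: bij_betw_def inj_on_def)
      ultimately show ?thesis by (simp add: c_def)
    qed
    show "x \<in> W \<longleftrightarrow> (\<forall>i<n. c i x = 0)" if "x \<in> V" for x
    proof
      assume "x \<in> W"
      then have "representation B x = representation C x"
        using representation_extend[OF B(3)] B C by auto
      then have "representation B x v = 0" if "v \<notin> C" for v
        using representation_ne_zero[of C x v] that by auto
      then show "\<forall>i<n. c i x = 0" using bB by (auto simp: c_def repB[OF \<open>x \<in> V\<close>])
    next
      assume "\<forall>i<n. c i x = 0"
      then show "x \<in> W" using inW[OF \<open>x \<in> V\<close>] by simp
    qed
  qed (fact add scl inW | erule inW)+
qed

end

section \<open>The polynomial ring in three variables\<close>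

text \<open>In \<open>ideal\<close> this rule reads \<open>a * (b * x) = (a * b) * x\<close> and
  rewrites against \<open>mult.assoc\<close> and \<open>ac_simps\<close>.\<close>

declare ideal.scale_scale [simp del] kspace.scale_scale [simp del]

lemma UNIV_3_eq: "(UNIV :: 3 set) = {0, 1, 2}"
proof -
  have "card {0, 1, 2 :: 3} = 3" by simp
  then have "{0, 1, 2 :: 3} = UNIV"
    by (intro card_subset_eq) auto
  then show ?thesis by simp
qed

lemma exhaust_three: "i = 0 \<or> i = 1 \<or> i = (2::3)"
  using UNIV_I[of i] unfolding UNIV_3_eq by blast

lemma forall_three: "(\<forall>i::3. P i) \<longleftrightarrow> P 0 \<and> P 1 \<and> P 2"
  by (metis exhaust_three)

lemma sum_three: "(\<Sum>i\<in>UNIV. f (i::3)) = f 0 + f 1 + f 2"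
  unfolding UNIV_3_eq by (simp add: add.assoc)

type_synonym expo = "3 \<Rightarrow>\<^sub>0 nat"

abbreviation lk :: "('a \<Rightarrow>\<^sub>0 'b::zero) \<Rightarrow> 'a \<Rightarrow> 'b" where "lk \<equiv> Poly_Mapping.lookup"

definition mon :: "expo \<Rightarrow> 'k::field_char_0 poly3" where
  "mon u = Poly_Mapping.single u 1"

lemma X_mono: "X i = mon (Poly_Mapping.single i 1)"
  by (simp add: X_def mon_def)

lemma mdeg_three: "mdeg m = lk m 0 + lk m 1 + lk m 2"
  by (simp add: mdeg_def sum_three)

lemma expo_eq_iff: "m = n \<longleftrightarrow> lk m 0 = lk n 0 \<and> lk m 1 = lk n 1 \<and> lk m 2 = lk (n :: expo) 2"
proof
  assume "lk m 0 = lk n 0 \<and> lk m 1 = lk n 1 \<and> lk m 2 = lk n 2"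
  then have "lk m i = lk n i" for i using exhaust_three[of i] by auto
  then show "m = n" by (rule poly_mapping_eqI)
qed simp

lemma mdeg_eq_0_iff: "mdeg m = 0 \<longleftrightarrow> m = 0"
  by (simp add: expo_eq_iff mdeg_three)

lemma mdeg_add: "mdeg (m + n) = mdeg m + mdeg n"
  by (simp add: mdeg_three lookup_add)

lemma mdeg_single: "mdeg (Poly_Mapping.single i d) = d"
  using exhaust_three[of i] by (auto simp: mdeg_three lookup_single when_def)

lemma mdeg_0 [simp]: "mdeg 0 = 0"
  by (simp add: mdeg_three)

lemma lookup_single_mult:
  fixes f :: "expo \<Rightarrow>\<^sub>0 'k::field_char_0"
  shows "lk (Poly_Mapping.single u c * f) (u + m) = c * lk f m"
proof -
  have "lk (Poly_Mapping.single u c * f) (u + m) =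
      (\<Sum>l. (c when u = l) * (\<Sum>q. lk f q when u + m = l + q))"
    by (simp add: lookup_mult lookup_single)
  also have "\<dots> = (\<Sum>l. (c * (\<Sum>q. lk f q when u + m = u + q)) when l = u)"
    by (rule Sum_any.cong) (auto simp: when_def)
  also have "\<dots> = c * lk f m" by (simp add: when_def eq_commute flip: when_def)
  finally show ?thesis .
qed

lemma lookup_single_mult_outside:
  fixes f :: "expo \<Rightarrow>\<^sub>0 'k::field_char_0"
  assumes "\<And>n. m \<noteq> u + n"
  shows "lk (Poly_Mapping.single u c * f) m = 0"
proof (rule ccontr)
  assume "lk (Poly_Mapping.single u c * f) m \<noteq> 0"
  then have "m \<in> Poly_Mapping.keys (Poly_Mapping.single u c * f)" by (simp add: in_keys_iff)
  then show False using keys_mult[of "Poly_Mapping.single u c" f] assms by (auto split: if_splits)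
qed

lemma lookup_mono_mult: "lk (mon u * f) (u + m) = lk f m"
  by (simp add: mon_def lookup_single_mult)

lemma lookup_const3_mult: "lk (const3 c * f) m = c * lk f m"
  using lookup_single_mult[of 0 c f m] by (simp add: const3_def)

lemma mono_add: "mon (u + v) = mon u * mon v"
  by (simp add: mon_def mult_single)

lemma mono_0: "mon 0 = 1"
  by (simp add: mon_def)

lemma mono_nonzero [simp]: "mon u \<noteq> 0"
proof
  assume "mon u = (0 :: 'a poly3)"
  then have "lk (mon u :: 'a poly3) u = 0" by simp
  then show False by (simp add: mon_def)
qed

lemma const3_simps:
  "const3 0 = 0" "const3 1 = 1" "const3 (a + b) = const3 a + const3 b" "const3 (a * b) = const3 a * const3 b"
  "const3 (- a) = - const3 a" "const3 (a - b) = const3 a - const3 b"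
  by (simp_all add: const3_def single_add mult_single single_uminus single_diff)

lemma const3_eq_iff: "const3 a = const3 b \<longleftrightarrow> a = b"
  by (auto simp: const3_def dest: arg_cong[where f = "\<lambda>f. lk f 0"])

lemma const3_eq_0_iff [simp]: "const3 a = 0 \<longleftrightarrow> a = 0"
  using const3_eq_iff[of a 0] by (simp add: const3_simps)

interpretation ks: fd_space "\<lambda>c (f :: 'k::field_char_0 poly3). const3 c * f" ..

lemma linear_mult_left: "Vector_Spaces.linear (\<lambda>c (f :: 'k::field_char_0 poly3). const3 c * f) (\<lambda>c f. const3 c * f) ((*) g)"
  unfolding Vector_Spaces.linear_iff by (simp add: kspace.vector_space_axioms distrib_left mult.left_commute)

subsection \<open>Homogeneous components and division by monomials\<close>

definition restr :: "(expo \<Rightarrow> bool) \<Rightarrow> 'k::field_char_0 poly3 \<Rightarrow> 'k poly3" where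
  "restr P = Poly_Mapping.mapp (\<lambda>m c. if P m then c else 0)"

lemma lookup_restr: "lk (restr P f) m = (if P m then lk f m else 0)"
  by (auto simp: restr_def lookup_mapp when_def in_keys_iff)

lemma restr_add: "restr P (f + g) = restr P f + restr P g"
  by (rule poly_mapping_eqI) (simp add: lookup_restr lookup_add)

lemma restr_split: "f = restr P f + restr (\<lambda>m. \<not> P m) f"
  by (rule poly_mapping_eqI) (simp add: lookup_restr lookup_add)

lemma restr_id: "(\<And>m. m \<in> Poly_Mapping.keys f \<Longrightarrow> P m) \<Longrightarrow> restr P f = f"
  by (rule poly_mapping_eqI) (auto simp: lookup_restr in_keys_iff)

lemma restr_eq_0: "(\<And>m. m \<in> Poly_Mapping.keys f \<Longrightarrow> \<not> P m) \<Longrightarrow> restr P f = 0"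
  by (rule poly_mapping_eqI) (auto simp: lookup_restr in_keys_iff)

lemma keys_restr: "Poly_Mapping.keys (restr P f) = {m \<in> Poly_Mapping.keys f. P m}"
  by (auto simp: in_keys_iff lookup_restr split: if_splits)

lemma restr_sum: "restr P (sum f A) = (\<Sum>i\<in>A. restr P (f i))"
  by (rule poly_mapping_eqI) (simp add: lookup_restr lookup_sum)

definition hcomp :: "int \<Rightarrow> 'k::field_char_0 poly3 \<Rightarrow> 'k poly3" where
  "hcomp d = restr (\<lambda>m. int (mdeg m) = d)"

lemma lookup_hcomp: "lk (hcomp d f) m = (if int (mdeg m) = d then lk f m else 0)"
  by (simp add: hcomp_def lookup_restr)

lemma hcomp_add: "hcomp d (f + g) = hcomp d f + hcomp d g"
  by (simp add: hcomp_def restr_add)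

lemma hcomp_zero [simp]: "hcomp d 0 = 0"
  by (rule poly_mapping_eqI) (simp add: lookup_hcomp)

lemma hcomp_setsum: "hcomp d (sum f A) = (\<Sum>i\<in>A. hcomp d (f i))"
  by (simp add: hcomp_def restr_sum)

lemma hom_partI: "(\<And>m. lk f m \<noteq> 0 \<Longrightarrow> int (mdeg m) = d) \<Longrightarrow> f \<in> hom_part d"
  by (auto simp: hom_part_def in_keys_iff)

lemma hom_partD: "f \<in> hom_part d \<Longrightarrow> lk f m \<noteq> 0 \<Longrightarrow> int (mdeg m) = d"
  by (auto simp: hom_part_def in_keys_iff)

lemma hcomp_in: "hcomp d f \<in> hom_part d"
  by (rule hom_partI) (auto simp: lookup_hcomp split: if_splits)

lemma hcomp_id: "f \<in> hom_part d \<Longrightarrow> hcomp d f = f"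
  unfolding hcomp_def by (rule restr_id) (auto simp: hom_part_def)

lemma hcomp_other: "f \<in> hom_part d \<Longrightarrow> d \<noteq> d' \<Longrightarrow> hcomp d' f = 0"
  unfolding hcomp_def by (rule restr_eq_0) (auto simp: hom_part_def)

lemma hom_part_0 [simp]: "0 \<in> hom_part d"
  by (simp add: hom_part_def)

lemma hom_part_add: "f \<in> hom_part d \<Longrightarrow> g \<in> hom_part d \<Longrightarrow> f + g \<in> hom_part d"
  by (rule hom_partI) (metis add.right_neutral hom_partD lookup_add)

lemma hom_part_mult: "f \<in> hom_part a \<Longrightarrow> g \<in> hom_part b \<Longrightarrow> f * g \<in> hom_part (a + b)"
  unfolding hom_part_def using keys_mult[of f g] by (fastforce simp: mdeg_add)

lemma hom_part_const: "const3 c \<in> hom_part 0"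
  by (rule hom_partI) (auto simp: const3_def lookup_single when_def split: if_splits)

lemma hom_part_scale: "f \<in> hom_part d \<Longrightarrow> const3 c * f \<in> hom_part d"
  using hom_part_mult[OF hom_part_const, of f d c] by simp

lemma hom_part_uminus: "f \<in> hom_part d \<Longrightarrow> - f \<in> hom_part d"
  using hom_part_scale[of f d "-1"] by (simp add: const3_simps)

lemma hom_part_diff: "f \<in> hom_part d \<Longrightarrow> g \<in> hom_part d \<Longrightarrow> f - g \<in> hom_part d"
  using hom_part_add[OF _ hom_part_uminus, of f d g] by simp

lemma hom_part_sum: "(\<And>i. i \<in> A \<Longrightarrow> f i \<in> hom_part d) \<Longrightarrow> sum f A \<in> hom_part d"
  by (induction A rule: infinite_finite_induct) (auto intro: hom_part_add)

lemma hom_part_mono: "mon u \<in> hom_part (int (mdeg u))"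
  by (rule hom_partI) (auto simp: mon_def lookup_single when_def split: if_splits)

lemma hom_part_X: "X i \<in> hom_part 1"
  using hom_part_mono[of "Poly_Mapping.single i 1"] by (simp add: X_mono mdeg_single)

lemma hom_part_neg: "d < 0 \<Longrightarrow> hom_part d = {0}"
proof -
  assume "d < 0"
  have "f = 0" if "f \<in> hom_part d" for f :: "'a poly3"
  proof (rule poly_mapping_eqI)
    fix m show "lk f m = lk 0 m"
      using hom_partD[OF that, of m] \<open>d < 0\<close> by (cases "lk f m = 0") auto
  qed
  then show ?thesis by auto
qed

lemma subspace_hom_part: "kspace.subspace (hom_part d)"
  by (auto simp: kspace.subspace_def hom_part_add hom_part_scale)

text \<open>Multiplication by \<open>g\<close> shifts all degrees by \<open>a\<close>, so the part
  of \<open>f\<close> outside degree \<open>d\<close> cannot reach degree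
  \<open>a + d\<close>.\<close>

lemma hcomp_mult: "g \<in> hom_part a \<Longrightarrow> hcomp (a + d) (g * f) = g * hcomp d f"
proof -
  assume g: "g \<in> hom_part a"
  let ?r = "restr (\<lambda>m. int (mdeg m) \<noteq> d) f"
  have "hcomp (a + d) (g * ?r) = 0"
    unfolding hcomp_def
  proof (rule restr_eq_0)
    fix m assume "m \<in> Poly_Mapping.keys (g * ?r)"
    then obtain p q where "m = p + q" "p \<in> Poly_Mapping.keys g" "q \<in> Poly_Mapping.keys ?r"
      using keys_mult by blast
    then show "int (mdeg m) \<noteq> a + d" using g by (auto simp: keys_restr mdeg_add hom_part_def)
  qed
  moreover have "g * f = g * hcomp d f + g * ?r"
    using restr_split[of f "\<lambda>m. int (mdeg m) = d"] by (simp add: hcomp_def flip: distrib_left)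
  ultimately show ?thesis
    by (simp add: hcomp_add hcomp_id[OF hom_part_mult[OF g hcomp_in]])
qed

lemma hcomp_mult': "g \<in> hom_part a \<Longrightarrow> hcomp d (g * f) = g * hcomp (d - a) f"
  using hcomp_mult[of g a "d - a" f] by simp

text \<open>Terms not divisible by \<open>mon u\<close> are dropped, so the operation is total; it
  is a genuine division only when every monomial of \<open>f\<close> is a multiple of
  \<open>u\<close>.\<close>

definition mdiv :: "expo \<Rightarrow> 'k::field_char_0 poly3 \<Rightarrow> 'k poly3" where
  "mdiv u f = Poly_Mapping.map_key ((+) u) f"

lemma lookup_mdiv: "lk (mdiv u f) m = lk f (u + m)"
  by (simp add: mdiv_def map_key.rep_eq)

lemma mono_mdiv:
  assumes "\<And>m. lk f m \<noteq> 0 \<Longrightarrow> \<exists>n. m = u + n"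
  shows "mon u * mdiv u f = f"
proof (rule poly_mapping_eqI)
  fix m
  show "lk (mon u * mdiv u f) m = lk f m"
  proof (cases "\<exists>n. m = u + n")
    case True
    then show ?thesis by (auto simp: lookup_mono_mult lookup_mdiv)
  next
    case False
    then have "lk (mon u * mdiv u f) m = 0"
      unfolding mon_def by (intro lookup_single_mult_outside) auto
    then show ?thesis using False assms by metis
  qed
qed

lemma mdiv_hom_part: "f \<in> hom_part d \<Longrightarrow> mdiv u f \<in> hom_part (d - int (mdeg u))"
  by (rule hom_partI) (auto simp: lookup_mdiv mdeg_add dest!: hom_partD)

lemma mono_mult_left_cancel: "mon u * f = mon u * g \<longleftrightarrow> f = g"
  by (metis lookup_mono_mult poly_mapping_eqI)

lemma expo_dvd_iff: "(\<exists>n. m = u + n) \<longleftrightarrow> (\<forall>i. lk u i \<le> lk (m::expo) i)"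
proof
  assume *: "\<forall>i. lk u i \<le> lk m i"
  have "m = u + (m - u)"
    by (rule poly_mapping_eqI) (use * in \<open>simp add: lookup_add lookup_minus\<close>)
  then show "\<exists>n. m = u + n" by blast
qed (auto simp: lookup_add)

lemma X_mdiv:
  assumes "\<And>m. lk f m \<noteq> 0 \<Longrightarrow> lk m i > 0"
  shows "X i * mdiv (Poly_Mapping.single i 1) f = f"
  unfolding X_mono
proof (rule mono_mdiv)
  fix m assume "lk f m \<noteq> 0"
  then have "\<forall>j. lk (Poly_Mapping.single i 1) j \<le> lk m j"
    using assms[of m] by (auto simp: lookup_single when_def)
  then show "\<exists>n. m = Poly_Mapping.single i 1 + n" using expo_dvd_iff by blast
qed

lemma lookup_X_mult_0: "lk m i = 0 \<Longrightarrow> lk (X i * f) m = 0"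
  unfolding X_def by (rule lookup_single_mult_outside) (auto simp: lookup_add)

lemma lookup_X_mult: "lk (X i * f) (Poly_Mapping.single i 1 + m) = lk f m"
  unfolding X_mono by (rule lookup_mono_mult)

lemma X_mult_left_cancel: "X i * f = X i * g \<longleftrightarrow> f = g"
  unfolding X_mono by (rule mono_mult_left_cancel)

lemma mdiv_X_hom_part: "f \<in> hom_part d \<Longrightarrow> mdiv (Poly_Mapping.single i 1) f \<in> hom_part (d - 1)"
  using mdiv_hom_part[of f d "Poly_Mapping.single i 1"] by (simp add: mdeg_single)

lemma hom_part_restr: "f \<in> hom_part d \<Longrightarrow> restr P f \<in> hom_part d"
  by (rule hom_partI) (auto simp: lookup_restr split: if_splits dest: hom_partD)

text \<open>Each monomial other than 1 is charged to the first variable dividing it. The hypothesis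
  is on the constant term rather than the degree, since entries of minimal matrices may have degree
  0 and are then zero.\<close>

lemma X_decompose:
  assumes f: "f \<in> hom_part d" and "lk f 0 = 0"
  obtains g :: "3 \<Rightarrow> 'k::field_char_0 poly3" where "\<And>i. g i \<in> hom_part (d - 1)" "f = X 0 * g 0 + X 1 * g 1 + X 2 * g 2"
proof -
  define f0 where "f0 = restr (\<lambda>m. lk m 0 > 0) f"
  define f1 where "f1 = restr (\<lambda>m. lk m 0 = 0 \<and> lk m 1 > 0) f"
  define f2 where "f2 = restr (\<lambda>m. lk m 0 = 0 \<and> lk m 1 = 0) f"
  have "lk m 2 > 0" if "lk f2 m \<noteq> 0" for m
  proof (rule ccontr)
    assume "\<not> lk m 2 > 0"
    then have "lk m i = 0" for i
      using that exhaust_three[of i] by (auto simp: f2_def lookup_restr split: if_splits)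
    then have "m = 0" by (intro poly_mapping_eqI) simp
    then show False using that assms by (simp add: f2_def lookup_restr)
  qed
  then have "X 2 * mdiv (Poly_Mapping.single 2 1) f2 = f2" by (rule X_mdiv)
  moreover have "X 0 * mdiv (Poly_Mapping.single 0 1) f0 = f0"
    by (rule X_mdiv) (auto simp: f0_def lookup_restr split: if_splits)
  moreover have "X 1 * mdiv (Poly_Mapping.single 1 1) f1 = f1"
    by (rule X_mdiv) (auto simp: f1_def lookup_restr split: if_splits)
  moreover have "f = f0 + f1 + f2"
    by (rule poly_mapping_eqI) (auto simp: f0_def f1_def f2_def lookup_restr lookup_add)
  moreover have "f0 \<in> hom_part d" "f1 \<in> hom_part d" "f2 \<in> hom_part d"
    using f by (simp_all add: f0_def f1_def f2_def hom_part_restr)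
  ultimately show thesis
    by (intro that[of "\<lambda>i. mdiv (Poly_Mapping.single i 1) (if i = 0 then f0 else if i = 1 then f1 else f2)"])
      (auto simp: mdiv_X_hom_part simp del: One_nat_def)
qed

lemma X_decompose_pos:
  assumes f: "f \<in> hom_part d" and "d > 0"
  obtains g :: "3 \<Rightarrow> 'k::field_char_0 poly3" where "\<And>i. g i \<in> hom_part (d - 1)" "f = X 0 * g 0 + X 1 * g 1 + X 2 * g 2"
proof (rule X_decompose[OF f])
  show "lk f 0 = 0" using assms hom_partD[OF f, of 0] by auto
qed (rule that)

lemma max_ideal_lookup_0: "f \<in> max_ideal \<Longrightarrow> lk f 0 = 0"
  unfolding max_ideal_def
proof (induction f rule: ideal.span_induct_alt)
  case (step c x y)
  then obtain i where "x = X i" by auto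
  then have "lk (c * x) 0 = 0" using lookup_X_mult_0[of 0 i c] by (simp add: mult.commute)
  then show ?case using step by (simp add: lookup_add)
qed simp

lemma hcomp_sum: "(\<Sum>d\<in>mdeg ` Poly_Mapping.keys f. hcomp (int d) f) = f"
  by (rule poly_mapping_eqI) (auto simp: lookup_sum lookup_hcomp in_keys_iff sum.delta' image_iff)

lemma lookup_0_max_ideal:
  assumes "lk f 0 = 0"
  shows "f \<in> max_ideal"
proof -
  have ih: "g * X i \<in> max_ideal" for g :: "'a poly3" and i
    unfolding max_ideal_def by (intro ideal.span_scale ideal.span_base) auto
  have "hcomp (int d) f \<in> max_ideal" for d
  proof -
    have "lk (hcomp (int d) f) 0 = 0" using assms by (simp add: lookup_hcomp)
    then show ?thesis
    proof (rule X_decompose[OF hcomp_in])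
      fix g :: "3 \<Rightarrow> 'a poly3" assume "hcomp (int d) f = X 0 * g 0 + X 1 * g 1 + X 2 * g 2"
      then show ?thesis using ih[of "g 0" 0] ih[of "g 1" 1] ih[of "g 2" 2]
        unfolding max_ideal_def by (simp add: ideal.span_add mult.commute)
    qed
  qed
  then have "(\<Sum>d\<in>mdeg ` Poly_Mapping.keys f. hcomp (int d) f) \<in> max_ideal"
    unfolding max_ideal_def by (intro ideal.span_sum)
  then show ?thesis unfolding hcomp_sum .
qed

subsection \<open>Koszul relations\<close>

context
  fixes a b c u0 u1 u2 w0 w1 w2 A A' B C v :: "'a::idom"
begin

text \<open>The identities of this context serve \<open>koszul_exchange\<close> and
  \<open>koszul_X\<close>. They are stated over an arbitrary domain; \<open>A\<close> stands for an
  invertible scalar with inverse \<open>A'\<close>, and \<open>a\<close> is exchanged for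
  \<open>A * a + B * b + C * c\<close>.\<close>

lemma exchange_eq0:
  assumes "(A * a + B * b + C * c) * u0 + b * u1 + c * u2 = 0"
  shows "a * (A * u0) + b * (u1 + B * u0) + c * (u2 + C * u0) = 0"
proof -
  have "a * (A * u0) + b * (u1 + B * u0) + c * (u2 + C * u0) = (A * a + B * b + C * c) * u0 + b * u1 + c * u2"
    by (simp only: distrib_left distrib_right ac_simps)
  then show ?thesis using assms by simp
qed

lemma exchange_eq1:
  assumes "A * A' = 1" "A * u0 = b * w2 - c * w1"
  shows "u0 = b * (A' * w2) - c * (A' * w1)"
proof -
  have "u0 = A' * (A * u0)" using assms(1) by (simp add: mult.assoc[symmetric] mult.commute)
  then show ?thesis unfolding assms(2) by (simp add: right_diff_distrib mult.left_commute)
qed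

lemma exchange_eq2:
  assumes "A * A' = 1" "A * u0 = b * w2 - c * w1" "u1 + B * u0 = c * w0 - a * w2"
  shows "u1 = c * (w0 + A' * (B * w1 + C * w2)) - (A * a + B * b + C * c) * (A' * w2)"
proof -
  have u1: "u1 = c * w0 - a * w2 - B * (b * (A' * w2) - c * (A' * w1))"
    using assms(3) exchange_eq1[OF assms(1,2)] by (simp add: eq_diff_eq)
  have "A * a * (A' * w2) = (A * A') * (a * w2)" by (simp only: ac_simps)
  then have "A * a * (A' * w2) = a * w2" unfolding assms(1) by simp
  then show ?thesis unfolding u1 distrib_right by (simp add: algebra_simps)
qed

lemma exchange_eq3:
  assumes "A * A' = 1" "A * u0 = b * w2 - c * w1" "u2 + C * u0 = a * w1 - b * w0"
  shows "u2 = (A * a + B * b + C * c) * (A' * w1) - b * (w0 + A' * (B * w1 + C * w2))"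
proof -
  have u2: "u2 = a * w1 - b * w0 - C * (b * (A' * w2) - c * (A' * w1))"
    using assms(3) exchange_eq1[OF assms(1,2)] by (simp add: eq_diff_eq)
  have "A * a * (A' * w1) = (A * A') * (a * w1)" by (simp only: ac_simps)
  then have "A * a * (A' * w1) = a * w1" unfolding assms(1) by simp
  then show ?thesis unfolding u2 distrib_right by (simp add: algebra_simps)
qed

lemma koszul_eq1:
  assumes "a * u0 + b * u1 + c * (a * w1 + b * v) = 0"
  shows "b * (u1 + c * v) = - (a * (u0 + c * w1))"
proof -
  have "b * (u1 + c * v) + a * (u0 + c * w1) = a * u0 + b * u1 + c * (a * w1 + b * v)"
    by (simp only: distrib_left ac_simps)
  then show ?thesis using assms by (simp add: eq_neg_iff_add_eq_0)
qed

lemma koszul_eq2: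
  "b * (u1 + c * v) = - (a * (u0 + c * w1)) \<Longrightarrow> u0 + c * w1 = b * w2 \<Longrightarrow> b * (u1 + c * v) = b * (- (a * w2))"
  by (simp add: mult.left_commute)

lemma koszul_eq3: "u0 + c * w1 = b * w2 \<Longrightarrow> u0 = b * w2 - c * w1"
  by (simp add: eq_diff_eq)

lemma koszul_eq4: "u1 + c * v = - (a * w2) \<Longrightarrow> u1 = c * (- v) - a * w2"
  by (metis add_diff_cancel_right' diff_conv_add_uminus mult_minus_right add.commute)

lemma koszul_eq5: "a * w1 + b * v = a * w1 - b * (- v)"
  by simp

end

text \<open>Exactness of the Koszul complex of the variables next to its left end: a triple
  proportional to \<open>(X 0, X 1, X 2)\<close> is a multiple of it. The first equation already
  forces \<open>X 0\<close> to divide \<open>w0\<close>.\<close>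

lemma koszul_first:
  assumes "w0 \<in> hom_part d" "X 0 * w1 = X 1 * w0" "X 0 * w2 = X 2 * w0"
  shows "\<exists>s\<in>hom_part (d - 1). w0 = X 0 * s \<and> w1 = X 1 * s \<and> w2 = X 2 * s"
proof -
  let ?s = "mdiv (Poly_Mapping.single 0 1) w0"
  have s: "X 0 * ?s = w0"
  proof (rule X_mdiv)
    fix m assume m: "lk w0 m \<noteq> 0"
    show "lk m 0 > 0"
    proof (rule ccontr)
      assume "\<not> lk m 0 > 0"
      then have "lk (Poly_Mapping.single 1 1 + m) 0 = 0" by (simp add: lookup_add lookup_single)
      then have "lk (X 1 * w0) (Poly_Mapping.single 1 1 + m) = 0"
        unfolding assms(2)[symmetric] by (rule lookup_X_mult_0)
      then show False using m by (simp add: lookup_X_mult del: One_nat_def)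
    qed
  qed
  have "X 0 * w1 = X 0 * (X 1 * ?s)" "X 0 * w2 = X 0 * (X 2 * ?s)"
    unfolding assms(2,3) by (metis s mult.left_commute)+
  then have "w1 = X 1 * ?s" "w2 = X 2 * ?s" unfolding X_mult_left_cancel .
  then show ?thesis using s mdiv_X_hom_part[OF assms(1)] by metis
qed

text \<open>Graded exactness of the Koszul complex at its first syzygies: every relation is a cross
  product with \<open>(a, b, c)\<close>. The drop from \<open>d\<close> to \<open>d - 1\<close> is
  the one for linear forms \<open>a\<close>, \<open>b\<close>, \<open>c\<close>.\<close>

definition koszul :: "'k::field_char_0 poly3 \<Rightarrow> 'k poly3 \<Rightarrow> 'k poly3 \<Rightarrow> bool" where
  "koszul a b c \<longleftrightarrow> (\<forall>d. \<forall>u0\<in>hom_part d. \<forall>u1\<in>hom_part d. \<forall>u2\<in>hom_part d.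
     a * u0 + b * u1 + c * u2 = 0 \<longrightarrow>
     (\<exists>w0\<in>hom_part (d - 1). \<exists>w1\<in>hom_part (d - 1). \<exists>w2\<in>hom_part (d - 1).
        u0 = b * w2 - c * w1 \<and> u1 = c * w0 - a * w2 \<and> u2 = a * w1 - b * w0))"

lemma koszulD:
  assumes "koszul a b c" "u0 \<in> hom_part d" "u1 \<in> hom_part d" "u2 \<in> hom_part d"
    "a * u0 + b * u1 + c * u2 = 0"
  obtains w0 w1 w2 where "w0 \<in> hom_part (d - 1)" "w1 \<in> hom_part (d - 1)" "w2 \<in> hom_part (d - 1)"
    "u0 = b * w2 - c * w1" "u1 = c * w0 - a * w2" "u2 = a * w1 - b * w0"
  using assms unfolding koszul_def by blast

text \<open>Modulo \<open>X 0\<close> and \<open>X 1\<close> the relation says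
  \<open>X 2 * u2 = 0\<close>, so \<open>u2 = X 0 * w1 + X 1 * v\<close>. Substituting leaves a
  relation between the coprime elements \<open>X 0\<close> and \<open>X 1\<close> only.\<close>

lemma koszul_X: "koszul (X 0) (X 1) (X 2)"
  unfolding koszul_def
proof (intro allI ballI impI)
  fix d and u0 u1 u2 :: "'a poly3"
  assume u: "u0 \<in> hom_part d" "u1 \<in> hom_part d" "u2 \<in> hom_part d"
    and eq: "X 0 * u0 + X 1 * u1 + X 2 * u2 = 0"
  define a where "a = restr (\<lambda>m. lk m 0 > 0) u2"
  define b where "b = restr (\<lambda>m. \<not> lk m 0 > 0) u2"
  have u2: "u2 = a + b" unfolding a_def b_def by (rule restr_split)
  have "X 0 * mdiv (Poly_Mapping.single 0 1) a = a"
    by (rule X_mdiv) (auto simp: a_def lookup_restr split: if_splits)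
  moreover have "X 1 * mdiv (Poly_Mapping.single 1 1) b = b"
  proof (rule X_mdiv)
    fix m assume "lk b m \<noteq> 0"
    then have m: "lk u2 m \<noteq> 0" "lk m 0 = 0" by (auto simp: b_def lookup_restr split: if_splits)
    show "lk m 1 > 0"
    proof (rule ccontr)
      assume m1: "\<not> lk m 1 > 0"
      \<comment> \<open>This monomial involves neither of the first two variables, so only
        \<open>X 2 * u2\<close> contributes to its coefficient in the relation.\<close>
      let ?m = "Poly_Mapping.single 2 1 + m"
      have "lk ?m 0 = 0" "lk ?m 1 = 0" using m m1 by (simp_all add: lookup_add lookup_single)
      then have "lk (X 0 * u0) ?m = 0" "lk (X 1 * u1) ?m = 0" by (simp_all add: lookup_X_mult_0)
      then have "lk (X 2 * u2) ?m = 0" using arg_cong[OF eq, of "\<lambda>f. lk f ?m"] by (simp add: lookup_add)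
      then show False using m by (simp add: lookup_X_mult del: One_nat_def)
    qed
  qed
  moreover have "a \<in> hom_part d" "b \<in> hom_part d"
    unfolding a_def b_def by (rule hom_part_restr[OF u(3)])+
  ultimately obtain w1 v where w: "w1 \<in> hom_part (d - 1)" "v \<in> hom_part (d - 1)" "a = X 0 * w1" "b = X 1 * v"
    using mdiv_X_hom_part by metis
  have eq': "X 1 * (u1 + X 2 * v) = - (X 0 * (u0 + X 2 * w1))"
    using eq unfolding u2 w(3,4) by (rule koszul_eq1)
  have "X 1 * mdiv (Poly_Mapping.single 1 1) (u0 + X 2 * w1) = u0 + X 2 * w1"
  proof (rule X_mdiv)
    fix m assume m: "lk (u0 + X 2 * w1) m \<noteq> 0"
    show "lk m 1 > 0"
    proof (rule ccontr)
      assume "\<not> lk m 1 > 0"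
      then have "lk (Poly_Mapping.single 0 1 + m) 1 = 0" by (simp add: lookup_add lookup_single)
      then have "lk (X 1 * (u1 + X 2 * v)) (Poly_Mapping.single 0 1 + m) = 0"
        by (rule lookup_X_mult_0)
      then show False using m lookup_X_mult[of 0 "u0 + X 2 * w1" m] unfolding eq' lookup_uminus by simp
    qed
  qed
  moreover have "u0 + X 2 * w1 \<in> hom_part d"
    using u hom_part_mult[OF hom_part_X w(1), of 2] by (simp add: hom_part_add)
  ultimately obtain w2 where w2: "w2 \<in> hom_part (d - 1)" "u0 + X 2 * w1 = X 1 * w2"
    using mdiv_X_hom_part by metis
  have "X 1 * (u1 + X 2 * v) = X 1 * (- (X 0 * w2))"
    using eq' w2(2) by (rule koszul_eq2)
  then have "u1 + X 2 * v = - (X 0 * w2)" unfolding X_mult_left_cancel .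
  then have "u1 = X 2 * (- v) - X 0 * w2" by (rule koszul_eq4)
  moreover have "u0 = X 1 * w2 - X 2 * w1" using w2(2) by (rule koszul_eq3)
  moreover have "u2 = X 0 * w1 - X 1 * (- v)" unfolding u2 w(3,4) by (rule koszul_eq5)
  ultimately show "\<exists>w0\<in>hom_part (d - 1). \<exists>w1\<in>hom_part (d - 1). \<exists>w2\<in>hom_part (d - 1).
      u0 = X 1 * w2 - X 2 * w1 \<and> u1 = X 2 * w0 - X 0 * w2 \<and> u2 = X 0 * w1 - X 1 * w0"
    using w w2 hom_part_uminus by blast
qed

lemma koszul_rotate:
  assumes "koszul a b c" shows "koszul b c a"
  unfolding koszul_def
proof (intro allI ballI impI)
  fix d u0 u1 u2
  assume u: "u0 \<in> hom_part d" "u1 \<in> hom_part d" "u2 \<in> hom_part d" and eq: "b * u0 + c * u1 + a * u2 = 0"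
  have "a * u2 + b * u0 + c * u1 = 0" using eq by (simp add: ac_simps)
  from koszulD[OF assms u(3,1,2) this] obtain w0 w1 w2
    where w: "w0 \<in> hom_part (d - 1)" "w1 \<in> hom_part (d - 1)" "w2 \<in> hom_part (d - 1)"
      "u2 = b * w2 - c * w1" "u0 = c * w0 - a * w2" "u1 = a * w1 - b * w0" .
  then show "\<exists>w0\<in>hom_part (d - 1). \<exists>w1\<in>hom_part (d - 1). \<exists>w2\<in>hom_part (d - 1).
      u0 = c * w2 - a * w1 \<and> u1 = a * w0 - b * w2 \<and> u2 = b * w1 - c * w0"
    by (intro bexI[of _ w1] bexI[of _ w2] bexI[of _ w0]) auto
qed

lemma koszul_swap:
  assumes "koszul a b c" shows "koszul b a c"
  unfolding koszul_def
proof (intro allI ballI impI)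
  fix d u0 u1 u2
  assume u: "u0 \<in> hom_part d" "u1 \<in> hom_part d" "u2 \<in> hom_part d" and eq: "b * u0 + a * u1 + c * u2 = 0"
  have "a * u1 + b * u0 + c * u2 = 0" using eq by (simp add: add.commute)
  from koszulD[OF assms u(2,1,3) this] obtain w0 w1 w2
    where w: "w0 \<in> hom_part (d - 1)" "w1 \<in> hom_part (d - 1)" "w2 \<in> hom_part (d - 1)"
      "u1 = b * w2 - c * w1" "u0 = c * w0 - a * w2" "u2 = a * w1 - b * w0" .
  then have "u0 = a * (- w2) - c * (- w0)" "u1 = c * (- w1) - b * (- w2)" "u2 = b * (- w0) - a * (- w1)"
    by simp_all
  then show "\<exists>w0\<in>hom_part (d - 1). \<exists>w1\<in>hom_part (d - 1). \<exists>w2\<in>hom_part (d - 1).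
      u0 = a * w2 - c * w1 \<and> u1 = c * w0 - b * w2 \<and> u2 = b * w1 - a * w0"
    using hom_part_uminus[OF w(1)] hom_part_uminus[OF w(2)] hom_part_uminus[OF w(3)] by blast
qed

lemma koszul_exchange:
  assumes k: "koszul a b c" and r: "r0 \<noteq> 0"
  shows "koszul (const3 r0 * a + const3 r1 * b + const3 r2 * c) b c"
  unfolding koszul_def
proof (intro allI ballI impI)
  let ?A = "const3 r0" and ?A' = "const3 (1 / r0)" and ?B = "const3 r1" and ?C = "const3 r2"
  let ?a = "?A * a + ?B * b + ?C * c"
  fix d u0 u1 u2
  assume u: "u0 \<in> hom_part d" "u1 \<in> hom_part d" "u2 \<in> hom_part d" and eq: "?a * u0 + b * u1 + c * u2 = 0"
  have AA: "?A * ?A' = 1" using r by (simp add: const3_simps(2) flip: const3_simps(4))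
  have "a * (?A * u0) + b * (u1 + ?B * u0) + c * (u2 + ?C * u0) = 0"
    using eq by (rule exchange_eq0)
  from koszulD[OF k hom_part_scale[OF u(1)] hom_part_add[OF u(2) hom_part_scale[OF u(1)]]
      hom_part_add[OF u(3) hom_part_scale[OF u(1)]] this] obtain w0 w1 w2
    where w: "w0 \<in> hom_part (d - 1)" "w1 \<in> hom_part (d - 1)" "w2 \<in> hom_part (d - 1)"
      "?A * u0 = b * w2 - c * w1" "u1 + ?B * u0 = c * w0 - a * w2" "u2 + ?C * u0 = a * w1 - b * w0" .
  have "u0 = b * (?A' * w2) - c * (?A' * w1)"
    using AA w(4) by (rule exchange_eq1)
  moreover have "u1 = c * (w0 + ?A' * (?B * w1 + ?C * w2)) - ?a * (?A' * w2)"
    using AA w(4,5) by (rule exchange_eq2)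
  moreover have "u2 = ?a * (?A' * w1) - b * (w0 + ?A' * (?B * w1 + ?C * w2))"
    using AA w(4,6) by (rule exchange_eq3)
  moreover have "w0 + ?A' * (?B * w1 + ?C * w2) \<in> hom_part (d - 1)"
    using w by (intro hom_part_add hom_part_scale)
  ultimately show "\<exists>w0\<in>hom_part (d - 1). \<exists>w1\<in>hom_part (d - 1). \<exists>w2\<in>hom_part (d - 1).
      u0 = b * w2 - c * w1 \<and> u1 = c * w0 - ?a * w2 \<and> u2 = ?a * w1 - b * w0"
    using hom_part_scale[OF w(2), of "1/r0"] hom_part_scale[OF w(3), of "1/r0"] by blast
qed

subsection \<open>Bases of the space of linear forms\<close>

lemma hom_part_0_const: "f \<in> hom_part 0 \<Longrightarrow> f = const3 (lk f 0)"
proof (rule poly_mapping_eqI)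
  fix m assume f: "f \<in> hom_part 0"
  show "lk f m = lk (const3 (lk f 0)) m"
  proof (cases "m = 0")
    case False
    then have "mdeg m \<noteq> 0" by (simp add: mdeg_eq_0_iff)
    then have "lk f m = 0" using hom_partD[OF f, of m] by auto
    then show ?thesis using False by (simp add: const3_def lookup_single)
  qed (simp add: const3_def)
qed

definition lcomb :: "'k::field_char_0 \<Rightarrow> 'k \<Rightarrow> 'k \<Rightarrow> 'k poly3 \<Rightarrow> 'k poly3 \<Rightarrow> 'k poly3 \<Rightarrow> 'k poly3" where
  "lcomb r0 r1 r2 a b c = const3 r0 * a + const3 r1 * b + const3 r2 * c"

text \<open>Collects what is used of a coordinate system: generation of the linear forms and the
  Koszul property. The independence condition \<open>lbasis\<close> is what can be checked in
  practice; \<open>lbasis_lspan\<close> leads from it to this one.\<close>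

definition lspan :: "'k::field_char_0 poly3 \<Rightarrow> 'k poly3 \<Rightarrow> 'k poly3 \<Rightarrow> bool" where
  "lspan a b c \<longleftrightarrow> a \<in> hom_part 1 \<and> b \<in> hom_part 1 \<and> c \<in> hom_part 1 \<and>
     (\<forall>v\<in>hom_part 1. \<exists>r0 r1 r2. v = lcomb r0 r1 r2 a b c) \<and> koszul a b c"

definition lbasis :: "'k::field_char_0 poly3 \<Rightarrow> 'k poly3 \<Rightarrow> 'k poly3 \<Rightarrow> bool" where
  "lbasis a b c \<longleftrightarrow> a \<in> hom_part 1 \<and> b \<in> hom_part 1 \<and> c \<in> hom_part 1 \<and>
     (\<forall>r0 r1 r2. lcomb r0 r1 r2 a b c = 0 \<longrightarrow> r0 = 0 \<and> r1 = 0 \<and> r2 = 0)"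

lemma lspan_X: "lspan (X 0) (X 1) (X 2)"
  unfolding lspan_def
proof (intro conjI ballI hom_part_X koszul_X)
  fix v :: "'a poly3" assume "v \<in> hom_part 1"
  then show "\<exists>r0 r1 r2. v = lcomb r0 r1 r2 (X 0) (X 1) (X 2)"
  proof (rule X_decompose_pos)
    fix g :: "3 \<Rightarrow> 'a poly3" assume g: "\<And>i. g i \<in> hom_part (1 - 1)" "v = X 0 * g 0 + X 1 * g 1 + X 2 * g 2"
    have "g i = const3 (lk (g i) 0)" for i using g(1)[of i] by (intro hom_part_0_const) simp
    then have "v = lcomb (lk (g 0) 0) (lk (g 1) 0) (lk (g 2) 0) (X 0) (X 1) (X 2)"
      using g(2) unfolding lcomb_def by (metis mult.commute)
    then show ?thesis by blast
  qed simp
qed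

lemma lcomb_rotate: "lcomb r0 r1 r2 a b c = lcomb r1 r2 r0 b c a"
  by (simp add: lcomb_def ac_simps)

lemma lcomb_swap: "lcomb r0 r1 r2 a b c = lcomb r1 r0 r2 b a c"
  by (simp add: lcomb_def ac_simps)

lemma lspan_rotate: "lspan a b c \<Longrightarrow> lspan b c a"
  unfolding lspan_def by (auto simp: lcomb_rotate[of _ _ _ a b c] intro: koszul_rotate) blast

lemma lspan_swap: "lspan a b c \<Longrightarrow> lspan b a c"
  unfolding lspan_def by (auto simp: lcomb_swap[of _ _ _ a b c] intro: koszul_swap) blast

lemma lspan_exchange:
  assumes l: "lspan a b c" and v: "v = lcomb r0 r1 r2 a b c" and r: "r0 \<noteq> 0"
  shows "lspan v b c"
  unfolding lspan_def
proof (intro conjI ballI)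
  show "v \<in> hom_part 1" "b \<in> hom_part 1" "c \<in> hom_part 1"
    using l unfolding v lspan_def lcomb_def by (auto intro!: hom_part_add hom_part_scale)
  show "koszul v b c" using l koszul_exchange[OF _ r] unfolding v lcomb_def lspan_def by blast
  fix u :: "'a poly3" assume "u \<in> hom_part 1"
  then obtain s0 s1 s2 where u: "u = lcomb s0 s1 s2 a b c" using l unfolding lspan_def by blast
  have e: "const3 s0 = const3 (s0 / r0) * const3 r0"
    unfolding const3_simps(4)[symmetric] using r by simp
  have "u = lcomb (s0 / r0) (s1 - s0 / r0 * r1) (s2 - s0 / r0 * r2) v b c"
    unfolding u v lcomb_def const3_simps(4,6) e by (simp add: algebra_simps)
  then show "\<exists>r0 r1 r2. u = lcomb r0 r1 r2 v b c" by blast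
qed

lemma lcomb_0 [simp]: "lcomb 0 0 0 a b c = 0" by (simp add: lcomb_def const3_simps)

text \<open>Steinitz exchange, starting from the variables and bringing in \<open>v0\<close>,
  \<open>v1\<close>, \<open>v2\<close> one at a time. Each exchange preserves the Koszul property,
  so no automorphism of the ring has to be constructed.\<close>

lemma lbasis_lspan:
  assumes "lbasis v0 v1 v2"
  shows "lspan v0 v1 v2"
proof -
  have v: "v0 \<in> hom_part 1" "v1 \<in> hom_part 1" "v2 \<in> hom_part 1" using assms unfolding lbasis_def by auto
  have ind: "r0 = 0 \<and> r1 = 0 \<and> r2 = 0" if "lcomb r0 r1 r2 v0 v1 v2 = 0" for r0 r1 r2
    using assms that unfolding lbasis_def by auto
  have "\<exists>p q. lspan v0 p q"
  proof -
    obtain r0 r1 r2 where r: "v0 = lcomb r0 r1 r2 (X 0) (X 1) (X 2)"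
      using lspan_X v(1) unfolding lspan_def by blast
    have "v0 \<noteq> 0" using ind[of 1 0 0] by (auto simp: lcomb_def const3_simps)
    then have "r0 \<noteq> 0 \<or> r1 \<noteq> 0 \<or> r2 \<noteq> 0" using r by (auto simp: lcomb_def const3_simps)
    then consider "r0 \<noteq> 0" | "r1 \<noteq> 0" | "r2 \<noteq> 0" by blast
    then show ?thesis
    proof cases
      case 1 then show ?thesis using lspan_exchange[OF lspan_X r] by blast
    next
      case 2
      have "v0 = lcomb r1 r2 r0 (X 1) (X 2) (X 0)" unfolding r lcomb_def by (simp add: ac_simps)
      then show ?thesis using lspan_exchange[OF lspan_rotate[OF lspan_X]] 2 by blast
    next
      case 3
      have "v0 = lcomb r2 r0 r1 (X 2) (X 0) (X 1)" unfolding r lcomb_def by (simp add: ac_simps)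
      then show ?thesis using lspan_exchange[OF lspan_rotate[OF lspan_rotate[OF lspan_X]]] 3 by blast
    qed
  qed
  then obtain p q where pq: "lspan v0 p q" by blast
  have "\<exists>p. lspan v1 p v0"
  proof -
    obtain r0 r1 r2 where r: "v1 = lcomb r0 r1 r2 v0 p q"
      using pq v(2) unfolding lspan_def by blast
    have "r1 \<noteq> 0 \<or> r2 \<noteq> 0"
    proof (rule ccontr)
      assume "\<not> (r1 \<noteq> 0 \<or> r2 \<noteq> 0)"
      then have "lcomb r0 (-1) 0 v0 v1 v2 = 0" using r by (simp add: lcomb_def const3_simps)
      then show False using ind by fastforce
    qed
    then show ?thesis
    proof
      assume "r1 \<noteq> 0"
      moreover have "v1 = lcomb r1 r2 r0 p q v0" unfolding r lcomb_def by (simp add: ac_simps)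
      ultimately show ?thesis using lspan_exchange[OF lspan_rotate[OF pq]] by blast
    next
      assume "r2 \<noteq> 0"
      moreover have "v1 = lcomb r2 r1 r0 q p v0" unfolding r lcomb_def by (simp add: ac_simps)
      ultimately show ?thesis using lspan_exchange[OF lspan_swap[OF lspan_rotate[OF pq]]] by blast
    qed
  qed
  then obtain p where p: "lspan v1 p v0" by blast
  obtain r0 r1 r2 where r: "v2 = lcomb r0 r1 r2 v1 p v0"
    using p v(3) unfolding lspan_def by blast
  have "r1 \<noteq> 0"
  proof
    assume "r1 = 0"
    then have "lcomb r2 r0 (-1) v0 v1 v2 = 0" using r by (simp add: lcomb_def const3_simps)
    then show False using ind by fastforce
  qed
  moreover have "v2 = lcomb r1 r2 r0 p v0 v1" unfolding r lcomb_def by (simp add: ac_simps)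
  ultimately have "lspan v2 v0 v1" using lspan_exchange[OF lspan_rotate[OF p]] by blast
  then show ?thesis by (rule lspan_rotate)
qed

lemma lspanD:
  assumes "lspan a b c"
  shows "a \<in> hom_part 1" "b \<in> hom_part 1" "c \<in> hom_part 1" "koszul a b c"
    "v \<in> hom_part 1 \<Longrightarrow> \<exists>r0 r1 r2. v = lcomb r0 r1 r2 a b c"
  using assms unfolding lspan_def by auto

text \<open>Read as a relation with coefficient 0 at \<open>b\<close>, the equation gives
  \<open>w0\<close>, \<open>w2\<close> with \<open>a * w2 = c * w0\<close> in degree
  \<open>d - 1\<close>, to which the induction applies.\<close>

lemma koszul_coprime:
  assumes k: "koszul a b c" and b: "b \<in> hom_part 1" and f: "f \<in> hom_part d" "h \<in> hom_part d" and eq: "a * f = c * h"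
  shows "\<exists>g\<in>hom_part (d - 1). f = c * g \<and> h = a * g"
  using f eq
proof (induction "nat d" arbitrary: d f h rule: less_induct)
  case less
  show ?case
  proof (cases "d < 0")
    case True
    then have "f = 0" "h = 0" using less.prems hom_part_neg by auto
    then show ?thesis by (auto intro!: bexI[of _ 0])
  next
    case False
    have "a * f + b * 0 + c * (- h) = 0" using less.prems by simp
    from koszulD[OF k less.prems(1) hom_part_0 hom_part_uminus[OF less.prems(2)] this]
    obtain w0 w1 w2 where w: "w0 \<in> hom_part (d - 1)" "w1 \<in> hom_part (d - 1)" "w2 \<in> hom_part (d - 1)"
        "f = b * w2 - c * w1" "0 = c * w0 - a * w2" "- h = a * w1 - b * w0" .
    have "\<exists>g\<in>hom_part (d - 1 - 1). w2 = c * g \<and> w0 = a * g"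
    proof (cases "d = 0")
      case True
      then have "w2 = 0" "w0 = 0" using w hom_part_neg[of "d - 1"] by auto
      then show ?thesis by (auto intro!: bexI[of _ 0])
    next
      case F: False
      show ?thesis using less.hyps[of "d - 1" w2 w0] w False F by auto
    qed
    then obtain g where g: "g \<in> hom_part (d - 1 - 1)" "w2 = c * g" "w0 = a * g" by blast
    have "f = c * (b * g - w1)" using w(4) g by (simp add: algebra_simps)
    moreover have "h = a * (b * g - w1)"
    proof -
      have "h = b * w0 - a * w1" using w(6) by (metis minus_diff_eq minus_minus)
      then show ?thesis using g by (simp add: algebra_simps)
    qed
    moreover have "b * g - w1 \<in> hom_part (d - 1)"
      using hom_part_diff[OF _ w(2)] hom_part_mult[OF b g(1)] by simp
    ultimately show ?thesis by blast
  qed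
qed

lemma lspan_decompose:
  assumes l: "lspan a b c" and f: "f \<in> hom_part d" "d > 0"
  shows "\<exists>g0\<in>hom_part (d - 1). \<exists>g1\<in>hom_part (d - 1). \<exists>g2\<in>hom_part (d - 1).
    f = a * g0 + b * g1 + c * g2"
proof (rule X_decompose_pos[OF f])
  fix g :: "3 \<Rightarrow> 'a poly3"
  assume g: "\<And>i. g i \<in> hom_part (d - 1)" "f = X 0 * g 0 + X 1 * g 1 + X 2 * g 2"
  have "\<exists>r0 r1 r2. X i = lcomb r0 r1 r2 a b c" for i
    using l hom_part_X unfolding lspan_def by blast
  then obtain r0 r1 r2 where r: "\<And>i. X i = lcomb (r0 i) (r1 i) (r2 i) a b c" by metis
  define h where "h r = const3 (r 0) * g 0 + const3 (r 1) * g 1 + const3 (r 2) * g 2" for r :: "3 \<Rightarrow> 'a"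
  have "h r \<in> hom_part (d - 1)" for r
    unfolding h_def by (intro hom_part_add hom_part_scale g)
  moreover have "f = a * h r0 + b * h r1 + c * h r2"
    unfolding g(2) r lcomb_def h_def by (simp add: algebra_simps)
  ultimately show ?thesis by blast
qed

lemma hom_part_power: "a \<in> hom_part 1 \<Longrightarrow> a ^ n \<in> hom_part (int n)"
proof (induction n)
  case 0
  then show ?case using hom_part_const[of 1] by (simp add: const3_simps)
next
  case (Suc n)
  then show ?case using hom_part_mult[of a 1 "a ^ n" "int n"] by (simp add: add.commute)
qed

text \<open>Modulo \<open>b\<close> and \<open>c\<close> the ring is a polynomial ring in
  \<open>a\<close>, so in degree \<open>n\<close> only multiples of \<open>a ^ n\<close>
  survive.\<close>

lemma lspan_power_decompose:
  assumes l: "lspan a b c" and f: "f \<in> hom_part (int n)"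
  shows "\<exists>r. \<exists>g1\<in>hom_part (int n - 1). \<exists>g2\<in>hom_part (int n - 1). f = const3 r * a ^ n + b * g1 + c * g2"
  using f
proof (induction n arbitrary: f)
  case 0
  then show ?case using hom_part_0_const[of f] by (intro exI[of _ "lk f 0"] bexI[of _ 0]) auto
next
  case (Suc n)
  then obtain g0 g1 g2 where g: "g0 \<in> hom_part (int n)" "g1 \<in> hom_part (int n)" "g2 \<in> hom_part (int n)"
    "f = a * g0 + b * g1 + c * g2"
    using lspan_decompose[OF l Suc.prems] by (auto simp del: of_nat_Suc) (auto)
  obtain r h1 h2 where h: "h1 \<in> hom_part (int n - 1)" "h2 \<in> hom_part (int n - 1)"
    "g0 = const3 r * a ^ n + b * h1 + c * h2" using Suc.IH[OF g(1)] by blast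
  have "f = const3 r * a ^ Suc n + b * (a * h1 + g1) + c * (a * h2 + g2)"
    unfolding g(4) h(3) by (simp add: algebra_simps)
  moreover have "a * h1 + g1 \<in> hom_part (int n)" "a * h2 + g2 \<in> hom_part (int n)"
    using hom_part_mult[OF lspanD(1)[OF l] h(1)] hom_part_mult[OF lspanD(1)[OF l] h(2)] g(2,3)
    by (auto intro: hom_part_add)
  ultimately show ?case by (metis add_diff_cancel_right' of_nat_Suc add.commute)
qed

subsection \<open>Dimensions of the graded pieces\<close>

definition monset :: "nat \<Rightarrow> expo set" where
  "monset n = {m. mdeg m = n}"

definition expo_of :: "nat \<Rightarrow> nat \<Rightarrow> nat \<Rightarrow> expo" where
  "expo_of p q r = Poly_Mapping.single 0 p + Poly_Mapping.single 1 q + Poly_Mapping.single 2 r"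

lemma lookup_expo_of [simp]: "lk (expo_of p q r) 0 = p" "lk (expo_of p q r) 1 = q" "lk (expo_of p q r) 2 = r"
  by (simp_all add: expo_of_def lookup_add lookup_single)

lemma mdeg_expo_of [simp]: "mdeg (expo_of p q r) = p + q + r"
  by (simp add: mdeg_three)

lemma bij_betw_monset:
  "bij_betw (\<lambda>(p, q). expo_of p q (n - p - q)) (SIGMA p:{..n}. {..n - p}) (monset n)"
proof (rule bij_betw_byWitness[where f' = "\<lambda>m. (lk m 0, lk m 1)"])
  show "\<forall>m\<in>monset n. (case (lk m 0, lk m 1) of (p, q) \<Rightarrow> expo_of p q (n - p - q)) = m"
    by (auto simp: monset_def mdeg_three expo_eq_iff)
qed (auto simp: monset_def mdeg_three)

lemma finite_monset: "finite (monset n)"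
  using bij_betw_finite[OF bij_betw_monset, of n] by simp

lemma card_monset: "2 * card (monset n) = (n + 1) * (n + 2)"
proof -
  have "card (monset n) = (\<Sum>p\<le>n. Suc (n - p))"
    using bij_betw_same_card[OF bij_betw_monset, of n] by (simp add: card_SigmaI)
  also have "\<dots> = (\<Sum>p\<le>n. Suc p)"
    by (rule sum.reindex_bij_witness[of _ "\<lambda>p. n - p" "\<lambda>p. n - p"]) auto
  also have "2 * \<dots> = (n + 1) * (n + 2)" by (induction n) auto
  finally show ?thesis .
qed

lemma inj_mono: "inj mon"
proof (rule injI)
  fix u v assume "mon u = (mon v :: 'a poly3)"
  then have "lk (mon u :: 'a poly3) u = lk (mon v) u" by simp
  then show "u = v" by (auto simp: mon_def lookup_single when_def split: if_splits)
qed

lemma lookup_mono: "lk (mon u) m = (if u = m then 1 else 0)"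
  by (auto simp: mon_def lookup_single when_def)

lemma expand_monset:
  assumes "finite S" "\<And>m. lk f m \<noteq> 0 \<Longrightarrow> m \<in> S"
  shows "(\<Sum>m\<in>S. const3 (lk f m) * mon m) = f"
proof (rule poly_mapping_eqI)
  fix n
  have "lk (\<Sum>m\<in>S. const3 (lk f m) * mon m) n = (\<Sum>m\<in>S. if m = n then lk f m else 0)"
    unfolding lookup_sum by (rule sum.cong) (auto simp: lookup_const3_mult lookup_mono)
  also have "\<dots> = lk f n" using assms by (auto simp: sum.delta)
  finally show "lk (\<Sum>m\<in>S. const3 (lk f m) * mon m) n = lk f n" .
qed

lemma independent_mono: "kspace.independent (mon ` S :: 'k::field_char_0 poly3 set)"
proof -
  have "u v = 0" if t: "finite t" "t \<subseteq> mon ` S" "(\<Sum>v\<in>t. const3 (u v) * v) = 0" "v \<in> t"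
    for t u and v :: "'k poly3"
  proof -
    obtain m where m: "v = mon m" using t by auto
    have "0 = lk (\<Sum>v\<in>t. const3 (u v) * v) m" using t by simp
    also have "\<dots> = (\<Sum>w\<in>t. if w = v then u v else 0)"
      unfolding lookup_sum
    proof (rule sum.cong)
      fix w assume "w \<in> t"
      then obtain n where "w = mon n" using t by auto
      then show "lk (const3 (u w) * w) m = (if w = v then u v else 0)"
        using inj_eq[OF inj_mono, of n m] m by (auto simp: lookup_const3_mult lookup_mono)
    qed simp
    finally show ?thesis using t by (simp add: sum.delta)
  qed
  then show ?thesis unfolding kspace.independent_explicit_module by blast
qed

lemma hom_part_span: "(hom_part (int n) :: 'k::field_char_0 poly3 set) = kspace.span (mon ` monset n)"
  (is "?L = ?R")
proof
  show "?R \<subseteq> ?L"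
    by (rule kspace.span_minimal) (use hom_part_mono subspace_hom_part in \<open>auto simp: monset_def\<close>)
  show "?L \<subseteq> ?R"
  proof
    fix f :: "'k poly3" assume f: "f \<in> hom_part (int n)"
    have "(\<Sum>m\<in>monset n. const3 (lk f m) * mon m) = f"
      by (rule expand_monset[OF finite_monset]) (use hom_partD[OF f] in \<open>auto simp: monset_def\<close>)
    moreover have "(\<Sum>m\<in>monset n. const3 (lk f m) * mon m) \<in> kspace.span (mon ` monset n)"
      by (intro kspace.span_sum kspace.span_scale kspace.span_base) auto
    ultimately show "f \<in> kspace.span (mon ` monset n)" by simp
  qed
qed

text \<open>Extended by zero to negative degrees, so that dimension formulas with shifts hold
  uniformly.\<close>

definition dimR :: "int \<Rightarrow> int" where
  "dimR d = (if d < 0 then 0 else (d + 1) * (d + 2) div 2)"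

abbreviation kdim :: "'k::field_char_0 poly3 set \<Rightarrow> int" where
  "kdim V \<equiv> int (kspace.dim V)"

lemma dim_hom_part: "kdim (hom_part d :: 'k::field_char_0 poly3 set) = dimR d"
proof (cases "d < 0")
  case True
  then show ?thesis using kspace.dim_le_card[of "{0}" "{}"] by (simp add: hom_part_neg dimR_def)
next
  case False
  then obtain n where n: "d = int n" by (metis nat_0_le not_less)
  have "kspace.dim (hom_part d :: 'k poly3 set) = card (mon ` monset n :: 'k poly3 set)"
    unfolding n hom_part_span kspace.dim_span by (rule kspace.dim_eq_card_independent[OF independent_mono])
  also have "\<dots> = card (monset n)" using inj_mono by (intro card_image) (auto intro: inj_on_subset)
  finally have "2 * kdim (hom_part d :: 'k poly3 set) = int ((n + 1) * (n + 2))"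
    using card_monset[of n] by (metis of_nat_mult of_nat_numeral)
  then show ?thesis unfolding dimR_def n by (simp add: algebra_simps)
qed

lemma fin_dim_hom_part: "ks.fin_dim (hom_part d)"
proof (cases "d < 0")
  case True
  then show ?thesis by (auto simp: hom_part_neg intro: ks.fin_dimI[of "{}"])
next
  case False
  then obtain n where n: "d = int n" by (metis nat_0_le not_less)
  show ?thesis unfolding n by (rule ks.fin_dimI[of "mon ` monset n"]) (simp_all add: hom_part_span finite_monset)
qed

lemma dimR_twice: "d \<ge> -2 \<Longrightarrow> 2 * dimR d = (d + 1) * (d + 2)"
proof -
  assume d: "d \<ge> -2"
  have "even ((d + 1) * (d + 2))" by simp
  then show ?thesis using d by (cases "d = -1"; cases "d = -2") (auto simp: dimR_def)
qed

lemma dimR_diff: "dimR d - dimR (d - 1) = (if d < 0 then 0 else d + 1)"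
  using dimR_twice[of d] dimR_twice[of "d - 1"]
  by (cases "d < 0") (auto simp: dimR_def algebra_simps)

text \<open>The Hilbert series of the polynomial ring is \<open>1 / (1 - t) ^ 3\<close>.\<close>

lemma dimR_third_difference:
  "dimR d - 3 * dimR (d - 1) + 3 * dimR (d - 2) - dimR (d - 3) = (if d = 0 then 1 else 0)"
  using dimR_diff[of d] dimR_diff[of "d - 1"] dimR_diff[of "d - 2"] by (smt (verit))

lemma fin_dim_subset_hom_part: "V \<subseteq> hom_part d \<Longrightarrow> ks.fin_dim V"
  using ks.fin_dim_subset[OF fin_dim_hom_part] .

subsection \<open>Quotient dimensions\<close>

text \<open>A quotient basis is independent, and its span is a complement of \<open>W\<close> in
  \<open>V\<close>.\<close>

lemma quot_basis_card:
  fixes V W B :: "'k::field_char_0 poly3 set"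
  assumes V: "kspace.subspace V" "ks.fin_dim V" and W: "kspace.subspace W" "W \<subseteq> V"
    and B: "finite B" "quot_basis V W B"
  shows "card B + kspace.dim W = kspace.dim V"
proof -
  have BV: "B \<subseteq> V" and sp: "V \<subseteq> kspace.span (B \<union> W)"
    and ind: "\<And>c. (\<Sum>b\<in>B. const3 (c b) * b) \<in> W \<Longrightarrow> \<forall>b\<in>B. c b = 0"
    using B(2) unfolding quot_basis_def by auto
  have indB: "kspace.independent B"
    unfolding kspace.independent_explicit_module
  proof (intro allI impI)
    fix t u v assume t: "finite t" "t \<subseteq> B" "(\<Sum>v\<in>t. const3 (u v) * v) = 0" "v \<in> t"
    have "(\<Sum>b\<in>B. const3 (if b \<in> t then u b else 0) * b) = (\<Sum>v\<in>t. const3 (u v) * v)"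
      using t B by (intro sum.mono_neutral_cong_right) auto
    then have "(\<Sum>b\<in>B. const3 (if b \<in> t then u b else 0) * b) \<in> W"
      using t(3) kspace.subspace_0[OF W(1)] by simp
    then have "\<forall>b\<in>B. (if b \<in> t then u b else 0) = 0" by (rule ind)
    then show "u v = 0" using t(2,4) by (metis subsetD)
  qed
  have int: "kspace.span B \<inter> W = {0}"
  proof -
    have "x = 0" if x: "x \<in> kspace.span B" "x \<in> W" for x
    proof -
      obtain c where c: "x = (\<Sum>b\<in>B. const3 (c b) * b)"
        using x(1) unfolding kspace.span_finite[OF B(1)] by blast
      then have "\<forall>b\<in>B. c b = 0" using ind x(2) by auto
      then show ?thesis unfolding c by (simp add: const3_simps)
    qed
    then show ?thesis using W(1) kspace.span_zero kspace.subspace_0 by blast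
  qed
  have "kspace.span B \<oplus>\<^sub>s W = V"
  proof
    show "kspace.span B \<oplus>\<^sub>s W \<subseteq> V"
      by (rule ks.set_add_least[OF V(1) kspace.span_minimal[OF BV V(1)] W(2)])
    show "V \<subseteq> kspace.span B \<oplus>\<^sub>s W"
      using sp unfolding kspace.span_Un set_add_def kspace.span_eq_iff[THEN iffD2, OF W(1)] by simp
  qed
  moreover have "kspace.dim (kspace.span B \<oplus>\<^sub>s W) + kspace.dim (kspace.span B \<inter> W) = kspace.dim (kspace.span B) + kspace.dim W"
    using B(1) W V by (intro ks.dim_set_add) (auto intro: ks.fin_dimI ks.fin_dim_subset)
  moreover have "kspace.dim ({0} :: 'k poly3 set) = 0"
    using kspace.dim_le_card[of "{0}" "{}"] by simp
  ultimately show ?thesis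
    using kspace.dim_eq_card_independent[OF indB] by (simp add: int)
qed

lemma quot_basis_exists:
  fixes V W :: "'k::field_char_0 poly3 set"
  assumes V: "kspace.subspace V" "ks.fin_dim V" and W: "kspace.subspace W" "W \<subseteq> V"
  shows "\<exists>B. finite B \<and> quot_basis V W B"
proof -
  have "kspace.dim W \<le> kspace.dim V" using ks.dim_mono_fin_dim V W by blast
  then obtain n where n: "kspace.dim V = kspace.dim W + n" using le_Suc_ex by blast
  show ?thesis
  proof (rule ks.quotient_coordinates[OF V W n])
    fix b :: "nat \<Rightarrow> 'k poly3" and c :: "nat \<Rightarrow> 'k poly3 \<Rightarrow> 'k"
    assume b: "\<And>i. i < n \<Longrightarrow> b i \<in> V" and add: "\<And>i x y. c i (x + y) = c i x + c i y"
      and scl: "\<And>i r x. c i (const3 r * x) = r * c i x"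
      and delta: "\<And>i j. i < n \<Longrightarrow> j < n \<Longrightarrow> c i (b j) = (if i = j then 1 else 0)"
      and W': "\<And>x. x \<in> V \<Longrightarrow> x \<in> W \<longleftrightarrow> (\<forall>i<n. c i x = 0)"
      and rep: "\<And>x. x \<in> V \<Longrightarrow> x - (\<Sum>i<n. const3 (c i x) * b i) \<in> W"
    have zero: "c i 0 = 0" for i using scl[of i 0 0] by (simp add: const3_simps)
    have csum: "c i (sum f A) = (\<Sum>x\<in>A. c i (f x))" for i f and A :: "'k poly3 set"
      by (induction A rule: infinite_finite_induct) (simp_all add: zero add)
    have "b ` {..<n} \<subseteq> V" using b by auto
    moreover have "V \<subseteq> kspace.span (b ` {..<n} \<union> W)"
    proof
      fix x assume "x \<in> V"
      have "(\<Sum>i<n. const3 (c i x) * b i) \<in> kspace.span (b ` {..<n} \<union> W)"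
        by (intro kspace.span_sum kspace.span_scale kspace.span_base) auto
      moreover have "x - (\<Sum>i<n. const3 (c i x) * b i) \<in> kspace.span (b ` {..<n} \<union> W)"
        using rep[OF \<open>x \<in> V\<close>] by (intro kspace.span_base) auto
      ultimately show "x \<in> kspace.span (b ` {..<n} \<union> W)" using kspace.span_add by fastforce
    qed
    moreover have "\<forall>y\<in>b ` {..<n}. d y = 0" if "(\<Sum>y\<in>b ` {..<n}. const3 (d y) * y) \<in> W" for d
    proof
      fix y assume "y \<in> b ` {..<n}"
      then obtain j where j: "j < n" "y = b j" by auto
      have "0 = c j (\<Sum>y\<in>b ` {..<n}. const3 (d y) * y)" using W' W that j by auto
      also have "\<dots> = (\<Sum>z\<in>b ` {..<n}. if z = y then d y else 0)"
        unfolding csum scl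
      proof (rule sum.cong)
        fix z assume "z \<in> b ` {..<n}"
        then obtain i where "i < n" "z = b i" by auto
        then show "d z * c j z = (if z = y then d y else 0)"
          using delta[of j i] delta[of j j] j by (auto split: if_splits)
      qed simp
      finally show "d y = 0" using j by (simp add: sum.delta)
    qed
    ultimately have "quot_basis V W (b ` {..<n})" unfolding quot_basis_def by blast
    then show ?thesis by blast
  qed
qed

lemma quot_dim_eq:
  fixes V W :: "'k::field_char_0 poly3 set"
  assumes "kspace.subspace V" "ks.fin_dim V" "kspace.subspace W" "W \<subseteq> V"
  shows "int (quot_dim V W) = kdim V - kdim W"
proof -
  obtain B where B: "finite B" "quot_basis V W B" using quot_basis_exists[OF assms] by blast
  have "quot_dim V W = card B"
    unfolding quot_dim_def
  proof (rule the_equality)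
    show "n = card B" if "\<exists>B. finite B \<and> card B = n \<and> quot_basis V W B" for n
      using that quot_basis_card[OF assms] B by (metis add_right_cancel)
  qed (use B in auto)
  then show ?thesis using quot_basis_card[OF assms B] by linarith
qed

lemma hom_part_mult_le: "a \<in> hom_part i \<Longrightarrow> f \<in> hom_part j \<Longrightarrow> i + j = d \<Longrightarrow> a * f \<in> hom_part d"
  using hom_part_mult[of a i f j] by simp

section \<open>Homogeneous ideals and level algebras\<close>

lemma homogeneous_ideal_subspace: "homogeneous_ideal I \<Longrightarrow> ideal.subspace I"
  unfolding homogeneous_ideal_def by auto

lemma ideal_kspace_subspace: "ideal.subspace I \<Longrightarrow> kspace.subspace I"
  unfolding ideal.subspace_def kspace.subspace_def by auto

lemma ideal_mult: "ideal.subspace I \<Longrightarrow> f \<in> I \<Longrightarrow> g * f \<in> I"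
  by (rule ideal.subspace_scale)

lemma homogeneous_ideal_hcomp:
  assumes "homogeneous_ideal I" "f \<in> I"
  shows "hcomp d f \<in> I"
proof -
  obtain S where S: "S \<subseteq> (\<Union>d. hom_part d)" "I = ideal.span S"
    using assms(1) unfolding homogeneous_ideal_def by blast
  have "f \<in> ideal.span S" using assms S by simp
  then have "hcomp d f \<in> ideal.span S"
  proof (induction rule: ideal.span_induct_alt)
    case base
    then show ?case by (simp add: ideal.span_zero)
  next
    case (step c x y)
    then obtain a where "x \<in> hom_part a" using S by blast
    then have "hcomp d (c * x) = hcomp (d - a) c * x" using hcomp_mult'[of x a d c] by (simp add: mult.commute)
    then show ?case using step by (simp add: hcomp_add ideal.span_add ideal.span_scale ideal.span_base)
  qed
  then show ?thesis using S by simp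
qed

abbreviation ideal_part :: "'k::field_char_0 poly3 set \<Rightarrow> int \<Rightarrow> 'k poly3 set" where
  "ideal_part I d \<equiv> I \<inter> hom_part d"

lemma subspace_ideal_part: "ideal.subspace I \<Longrightarrow> kspace.subspace (ideal_part I d)"
  by (rule kspace.subspace_inter[OF ideal_kspace_subspace subspace_hom_part])

lemma int_hilb:
  assumes "ideal.subspace I"
  shows "int (hilb I i) = dimR (int i) - kdim (ideal_part I (int i))"
  using quot_dim_eq[OF subspace_hom_part fin_dim_hom_part subspace_ideal_part[OF assms], of "int i"]
  by (simp add: hilb_def dim_hom_part)

lemma ideal_part_eq_hom_part:
  fixes I :: "'a::field_char_0 poly3 set"
  assumes "ideal.subspace I" "kdim (ideal_part I d) \<ge> dimR d"
  shows "hom_part d \<subseteq> I"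
proof -
  have "kspace.dim (hom_part d :: 'a poly3 set) \<le> kspace.dim (ideal_part I d)"
    using assms(2) dim_hom_part[of d, where 'k = 'a] by linarith
  then have "ideal_part I d = hom_part d"
    by (intro ks.subspace_eqI_dim[OF subspace_ideal_part[OF assms(1)] fin_dim_hom_part subspace_hom_part]) auto
  then show ?thesis by blast
qed

lemma hilb_eq_0_iff:
  assumes "ideal.subspace I"
  shows "hilb I i = 0 \<longleftrightarrow> hom_part (int i) \<subseteq> I"
proof
  assume "hilb I i = 0"
  then show "hom_part (int i) \<subseteq> I" using int_hilb[OF assms, of i] ideal_part_eq_hom_part[OF assms] by auto
next
  assume "hom_part (int i) \<subseteq> I"
  then have "ideal_part I (int i) = hom_part (int i)" by auto
  then show "hilb I i = 0" using int_hilb[OF assms, of i] by (simp add: dim_hom_part)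
qed

text \<open>For a subspace \<open>W\<close> this is the product \<open>R\<^sub>1 W\<close>. One
  coefficient per variable is enough because \<open>W\<close> is closed under addition;
  \<open>mult_part_linear\<close> frees it from the choice of coordinates.\<close>

definition mult_part :: "'k::field_char_0 poly3 set \<Rightarrow> 'k poly3 set" where
  "mult_part W = {X 0 * g0 + X 1 * g1 + X 2 * g2 | g0 g1 g2. g0 \<in> W \<and> g1 \<in> W \<and> g2 \<in> W}"

lemma subspace_mult_part:
  assumes "kspace.subspace W"
  shows "kspace.subspace (mult_part W)"
  unfolding kspace.subspace_def
proof (intro conjI allI ballI)
  show "0 \<in> mult_part W" unfolding mult_part_def using kspace.subspace_0[OF assms] by force
  fix x assume "x \<in> mult_part W"
  then obtain g0 g1 g2 where x: "g0 \<in> W" "g1 \<in> W" "g2 \<in> W" "x = X 0 * g0 + X 1 * g1 + X 2 * g2"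
    unfolding mult_part_def by blast
  {
    fix y assume "y \<in> mult_part W"
    then obtain h0 h1 h2 where y: "h0 \<in> W" "h1 \<in> W" "h2 \<in> W" "y = X 0 * h0 + X 1 * h1 + X 2 * h2"
      unfolding mult_part_def by blast
    have "x + y = X 0 * (g0 + h0) + X 1 * (g1 + h1) + X 2 * (g2 + h2)"
      unfolding x y by (simp add: algebra_simps)
    then show "x + y \<in> mult_part W"
      unfolding mult_part_def using kspace.subspace_add[OF assms] x y by blast
  }
  fix c
  have "const3 c * x = X 0 * (const3 c * g0) + X 1 * (const3 c * g1) + X 2 * (const3 c * g2)"
    unfolding x by (simp add: algebra_simps)
  then show "const3 c * x \<in> mult_part W"
    unfolding mult_part_def using kspace.subspace_scale[OF assms] x by blast
qed

lemma mult_part_hom_part: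
  assumes "d > 0" shows "mult_part (hom_part (d - 1) :: 'k::field_char_0 poly3 set) = hom_part d" (is "?L = ?R")
proof
  have "X i * g \<in> hom_part d" if "g \<in> hom_part (d - 1)" for i and g :: "'k poly3"
    using hom_part_mult[OF hom_part_X that, of i] by simp
  then show "?L \<subseteq> ?R"
    unfolding mult_part_def by (auto intro!: hom_part_add)
  show "?R \<subseteq> ?L"
    using lspan_decompose[OF lspan_X _ assms] unfolding mult_part_def by blast
qed

lemma mult_part_subset:
  assumes "W \<subseteq> hom_part (d - 1)" shows "mult_part W \<subseteq> hom_part d"
proof -
  have "X i * g \<in> hom_part d" if "g \<in> W" for i g
    using hom_part_mult[OF hom_part_X, of g "d - 1" i] assms that by auto
  then show ?thesis unfolding mult_part_def by (auto intro!: hom_part_add)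
qed

lemma mult_part_ideal: "ideal.subspace I \<Longrightarrow> W \<subseteq> I \<Longrightarrow> mult_part W \<subseteq> I"
  unfolding mult_part_def by (auto intro!: ideal.subspace_add ideal_mult)

lemma mult_part_linear:
  assumes "kspace.subspace W" "v \<in> hom_part 1" "f \<in> W"
  shows "v * f \<in> mult_part W"
proof -
  obtain r0 r1 r2 where v: "v = lcomb r0 r1 r2 (X 0) (X 1) (X 2)"
    using lspanD(5)[OF lspan_X assms(2)] by blast
  have "v * f = X 0 * (const3 r0 * f) + X 1 * (const3 r1 * f) + X 2 * (const3 r2 * f)"
    unfolding v lcomb_def by (simp add: algebra_simps)
  then show ?thesis unfolding mult_part_def using kspace.subspace_scale[OF assms(1,3)] by blast
qed

definition num_gens :: "'k::field_char_0 poly3 set \<Rightarrow> int \<Rightarrow> int" where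
  "num_gens I d = kdim (ideal_part I d) - kdim (mult_part (ideal_part I (d - 1)))"

lemma artinian_hom_part_subset:
  assumes "artinian_quotient I" "homogeneous_ideal I"
  shows "\<exists>N. \<forall>n\<ge>N. hom_part (int n) \<subseteq> I"
proof -
  have I: "ideal.subspace I" by (rule homogeneous_ideal_subspace[OF assms(2)])
  \<comment> \<open>\<open>J n\<close> is \<open>I\<close> plus everything of degree at least
    \<open>n\<close>; once this descending chain is stationary, all further graded pieces lie in
    \<open>I\<close>.\<close>
  define J where "J n = {f. \<forall>d<n. hcomp (int d) f \<in> I}" for n
  have "ideal.subspace (J n)" for n
    unfolding ideal.subspace_def
  proof (intro conjI allI ballI)
    show "0 \<in> J n" using ideal.subspace_0[OF I] by (simp add: J_def)
    show "f + g \<in> J n" if "f \<in> J n" "g \<in> J n" for f g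
      using that ideal.subspace_add[OF I] by (simp add: J_def hcomp_add)
    fix c f assume f: "f \<in> J n"
    have "hcomp (int d) (c * f) \<in> I" if "d < n" for d
    proof -
      have "hcomp (int d) (c * f) = (\<Sum>a\<in>mdeg ` Poly_Mapping.keys c. hcomp (int a) c * hcomp (int d - int a) f)"
        by (subst hcomp_sum[of c, symmetric])
          (simp only: sum_distrib_right hcomp_setsum hcomp_mult'[OF hcomp_in])
      moreover have "hcomp (int d - int a) f \<in> I" for a
      proof (cases "a \<le> d")
        case True
        have "hcomp (int (d - a)) f \<in> I" using f that unfolding J_def by simp
        then show ?thesis using True by (simp add: of_nat_diff)
      next
        case False
        then have "hcomp (int d - int a) f = 0" using hcomp_in[of "int d - int a" f] hom_part_neg[of "int d - int a"] by auto
        then show ?thesis using ideal.subspace_0[OF I] by simp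
      qed
      ultimately show ?thesis by (auto intro!: ideal.subspace_sum[OF I] ideal_mult[OF I])
    qed
    then show "c * f \<in> J n" by (simp add: J_def)
  qed
  moreover have "I \<subseteq> J n" "J (Suc n) \<subseteq> J n" for n
    using homogeneous_ideal_hcomp[OF assms(2)] by (auto simp: J_def)
  ultimately obtain N where N: "\<forall>n\<ge>N. J n = J N"
    using assms(1) unfolding artinian_quotient_def by blast
  have "hom_part (int n) \<subseteq> I" if "n \<ge> N" for n
  proof
    fix f :: "'a poly3" assume f: "f \<in> hom_part (int n)"
    then have "f \<in> J n"
      using hcomp_other[OF f] ideal.subspace_0[OF I] by (auto simp: J_def)
    then have "f \<in> J (Suc n)" using N that by (metis le_SucI)
    then show "f \<in> I" using hcomp_id[OF f] by (auto simp: J_def)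
  qed
  then show ?thesis by blast
qed

lemma hilb_above_socle_degree:
  assumes "artinian_algebra I" "i > socle_degree I"
  shows "hilb I i = 0"
proof (rule ccontr)
  assume i: "hilb I i \<noteq> 0"
  have I: "ideal.subspace I" using assms(1) homogeneous_ideal_subspace unfolding artinian_algebra_def by blast
  obtain N where N: "\<forall>n\<ge>N. hom_part (int n) \<subseteq> I"
    using artinian_hom_part_subset assms(1) unfolding artinian_algebra_def by blast
  have "k \<le> N" if "hilb I k > 0" for k
    using that N hilb_eq_0_iff[OF I, of k] by (metis less_numeral_extra(3) linear)
  then have "i \<le> socle_degree I"
    unfolding socle_degree_def using i by (intro Greatest_le_nat) auto
  then show False using assms(2) by simp
qed

lemma socle_iff:
  assumes "ideal.subspace I"
  shows "f \<in> socle I \<longleftrightarrow> (\<forall>i. X i * f \<in> I)"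
proof
  assume "f \<in> socle I"
  then show "\<forall>i. X i * f \<in> I" unfolding socle_def max_ideal_def by (auto intro: ideal.span_base)
next
  assume *: "\<forall>i. X i * f \<in> I"
  have "g * f \<in> I" if "g \<in> ideal.span (range X)" for g
    using that
  proof (induction rule: ideal.span_induct_alt)
    case base then show ?case using ideal.subspace_0[OF assms] by simp
  next
    case (step c x y)
    then have "c * (x * f) \<in> I" using * ideal_mult[OF assms] by auto
    then show ?case using step ideal.subspace_add[OF assms] by (simp add: distrib_right mult.assoc)
  qed
  then show "f \<in> socle I" unfolding socle_def max_ideal_def by simp
qed

lemma subspace_socle:
  assumes "ideal.subspace I" shows "ideal.subspace (socle I)"
  unfolding ideal.subspace_def Ball_def socle_iff[OF assms]
  using ideal.subspace_add[OF assms] ideal_mult[OF assms]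
  by (simp add: ideal.subspace_0[OF assms] distrib_left mult.left_commute)

lemma socle_dim_0_iff:
  assumes "ideal.subspace I"
  shows "socle_dim I i = 0 \<longleftrightarrow> (\<forall>f\<in>hom_part (int i). (\<forall>j. X j * f \<in> I) \<longrightarrow> f \<in> I)"
proof -
  let ?S = "ideal_part (socle I) (int i)" and ?W = "ideal_part I (int i)"
  have S: "kspace.subspace ?S" using subspace_ideal_part[OF subspace_socle[OF assms]] .
  have W: "kspace.subspace ?W" using subspace_ideal_part[OF assms] .
  have WS: "?W \<subseteq> ?S" using ideal_mult[OF assms] by (auto simp: socle_iff[OF assms])
  have fd: "ks.fin_dim ?S" by (rule fin_dim_subset_hom_part) auto
  have eq: "int (socle_dim I i) = kdim ?S - kdim ?W"
    unfolding socle_dim_def by (rule quot_dim_eq[OF S fd W WS])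
  have "socle_dim I i = 0 \<longleftrightarrow> ?S = ?W"
  proof
    assume "socle_dim I i = 0"
    then have "kspace.dim ?S \<le> kspace.dim ?W" using eq by simp
    then show "?S = ?W" using ks.subspace_eqI_dim[OF W fd S WS] by simp
  next
    assume "?S = ?W"
    then show "socle_dim I i = 0" using eq by simp
  qed
  then show ?thesis using WS by (auto simp: socle_iff[OF assms])
qed

section \<open>Linear systems and linear functionals\<close>

lemma homogeneous_system_nontrivial:
  fixes A :: "'a \<Rightarrow> 'b \<Rightarrow> 'k::field"
  assumes "finite T" "finite S" "card S > card T"
  shows "\<exists>c. (\<exists>i\<in>S. c i \<noteq> 0) \<and> (\<forall>j\<in>T. (\<Sum>i\<in>S. c i * A i j) = 0)"
  using assms
proof (induction T arbitrary: S A rule: finite_induct)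
  case empty
  then obtain i where "i \<in> S" by fastforce
  then show ?case by (intro exI[of _ "\<lambda>_. 1"]) auto
next
  case (insert t T)
  show ?case
  proof (cases "\<forall>i\<in>S. A i t = 0")
    case True
    then show ?thesis using insert.IH[of S A] insert.prems insert.hyps by auto
  next
    case False
    then obtain p where p: "p \<in> S" "A p t \<noteq> 0" by blast
    \<comment> \<open>Gaussian elimination with pivot \<open>A p t\<close>: equation
      \<open>t\<close> eliminates the unknown \<open>p\<close>, leaving one equation and one unknown
      fewer.\<close>
    let ?S = "S - {p}"
    define A' where "A' i j = A i j - A i t / A p t * A p j" for i j
    have "card ?S > card T" using insert p by (simp add: card_Diff_singleton)
    then obtain c where c: "\<exists>i\<in>?S. c i \<noteq> 0" "\<forall>j\<in>T. (\<Sum>i\<in>?S. c i * A' i j) = 0"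
      using insert.IH[of ?S A'] insert.prems by auto
    define d where "d = (\<Sum>i\<in>?S. c i * A i t) / A p t"
    have sum: "(\<Sum>i\<in>S. (c(p := - d)) i * A i j) = (\<Sum>i\<in>?S. c i * A i j) - d * A p j" for j
    proof -
      have "(\<Sum>i\<in>S. (c(p := - d)) i * A i j) = (c(p := - d)) p * A p j + (\<Sum>i\<in>?S. (c(p := - d)) i * A i j)"
        using p insert.prems by (intro sum.remove) auto
      then show ?thesis by simp
    qed
    have "(\<Sum>i\<in>S. (c(p := - d)) i * A i j) = 0" if "j \<in> insert t T" for j
    proof (cases "j = t")
      case True
      then show ?thesis unfolding sum using p by (simp add: d_def)
    next
      case False
      then have "0 = (\<Sum>i\<in>?S. c i * A' i j)" using c that by auto
      also have "\<dots> = (\<Sum>i\<in>?S. c i * A i j) - (\<Sum>i\<in>?S. c i * A i t) / A p t * A p j"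
        unfolding A'_def by (simp add: right_diff_distrib sum_subtractf sum_distrib_right sum_divide_distrib mult.assoc)
      finally have "(\<Sum>i\<in>?S. c i * A i j) - d * A p j = 0" unfolding d_def by simp
      then show ?thesis by (simp only: sum)
    qed
    moreover have "\<exists>i\<in>S. (c(p := - d)) i \<noteq> 0" using c by auto
    ultimately show ?thesis by blast
  qed
qed

definition lin :: "('k::field_char_0 poly3 \<Rightarrow> 'k) \<Rightarrow> bool" where
  "lin \<phi> \<longleftrightarrow> (\<forall>x y. \<phi> (x + y) = \<phi> x + \<phi> y) \<and> (\<forall>r x. \<phi> (const3 r * x) = r * \<phi> x)"

lemma lin_simps:
  assumes "lin \<phi>"
  shows "\<phi> (x + y) = \<phi> x + \<phi> y" "\<phi> (const3 r * x) = r * \<phi> x" "\<phi> 0 = 0" "\<phi> (- x) = - \<phi> x"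
    "\<phi> (x - y) = \<phi> x - \<phi> y"
proof -
  show a: "\<phi> (x + y) = \<phi> x + \<phi> y" for x y using assms unfolding lin_def by blast
  show s: "\<phi> (const3 r * x) = r * \<phi> x" for r x using assms unfolding lin_def by blast
  show "\<phi> 0 = 0" using s[of 0 0] by simp
  show m: "\<phi> (- x) = - \<phi> x" for x using s[of "- 1" x] by (simp add: const3_simps)
  show "\<phi> (x - y) = \<phi> x - \<phi> y" using a[of x "- y"] m by simp
qed

lemma lin_sum: "lin \<phi> \<Longrightarrow> \<phi> (sum f A) = (\<Sum>i\<in>A. \<phi> (f i))"
  by (induction A rule: infinite_finite_induct) (simp_all add: lin_simps)

lemma lin_mult: "lin \<phi> \<Longrightarrow> lin (\<lambda>f. \<phi> (l * f))"
  unfolding lin_def distrib_left mult.left_commute[of l "const3 _"] by blast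

lemma lin_combination: "lin \<phi> \<Longrightarrow> lin \<psi> \<Longrightarrow> lin (\<lambda>f. s * \<phi> f + t * \<psi> f)"
  unfolding lin_def by (simp add: algebra_simps)

lemma lcomb_mult: "lcomb r0 r1 r2 a b c * f = const3 r0 * (a * f) + const3 r1 * (b * f) + const3 r2 * (c * f)"
  by (simp add: lcomb_def algebra_simps)

lemma lcomb_hom_part:
  "a \<in> hom_part d \<Longrightarrow> b \<in> hom_part d \<Longrightarrow> c \<in> hom_part d \<Longrightarrow> lcomb r0 r1 r2 a b c \<in> hom_part d"
  unfolding lcomb_def by (intro hom_part_add hom_part_scale)

lemma lbasis_extend:
  assumes a: "a \<in> hom_part 1" and b: "b \<in> hom_part 1"
    and ind: "\<And>s t. const3 s * a + const3 t * b = 0 \<Longrightarrow> s = 0 \<and> t = 0"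
  obtains v where "lbasis v a b"
proof -
  have "\<exists>i. \<forall>s t. X i \<noteq> const3 s * a + const3 t * b"
  proof (rule ccontr)
    assume "\<not> ?thesis"
    then have "\<forall>i. \<exists>s t. X i = const3 s * a + const3 t * b" by blast
    then obtain s t where st: "\<And>i. X i = const3 (s i) * a + const3 (t i) * b" by metis
    \<comment> \<open>If all three variables were combinations of \<open>a\<close> and
      \<open>b\<close>, their coordinate pairs \<open>(s i, t i)\<close> would be dependent, and
      with them the variables.\<close>
    have "\<exists>c. (\<exists>i\<in>(UNIV::3 set). c i \<noteq> 0) \<and>
        (\<forall>j\<in>{False, True}. (\<Sum>i\<in>UNIV. c i * (if j then s i else t i)) = 0)"
      by (rule homogeneous_system_nontrivial) simp_all
    then obtain c where c: "\<exists>i\<in>(UNIV::3 set). c i \<noteq> 0"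
        "\<forall>j\<in>{False, True}. (\<Sum>i\<in>UNIV. c i * (if j then s i else t i)) = 0" by blast
    have cs: "c 0 * s 0 + c 1 * s 1 + c 2 * s 2 = 0" "c 0 * t 0 + c 1 * t 1 + c 2 * t 2 = 0"
      using c(2) by (auto simp: sum_three)
    have "lcomb (c 0) (c 1) (c 2) (X 0) (X 1) (X 2) =
        const3 (c 0 * s 0 + c 1 * s 1 + c 2 * s 2) * a + const3 (c 0 * t 0 + c 1 * t 1 + c 2 * t 2) * b"
      unfolding lcomb_def st const3_simps by (simp add: algebra_simps)
    then have "lcomb (c 0) (c 1) (c 2) (X 0) (X 1) (X 2) = 0" unfolding cs by (simp add: const3_simps)
    then have *: "lk (lcomb (c 0) (c 1) (c 2) (X 0) (X 1) (X 2)) (Poly_Mapping.single i 1) = 0" for i by simp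
    have "c i = 0" for i
      using *[of i] exhaust_three[of i]
      by (auto simp: lcomb_def lookup_add lookup_const3_mult X_def lookup_single when_def expo_eq_iff)
    then show False using c(1) by blast
  qed
  then obtain i where i: "\<And>s t. X i \<noteq> const3 s * a + const3 t * b" by blast
  have "lbasis (X i) a b"
    unfolding lbasis_def
  proof (intro conjI allI impI)
    fix r0 r1 r2 assume z: "lcomb r0 r1 r2 (X i) a b = 0"
    have r0: "r0 = 0"
    proof (rule ccontr)
      assume r: "r0 \<noteq> 0"
      have "const3 r0 * X i = - (const3 r1 * a + const3 r2 * b)"
        using z unfolding lcomb_def add.assoc by (rule eq_neg_iff_add_eq_0[THEN iffD2])
      then have "const3 (1 / r0) * (const3 r0 * X i) = const3 (1 / r0) * - (const3 r1 * a + const3 r2 * b)"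
        by simp
      moreover have "const3 (1 / r0) * (const3 r0 * X i) = X i"
        using r by (simp add: const3_simps(2) flip: mult.assoc const3_simps(4))
      moreover have "const3 (1 / r0) * - (const3 r1 * a + const3 r2 * b) = const3 (- r1 / r0) * a + const3 (- r2 / r0) * b"
        by (simp add: divide_inverse const3_simps algebra_simps)
      ultimately show False using i by metis
    qed
    then show "r0 = 0" by simp
    show "r1 = 0" "r2 = 0" using z ind[of r1 r2] r0 by (auto simp: lcomb_def const3_simps)
  qed (use a b hom_part_X in auto)
  then show thesis by (rule that)
qed

text \<open>A level ideal whose \<open>h\<close>-vector ends with 3, 2, in terms of dimensions of
  its graded pieces. The Hilbert function strictly between degrees 1 and \<open>e - 1\<close> is
  left open: it is part of what is to be determined.\<close>

locale level_type2 =
  fixes I :: "'k::field_char_0 poly3 set" and e :: nat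
  assumes ideal: "ideal.subspace I" and no_linear: "I \<inter> hom_part 1 = {0}"
    and above: "\<And>d. d > int e \<Longrightarrow> hom_part d \<subseteq> I"
    and socle_below: "\<And>i f. i < e \<Longrightarrow> f \<in> hom_part (int i) \<Longrightarrow> (\<And>j. X j * f \<in> I) \<Longrightarrow> f \<in> I"
    and e3: "3 \<le> e"
    and dim_e: "kdim (ideal_part I (int e)) = dimR (int e) - 2"
    and dim_e1: "kdim (ideal_part I (int e - 1)) = dimR (int e - 1) - 3"
begin

lemma socle_lspan:
  assumes l: "lspan a b c" and f: "f \<in> hom_part d" "d < int e" and m: "a * f \<in> I" "b * f \<in> I" "c * f \<in> I"
  shows "f \<in> I"
proof (cases "d < 0")
  case True
  then have "f = 0" using hom_part_neg f(1) by blast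
  then show ?thesis using ideal.subspace_0[OF ideal] by simp
next
  case False
  then obtain i where i: "d = int i" by (metis nat_0_le not_less)
  show ?thesis
  proof (rule socle_below[of i])
    show "X j * f \<in> I" for j
    proof -
      obtain r0 r1 r2 where "X j = lcomb r0 r1 r2 a b c" using lspanD(5)[OF l hom_part_X] by blast
      then show ?thesis using m ideal_mult[OF ideal] ideal.subspace_add[OF ideal] by (simp add: lcomb_mult)
    qed
  qed (use f i in auto)
qed

text \<open>For a level algebra, membership in \<open>I\<close> is detected in degree
  \<open>e\<close>. Vanishing socle below \<open>e\<close> allows a descent from degree
  \<open>d + 1\<close> to degree \<open>d\<close>.\<close>

lemma membership:
  assumes "f \<in> hom_part d" "d \<le> int e" "\<And>g. g \<in> hom_part (int e - d) \<Longrightarrow> g * f \<in> I"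
  shows "f \<in> I"
  using assms
proof (induction "nat (int e - d)" arbitrary: d f)
  case 0
  then have "d = int e" by simp
  then have "1 \<in> hom_part (int e - d)" using hom_part_const[of 1] by (simp add: const3_simps)
  then show ?case using 0(4)[of 1] by simp
next
  case (Suc n)
  have "X j * f \<in> I" for j
  proof (rule Suc(1)[of "d + 1"])
    show "X j * f \<in> hom_part (d + 1)" using hom_part_mult[OF hom_part_X Suc(3), of j] by (simp add: add.commute)
    show "g * (X j * f) \<in> I" if "g \<in> hom_part (int e - (d + 1))" for g
      using Suc(5)[of "g * X j"] hom_part_mult[OF that hom_part_X[of j]] by (simp add: mult.assoc)
  qed (use Suc(2) in auto)
  then show ?case using socle_lspan[OF lspan_X Suc(3)] Suc(2) by auto
qed

text \<open>\<open>F\<close> and \<open>G\<close> restrict to a basis of the dual of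
  \<open>R\<^sub>e / I\<^sub>e\<close>, the top degree of the inverse system. They are functions on
  all of \<open>R\<close>, but only their values on forms of degree \<open>e\<close> matter.\<close>

definition pair :: "('k poly3 \<Rightarrow> 'k) \<Rightarrow> ('k poly3 \<Rightarrow> 'k) \<Rightarrow> bool" where
  "pair F G \<longleftrightarrow> lin F \<and> lin G \<and> (\<forall>f\<in>hom_part (int e). f \<in> I \<longleftrightarrow> F f = 0 \<and> G f = 0) \<and>
     (\<forall>s t. (\<forall>f\<in>hom_part (int e). s * F f + t * G f = 0) \<longrightarrow> s = 0 \<and> t = 0)"

lemma pair_exists:
  obtains F G b1 b2 where "pair F G" "b1 \<in> hom_part (int e)" "b2 \<in> hom_part (int e)"
    "F b1 = 1" "G b1 = 0" "F b2 = 0" "G b2 = 1"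
    "\<And>f. f \<in> hom_part (int e) \<Longrightarrow> f - (const3 (F f) * b1 + const3 (G f) * b2) \<in> I"
proof -
  have "kspace.dim (hom_part (int e) :: 'k poly3 set) = kspace.dim (ideal_part I (int e)) + 2"
    using dim_e dim_hom_part[of "int e", where 'k = 'k] by linarith
  then show thesis
  proof (rule ks.quotient_coordinates[OF subspace_hom_part fin_dim_hom_part subspace_ideal_part[OF ideal] Int_lower2])
    fix b :: "nat \<Rightarrow> 'k poly3" and c :: "nat \<Rightarrow> 'k poly3 \<Rightarrow> 'k"
    assume b: "\<And>i. i < 2 \<Longrightarrow> b i \<in> hom_part (int e)"
      and add: "\<And>i x y. c i (x + y) = c i x + c i y" and scl: "\<And>i r x. c i (const3 r * x) = r * c i x"
      and delta: "\<And>i j. i < 2 \<Longrightarrow> j < 2 \<Longrightarrow> c i (b j) = (if i = j then 1 else 0)"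
      and W: "\<And>x. x \<in> hom_part (int e) \<Longrightarrow> x \<in> ideal_part I (int e) \<longleftrightarrow> (\<forall>i<2. c i x = 0)"
      and rep: "\<And>x. x \<in> hom_part (int e) \<Longrightarrow> x - (\<Sum>i<2. const3 (c i x) * b i) \<in> ideal_part I (int e)"
    have all2: "(\<forall>i<2. P i) \<longleftrightarrow> P 0 \<and> P (1::nat)" for P by (auto simp: less_2_cases_iff)
    have l: "lin (c i)" for i unfolding lin_def using add scl by blast
    have "s = 0 \<and> t = 0" if "\<forall>f\<in>hom_part (int e). s * c 0 f + t * c 1 f = 0" for s t
    proof -
      have "s * c 0 (b 0) + t * c 1 (b 0) = 0" "s * c 0 (b 1) + t * c 1 (b 1) = 0"
        using that b by auto
      then show ?thesis using delta[of 0 0] delta[of 0 1] delta[of 1 0] delta[of 1 1] by simp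
    qed
    moreover have "f \<in> I \<longleftrightarrow> c 0 f = 0 \<and> c 1 f = 0" if "f \<in> hom_part (int e)" for f
      using W[OF that] that by (simp add: all2)
    ultimately have "pair (c 0) (c 1)" unfolding pair_def using l by blast
    then show thesis
      using that[of "c 0" "c 1" "b 0" "b 1"] b delta rep by (simp add: numeral_2_eq_2)
  qed
qed

lemma pairD:
  assumes "pair F G"
  shows "lin F" "lin G" "f \<in> hom_part (int e) \<Longrightarrow> f \<in> I \<longleftrightarrow> F f = 0 \<and> G f = 0"
    "(\<And>f. f \<in> hom_part (int e) \<Longrightarrow> s * F f + t * G f = 0) \<Longrightarrow> s = 0 \<and> t = 0"
  using assms unfolding pair_def by blast+

lemma pair_change:
  assumes p: "pair F G" and det: "a * d - b * c \<noteq> 0"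
  shows "pair (\<lambda>f. a * F f + b * G f) (\<lambda>f. c * F f + d * G f)"
proof -
  have inv: "x = 0 \<and> y = 0" if "a * x + b * y = 0" "c * x + d * y = 0" for x y
  proof -
    have "(a * d - b * c) * x = d * (a * x + b * y) - b * (c * x + d * y)" by (simp add: algebra_simps)
    moreover have "(a * d - b * c) * y = a * (c * x + d * y) - c * (a * x + b * y)" by (simp add: algebra_simps)
    ultimately show ?thesis using that det by simp
  qed
  have inv': "s = 0 \<and> t = 0" if "s * a + t * c = 0" "s * b + t * d = 0" for s t
  proof -
    have "(a * d - b * c) * s = d * (s * a + t * c) - c * (s * b + t * d)" by (simp add: algebra_simps)
    moreover have "(a * d - b * c) * t = a * (s * b + t * d) - b * (s * a + t * c)" by (simp add: algebra_simps)
    ultimately show ?thesis using that det by simp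
  qed
  have "s = 0 \<and> t = 0" if "\<forall>f\<in>hom_part (int e). s * (a * F f + b * G f) + t * (c * F f + d * G f) = 0" for s t
  proof (rule inv')
    have "(s * a + t * c) * F f + (s * b + t * d) * G f = 0" if "f \<in> hom_part (int e)" for f
      using \<open>\<forall>f\<in>_. _\<close> that by (simp add: algebra_simps)
    then show "s * a + t * c = 0" "s * b + t * d = 0" using pairD(4)[OF p] by blast+
  qed
  moreover have "f \<in> I \<longleftrightarrow> a * F f + b * G f = 0 \<and> c * F f + d * G f = 0" if "f \<in> hom_part (int e)" for f
    using pairD(3)[OF p that] inv[of "F f" "G f"] by auto
  ultimately show ?thesis
    unfolding pair_def using lin_combination[OF pairD(1,2)[OF p]] by blast
qed

lemma pair_swap: "pair F G \<Longrightarrow> pair G F"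
  using pair_change[of F G 0 0 1 1] by simp

text \<open>The contraction of \<open>F\<close> by \<open>l\<close> is zero; for \<open>F\<close>
  viewed as a dual form, its derivative in the direction of \<open>l\<close> vanishes.\<close>

definition kills :: "'k poly3 \<Rightarrow> ('k poly3 \<Rightarrow> 'k) \<Rightarrow> bool" where
  "kills l F \<longleftrightarrow> (\<forall>f\<in>hom_part (int e - 1). F (l * f) = 0)"

lemma hom_part_mult1: "l \<in> hom_part 1 \<Longrightarrow> f \<in> hom_part (d - 1) \<Longrightarrow> l * f \<in> hom_part d"
  using hom_part_mult[of l 1 f "d - 1"] by simp

text \<open>Such an \<open>l\<close> would lie in \<open>I\<close> by \<open>membership\<close>, and
  \<open>I\<close> has no nonzero linear form.\<close>

lemma kills_both:
  assumes p: "pair F G" and l: "l \<in> hom_part 1" and k: "kills l F" "kills l G"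
  shows "l = 0"
proof -
  have "l \<in> I"
  proof (rule membership[OF l])
    fix g :: "'k poly3" assume g: "g \<in> hom_part (int e - 1)"
    have "l * g \<in> hom_part (int e)" using hom_part_mult1[OF l g] .
    then show "g * l \<in> I" using pairD(3)[OF p] k g by (simp add: kills_def mult.commute)
  qed (use e3 in auto)
  then show ?thesis using l no_linear by blast
qed

lemma membership_pair:
  assumes p: "pair F G" and f: "f \<in> hom_part d" "d \<le> int e"
    and "\<And>g. g \<in> hom_part (int e - d) \<Longrightarrow> F (g * f) = 0" "\<And>g. g \<in> hom_part (int e - d) \<Longrightarrow> G (g * f) = 0"
  shows "f \<in> I"
proof (rule membership[OF f])
  fix g :: "'k poly3" assume g: "g \<in> hom_part (int e - d)"
  then have "g * f \<in> hom_part (int e)" using hom_part_mult[OF g f(1)] by simp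
  then show "g * f \<in> I" using pairD(3)[OF p] assms(4,5)[OF g] by blast
qed

lemma functionals_on_degree_e1:
  obtains b :: "nat \<Rightarrow> 'k poly3" and c :: "nat \<Rightarrow> 'k poly3 \<Rightarrow> 'k" where
    "\<And>i. i < 3 \<Longrightarrow> b i \<in> hom_part (int e - 1)"
    "\<And>f. f \<in> hom_part (int e - 1) \<Longrightarrow> f - (\<Sum>i<3. const3 (c i f) * b i) \<in> ideal_part I (int e - 1)"
    "\<And>i. lin (c i)" "\<And>f i. f \<in> I \<Longrightarrow> f \<in> hom_part (int e - 1) \<Longrightarrow> i < 3 \<Longrightarrow> c i f = 0"
    "\<And>i j. i < 3 \<Longrightarrow> j < 3 \<Longrightarrow> c i (b j) = (if i = j then 1 else 0)"
proof -
  have "kspace.dim (hom_part (int e - 1) :: 'k poly3 set) = kspace.dim (ideal_part I (int e - 1)) + 3"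
    using dim_e1 dim_hom_part[of "int e - 1", where 'k = 'k] by linarith
  then show thesis
  proof (rule ks.quotient_coordinates[OF subspace_hom_part fin_dim_hom_part subspace_ideal_part[OF ideal] Int_lower2])
    fix b :: "nat \<Rightarrow> 'k poly3" and c :: "nat \<Rightarrow> 'k poly3 \<Rightarrow> 'k"
    assume b: "\<And>i. i < 3 \<Longrightarrow> b i \<in> hom_part (int e - 1)"
      and add: "\<And>i x y. c i (x + y) = c i x + c i y" and scl: "\<And>i r x. c i (const3 r * x) = r * c i x"
      and delta: "\<And>i j. i < 3 \<Longrightarrow> j < 3 \<Longrightarrow> c i (b j) = (if i = j then 1 else 0)"
      and W: "\<And>x. x \<in> hom_part (int e - 1) \<Longrightarrow> x \<in> ideal_part I (int e - 1) \<longleftrightarrow> (\<forall>i<3. c i x = 0)"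
      and rep: "\<And>x. x \<in> hom_part (int e - 1) \<Longrightarrow> x - (\<Sum>i<3. const3 (c i x) * b i) \<in> ideal_part I (int e - 1)"
    have "lin (c i)" for i unfolding lin_def using add scl by blast
    then show thesis using that[of b c] b delta rep W by blast
  qed
qed

lemma four_functionals_dependent:
  fixes \<phi> :: "nat \<Rightarrow> 'k poly3 \<Rightarrow> 'k"
  assumes l: "\<And>i. lin (\<phi> i)" and z: "\<And>i f. f \<in> I \<Longrightarrow> f \<in> hom_part (int e - 1) \<Longrightarrow> \<phi> i f = 0"
  obtains r0 r1 r2 r3 where "r0 \<noteq> 0 \<or> r1 \<noteq> 0 \<or> r2 \<noteq> 0 \<or> r3 \<noteq> 0"
    "\<And>f. f \<in> hom_part (int e - 1) \<Longrightarrow> r0 * \<phi> 0 f + r1 * \<phi> 1 f + r2 * \<phi> 2 f + r3 * \<phi> 3 f = 0"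
proof (rule functionals_on_degree_e1)
  fix b :: "nat \<Rightarrow> 'k poly3" and c :: "nat \<Rightarrow> 'k poly3 \<Rightarrow> 'k"
  assume b: "\<And>i. i < 3 \<Longrightarrow> b i \<in> hom_part (int e - 1)"
    and rep: "\<And>f. f \<in> hom_part (int e - 1) \<Longrightarrow> f - (\<Sum>i<3. const3 (c i f) * b i) \<in> ideal_part I (int e - 1)"
  obtain r where r: "\<exists>i\<in>{..<4::nat}. r i \<noteq> 0" "\<forall>j\<in>{..<3::nat}. (\<Sum>i\<in>{..<4}. r i * \<phi> i (b j)) = 0"
    using homogeneous_system_nontrivial[of "{..<3::nat}" "{..<4::nat}" "\<lambda>i j. \<phi> i (b j)"] by auto
  have sum4: "(\<Sum>i\<in>{..<4::nat}. h i) = h 0 + h 1 + h 2 + h 3" for h :: "nat \<Rightarrow> 'k"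
    by (simp add: eval_nat_numeral)
  have "(\<Sum>i<4. r i * \<phi> i f) = 0" if f: "f \<in> hom_part (int e - 1)" for f
  proof -
    have "\<phi> i f = (\<Sum>j<3. c j f * \<phi> i (b j))" for i
    proof -
      have "\<phi> i (f - (\<Sum>j<3. const3 (c j f) * b j)) = 0" using z rep[OF f] by blast
      then show ?thesis using l[of i] by (simp add: lin_simps lin_sum)
    qed
    then have "(\<Sum>i<4. r i * \<phi> i f) = (\<Sum>i<4. \<Sum>j<3. c j f * (r i * \<phi> i (b j)))"
      by (simp add: sum_distrib_left mult.left_commute)
    also have "\<dots> = (\<Sum>j<3. c j f * (\<Sum>i<4. r i * \<phi> i (b j)))"
      unfolding sum_distrib_left by (rule sum.swap)
    also have "\<dots> = 0" using r(2) by simp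
    finally show ?thesis .
  qed
  moreover have "r 0 \<noteq> 0 \<or> r 1 \<noteq> 0 \<or> r 2 \<noteq> 0 \<or> r 3 \<noteq> 0"
    using r(1) by (auto simp: lessThan_iff less_Suc_eq eval_nat_numeral)
  ultimately show thesis using that unfolding sum4 by blast
qed

text \<open>Two equations on the three-dimensional quotient in degree \<open>e - 1\<close> leave a
  nonzero class.\<close>

lemma two_functionals_common_zero:
  assumes l: "lin \<phi>" "lin \<psi>"
  obtains g where "g \<in> hom_part (int e - 1)" "g \<notin> I" "\<phi> g = 0" "\<psi> g = 0"
proof (rule functionals_on_degree_e1)
  fix b :: "nat \<Rightarrow> 'k poly3" and c :: "nat \<Rightarrow> 'k poly3 \<Rightarrow> 'k"
  assume b: "\<And>i. i < 3 \<Longrightarrow> b i \<in> hom_part (int e - 1)" and lc: "\<And>i. lin (c i)"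
    and z: "\<And>f i. f \<in> I \<Longrightarrow> f \<in> hom_part (int e - 1) \<Longrightarrow> i < 3 \<Longrightarrow> c i f = 0"
    and delta: "\<And>i j. i < 3 \<Longrightarrow> j < 3 \<Longrightarrow> c i (b j) = (if i = j then 1 else 0)"
  obtain r where r: "\<exists>i\<in>{..<3::nat}. r i \<noteq> 0" "\<forall>j\<in>{False, True}. (\<Sum>i\<in>{..<3}. r i * (if j then \<phi> (b i) else \<psi> (b i))) = 0"
    using homogeneous_system_nontrivial[of "{False, True}" "{..<3::nat}" "\<lambda>i j. if j then \<phi> (b i) else \<psi> (b i)"] by auto
  define g where "g = (\<Sum>i<3. const3 (r i) * b i)"
  have g: "g \<in> hom_part (int e - 1)" unfolding g_def using b by (auto intro!: hom_part_sum hom_part_scale)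
  have "\<phi> g = 0" "\<psi> g = 0" using r(2) l by (auto simp: g_def lin_sum lin_simps)
  moreover have "g \<notin> I"
  proof
    assume "g \<in> I"
    obtain i where i: "i < 3" "r i \<noteq> 0" using r(1) by auto
    have "c i g = (\<Sum>j<3. if j = i then r j else 0)"
      unfolding g_def lin_sum[OF lc] lin_simps(2)[OF lc] by (rule sum.cong) (use delta i in auto)
    also have "\<dots> = r i" using i by (simp add: sum.delta)
    finally show False using z[OF \<open>g \<in> I\<close> g i(1)] i by simp
  qed
  ultimately show thesis using that g by blast
qed

text \<open>\<open>k1\<close> and \<open>k2\<close> are the forms annihilating one member of the
  pencil, which is then dual to a power of \<open>l\<close>; the last clause records that
  \<open>I\<^sub>e\<close> lies in \<open>(k1, k2)\<close>. The common factor is \<open>w\<close>,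
  of the two quadrics \<open>w * k1\<close> and \<open>w * k2\<close>.\<close>

definition common_factor_case :: bool where
  "common_factor_case \<longleftrightarrow> (\<exists>l k1 k2 w. lbasis l k1 k2 \<and> w \<in> hom_part 1 \<and> w \<noteq> 0 \<and> w * k1 \<in> I \<and> w * k2 \<in> I \<and>
     w * l ^ (e - 1) \<notin> I \<and>
     (\<forall>f\<in>ideal_part I (int e). \<exists>g1\<in>hom_part (int e - 1). \<exists>g2\<in>hom_part (int e - 1). f = k1 * g1 + k2 * g2))"

text \<open>The model is \<open>D1 = v1\<^sup>2 - v0 v2\<close>, \<open>D2 = v1 v2 - v0 T v2\<close>, \<open>D3 = v2\<^sup>2 - v1 T v2\<close> for an operator \<open>T\<close> on
  the linear forms with cyclic vector \<open>v0\<close>, where \<open>v1 = T v0\<close> and \<open>v2 = T v1\<close>.\<close>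

definition three_quadrics_case :: bool where
  "three_quadrics_case \<longleftrightarrow> (\<exists>v0 v1 v2 D1 D2 D3. lbasis v0 v1 v2 \<and>
     D1 \<in> ideal_part I 2 \<and> D2 \<in> ideal_part I 2 \<and> D3 \<in> ideal_part I 2 \<and>
     (\<forall>q\<in>hom_part 2. \<exists>u\<in>hom_part 1. \<exists>r1 r2 r3. q = v0 * u + lcomb r1 r2 r3 D1 D2 D3) \<and>
     (\<exists>a\<in>hom_part 1. \<exists>b\<in>hom_part 1. v1 * D2 = a * D1 + b * D3) \<and>
     (\<exists>a\<in>hom_part 1. \<exists>b\<in>hom_part 1. v2 * D2 = a * D1 + b * D3))"

lemma functional_mult_I:
  assumes "pair F G" "l \<in> hom_part 1" "f \<in> I" "f \<in> hom_part (int e - 1)"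
  shows "F (l * f) = 0" "G (l * f) = 0"
  using pairD(3)[OF assms(1), of "l * f"] hom_part_mult1[OF assms(2,4)] ideal_mult[OF ideal assms(3)] by auto

text \<open>The functionals \<open>F (l * f)\<close>, \<open>G (l * f)\<close>,
  \<open>G (k1 * f)\<close>, \<open>G (k2 * f)\<close> of \<open>f\<close> are dependent in degree
  \<open>e - 1\<close>. Collecting the terms with \<open>G\<close> yields a linear form
  \<open>w\<close> with \<open>G (w * f) = - r0 * F (l * f)\<close>.\<close>

lemma common_factor_caseI:
  assumes p: "pair F G" and k: "k1 \<in> hom_part 1" "k2 \<in> hom_part 1" "kills k1 F" "kills k2 F"
    and ind: "\<And>s t. const3 s * k1 + const3 t * k2 = 0 \<Longrightarrow> s = 0 \<and> t = 0"
  shows common_factor_case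
proof -
  note lF = pairD(1)[OF p] and lG = pairD(2)[OF p]
  obtain l where l: "lbasis l k1 k2" using lbasis_extend[OF k(1,2) ind] by blast
  have sp: "lspan l k1 k2" by (rule lbasis_lspan[OF l])
  have l1: "l \<in> hom_part 1" using l unfolding lbasis_def by blast
  have kz: "F (k1 * g) = 0" "F (k2 * g) = 0" if "g \<in> hom_part (int e - 1)" for g
    using k that unfolding kills_def by auto
  have Fdec: "F f = r * F (l ^ e)"
    if "g1 \<in> hom_part (int e - 1)" "g2 \<in> hom_part (int e - 1)" "f = const3 r * l ^ e + k1 * g1 + k2 * g2" for f r g1 g2
    unfolding that(3) using kz that lF by (simp add: lin_simps)
  \<comment> \<open>Modulo \<open>k1\<close> and \<open>k2\<close> every form of degree
    \<open>e\<close> is a multiple of \<open>l ^ e\<close>, so otherwise \<open>F\<close> would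
    vanish in degree \<open>e\<close>.\<close>
  have Fl: "F (l ^ e) \<noteq> 0"
  proof
    assume 0: "F (l ^ e) = 0"
    have "1 * F f + 0 * G f = 0" if "f \<in> hom_part (int e)" for f
      using lspan_power_decompose[OF sp that] Fdec 0 by auto
    then show False using pairD(4)[OF p] by (metis zero_neq_one)
  qed
  have dec: "\<exists>g1\<in>hom_part (int e - 1). \<exists>g2\<in>hom_part (int e - 1). f = k1 * g1 + k2 * g2"
    if f: "f \<in> ideal_part I (int e)" for f
  proof -
    obtain r g1 g2 where g: "g1 \<in> hom_part (int e - 1)" "g2 \<in> hom_part (int e - 1)" "f = const3 r * l ^ e + k1 * g1 + k2 * g2"
      using lspan_power_decompose[OF sp] f by blast
    have "F f = 0" using pairD(3)[OF p] f by blast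
    then have "r = 0" using Fdec[OF g] Fl by simp
    then show ?thesis using g by (auto simp: const3_simps)
  qed
  define \<phi> where "\<phi> i f = (if i = 0 then F (l * f) else if i = 1 then G (l * f) else if i = 2 then G (k1 * f) else G (k2 * f))" for i :: nat and f
  have "\<phi> i = (if i = 0 then (\<lambda>f. F (l * f)) else if i = 1 then (\<lambda>f. G (l * f))
      else if i = 2 then (\<lambda>f. G (k1 * f)) else (\<lambda>f. G (k2 * f)))" for i
    unfolding \<phi>_def by (simp add: fun_eq_iff)
  then have "lin (\<phi> i)" for i
    using lin_mult[OF lF] lin_mult[OF lG] by simp
  moreover have "\<phi> i f = 0" if "f \<in> I" "f \<in> hom_part (int e - 1)" for i f
    using functional_mult_I[OF p _ that] l1 k unfolding \<phi>_def by auto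
  ultimately obtain r0 r1 r2 r3 where r: "r0 \<noteq> 0 \<or> r1 \<noteq> 0 \<or> r2 \<noteq> 0 \<or> r3 \<noteq> 0"
    "\<And>f. f \<in> hom_part (int e - 1) \<Longrightarrow> r0 * \<phi> 0 f + r1 * \<phi> 1 f + r2 * \<phi> 2 f + r3 * \<phi> 3 f = 0"
    using four_functionals_dependent by metis
  define w where "w = lcomb r1 r2 r3 l k1 k2"
  have w1: "w \<in> hom_part 1" unfolding w_def using l1 k by (intro lcomb_hom_part)
  have rel: "G (w * f) = - r0 * F (l * f)" if "f \<in> hom_part (int e - 1)" for f
  proof -
    have "G (w * f) = r1 * G (l * f) + r2 * G (k1 * f) + r3 * G (k2 * f)"
      by (simp add: w_def lcomb_mult lin_simps[OF lG])
    moreover have "r0 * F (l * f) + r1 * G (l * f) + r2 * G (k1 * f) + r3 * G (k2 * f) = 0"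
      using r(2)[OF that] by (simp add: \<phi>_def)
    ultimately have "G (w * f) + r0 * F (l * f) = 0" by (simp add: ac_simps)
    then show ?thesis by (simp add: eq_neg_iff_add_eq_0)
  qed
  define L where "L = l ^ (e - 1)"
  have le: "L \<in> hom_part (int e - 1)" "l * L = l ^ e"
    using hom_part_power[OF l1, of "e - 1"] e3 unfolding L_def by (auto simp: of_nat_diff simp flip: power_Suc)
  have Fw: "F (w * L) = r1 * F (l ^ e)"
    using kz[OF le(1)] lF by (simp add: w_def lcomb_mult lin_simps le)
  \<comment> \<open>Evaluating \<open>F\<close> and \<open>G\<close> at \<open>w * L\<close> would
    give \<open>r1 = 0\<close> and \<open>r0 = 0\<close>. Then \<open>w\<close> kills both
    functionals and is zero, so all four coefficients of the dependence vanish.\<close>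
  have wI: "w * L \<notin> I"
  proof
    assume "w * L \<in> I"
    then have "F (w * L) = 0" "G (w * L) = 0"
      using pairD(3)[OF p] hom_part_mult1[OF w1 le(1)] by auto
    then have z: "r0 = 0" "r1 = 0" using rel[OF le(1)] Fw Fl by (auto simp: le)
    then have "kills w F" unfolding kills_def w_def using kz lF by (simp add: lcomb_mult lin_simps)
    moreover have "kills w G" unfolding kills_def using rel z by simp
    ultimately have "w = 0" using kills_both[OF p w1] by blast
    then show False using l r(1) z unfolding lbasis_def w_def by blast
  qed
  \<comment> \<open>The relation turns \<open>G\<close> of a multiple of \<open>w * k\<close> into a
    multiple of \<open>F\<close> of a multiple of \<open>k\<close>, which is 0.\<close>
  have wk: "w * k \<in> I" if k': "k \<in> {k1, k2}" for k
  proof (rule membership_pair[OF p, of _ 2])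
    have k: "k \<in> hom_part 1" "\<And>g. g \<in> hom_part (int e - 1) \<Longrightarrow> F (k * g) = 0" using k' k kz by auto
    show "w * k \<in> hom_part 2" using hom_part_mult[OF w1 k(1)] by simp
    fix g :: "'k poly3" assume g: "g \<in> hom_part (int e - 2)"
    have gm: "g * v \<in> hom_part (int e - 1)" if "v \<in> hom_part 1" for v
      using hom_part_mult[OF g that] by (simp add: add.commute)
    show "F (g * (w * k)) = 0" using k(2)[OF gm[OF w1]] by (simp add: ac_simps)
    have "G (w * (g * k)) = - r0 * F (k * (g * l))" using rel[OF gm[OF k(1)]] by (simp add: ac_simps)
    then show "G (g * (w * k)) = 0" using k(2)[OF gm[OF l1]] by (simp add: ac_simps)
  qed (use e3 in auto)
  have "w \<noteq> 0" using wI ideal.subspace_0[OF ideal] by auto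
  then show ?thesis unfolding common_factor_case_def using l w1 wk wI[unfolded L_def] dec by blast
qed

end

section \<open>Pencils in which four members are annihilated by linear forms\<close>

context level_type2 begin

lemma three_quadrics_caseI:
  assumes "lbasis v0 v1 v2" "D1 \<in> ideal_part I 2" "D2 \<in> ideal_part I 2" "D3 \<in> ideal_part I 2"
    "\<forall>q\<in>hom_part 2. \<exists>u\<in>hom_part 1. \<exists>r1 r2 r3. q = v0 * u + lcomb r1 r2 r3 D1 D2 D3"
    and 1: "a \<in> hom_part 1" "b \<in> hom_part 1" "v1 * D2 = a * D1 + b * D3"
    and 2: "c \<in> hom_part 1" "d \<in> hom_part 1" "v2 * D2 = c * D1 + d * D3"
  shows three_quadrics_case
proof -
  have h1: "\<exists>a\<in>hom_part 1. \<exists>b\<in>hom_part 1. v1 * D2 = a * D1 + b * D3"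
    by (intro bexI[of _ a] bexI[of _ b] 1)
  have h2: "\<exists>a\<in>hom_part 1. \<exists>b\<in>hom_part 1. v2 * D2 = a * D1 + b * D3"
    by (intro bexI[of _ c] bexI[of _ d] 2)
  show ?thesis
    unfolding three_quadrics_case_def
    by (intro exI[of _ v0] exI[of _ v1] exI[of _ v2] exI[of _ D1] exI[of _ D2] exI[of _ D3] conjI) (fact assms(1-5) h1 h2)+
qed

lemma in_I_of_products:
  assumes p: "pair F G" and x: "x \<in> hom_part 1" "y \<in> hom_part 1"
    and "\<And>g. g \<in> hom_part (int e - 2) \<Longrightarrow> F (x * (y * g)) = 0"
    and "\<And>g. g \<in> hom_part (int e - 2) \<Longrightarrow> G (x * (y * g)) = 0"
  shows "x * y \<in> I"
proof (rule membership_pair[OF p, of _ 2])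
  show "x * y \<in> hom_part 2" using hom_part_mult[OF x] by simp
qed (use assms(4,5) e3 in \<open>simp_all add: mult.commute mult.left_commute\<close>)

text \<open>The conclusion is that \<open>I\<close> contains \<open>a * a\<close>,
  \<open>a * b\<close>, \<open>b * b\<close>, the minors of the matrix with rows
  \<open>(a, b, 0)\<close> and \<open>(0, a, b)\<close>. The forms \<open>c\<close> and
  \<open>d\<close> serve to show that \<open>F (a * f)\<close> and \<open>G (b * f)\<close> are
  proportional as functionals of \<open>f\<close>.\<close>

lemma singular_pencil:
  assumes p: "pair F G" and a: "a \<in> hom_part 1" "a \<noteq> 0" "kills a G" and b: "b \<in> hom_part 1" "b \<noteq> 0" "kills b F"
    and c: "c \<in> hom_part 1" "c \<noteq> 0" "kills c (\<lambda>f. F f + G f)"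
    and d: "d \<in> hom_part 1" "d \<noteq> 0" "kills d (\<lambda>f. F f - G f)"
  shows three_quadrics_case
proof -
  note lF = pairD(1)[OF p] and lG = pairD(2)[OF p]
  have aG: "G (a * f) = 0" and bF: "F (b * f) = 0" if "f \<in> hom_part (int e - 1)" for f
    using a b that unfolding kills_def by auto
  \<comment> \<open>Since \<open>a\<close> kills \<open>G\<close> and \<open>b\<close> kills
    \<open>F\<close>, applying \<open>F\<close> and \<open>G\<close> separates the two
    coefficients.\<close>
  have ind: "s = 0 \<and> t = 0" if z: "const3 s * a + const3 t * b = 0" for s t
  proof -
    have sF: "s * F (a * f) = 0" and tG: "t * G (b * f) = 0" if f: "f \<in> hom_part (int e - 1)" for f
    proof -
      have "const3 s * (a * f) + const3 t * (b * f) = 0"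
        using arg_cong[OF z, of "\<lambda>x. x * f"] by (simp add: distrib_right mult.assoc)
      then have "F (const3 s * (a * f) + const3 t * (b * f)) = 0" "G (const3 s * (a * f) + const3 t * (b * f)) = 0"
        using lin_simps(3)[OF lF] lin_simps(3)[OF lG] by simp_all
      then show "s * F (a * f) = 0" "t * G (b * f) = 0" using aG[OF f] bF[OF f] by (simp_all add: lin_simps[OF lF] lin_simps[OF lG])
    qed
    have "s = 0"
    proof (rule ccontr)
      assume "s \<noteq> 0"
      then have "kills a F" using sF unfolding kills_def by auto
      then show False using kills_both[OF p a(1)] a by blast
    qed
    moreover have "t = 0"
    proof (rule ccontr)
      assume "t \<noteq> 0"
      then have "kills b G" using tG unfolding kills_def by auto
      then show False using kills_both[OF p b(1)] b by blast
    qed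
    ultimately show ?thesis by blast
  qed
  obtain v where v: "lbasis v a b" using lbasis_extend[OF a(1) b(1) ind] by blast
  have sp: "lspan v a b" by (rule lbasis_lspan[OF v])
  have v1: "v \<in> hom_part 1" using v unfolding lbasis_def by blast
  obtain c0 c1 c2 where cc: "c = lcomb c0 c1 c2 v a b" using lspanD(5)[OF sp c(1)] by blast
  obtain d0 d1 d2 where dd: "d = lcomb d0 d1 d2 v a b" using lspanD(5)[OF sp d(1)] by blast
  have c': "c0 * (F (v * f) + G (v * f)) + c1 * F (a * f) + c2 * G (b * f) = 0"
    and d': "d0 * (F (v * f) - G (v * f)) + d1 * F (a * f) - d2 * G (b * f) = 0" if f: "f \<in> hom_part (int e - 1)" for f
  proof -
    have "F (c * f) + G (c * f) = 0" "F (d * f) - G (d * f) = 0" using c d f unfolding kills_def by auto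
    then show "c0 * (F (v * f) + G (v * f)) + c1 * F (a * f) + c2 * G (b * f) = 0"
        "d0 * (F (v * f) - G (v * f)) + d1 * F (a * f) - d2 * G (b * f) = 0"
      using aG[OF f] bF[OF f] unfolding cc dd lcomb_mult lin_simps[OF lF] lin_simps[OF lG]
      by (simp_all add: algebra_simps)
  qed
  \<comment> \<open>If \<open>c0\<close> or \<open>d0\<close> is zero, \<open>c'\<close> or
    \<open>d'\<close> is the desired relation. Otherwise take \<open>g\<close> outside
    \<open>I\<close> with \<open>F (a * g) = G (b * g) = 0\<close>: as 2 is invertible, the two
    relations give \<open>F (v * g) = G (v * g) = 0\<close>, so \<open>g\<close> would represent a
    socle element of degree \<open>e - 1\<close>.\<close>
  have "\<exists>s t. (s \<noteq> 0 \<or> t \<noteq> 0) \<and> (\<forall>f\<in>hom_part (int e - 1). s * F (a * f) + t * G (b * f) = 0)"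
  proof (cases "c0 = 0 \<or> d0 = 0")
    case True
    then show ?thesis
    proof
      assume "c0 = 0"
      then have "c1 \<noteq> 0 \<or> c2 \<noteq> 0" using c(2) cc by auto
      then show ?thesis using c' \<open>c0 = 0\<close> by (intro exI[of _ c1] exI[of _ c2]) auto
    next
      assume "d0 = 0"
      then have "d1 \<noteq> 0 \<or> d2 \<noteq> 0" using d(2) dd by auto
      then show ?thesis using d' \<open>d0 = 0\<close> by (intro exI[of _ d1] exI[of _ "- d2"]) auto
    qed
  next
    case False
    obtain g where g: "g \<in> hom_part (int e - 1)" "g \<notin> I" "F (a * g) = 0" "G (b * g) = 0"
      using two_functionals_common_zero[OF lin_mult[OF lF] lin_mult[OF lG], of a b] by blast
    have "F (v * g) + G (v * g) = 0" "F (v * g) - G (v * g) = 0" using c'[OF g(1)] d'[OF g(1)] g False by simp_all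
    then have s: "F (v * g) = - G (v * g)" "F (v * g) = G (v * g)" by (simp_all add: eq_neg_iff_add_eq_0)
    then have "2 * G (v * g) = 0" by (simp add: eq_neg_iff_add_eq_0)
    then have vg: "F (v * g) = 0" "G (v * g) = 0" using s by simp_all
    have "x * g \<in> I" if "x \<in> hom_part 1" "F (x * g) = 0" "G (x * g) = 0" for x
      using pairD(3)[OF p] hom_part_mult1[OF that(1) g(1)] that by blast
    then have "g \<in> I" using socle_lspan[OF sp g(1)] vg aG[OF g(1)] bF[OF g(1)] g v1 a b by simp
    then show ?thesis using g by blast
  qed
  then obtain s t where st: "s \<noteq> 0 \<or> t \<noteq> 0"
    "\<And>f. f \<in> hom_part (int e - 1) \<Longrightarrow> s * F (a * f) + t * G (b * f) = 0" by blast
  have s0: "s \<noteq> 0"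
  proof
    assume "s = 0"
    then have "kills b G" using st unfolding kills_def by auto
    then show False using kills_both[OF p b(1)] b by blast
  qed
  have t0: "t \<noteq> 0"
  proof
    assume "t = 0"
    then have "kills a F" using st unfolding kills_def by auto
    then show False using kills_both[OF p a(1)] a by blast
  qed
  have m: "x * g \<in> hom_part (int e - 1)" if "x \<in> hom_part 1" "g \<in> hom_part (int e - 2)" for x g :: "'k poly3"
    using hom_part_mult[OF that] by simp
  \<comment> \<open>The proportionality is used at \<open>a * g\<close>, where
    \<open>G (b * (a * g)) = G (a * (b * g))\<close> vanishes because \<open>a\<close> kills
    \<open>G\<close>.\<close>
  have aI: "a * a \<in> I"
  proof (rule in_I_of_products[OF p a(1) a(1)])
    fix g :: "'k poly3" assume g: "g \<in> hom_part (int e - 2)"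
    show "G (a * (a * g)) = 0" using aG m[OF a(1) g] by blast
    have "G (b * (a * g)) = G (a * (b * g))" by (simp add: mult.left_commute)
    then have "G (b * (a * g)) = 0" using aG m[OF b(1) g] by simp
    then show "F (a * (a * g)) = 0" using st(2)[OF m[OF a(1) g]] s0 by simp
  qed
  have abI: "a * b \<in> I"
  proof (rule in_I_of_products[OF p a(1) b(1)])
    fix g :: "'k poly3" assume g: "g \<in> hom_part (int e - 2)"
    show "G (a * (b * g)) = 0" using aG m[OF b(1) g] by blast
    show "F (a * (b * g)) = 0" using bF[OF m[OF a(1) g]] unfolding mult.left_commute[of a b g] .
  qed
  have bI: "b * b \<in> I"
  proof (rule in_I_of_products[OF p b(1) b(1)])
    fix g :: "'k poly3" assume g: "g \<in> hom_part (int e - 2)"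
    show "F (b * (b * g)) = 0" using bF m[OF b(1) g] by blast
    have "F (a * (b * g)) = F (b * (a * g))" by (simp add: mult.left_commute)
    then have "F (a * (b * g)) = 0" using bF m[OF a(1) g] by simp
    then show "G (b * (b * g)) = 0" using st(2)[OF m[OF b(1) g]] t0 by simp
  qed
  have "\<exists>u\<in>hom_part 1. \<exists>r1 r2 r3. q = v * u + lcomb r1 r2 r3 (a * a) (a * b) (b * b)" if q: "q \<in> hom_part 2" for q
  proof -
    obtain g0 g1 g2 where g: "g0 \<in> hom_part 1" "g1 \<in> hom_part 1" "g2 \<in> hom_part 1" "q = v * g0 + a * g1 + b * g2"
      using lspan_decompose[OF sp q] by auto
    obtain r0 r1 r2 s0 s1 s2 where r: "g1 = lcomb r0 r1 r2 v a b" "g2 = lcomb s0 s1 s2 v a b"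
      using lspanD(5)[OF sp g(2)] lspanD(5)[OF sp g(3)] by blast
    have "q = v * (g0 + const3 r0 * a + const3 s0 * b) + lcomb r1 (r2 + s1) s2 (a * a) (a * b) (b * b)"
      unfolding g(4) r lcomb_def const3_simps by (simp add: algebra_simps)
    moreover have "g0 + const3 r0 * a + const3 s0 * b \<in> hom_part 1"
      using g(1) a(1) b(1) by (intro hom_part_add hom_part_scale)
    ultimately show ?thesis by blast
  qed
  then have span: "\<forall>q\<in>hom_part 2. \<exists>u\<in>hom_part 1. \<exists>r1 r2 r3. q = v * u + lcomb r1 r2 r3 (a * a) (a * b) (b * b)"
    by blast
  have rel: "a * (a * b) = b * (a * a) + 0 * (b * b)" "b * (a * b) = 0 * (a * a) + a * (b * b)"
    by (simp_all add: ac_simps)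
  have "a * a \<in> hom_part 2" "a * b \<in> hom_part 2" "b * b \<in> hom_part 2"
    using hom_part_mult[OF a(1) a(1)] hom_part_mult[OF a(1) b(1)] hom_part_mult[OF b(1) b(1)] by simp_all
  then have D: "a * a \<in> ideal_part I 2" "a * b \<in> ideal_part I 2" "b * b \<in> ideal_part I 2"
    using aI abI bI by simp_all
  show ?thesis
    by (rule three_quadrics_caseI[OF v D span b(1) hom_part_0 rel(1) hom_part_0 a(1) rel(2)])
qed

end

lemma lbasis_combination:
  assumes b: "lbasis u v p"
    and x: "x0 = lcomb a0 b0 c0 u v p" "x1 = lcomb a1 b1 c1 u v p" "x2 = lcomb a2 b2 c2 u v p"
    and ind: "\<And>r0 r1 r2. r0 * a0 + r1 * a1 + r2 * a2 = 0 \<Longrightarrow> r0 * b0 + r1 * b1 + r2 * b2 = 0 \<Longrightarrow>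
      r0 * c0 + r1 * c1 + r2 * c2 = 0 \<Longrightarrow> r0 = 0 \<and> r1 = 0 \<and> r2 = 0"
  shows "lbasis x0 x1 x2"
proof -
  have uvp: "u \<in> hom_part 1" "v \<in> hom_part 1" "p \<in> hom_part 1" using b unfolding lbasis_def by blast+
  have "r0 = 0 \<and> r1 = 0 \<and> r2 = 0" if "lcomb r0 r1 r2 x0 x1 x2 = 0" for r0 r1 r2
  proof -
    have "lcomb (r0 * a0 + r1 * a1 + r2 * a2) (r0 * b0 + r1 * b1 + r2 * b2) (r0 * c0 + r1 * c1 + r2 * c2) u v p
        = lcomb r0 r1 r2 x0 x1 x2"
      unfolding x lcomb_def const3_simps by (simp add: algebra_simps)
    then show ?thesis using ind b that unfolding lbasis_def by metis
  qed
  then show ?thesis unfolding lbasis_def x using uvp by (auto intro: lcomb_hom_part)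
qed

section \<open>Pencils with a member annihilated by no nonzero linear form, and the
  dichotomy\<close>

context level_type2 begin

text \<open>The functionals \<open>G (X i * f)\<close> of \<open>f\<close> are independent, hence a
  basis of the three-dimensional dual space in degree \<open>e - 1\<close>; \<open>F (l * f)\<close>
  is expressed through them. In terms of the pencil, \<open>T\<close> is \<open>F\<close> divided by
  \<open>G\<close>.\<close>

lemma regular_operator:
  assumes p: "pair F G" and reg: "\<And>l. l \<in> hom_part 1 \<Longrightarrow> kills l G \<Longrightarrow> l = 0"
  obtains T where "\<And>l. l \<in> hom_part 1 \<Longrightarrow> T l \<in> hom_part 1"
    "\<And>l f. l \<in> hom_part 1 \<Longrightarrow> f \<in> hom_part (int e - 1) \<Longrightarrow> F (l * f) = G (T l * f)"
proof -
  note lF = pairD(1)[OF p] and lG = pairD(2)[OF p]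
  have "\<exists>m\<in>hom_part 1. \<forall>f\<in>hom_part (int e - 1). F (l * f) = G (m * f)" if l: "l \<in> hom_part 1" for l
  proof -
    define \<phi> where "\<phi> i = (if i = 0 then (\<lambda>f. F (l * f)) else if i = 1 then (\<lambda>f. G (X 0 * f))
      else if i = 2 then (\<lambda>f. G (X 1 * f)) else (\<lambda>f. G (X 2 * f)))" for i :: nat
    have "lin (\<phi> i)" for i using lin_mult[OF lF] lin_mult[OF lG] unfolding \<phi>_def by simp
    moreover have "\<phi> i f = 0" if "f \<in> I" "f \<in> hom_part (int e - 1)" for i f
      using functional_mult_I[OF p _ that] l unfolding \<phi>_def by (simp add: hom_part_X)
    ultimately obtain r0 r1 r2 r3 where r: "r0 \<noteq> 0 \<or> r1 \<noteq> 0 \<or> r2 \<noteq> 0 \<or> r3 \<noteq> 0"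
      "\<And>f. f \<in> hom_part (int e - 1) \<Longrightarrow> r0 * \<phi> 0 f + r1 * \<phi> 1 f + r2 * \<phi> 2 f + r3 * \<phi> 3 f = 0"
      using four_functionals_dependent[of \<phi>] by metis
    define m where "m = lcomb r1 r2 r3 (X 0) (X 1) (X 2)"
    have m1: "m \<in> hom_part 1" unfolding m_def by (intro lcomb_hom_part hom_part_X)
    have rel: "r0 * F (l * f) + G (m * f) = 0" if "f \<in> hom_part (int e - 1)" for f
      using r(2)[OF that] by (simp add: m_def \<phi>_def lcomb_mult lin_simps[OF lG] add.assoc)
    have "r0 \<noteq> 0"
    proof
      assume r0: "r0 = 0"
      then have "kills m G" using rel unfolding kills_def by simp
      then have m0: "m = 0" using reg m1 by blast
      have "lk m (Poly_Mapping.single i 1) = (if i = 0 then r1 else if i = 1 then r2 else r3)" for i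
        using exhaust_three[of i]
        by (auto simp: m_def lcomb_def lookup_add lookup_const3_mult X_def lookup_single when_def expo_eq_iff)
      from this[of 0] this[of 1] this[of 2] show False using r0 r(1) m0 by simp
    qed
    then have "F (l * f) = G ((const3 (- 1 / r0) * m) * f)" if "f \<in> hom_part (int e - 1)" for f
    proof -
      have "G ((const3 (- 1 / r0) * m) * f) = (- 1 / r0) * G (m * f)"
        unfolding mult.assoc lin_simps(2)[OF lG] ..
      moreover have "G (m * f) = - (r0 * F (l * f))" using rel[OF that] by (simp add: eq_neg_iff_add_eq_0 add.commute)
      ultimately show ?thesis using \<open>r0 \<noteq> 0\<close> by simp
    qed
    then show ?thesis using hom_part_scale[OF m1] by blast
  qed
  then have "\<exists>T. \<forall>l\<in>hom_part 1. T l \<in> hom_part 1 \<and> (\<forall>f\<in>hom_part (int e - 1). F (l * f) = G (T l * f))"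
    by (intro bchoice) blast
  then show thesis using that by blast
qed

text \<open>In each of \<open>F\<close> and \<open>G\<close> the defining equation of
  \<open>T\<close> moves \<open>T\<close> from one factor to the other, so the two products have
  equal values by commutativity.\<close>

lemma minors_in_I:
  assumes p: "pair F G" and T: "\<And>l. l \<in> hom_part 1 \<Longrightarrow> T l \<in> hom_part 1"
      "\<And>l f. l \<in> hom_part 1 \<Longrightarrow> f \<in> hom_part (int e - 1) \<Longrightarrow> F (l * f) = G (T l * f)"
    and lm: "l \<in> hom_part 1" "m \<in> hom_part 1"
  shows "l * T m - m * T l \<in> ideal_part I 2"
proof -
  note lF = pairD(1)[OF p] and lG = pairD(2)[OF p]
  have deg: "l * T m - m * T l \<in> hom_part 2"
    using hom_part_diff[OF hom_part_mult[OF lm(1) T(1)[OF lm(2)]] hom_part_mult[OF lm(2) T(1)[OF lm(1)]]] by simp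
  have "l * T m - m * T l \<in> I"
  proof (rule membership_pair[OF p deg])
    fix g :: "'k poly3" assume g: "g \<in> hom_part (int e - 2)"
    have m: "x * g \<in> hom_part (int e - 1)" if "x \<in> hom_part 1" for x
      using hom_part_mult[OF that g] by simp
    have "g * (l * T m - m * T l) = T m * (l * g) - T l * (m * g)" by (simp add: algebra_simps)
    then have "G (g * (l * T m - m * T l)) = G (T m * (l * g)) - G (T l * (m * g))" by (simp only: lin_simps[OF lG])
    also have "\<dots> = F (m * (l * g)) - F (l * (m * g))" using T(2) lm m by simp
    also have "m * (l * g) = l * (m * g)" by (rule mult.left_commute)
    finally show "G (g * (l * T m - m * T l)) = 0" by simp
    have "g * (l * T m - m * T l) = l * (T m * g) - m * (T l * g)" by (simp add: algebra_simps)
    then have "F (g * (l * T m - m * T l)) = F (l * (T m * g)) - F (m * (T l * g))" by (simp only: lin_simps[OF lF])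
    also have "\<dots> = G (T l * (T m * g)) - G (T m * (T l * g))" using T lm m by simp
    also have "T m * (T l * g) = T l * (T m * g)" by (rule mult.left_commute)
    finally show "F (g * (l * T m - m * T l)) = 0" by simp
  qed (use e3 in auto)
  then show ?thesis using deg by blast
qed

text \<open>The quadrics are the minors of the matrix with rows \<open>(v0, v1, v2)\<close> and
  \<open>(v1, v2, T v2)\<close>; expanding a determinant with a repeated row gives the two syzygies.
  Modulo \<open>v0\<close> they reduce to \<open>v1 * v1\<close>, \<open>v1 * v2\<close> and
  \<open>v2 * v2\<close> minus a combination of these two, hence span all quadrics.\<close>

lemma cyclic_three_quadrics:
  assumes minors: "\<And>l m. l \<in> hom_part 1 \<Longrightarrow> m \<in> hom_part 1 \<Longrightarrow> l * T m - m * T l \<in> ideal_part I 2"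
    and T: "T v0 = v1" "T v1 = v2" and b: "lbasis v0 v1 v2" and q1: "T v2 \<in> hom_part 1"
  shows three_quadrics_case
proof -
  let ?q = "T v2"
  have v: "v0 \<in> hom_part 1" "v1 \<in> hom_part 1" "v2 \<in> hom_part 1" using b unfolding lbasis_def by blast+
  have sp: "lspan v0 v1 v2" by (rule lbasis_lspan[OF b])
  define D1 where "D1 = v1 * v1 - v0 * v2"
  define D2 where "D2 = v2 * v1 - v0 * ?q"
  define D3 where "D3 = v2 * v2 - v1 * ?q"
  have D: "D1 \<in> ideal_part I 2" "D2 \<in> ideal_part I 2" "D3 \<in> ideal_part I 2"
    using minors[OF v(2) v(1)] minors[OF v(3) v(1)] minors[OF v(3) v(2)] unfolding T D1_def D2_def D3_def by simp_all
  obtain c0 c1 c2 where q: "?q = lcomb c0 c1 c2 v0 v1 v2" using lspanD(5)[OF sp q1] by blast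
  have sq: "v1 * v1 = D1 + v0 * v2" "v1 * v2 = D2 + v0 * ?q" "v2 * v2 = D3 + v1 * ?q"
    unfolding D1_def D2_def D3_def by (simp_all add: mult.commute)
  have v1q: "v1 * ?q = v0 * (const3 c0 * v1 + const3 c1 * v2 + const3 c2 * ?q) + const3 c1 * D1 + const3 c2 * D2"
  proof -
    have "v1 * ?q = const3 c0 * (v0 * v1) + const3 c1 * (v1 * v1) + const3 c2 * (v1 * v2)"
      by (subst q) (simp add: lcomb_def algebra_simps)
    then show ?thesis unfolding sq by (simp add: algebra_simps)
  qed
  have "\<exists>u\<in>hom_part 1. \<exists>r1 r2 r3. x = v0 * u + lcomb r1 r2 r3 D1 D2 D3" if x: "x \<in> hom_part 2" for x
  proof -
    obtain g0 g1 g2 where g: "g0 \<in> hom_part 1" "g1 \<in> hom_part 1" "g2 \<in> hom_part 1" "x = v0 * g0 + v1 * g1 + v2 * g2"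
      using lspan_decompose[OF sp x] by auto
    obtain r0 r1 r2 s0 s1 s2 where r: "g1 = lcomb r0 r1 r2 v0 v1 v2" "g2 = lcomb s0 s1 s2 v0 v1 v2"
      using lspanD(5)[OF sp g(2)] lspanD(5)[OF sp g(3)] by blast
    define y where "y = const3 c0 * v1 + const3 c1 * v2 + const3 c2 * ?q"
    have y: "y \<in> hom_part 1" unfolding y_def using v q1 by (intro hom_part_add hom_part_scale)
    have x': "x = v0 * g0 + const3 r0 * (v0 * v1) + const3 r1 * (v1 * v1) + const3 (r2 + s1) * (v1 * v2)
        + const3 s0 * (v0 * v2) + const3 s2 * (v2 * v2)"
      unfolding g(4) r lcomb_def const3_simps by (simp add: algebra_simps)
    have "v2 * v2 = D3 + (v0 * y + const3 c1 * D1 + const3 c2 * D2)" unfolding sq(3) v1q y_def ..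
    then have "x = v0 * (g0 + const3 r0 * v1 + const3 r1 * v2 + const3 (r2 + s1) * ?q + const3 s0 * v2 + const3 s2 * y)
        + lcomb (r1 + s2 * c1) (r2 + s1 + s2 * c2) s2 D1 D2 D3"
      unfolding x' sq(1,2) lcomb_def const3_simps by (simp add: algebra_simps)
    moreover have "g0 + const3 r0 * v1 + const3 r1 * v2 + const3 (r2 + s1) * ?q + const3 s0 * v2 + const3 s2 * y \<in> hom_part 1"
      using g v y q1 by (intro hom_part_add hom_part_scale)
    ultimately show ?thesis by blast
  qed
  then have span: "\<forall>x\<in>hom_part 2. \<exists>u\<in>hom_part 1. \<exists>r1 r2 r3. x = v0 * u + lcomb r1 r2 r3 D1 D2 D3"
    by blast
  have rel: "v1 * D2 = v2 * D1 + v0 * D3" "v2 * D2 = ?q * D1 + v1 * D3"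
    unfolding D1_def D2_def D3_def by (simp_all add: algebra_simps)
  show ?thesis
    by (rule three_quadrics_caseI[OF b D span v(3) v(1) rel(1) q1 v(2) rel(2)])
qed

text \<open>The member \<open>F - r G\<close> of the pencil is annihilated by both
  eigenvectors.\<close>

lemma eigenplane_common_factor:
  assumes p: "pair F G" and k: "k1 \<in> hom_part 1" "k2 \<in> hom_part 1"
    and ind: "\<And>s t. const3 s * k1 + const3 t * k2 = 0 \<Longrightarrow> s = 0 \<and> t = 0"
    and eig: "\<And>f. f \<in> hom_part (int e - 1) \<Longrightarrow> F (k1 * f) = r * G (k1 * f)"
      "\<And>f. f \<in> hom_part (int e - 1) \<Longrightarrow> F (k2 * f) = r * G (k2 * f)"
  shows common_factor_case
proof (rule common_factor_caseI[OF _ k _ _ ind])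
  show "pair (\<lambda>f. 1 * F f + (- r) * G f) (\<lambda>f. 0 * F f + 1 * G f)" by (rule pair_change[OF p]) simp
qed (use eig in \<open>auto simp: kills_def\<close>)

text \<open>An operator on a three-dimensional space without a cyclic vector has two independent
  eigenvectors for one eigenvalue. The proof tests explicit vectors for cyclicity and so finds that
  eigenvalue in the ground field.\<close>

lemma regular_pencil:
  assumes p: "pair F G" and reg: "\<And>l. l \<in> hom_part 1 \<Longrightarrow> kills l G \<Longrightarrow> l = 0"
  shows "three_quadrics_case \<or> common_factor_case"
proof (rule regular_operator[OF p reg])
  fix T assume T: "\<And>l. l \<in> hom_part 1 \<Longrightarrow> T l \<in> hom_part 1"
    "\<And>l f. l \<in> hom_part 1 \<Longrightarrow> f \<in> hom_part (int e - 1) \<Longrightarrow> F (l * f) = G (T l * f)"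
  note lF = pairD(1)[OF p] and lG = pairD(2)[OF p]
  \<comment> \<open>\<open>T\<close> comes from a choice of values; linearity has to be recovered
    from the fact that no nonzero form kills \<open>G\<close>.\<close>
  have T_unique: "T l = m" if "l \<in> hom_part 1" "m \<in> hom_part 1" "\<And>f. f \<in> hom_part (int e - 1) \<Longrightarrow> F (l * f) = G (m * f)" for l m
  proof -
    have "kills (T l - m) G" unfolding kills_def using T that by (simp add: left_diff_distrib lin_simps[OF lG] flip: T(2))
    then have "T l - m = 0" using reg hom_part_diff[OF T(1)[OF that(1)] that(2)] by blast
    then show ?thesis by simp
  qed
  have T_lin: "T (const3 r * l + const3 s * m) = const3 r * T l + const3 s * T m" if lm: "l \<in> hom_part 1" "m \<in> hom_part 1" for r s l m
  proof (rule T_unique)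
    show "const3 r * l + const3 s * m \<in> hom_part 1" "const3 r * T l + const3 s * T m \<in> hom_part 1"
      using lm T(1) by (auto intro!: hom_part_add hom_part_scale)
    show "F ((const3 r * l + const3 s * m) * f) = G ((const3 r * T l + const3 s * T m) * f)" if "f \<in> hom_part (int e - 1)" for f
      using T(2)[OF lm(1) that] T(2)[OF lm(2) that]
      by (simp add: distrib_right mult.assoc lin_simps[OF lF] lin_simps[OF lG])
  qed
  have T_add: "T (l + m) = T l + T m" if "l \<in> hom_part 1" "m \<in> hom_part 1" for l m
    using T_lin[OF that, of 1 1] by (simp add: const3_simps)
  have T_eig: "F (k * f) = r * G (k * f)" if "T k = const3 r * k" "k \<in> hom_part 1" "f \<in> hom_part (int e - 1)" for k r f
    using T(2)[OF that(2,3)] that(1) by (simp add: mult.assoc lin_simps[OF lG])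
  note minors = minors_in_I[OF p T]
  show ?thesis
  proof (rule ccontr)
    assume neg: "\<not> ?thesis"
    then have no_cyc: "\<not> lbasis v (T v) (T (T v))" if "v \<in> hom_part 1" for v
      using cyclic_three_quadrics[OF minors] T(1) that by blast
    have no_plane: False if "k1 \<in> hom_part 1" "k2 \<in> hom_part 1" "T k1 = const3 r * k1" "T k2 = const3 r * k2"
      "\<And>s t. const3 s * k1 + const3 t * k2 = 0 \<Longrightarrow> s = 0 \<and> t = 0" for k1 k2 r
      using eigenplane_common_factor[OF p that(1,2,5) T_eig[OF that(3,1)] T_eig[OF that(4,2)]] neg by blast
    have X_ind: "s = 0 \<and> t = 0" if "const3 s * X 0 + const3 t * X 1 = (0 :: 'k poly3)" for s t
    proof -
      have "lk (const3 s * X 0 + const3 t * X 1) (Poly_Mapping.single 0 1) = 0"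
        "lk (const3 s * X 0 + const3 t * X 1) (Poly_Mapping.single 1 1) = 0" using that by simp_all
      then show ?thesis
        by (auto simp: lookup_add lookup_const3_mult X_def lookup_single when_def expo_eq_iff)
    qed
    \<comment> \<open>Otherwise every linear form is an eigenvector. Comparing \<open>X 0\<close>,
      \<open>X 1\<close> and their sum shows that the eigenvalues of \<open>X 0\<close> and
      \<open>X 1\<close> agree, which gives the plane at once.\<close>
    have "\<exists>v\<in>hom_part 1. \<forall>s t. const3 s * v + const3 t * T v = 0 \<longrightarrow> s = 0 \<and> t = 0"
    proof (rule ccontr)
      assume *: "\<not> ?thesis"
      have eig: "\<exists>r. T v = const3 r * v" if v: "v \<in> hom_part 1" "v \<noteq> 0" for v
      proof -
        obtain s t where st: "const3 s * v + const3 t * T v = 0" "s \<noteq> 0 \<or> t \<noteq> 0" using * v by blast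
        have t: "t \<noteq> 0"
        proof
          assume "t = 0"
          then have "const3 s * v = 0" using st by (simp add: const3_simps)
          then show False using v st \<open>t = 0\<close> by simp
        qed
        have e: "const3 (1 / t) * const3 t = 1" "const3 (1 / t) * const3 s = const3 (s / t)"
          using t by (simp_all add: const3_simps(2) flip: const3_simps(4))
        have "const3 (1 / t) * (const3 s * v + const3 t * T v) = const3 (s / t) * v + T v"
          by (simp only: distrib_left mult.assoc[symmetric] e mult_1_left)
        then have "T v + const3 (s / t) * v = 0" using st by (simp add: add.commute)
        then have "T v = const3 (- (s / t)) * v" by (simp add: const3_simps(5) eq_neg_iff_add_eq_0)
        then show ?thesis by blast
      qed
      have X1: "X 0 \<noteq> (0 :: 'k poly3)" "X 1 \<noteq> (0 :: 'k poly3)" "X 0 + X 1 \<noteq> (0 :: 'k poly3)"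
        using X_ind[of 1 0] X_ind[of 0 1] X_ind[of 1 1] by (auto simp: const3_simps)
      obtain a b c where abc: "T (X 0) = const3 a * X 0" "T (X 1) = const3 b * X 1" "T (X 0 + X 1) = const3 c * (X 0 + X 1)"
        using eig[OF hom_part_X X1(1)] eig[OF hom_part_X X1(2)] eig[OF hom_part_add[OF hom_part_X hom_part_X] X1(3)] by blast
      have "const3 (a - c) * X 0 + const3 (b - c) * X 1 = 0"
        using abc T_add[OF hom_part_X hom_part_X, of 0 1] by (simp add: const3_simps algebra_simps)
      then have "a - c = 0 \<and> b - c = 0" by (rule X_ind)
      then have "a = c" "b = c" by auto
      then show False using no_plane[OF hom_part_X hom_part_X, of 0 c 1] abc X_ind by simp
    qed
    then obtain v where v: "v \<in> hom_part 1" "\<And>s t. const3 s * v + const3 t * T v = 0 \<Longrightarrow> s = 0 \<and> t = 0" by blast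
    define p where "p = T v"
    have p1: "p \<in> hom_part 1" unfolding p_def by (rule T(1)[OF v(1)])
    obtain u where u: "lbasis u v p" using lbasis_extend[OF v(1) p1] v(2) unfolding p_def by blast
    have sp: "lspan u v p" by (rule lbasis_lspan[OF u])
    have u1: "u \<in> hom_part 1" using u unfolding lbasis_def by blast
    have Tlc: "T (lcomb r0 r1 r2 u v p) = lcomb r0 r1 r2 (T u) (T v) (T p)" for r0 r1 r2
    proof -
      have "T (const3 1 * (const3 r0 * u + const3 r1 * v) + const3 r2 * p) = const3 1 * T (const3 r0 * u + const3 r1 * v) + const3 r2 * T p"
        using u1 v(1) p1 by (intro T_lin hom_part_add hom_part_scale)
      then show ?thesis unfolding lcomb_def by (simp add: T_lin[OF u1 v(1)] const3_simps)
    qed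
    obtain a0 \<beta> \<alpha> where Tp: "T p = lcomb a0 \<beta> \<alpha> u v p" using lspanD(5)[OF sp T(1)[OF p1]] by blast
    \<comment> \<open>A component of \<open>T p\<close> along \<open>u\<close> would make
      \<open>v\<close> cyclic. So \<open>v\<close> and \<open>p\<close> span an invariant plane, on
      which the characteristic polynomial of \<open>T\<close> is
      \<open>t ^ 2 - \<alpha> * t - \<beta>\<close>.\<close>
    have a0: "a0 = 0"
    proof (rule ccontr)
      assume "a0 \<noteq> 0"
      have "lbasis v (T v) (T (T v))"
        by (rule lbasis_combination[OF u, of _ 0 1 0 _ 0 0 1 _ a0 \<beta> \<alpha>])
          (use Tp \<open>a0 \<noteq> 0\<close> in \<open>auto simp: p_def lcomb_def const3_simps\<close>)
      then show False using no_cyc v(1) by blast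
    qed
    obtain s c1 c2 where Tu: "T u = lcomb s c1 c2 u v p" using lspanD(5)[OF sp T(1)[OF u1]] by blast
    have Tv: "T v = lcomb 0 0 1 u v p" by (simp add: lcomb_def p_def const3_simps)
    have Tgen: "T (lcomb x y z u v p) = lcomb (x * s) (x * c1 + z * \<beta>) (x * c2 + y + z * \<alpha>) u v p" for x y z
      unfolding Tlc unfolding Tu Tv Tp a0 unfolding lcomb_def const3_simps by (simp add: algebra_simps)
    \<comment> \<open>The vector \<open>u' = u - c2 v\<close> satisfies
      \<open>T u' = s u' + \<kappa> v\<close>, so it is cyclic unless \<open>\<kappa> = 0\<close>;
      then it is an eigenvector with eigenvalue \<open>s\<close>. The second test vector is
      \<open>u2 = u' + v\<close>.\<close>
    define \<kappa> where "\<kappa> = c1 + s * c2"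
    define u' where "u' = lcomb 1 (- c2) 0 u v p"
    define u2 where "u2 = lcomb 1 (1 - c2) 0 u v p"
    have in1: "lcomb x y z u v p \<in> hom_part 1" for x y z using u1 v(1) p1 by (rule lcomb_hom_part)
    have Tu': "T u' = lcomb s c1 0 u v p" "T (T u') = lcomb (s * s) (s * c1) (s * c2 + c1) u v p"
      unfolding u'_def by (simp_all add: Tgen)
    have Tu2: "T u2 = lcomb s c1 1 u v p" "T (T u2) = lcomb (s * s) (s * c1 + \<beta>) (s * c2 + c1 + \<alpha>) u v p"
      unfolding u2_def by (simp_all add: Tgen)
    have k0: "\<kappa> = 0"
    proof (rule ccontr)
      assume k: "\<kappa> \<noteq> 0"
      have "lbasis u' (T u') (T (T u'))"
      proof (rule lbasis_combination[OF u u'_def Tu'])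
        fix r0 r1 r2
        assume h: "r0 * 1 + r1 * s + r2 * (s * s) = 0" "r0 * - c2 + r1 * c1 + r2 * (s * c1) = 0"
          "r0 * 0 + r1 * 0 + r2 * (s * c2 + c1) = 0"
        have r2: "r2 = 0" using h(3) k by (simp add: \<kappa>_def add.commute)
        then have "r0 = - (r1 * s)" using h(1) by (simp add: eq_neg_iff_add_eq_0)
        then have "r1 * \<kappa> = 0" using h(2) r2 by (simp add: \<kappa>_def algebra_simps)
        then show "r0 = 0 \<and> r1 = 0 \<and> r2 = 0" using r2 k \<open>r0 = _\<close> by simp
      qed
      then show False using no_cyc in1 unfolding u'_def by blast
    qed
    then have c1: "c1 = - (s * c2)" by (simp add: \<kappa>_def eq_neg_iff_add_eq_0)
    \<comment> \<open>\<open>u2\<close> is cyclic unless \<open>s\<close> is also an eigenvalue of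
      \<open>T\<close> on the plane of \<open>v\<close> and \<open>p\<close>.\<close>
    have d0: "s * s = \<alpha> * s + \<beta>"
    proof (rule ccontr)
      assume d: "s * s \<noteq> \<alpha> * s + \<beta>"
      have "lbasis u2 (T u2) (T (T u2))"
      proof (rule lbasis_combination[OF u u2_def Tu2])
        fix r0 r1 r2
        assume h: "r0 * 1 + r1 * s + r2 * (s * s) = 0" "r0 * (1 - c2) + r1 * c1 + r2 * (s * c1 + \<beta>) = 0"
          "r0 * 0 + r1 * 1 + r2 * (s * c2 + c1 + \<alpha>) = 0"
        have r1: "r1 = - (r2 * \<alpha>)" using h(3) unfolding c1 by (simp add: eq_neg_iff_add_eq_0)
        have r0: "r0 = r2 * \<alpha> * s - r2 * (s * s)" using h(1) unfolding r1 by (simp add: algebra_simps eq_diff_eq)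
        have "r2 * (\<alpha> * s + \<beta> - s * s) = 0" using h(2) unfolding r0 r1 c1 by (simp add: algebra_simps)
        then have "r2 = 0" using d by simp
        then show "r0 = 0 \<and> r1 = 0 \<and> r2 = 0" using r0 r1 by simp
      qed
      then show False using no_cyc in1 unfolding u2_def by blast
    qed
    \<comment> \<open>The eigenvector for the root \<open>s\<close> inside that plane; it is
      independent of \<open>u'\<close>, which has a component along \<open>u\<close>.\<close>
    define k2 where "k2 = lcomb 0 (s - \<alpha>) 1 u v p"
    show False
    proof (rule no_plane[of u' k2 s])
      show "u' \<in> hom_part 1" "k2 \<in> hom_part 1" unfolding u'_def k2_def by (rule in1)+
      show "T u' = const3 s * u'" unfolding Tu' unfolding c1 u'_def lcomb_def const3_simps by (simp add: algebra_simps)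
      have \<beta>: "\<beta> = s * s - \<alpha> * s" using d0 by simp
      show "T k2 = const3 s * k2"
        unfolding k2_def Tgen unfolding \<beta> c1 lcomb_def const3_simps by (simp add: algebra_simps)
      fix x y assume "const3 x * u' + const3 y * k2 = 0"
      moreover have "const3 x * u' + const3 y * k2 = lcomb x (y * (s - \<alpha>) - x * c2) y u v p"
        unfolding u'_def k2_def lcomb_def const3_simps by (simp add: algebra_simps)
      ultimately show "x = 0 \<and> y = 0" using u unfolding lbasis_def by metis
    qed
  qed
qed

text \<open>If one of \<open>F\<close>, \<open>G\<close>, \<open>F + G\<close>, \<open>F - G\<close>
  is killed by no nonzero linear form, it can be made the second member of a basis of the pencil;
  otherwise all four are killed and \<open>singular_pencil\<close> applies.\<close>

theorem dichotomy: "three_quadrics_case \<or> common_factor_case"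
proof (rule pair_exists)
  fix F G assume p: "pair F G"
  have p1: "pair F (\<lambda>f. F f + G f)" using pair_change[OF p, of 1 1 0 1] by simp
  have p2: "pair F (\<lambda>f. F f - G f)" using pair_change[OF p, of 1 "-1" 0 1] by simp
  show ?thesis
  proof (cases "\<exists>a b c d. a \<in> hom_part 1 \<and> a \<noteq> 0 \<and> kills a G \<and> b \<in> hom_part 1 \<and> b \<noteq> 0 \<and> kills b F \<and>
      c \<in> hom_part 1 \<and> c \<noteq> 0 \<and> kills c (\<lambda>f. F f + G f) \<and> d \<in> hom_part 1 \<and> d \<noteq> 0 \<and> kills d (\<lambda>f. F f - G f)")
    case True
    then show ?thesis using singular_pencil[OF p] by blast
  next
    case False
    then consider "\<forall>l\<in>hom_part 1. kills l G \<longrightarrow> l = 0" | "\<forall>l\<in>hom_part 1. kills l F \<longrightarrow> l = 0"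
      | "\<forall>l\<in>hom_part 1. kills l (\<lambda>f. F f + G f) \<longrightarrow> l = 0" | "\<forall>l\<in>hom_part 1. kills l (\<lambda>f. F f - G f) \<longrightarrow> l = 0"
      by blast
    then show ?thesis
      by cases (use regular_pencil[OF p] regular_pencil[OF pair_swap[OF p]] regular_pencil[OF p1] regular_pencil[OF p2] in blast)+
  qed
qed

end

subsection \<open>Dimension counts\<close>

abbreviation mulset :: "'k::field_char_0 poly3 \<Rightarrow> 'k poly3 set \<Rightarrow> 'k poly3 set" (infixr "*\<^sub>s" 75) where
  "g *\<^sub>s W \<equiv> (*) g ` W"

lemma subspace_mulset: "kspace.subspace W \<Longrightarrow> kspace.subspace (g *\<^sub>s W)"
  unfolding kspace.subspace_def
proof (intro conjI allI ballI)
  assume W: "0 \<in> W \<and> (\<forall>x\<in>W. \<forall>y\<in>W. x + y \<in> W) \<and> (\<forall>c. \<forall>x\<in>W. const3 c * x \<in> W)"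
  show "0 \<in> g *\<^sub>s W" using W by force
  fix x assume "x \<in> g *\<^sub>s W"
  then obtain x' where x: "x' \<in> W" "x = g * x'" by blast
  show "x + y \<in> g *\<^sub>s W" if y: "y \<in> g *\<^sub>s W" for y
  proof -
    obtain y' where "y' \<in> W" "y = g * y'" using y by blast
    then have "x + y = g * (x' + y')" "x' + y' \<in> W" using x W by (simp_all add: distrib_left)
    then show ?thesis by blast
  qed
  show "const3 c * x \<in> g *\<^sub>s W" for c
  proof -
    have "const3 c * x = g * (const3 c * x')" "const3 c * x' \<in> W" using x W by (simp_all add: mult.left_commute)
    then show ?thesis by blast
  qed
qed

lemma kdim_mulset:
  assumes "g \<noteq> 0" "kspace.subspace W" "W \<subseteq> hom_part d"
  shows "kdim (g *\<^sub>s W) = kdim W"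
  using ks.dim_inj_image[OF linear_mult_left _ assms(2) fin_dim_subset_hom_part[OF assms(3)], of g] assms(1) by simp

lemma kdim_set_add:
  assumes "kspace.subspace A" "A \<subseteq> hom_part d" "kspace.subspace B" "B \<subseteq> hom_part d"
  shows "kdim (A \<oplus>\<^sub>s B) = kdim A + kdim B - kdim (A \<inter> B)"
  using ks.dim_set_add[OF assms(1) fin_dim_subset_hom_part[OF assms(2)] assms(3) fin_dim_subset_hom_part[OF assms(4)]]
  by linarith

lemma set_add_hom_part: "A \<subseteq> hom_part d \<Longrightarrow> B \<subseteq> hom_part d \<Longrightarrow> A \<oplus>\<^sub>s B \<subseteq> hom_part d"
  by (rule ks.set_add_least[OF subspace_hom_part])

lemma kdim_mono:
  assumes "kspace.subspace A" "kspace.subspace B" "A \<subseteq> B" "B \<subseteq> hom_part d"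
  shows "kdim A \<le> kdim B"
  using ks.dim_mono_fin_dim[OF assms(1) fin_dim_subset_hom_part[OF assms(4)] assms(2,3)] by simp

lemma subspace_eqI_kdim:
  assumes "kspace.subspace A" "kspace.subspace B" "A \<subseteq> B" "B \<subseteq> hom_part d" "kdim B \<le> kdim A"
  shows "A = B"
  using ks.subspace_eqI_dim[OF assms(1) fin_dim_subset_hom_part[OF assms(4)] assms(2,3)] assms(5) by simp

lemma kdim_zero [simp]: "kdim {0} = 0"
  using kspace.dim_le_card[of "{0}" "{}"] by simp

lemma kdim_span_le: "finite S \<Longrightarrow> kdim (kspace.span S) \<le> int (card S)"
  using kspace.dim_le_card[of "kspace.span S" S] by simp

lemma mult_part_zero: "mult_part {0} = {0}"
  unfolding mult_part_def by auto

lemma lspan_extend: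
  assumes v: "v \<in> hom_part 1" "v \<noteq> 0"
  shows "\<exists>p q. lspan p q v"
proof -
  obtain r0 r1 r2 where r: "v = lcomb r0 r1 r2 (X 0) (X 1) (X 2)"
    using lspanD(5)[OF lspan_X v(1)] by blast
  have "r0 \<noteq> 0 \<or> r1 \<noteq> 0 \<or> r2 \<noteq> 0" using r v(2) by (auto simp: lcomb_def const3_simps)
  then consider "r0 \<noteq> 0" | "r1 \<noteq> 0" | "r2 \<noteq> 0" by blast
  then show ?thesis
  proof cases
    case 1 then show ?thesis using lspan_rotate[OF lspan_exchange[OF lspan_X r]] by blast
  next
    case 2
    have "v = lcomb r1 r2 r0 (X 1) (X 2) (X 0)" unfolding r by (rule lcomb_rotate)
    then show ?thesis using lspan_rotate[OF lspan_exchange[OF lspan_rotate[OF lspan_X]]] 2 by blast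
  next
    case 3
    have "v = lcomb r2 r0 r1 (X 2) (X 0) (X 1)" unfolding r by (simp add: lcomb_def ac_simps)
    then show ?thesis using lspan_rotate[OF lspan_exchange[OF lspan_rotate[OF lspan_rotate[OF lspan_X]]]] 3 by blast
  qed
qed

section \<open>Hilbert function and generators in extreme degrees\<close>

context level_type2 begin

definition hi :: "int \<Rightarrow> int" where
  "hi d = dimR d - kdim (ideal_part I d)"

lemma hi_e: "hi (int e) = 2" "hi (int e - 1) = 3"
  unfolding hi_def using dim_e dim_e1 by auto

lemma ideal_part_1: "ideal_part I 1 = {0}" using no_linear by simp

lemma hi_1: "hi 1 = 3"
  unfolding hi_def ideal_part_1 by (simp add: dimR_def)

lemma one_notin: "1 \<notin> I"
proof
  assume "1 \<in> I"
  then have "X 0 \<in> I" using ideal_mult[OF ideal, of 1 "X 0"] by simp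
  then have "X 0 = (0 :: 'k poly3)" using no_linear hom_part_X[of 0] by blast
  then show False using mono_nonzero unfolding X_mono by blast
qed

lemma ideal_part_0: "ideal_part I 0 = {0}"
proof -
  have "f = 0" if f: "f \<in> I" "f \<in> hom_part 0" for f
  proof (rule ccontr)
    assume nz: "f \<noteq> 0"
    define c where "c = lk f 0"
    have fc: "f = const3 c" unfolding c_def by (rule hom_part_0_const[OF f(2)])
    then have "c \<noteq> 0" using nz by auto
    then have "const3 (1 / c) * f = 1" unfolding fc by (simp add: const3_simps(2) flip: const3_simps(4))
    then show False using one_notin ideal_mult[OF ideal f(1), of "const3 (1 / c)"] by simp
  qed
  then show ?thesis using ideal.subspace_0[OF ideal] by auto
qed

lemma ideal_part_low: "d \<le> 1 \<Longrightarrow> ideal_part I d = {0}"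
proof -
  assume "d \<le> 1"
  then consider "d < 0" | "d = 0" | "d = 1" by linarith
  then show ?thesis
    by cases (use hom_part_neg ideal.subspace_0[OF ideal] ideal_part_0 ideal_part_1 in auto)
qed

lemma sub_I: "kspace.subspace (ideal_part I d)"
  by (rule subspace_ideal_part[OF ideal])

lemma mult_part_ideal_part: "mult_part (ideal_part I (d - 1)) \<subseteq> ideal_part I d"
  using mult_part_ideal[OF ideal, of "ideal_part I (d - 1)"] mult_part_subset[of "ideal_part I (d - 1)" d] by auto

lemma num_gens_low: "d \<le> 1 \<Longrightarrow> num_gens I d = 0"
  unfolding num_gens_def using ideal_part_low[of d] ideal_part_low[of "d - 1"] by (simp add: mult_part_zero)

lemma num_gens_2: "num_gens I 2 = 6 - hi 2"
  unfolding num_gens_def hi_def using ideal_part_low[of 1] by (simp add: mult_part_zero dimR_def)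

lemma num_gens_high: "d \<ge> int e + 2 \<Longrightarrow> num_gens I d = 0"
proof -
  assume d: "d \<ge> int e + 2"
  have "ideal_part I d = hom_part d" "ideal_part I (d - 1) = hom_part (d - 1)" using above[of d] above[of "d - 1"] d by auto
  then show ?thesis unfolding num_gens_def using mult_part_hom_part[of d, where 'k = 'k] d by simp
qed

lemma num_gens_nonneg: "num_gens I d \<ge> 0"
  unfolding num_gens_def using kdim_mono[OF subspace_mult_part[OF sub_I] sub_I mult_part_ideal_part, of d] by auto

lemma common_kernel:
  fixes \<alpha> \<beta> :: "'k poly3 \<Rightarrow> 'k"
  assumes "lin \<alpha>" "lin \<beta>"
  obtains c where "c \<in> hom_part 1" "c \<noteq> 0" "\<alpha> c = 0" "\<beta> c = 0"
proof -
  have "\<exists>c. (\<exists>i\<in>(UNIV::3 set). c i \<noteq> 0) \<and>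
        (\<forall>j\<in>{False, True}. (\<Sum>i\<in>UNIV. c i * (if j then \<alpha> (X i) else \<beta> (X i))) = 0)"
    by (rule homogeneous_system_nontrivial) simp_all
  then obtain c where c: "\<exists>i\<in>(UNIV::3 set). c i \<noteq> 0"
    "\<forall>j\<in>{False, True}. (\<Sum>i\<in>UNIV. c i * (if j then \<alpha> (X i) else \<beta> (X i))) = 0" by blast
  define x where "x = lcomb (c 0) (c 1) (c 2) (X 0) (X 1) (X 2)"
  have "x \<in> hom_part 1" unfolding x_def by (intro lcomb_hom_part hom_part_X)
  moreover have "\<alpha> x = 0" "\<beta> x = 0"
    using c(2) by (auto simp: x_def lcomb_def lin_simps[OF assms(1)] lin_simps[OF assms(2)] sum_three)
  moreover have "x \<noteq> 0"
  proof
    assume "x = 0"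
    then have *: "lk x (Poly_Mapping.single i 1) = 0" for i by simp
    have "c i = 0" for i
      using *[of i] exhaust_three[of i]
      by (auto simp: x_def lcomb_def lookup_add lookup_const3_mult X_def lookup_single when_def expo_eq_iff)
    then show False using c(1) by blast
  qed
  ultimately show thesis using that by blast
qed

text \<open>In terms of inverse systems, \<open>\<phi>\<close> is a power of a linear form: all its derivatives are multiples
  of the single functional \<open>s F + t G\<close>.\<close>

lemma functional_rank_one:
  assumes p: "pair F G" and b: "b1 \<in> hom_part (int e)" "b2 \<in> hom_part (int e)"
    and dec: "\<forall>f\<in>hom_part (int e). f - (const3 (F f) * b1 + const3 (G f) * b2) \<in> I"
    and \<phi>: "lin \<phi>" "\<forall>x\<in>mult_part (ideal_part I (int e)). \<phi> x = 0"
    and nz: "g \<in> hom_part (int e + 1)" "\<phi> g \<noteq> 0"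
  shows "\<exists>s t \<gamma> l0. (s \<noteq> 0 \<or> t \<noteq> 0) \<and> lin \<gamma> \<and> l0 \<in> hom_part 1 \<and> \<gamma> l0 = 1 \<and>
    (\<forall>l\<in>hom_part 1. \<forall>f\<in>hom_part (int e). \<phi> (l * f) = \<gamma> l * (s * F f + t * G f)) \<and>
    (\<forall>l\<in>hom_part 1. \<gamma> l = 0 \<longrightarrow> kills l (\<lambda>f. s * F f + t * G f))"
proof -
  note lF = pairD(1)[OF p] and lG = pairD(2)[OF p]
  define \<alpha> where "\<alpha> l = \<phi> (l * b1)" for l
  define \<beta> where "\<beta> l = \<phi> (l * b2)" for l
  have l\<alpha>: "lin \<alpha>" "lin \<beta>"
    using lin_mult[OF \<phi>(1), of b1] lin_mult[OF \<phi>(1), of b2] unfolding \<alpha>_def \<beta>_def by (simp_all add: mult.commute)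
  have val: "\<phi> (l * f) = \<alpha> l * F f + \<beta> l * G f" if l: "l \<in> hom_part 1" and f: "f \<in> hom_part (int e)" for l f
  proof -
    let ?r = "f - (const3 (F f) * b1 + const3 (G f) * b2)"
    have "?r \<in> ideal_part I (int e)" using bspec[OF dec f] f b by (auto intro!: hom_part_diff hom_part_add hom_part_scale)
    then have "\<phi> (l * ?r) = 0" using \<phi>(2) mult_part_linear[OF sub_I l] by blast
    moreover have "l * ?r = l * f - (const3 (F f) * (l * b1) + const3 (G f) * (l * b2))"
      by (simp add: algebra_simps)
    ultimately have "\<phi> (l * f) - (F f * \<phi> (l * b1) + G f * \<phi> (l * b2)) = 0"
      by (simp only: lin_simps[OF \<phi>(1)])
    then show ?thesis unfolding \<alpha>_def \<beta>_def by (simp add: algebra_simps)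
  qed
  have compat: "\<alpha> l * F (m * f) + \<beta> l * G (m * f) = \<alpha> m * F (l * f) + \<beta> m * G (l * f)"
    if "l \<in> hom_part 1" "m \<in> hom_part 1" "f \<in> hom_part (int e - 1)" for l m f
    using val[OF that(1) hom_part_mult1[OF that(2,3)]] val[OF that(2) hom_part_mult1[OF that(1,3)]]
    by (simp add: mult.left_commute)
  \<comment> \<open>If this minor were nonzero, a nonzero \<open>c\<close> with
    \<open>\<alpha> c = \<beta> c = 0\<close> would, by \<open>compat\<close> with \<open>l\<close>
    and with \<open>m\<close>, kill both \<open>F\<close> and \<open>G\<close>.\<close>
  have minor: "\<alpha> l * \<beta> m = \<alpha> m * \<beta> l" if lm: "l \<in> hom_part 1" "m \<in> hom_part 1" for l m
  proof (rule ccontr)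
    assume d: "\<alpha> l * \<beta> m \<noteq> \<alpha> m * \<beta> l"
    obtain c where c: "c \<in> hom_part 1" "c \<noteq> 0" "\<alpha> c = 0" "\<beta> c = 0" using common_kernel[OF l\<alpha>] by blast
    have "F (c * f) = 0 \<and> G (c * f) = 0" if f: "f \<in> hom_part (int e - 1)" for f
    proof -
      have 1: "\<alpha> l * F (c * f) + \<beta> l * G (c * f) = 0" "\<alpha> m * F (c * f) + \<beta> m * G (c * f) = 0"
        using compat[OF c(1) lm(1) f] compat[OF c(1) lm(2) f] c by simp_all
      have F: "(\<alpha> l * \<beta> m - \<alpha> m * \<beta> l) * F (c * f) =
          \<beta> m * (\<alpha> l * F (c * f) + \<beta> l * G (c * f)) - \<beta> l * (\<alpha> m * F (c * f) + \<beta> m * G (c * f))"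
        by (simp add: algebra_simps)
      have G: "(\<alpha> l * \<beta> m - \<alpha> m * \<beta> l) * G (c * f) =
          \<alpha> l * (\<alpha> m * F (c * f) + \<beta> m * G (c * f)) - \<alpha> m * (\<alpha> l * F (c * f) + \<beta> l * G (c * f))"
        by (simp add: algebra_simps)
      show ?thesis using F G d unfolding 1 by simp
    qed
    then show False using kills_both[OF p c(1)] c(2) unfolding kills_def by blast
  qed
  have "\<exists>l0\<in>hom_part 1. \<alpha> l0 \<noteq> 0 \<or> \<beta> l0 \<noteq> 0"
  proof (rule ccontr)
    assume "\<not> ?thesis"
    then have z: "\<phi> (l * f) = 0" if "l \<in> hom_part 1" "f \<in> hom_part (int e)" for l f using val[OF that] that by simp
    obtain g0 g1 g2 where "g0 \<in> hom_part (int e)" "g1 \<in> hom_part (int e)" "g2 \<in> hom_part (int e)"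
      "g = X 0 * g0 + X 1 * g1 + X 2 * g2" using lspan_decompose[OF lspan_X nz(1)] by auto
    then show False
      using nz(2) z[OF hom_part_X, of g0 0] z[OF hom_part_X, of g1 1] z[OF hom_part_X, of g2 2] by (simp add: lin_simps[OF \<phi>(1)])
  qed
  then obtain l0 where l0: "l0 \<in> hom_part 1" "\<alpha> l0 \<noteq> 0 \<or> \<beta> l0 \<noteq> 0" by blast
  define s where "s = \<alpha> l0"
  define t where "t = \<beta> l0"
  \<comment> \<open>By \<open>minor\<close> both \<open>\<alpha>\<close> and \<open>\<beta>\<close>
    are multiples of one functional. It is normalised to 1 at \<open>l0\<close>, dividing by
    whichever of \<open>s\<close>, \<open>t\<close> is nonzero; the zero summands bring it into the
    form of \<open>lin_combination\<close>.\<close>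
  define \<gamma> where "\<gamma> l = (if s \<noteq> 0 then (1 / s) * \<alpha> l + 0 * \<beta> l else 0 * \<alpha> l + (1 / t) * \<beta> l)" for l
  have l\<gamma>: "lin \<gamma>" unfolding \<gamma>_def
    using lin_combination[OF l\<alpha>, of 0 "1 / t"] lin_combination[OF l\<alpha>, of "1 / s" 0] by (cases "s = 0") simp_all
  have g: "\<alpha> l = \<gamma> l * s" "\<beta> l = \<gamma> l * t" if l: "l \<in> hom_part 1" for l
    using minor[OF l l0(1)] l0(2) unfolding \<gamma>_def s_def[symmetric] t_def[symmetric]
    by (auto simp: field_simps)
  have g0: "\<gamma> l0 = 1" using l0(2) unfolding \<gamma>_def s_def t_def by auto
  have val': "\<phi> (l * f) = \<gamma> l * (s * F f + t * G f)" if "l \<in> hom_part 1" "f \<in> hom_part (int e)" for l f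
    using val[OF that] g[OF that(1)] by (simp add: algebra_simps)
  have "kills l (\<lambda>f. s * F f + t * G f)" if l: "l \<in> hom_part 1" "\<gamma> l = 0" for l
    unfolding kills_def
  proof
    fix f :: "'k poly3" assume f: "f \<in> hom_part (int e - 1)"
    show "s * F (l * f) + t * G (l * f) = 0"
      using compat[OF l(1) l0(1) f] g[OF l(1)] l(2) unfolding s_def t_def by simp
  qed
  then show ?thesis using l\<gamma> l0(1) g0 val' l0(2) unfolding s_def[symmetric] t_def[symmetric] by blast
qed

lemma num_gens_e1_le: "num_gens I (int e + 1) \<le> 1"
proof (rule ccontr)
  assume neg: "\<not> ?thesis"
  let ?R = "hom_part (int e + 1) :: 'k poly3 set" and ?M = "mult_part (ideal_part I (int e))"
  have MR: "?M \<subseteq> ?R" by (rule mult_part_subset) auto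
  have M: "kspace.subspace ?M" by (rule subspace_mult_part[OF sub_I])
  have "ideal_part I (int e + 1) = ?R" using above[of "int e + 1"] by auto
  then have "kdim ?R \<ge> kdim ?M + 2" using neg unfolding num_gens_def by simp
  then have "kspace.dim ?R = kspace.dim ?M + (kspace.dim ?R - kspace.dim ?M)" "kspace.dim ?R - kspace.dim ?M \<ge> 2"
    by linarith+
  then obtain n where n: "kspace.dim ?R = kspace.dim ?M + n" "n \<ge> 2" by metis
  show False
  proof (rule ks.quotient_coordinates[OF subspace_hom_part fin_dim_hom_part M MR n(1)])
    fix b :: "nat \<Rightarrow> 'k poly3" and c :: "nat \<Rightarrow> 'k poly3 \<Rightarrow> 'k"
    assume b: "\<And>i. i < n \<Longrightarrow> b i \<in> ?R"
      and add: "\<And>i x y. c i (x + y) = c i x + c i y" and scl: "\<And>i r x. c i (const3 r * x) = r * c i x"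
      and delta: "\<And>i j. i < n \<Longrightarrow> j < n \<Longrightarrow> c i (b j) = (if i = j then 1 else 0)"
      and W: "\<And>x. x \<in> ?R \<Longrightarrow> x \<in> ?M \<longleftrightarrow> (\<forall>i<n. c i x = 0)"
    have lc: "lin (c i)" for i unfolding lin_def using add scl by blast
    have cM: "c i x = 0" if "x \<in> ?M" "i < n" for i x using W that MR by blast
    have d: "c 0 (b 0) = 1" "c 0 (b 1) = 0" "c 1 (b 1) = 1" "b 0 \<in> ?R" "b 1 \<in> ?R"
      using delta[of 0 0] delta[of 0 1] delta[of 1 1] b[of 0] b[of 1] n(2) by simp_all
    show False
    proof (rule pair_exists)
      fix F G b1 b2
      assume p: "pair F G" and factor_hilb: "b1 \<in> hom_part (int e)" "b2 \<in> hom_part (int e)"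
        and dec: "\<And>f. f \<in> hom_part (int e) \<Longrightarrow> f - (const3 (F f) * b1 + const3 (G f) * b2) \<in> I"
      note lF = pairD(1)[OF p] and lG = pairD(2)[OF p]
      have dec': "\<forall>f\<in>hom_part (int e). f - (const3 (F f) * b1 + const3 (G f) * b2) \<in> I" using dec by blast
      note fro = functional_rank_one[OF p factor_hilb dec' lc]
      have c0: "\<forall>x\<in>?M. c 0 x = 0" and c1: "\<forall>x\<in>?M. c 1 x = 0" using cM n(2) by auto
      have nz: "c 0 (b 0) \<noteq> 0" "c 1 (b 1) \<noteq> 0" using d by simp_all
      obtain s t \<gamma> l0 where A: "s \<noteq> 0 \<or> t \<noteq> 0" "lin \<gamma>" "l0 \<in> hom_part 1" "\<gamma> l0 = 1"
        and B: "\<forall>l\<in>hom_part 1. \<forall>f\<in>hom_part (int e). c 0 (l * f) = \<gamma> l * (s * F f + t * G f)"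
        "\<forall>l\<in>hom_part 1. \<gamma> l = 0 \<longrightarrow> kills l (\<lambda>f. s * F f + t * G f)"
        using fro[OF c0 d(4) nz(1)] by (elim exE conjE) (rule that; assumption)
      note 1 = A B[rule_format]
      obtain s' t' \<gamma>' l1 where A: "s' \<noteq> 0 \<or> t' \<noteq> 0" "lin \<gamma>'" "l1 \<in> hom_part 1" "\<gamma>' l1 = 1"
        and B: "\<forall>l\<in>hom_part 1. \<forall>f\<in>hom_part (int e). c 1 (l * f) = \<gamma>' l * (s' * F f + t' * G f)"
        "\<forall>l\<in>hom_part 1. \<gamma>' l = 0 \<longrightarrow> kills l (\<lambda>f. s' * F f + t' * G f)"
        using fro[OF c1 d(5) nz(2)] by (elim exE conjE) (rule that; assumption)
      note 2 = A B[rule_format]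
      \<comment> \<open>Two independent members would form a basis of the pencil, and a common zero
        of \<open>\<gamma>\<close> and \<open>\<gamma>'\<close> would kill both.\<close>
      have prp: "s * t' = t * s'"
      proof (rule ccontr)
        assume "s * t' \<noteq> t * s'"
        then have p': "pair (\<lambda>f. s * F f + t * G f) (\<lambda>f. s' * F f + t' * G f)" by (intro pair_change[OF p]) simp
        obtain x where "x \<in> hom_part 1" "x \<noteq> 0" "\<gamma> x = 0" "\<gamma>' x = 0" using common_kernel[OF 1(2) 2(2)] by blast
        then show False using kills_both[OF p'] 1(6) 2(6) by blast
      qed
      define q where "q = (if s \<noteq> 0 then s' / s else t' / t)"
      have q: "s' = q * s" "t' = q * t"
        using prp 1(1) unfolding q_def by (auto simp: field_simps)
      have "q \<noteq> 0" using q 2(1) by auto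
      \<comment> \<open>Otherwise every linear form is a multiple of \<open>m\<close> plus a zero of
        \<open>\<gamma>'\<close>. Both parts kill the same member of the pencil, which would then
        vanish in degree \<open>e\<close>.\<close>
      have kg: "\<gamma>' m = 0" if m: "m \<in> hom_part 1" "\<gamma> m = 0" for m
      proof (rule ccontr)
        assume nz: "\<gamma>' m \<noteq> 0"
        have km: "s * F (m * f) + t * G (m * f) = 0" if "f \<in> hom_part (int e - 1)" for f
          using 1(6)[OF m] that unfolding kills_def by blast
        have all: "s * F (l * f) + t * G (l * f) = 0" if l: "l \<in> hom_part 1" and f: "f \<in> hom_part (int e - 1)" for l f
        proof -
          let ?l = "l - const3 (\<gamma>' l / \<gamma>' m) * m"
          have l': "?l \<in> hom_part 1" using l m by (intro hom_part_diff hom_part_scale)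
          have "\<gamma>' ?l = 0" using nz by (simp add: lin_simps[OF 2(2)])
          then have "q * (s * F (?l * f) + t * G (?l * f)) = 0"
            using 2(6)[OF l'] f unfolding kills_def q by (simp add: algebra_simps)
          then have "s * F (?l * f) + t * G (?l * f) = 0" using \<open>q \<noteq> 0\<close> by simp
          moreover have "?l * f = l * f - const3 (\<gamma>' l / \<gamma>' m) * (m * f)" by (simp add: left_diff_distrib mult.assoc)
          ultimately have "s * F (l * f) + t * G (l * f) = (\<gamma>' l / \<gamma>' m) * (s * F (m * f) + t * G (m * f))"
            by (simp only: lin_simps[OF lF] lin_simps[OF lG]) (simp add: algebra_simps)
          then show ?thesis using km[OF f] by simp
        qed
        have "s * F f + t * G f = 0" if f: "f \<in> hom_part (int e)" for f
        proof -
          obtain g0 g1 g2 where g: "g0 \<in> hom_part (int e - 1)" "g1 \<in> hom_part (int e - 1)" "g2 \<in> hom_part (int e - 1)"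
            "f = X 0 * g0 + X 1 * g1 + X 2 * g2" using lspan_decompose[OF lspan_X f] e3 by auto
          have "s * F f + t * G f = (s * F (X 0 * g0) + t * G (X 0 * g0)) + (s * F (X 1 * g1) + t * G (X 1 * g1)) + (s * F (X 2 * g2) + t * G (X 2 * g2))"
            unfolding g(4) lin_simps[OF lF] lin_simps[OF lG] by (simp add: algebra_simps)
          then show ?thesis using all[OF hom_part_X g(1)] all[OF hom_part_X g(2)] all[OF hom_part_X g(3)] by simp
        qed
        then show False using pairD(4)[OF p] 1(1) by blast
      qed
      have g': "\<gamma>' l = \<gamma>' l0 * \<gamma> l" if l: "l \<in> hom_part 1" for l
      proof -
        have "l - const3 (\<gamma> l) * l0 \<in> hom_part 1" using l 1(3) by (intro hom_part_diff hom_part_scale)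
        moreover have "\<gamma> (l - const3 (\<gamma> l) * l0) = 0" using 1(4) by (simp add: lin_simps[OF 1(2)])
        ultimately have "\<gamma>' (l - const3 (\<gamma> l) * l0) = 0" by (rule kg)
        then show ?thesis by (simp add: lin_simps[OF 2(2)])
      qed
      have rel: "c 1 (l * f) = q * \<gamma>' l0 * c 0 (l * f)" if "l \<in> hom_part 1" "f \<in> hom_part (int e)" for l f
        unfolding 1(5)[OF that] 2(5)[OF that] g'[OF that(1)] q by (simp add: algebra_simps)
      obtain g0 g1 g2 where g: "g0 \<in> hom_part (int e)" "g1 \<in> hom_part (int e)" "g2 \<in> hom_part (int e)"
        "b 1 = X 0 * g0 + X 1 * g1 + X 2 * g2" using lspan_decompose[OF lspan_X d(5)] by auto
      have "c 1 (b 1) = q * \<gamma>' l0 * c 0 (b 1)"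
        unfolding g(4) lin_simps[OF lc] rel[OF hom_part_X g(1)] rel[OF hom_part_X g(2)] rel[OF hom_part_X g(3)]
        by (simp add: algebra_simps)
      then show False using d by simp
    qed
  qed
qed

end

section \<open>Hilbert function and generators in the three quadrics case\<close>

context level_type2 begin

text \<open>Multiplication by \<open>v0\<close> is onto in \<open>R / I\<close> from degree 1 on, so
  \<open>hi\<close> is non-increasing and, being 3 at both ends, constant. Below degree
  \<open>e\<close> the ideal \<open>J\<close> of the quadrics then equals \<open>I\<close>. In
  degree \<open>e\<close> it still has codimension 3 because of the syzygies, whereas
  \<open>I\<close> has codimension 2: this is the one new generator.\<close>

lemma three_quadrics_numbers:
  assumes three_quadrics_case
  shows "\<And>d. 1 \<le> d \<Longrightarrow> d \<le> int e - 1 \<Longrightarrow> hi d = 3"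
    and "\<And>d. 3 \<le> d \<Longrightarrow> d \<le> int e - 1 \<Longrightarrow> num_gens I d = 0"
    and "num_gens I (int e) = 1"
proof -
  obtain v0 v1 v2 D1 D2 D3 where v: "lbasis v0 v1 v2"
    and D: "D1 \<in> ideal_part I 2" "D2 \<in> ideal_part I 2" "D3 \<in> ideal_part I 2"
    and span: "\<forall>q\<in>hom_part 2. \<exists>u\<in>hom_part 1. \<exists>r1 r2 r3. q = v0 * u + lcomb r1 r2 r3 D1 D2 D3"
    and rel1: "\<exists>a\<in>hom_part 1. \<exists>b\<in>hom_part 1. v1 * D2 = a * D1 + b * D3"
    and rel2: "\<exists>a\<in>hom_part 1. \<exists>b\<in>hom_part 1. v2 * D2 = a * D1 + b * D3"
    using assms unfolding three_quadrics_case_def by blast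
  have sp: "lspan v0 v1 v2" by (rule lbasis_lspan[OF v])
  have v1: "v0 \<in> hom_part 1" "v1 \<in> hom_part 1" "v2 \<in> hom_part 1" using v unfolding lbasis_def by blast+
  have v0n: "v0 \<noteq> 0"
  proof
    assume "v0 = 0"
    then have "lcomb 1 0 0 v0 v1 v2 = 0" by (simp add: lcomb_def const3_simps)
    then have "(1::'k) = 0" using v unfolding lbasis_def by blast
    then show False by simp
  qed
  have D2: "D1 \<in> hom_part 2" "D2 \<in> hom_part 2" "D3 \<in> hom_part 2" and DI: "D1 \<in> I" "D2 \<in> I" "D3 \<in> I" using D by auto
  define J where "J d = D1 *\<^sub>s hom_part (d - 2) \<oplus>\<^sub>s D2 *\<^sub>s hom_part (d - 2) \<oplus>\<^sub>s D3 *\<^sub>s hom_part (d - 2)" for d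
  have DR: "D1 *\<^sub>s hom_part (d - 2) \<subseteq> hom_part d" "D2 *\<^sub>s hom_part (d - 2) \<subseteq> hom_part d" "D3 *\<^sub>s hom_part (d - 2) \<subseteq> hom_part d" for d
    using hom_part_mult_le[OF D2(1)] hom_part_mult_le[OF D2(2)] hom_part_mult_le[OF D2(3)] by auto
  have sD: "kspace.subspace (D *\<^sub>s hom_part d)" for D :: "'k poly3" and d by (rule subspace_mulset[OF subspace_hom_part])
  have sJ: "kspace.subspace (J d)" for d unfolding J_def by (intro ks.subspace_set_add sD)
  have JR: "J d \<subseteq> hom_part d" for d unfolding J_def by (intro set_add_hom_part DR)
  have JI: "J d \<subseteq> I" for d
  proof -
    have "D *\<^sub>s hom_part a \<subseteq> I" if D: "D \<in> I" for D a
    proof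
      fix x assume "x \<in> D *\<^sub>s hom_part a"
      then obtain f where "x = D * f" by blast
      then show "x \<in> I" using ideal_mult[OF ideal D, of f] by (simp add: mult.commute)
    qed
    then show ?thesis
      unfolding J_def using DI by (intro ks.set_add_least[OF ideal_kspace_subspace[OF ideal]])
  qed
  have JmemI: "D1 * f1 + D2 * f2 + D3 * f3 \<in> J d" if "f1 \<in> hom_part (d - 2)" "f2 \<in> hom_part (d - 2)" "f3 \<in> hom_part (d - 2)" for f1 f2 f3 d
    unfolding J_def using that by (intro set_addI) auto
  have JmemE: "\<exists>f1\<in>hom_part (d - 2). \<exists>f2\<in>hom_part (d - 2). \<exists>f3\<in>hom_part (d - 2). x = D1 * f1 + D2 * f2 + D3 * f3"
    if "x \<in> J d" for x d
    using that unfolding J_def by (auto elim!: set_addE)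
  have J_mult: "v * x \<in> J (i + d)" if vx: "v \<in> hom_part i" "x \<in> J d" for v x i d
  proof -
    obtain f1 f2 f3 where f: "f1 \<in> hom_part (d - 2)" "f2 \<in> hom_part (d - 2)" "f3 \<in> hom_part (d - 2)" "x = D1 * f1 + D2 * f2 + D3 * f3"
      using JmemE[OF vx(2)] by blast
    have "v * x = D1 * (v * f1) + D2 * (v * f2) + D3 * (v * f3)" unfolding f(4) by (simp add: algebra_simps)
    moreover have "v * g \<in> hom_part (i + d - 2)" if "g \<in> hom_part (d - 2)" for g
      using hom_part_mult_le[OF vx(1) that, of "i + d - 2"] by simp
    ultimately show ?thesis using JmemI[of "v * f1" "i + d"] f by simp
  qed
  have J_lcomb: "lcomb r1 r2 r3 D1 D2 D3 \<in> J 2" for r1 r2 r3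
  proof -
    have "lcomb r1 r2 r3 D1 D2 D3 = D1 * const3 r1 + D2 * const3 r2 + D3 * const3 r3" by (simp add: lcomb_def mult.commute)
    moreover have "D1 * const3 r1 + D2 * const3 r2 + D3 * const3 r3 \<in> J 2" by (rule JmemI) (simp_all add: hom_part_const)
    ultimately show ?thesis by simp
  qed
  \<comment> \<open>Modulo the quadrics every form of degree 2 is a multiple of \<open>v0\<close>,
    so each further degree can be absorbed into one more factor \<open>v0\<close>.\<close>
  have decomp: "\<exists>u\<in>hom_part 1. \<exists>j\<in>J (int n + 2). f = v0 ^ (n + 1) * u + j" if "f \<in> hom_part (int n + 2)" for f n
    using that
  proof (induction n arbitrary: f)
    case 0
    then show ?case using span J_lcomb by fastforce
  next
    case (Suc n)
    obtain g0 g1 g2 where g: "g0 \<in> hom_part (int n + 2)" "g1 \<in> hom_part (int n + 2)" "g2 \<in> hom_part (int n + 2)"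
      "f = v0 * g0 + v1 * g1 + v2 * g2" using lspan_decompose[OF sp Suc.prems] by (auto simp: algebra_simps)
    obtain u0 u1 u2 j0 j1 j2 where u: "u0 \<in> hom_part 1" "u1 \<in> hom_part 1" "u2 \<in> hom_part 1"
      and j: "j0 \<in> J (int n + 2)" "j1 \<in> J (int n + 2)" "j2 \<in> J (int n + 2)"
      and eq: "g0 = v0 ^ (n + 1) * u0 + j0" "g1 = v0 ^ (n + 1) * u1 + j1" "g2 = v0 ^ (n + 1) * u2 + j2"
      using Suc.IH[OF g(1)] Suc.IH[OF g(2)] Suc.IH[OF g(3)] by blast
    have "v0 * u0 + v1 * u1 + v2 * u2 \<in> hom_part 2"
      using hom_part_mult_le[OF v1(1) u(1), of 2] hom_part_mult_le[OF v1(2) u(2), of 2] hom_part_mult_le[OF v1(3) u(3), of 2]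
      by (simp add: hom_part_add)
    then obtain u r1 r2 r3 where q: "u \<in> hom_part 1" "v0 * u0 + v1 * u1 + v2 * u2 = v0 * u + lcomb r1 r2 r3 D1 D2 D3"
      using span by blast
    define L where "L = v0 ^ (n + 1)"
    have L: "L \<in> hom_part (int n + 1)" unfolding L_def using hom_part_power[OF v1(1), of "n + 1"] by (simp add: add.commute)
    have "f = L * (v0 * u0 + v1 * u1 + v2 * u2) + (v0 * j0 + v1 * j1 + v2 * j2)"
      unfolding g(4) eq L_def[symmetric] by (simp add: algebra_simps)
    also have "\<dots> = (v0 * L) * u + (L * lcomb r1 r2 r3 D1 D2 D3 + (v0 * j0 + v1 * j1 + v2 * j2))"
      unfolding q(2) by (simp add: algebra_simps)
    finally have "f = v0 ^ (Suc n + 1) * u + (L * lcomb r1 r2 r3 D1 D2 D3 + (v0 * j0 + v1 * j1 + v2 * j2))"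
      unfolding L_def by simp
    moreover have "L * lcomb r1 r2 r3 D1 D2 D3 + (v0 * j0 + v1 * j1 + v2 * j2) \<in> J (int (Suc n) + 2)"
      using J_mult[OF L J_lcomb, of r1 r2 r3] J_mult[OF v1(1) j(1)] J_mult[OF v1(2) j(2)] J_mult[OF v1(3) j(3)]
      by (intro kspace.subspace_add[OF sJ]) (simp_all add: algebra_simps)
    ultimately show ?case using q(1) by blast
  qed
  have powR: "v0 ^ (n + 1) *\<^sub>s hom_part 1 \<subseteq> hom_part (int n + 2)" for n
    using hom_part_mult_le[OF hom_part_power[OF v1(1), of "n + 1"]] by auto
  have J_lower: "dimR (int n + 2) \<le> 3 + kdim (J (int n + 2))" for n
  proof -
    let ?P = "v0 ^ (n + 1) *\<^sub>s hom_part 1"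
    have P: "kspace.subspace ?P" by (rule sD)
    have "hom_part (int n + 2) \<subseteq> ?P \<oplus>\<^sub>s J (int n + 2)"
    proof
      fix f :: "'k poly3" assume "f \<in> hom_part (int n + 2)"
      then obtain u j where "u \<in> hom_part 1" "j \<in> J (int n + 2)" "f = v0 ^ (n + 1) * u + j" using decomp by blast
      then show "f \<in> ?P \<oplus>\<^sub>s J (int n + 2)" by (metis imageI set_addI)
    qed
    then have "dimR (int n + 2) \<le> kdim (?P \<oplus>\<^sub>s J (int n + 2))"
      using kdim_mono[OF subspace_hom_part ks.subspace_set_add[OF P sJ] _ set_add_hom_part[OF powR JR]]
      by (simp add: dim_hom_part)
    also have "\<dots> \<le> kdim ?P + kdim (J (int n + 2))" using kdim_set_add[OF P powR sJ JR] by simp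
    also have "kdim ?P = 3" using kdim_mulset[OF _ subspace_hom_part subset_refl, of "v0 ^ (n + 1)" 1] v0n
      by (simp add: dim_hom_part dimR_def)
    finally show ?thesis .
  qed
  have J_le_I: "kdim (J d) \<le> kdim (ideal_part I d)" for d
    using kdim_mono[OF sJ sub_I, of d d] JI JR by blast
  have hi_le: "hi (int n + 2) \<le> 3" for n unfolding hi_def using J_lower[of n] J_le_I[of "int n + 2"] by linarith
  have hi_step: "hi (int n + 2) \<le> hi (int n + 1)" for n
  proof -
    let ?A = "v0 *\<^sub>s hom_part (int n + 1)" and ?B = "ideal_part I (int n + 2)"
    have A: "kspace.subspace ?A" by (rule sD)
    have AR: "?A \<subseteq> hom_part (int n + 2)" using hom_part_mult_le[OF v1(1)] by auto
    have "hom_part (int n + 2) \<subseteq> ?A \<oplus>\<^sub>s ?B"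
    proof
      fix f :: "'k poly3" assume "f \<in> hom_part (int n + 2)"
      then obtain u j where u: "u \<in> hom_part 1" "j \<in> J (int n + 2)" "f = v0 ^ (n + 1) * u + j" using decomp by blast
      have "v0 ^ n * u \<in> hom_part (int n + 1)" using hom_part_mult_le[OF hom_part_power[OF v1(1)] u(1), of n] by simp
      then have "v0 * (v0 ^ n * u) \<in> ?A" by blast
      moreover have "f = v0 * (v0 ^ n * u) + j" unfolding u(3) by (simp add: mult.assoc)
      moreover have "j \<in> ?B" using u(2) JI JR by blast
      ultimately show "f \<in> ?A \<oplus>\<^sub>s ?B" using set_addI by metis
    qed
    then have "dimR (int n + 2) \<le> kdim (?A \<oplus>\<^sub>s ?B)"
      using kdim_mono[OF subspace_hom_part ks.subspace_set_add[OF A sub_I] _ set_add_hom_part[OF AR Int_lower2]]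
      by (simp add: dim_hom_part)
    moreover have "v0 *\<^sub>s ideal_part I (int n + 1) \<subseteq> ?A \<inter> ?B"
      using ideal_mult[OF ideal] AR by blast
    then have "kdim (v0 *\<^sub>s ideal_part I (int n + 1)) \<le> kdim (?A \<inter> ?B)"
      using kdim_mono[OF subspace_mulset[OF sub_I] kspace.subspace_inter[OF A sub_I]] AR by blast
    moreover have "kdim (v0 *\<^sub>s ideal_part I (int n + 1)) = kdim (ideal_part I (int n + 1))"
      using kdim_mulset[OF v0n sub_I Int_lower2] .
    moreover have "kdim ?A = dimR (int n + 1)"
      using kdim_mulset[OF v0n subspace_hom_part subset_refl] by (simp add: dim_hom_part)
    ultimately show ?thesis using kdim_set_add[OF A AR sub_I Int_lower2] unfolding hi_def by linarith
  qed
  have hi_mono: "hi (int (n + m) + 1) \<le> hi (int n + 1)" for n m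
  proof (induction m)
    case (Suc m)
    then show ?case using hi_step[of "n + m"] by (simp add: add.commute add.left_commute)
  qed simp
  show hi3: "hi d = 3" if d: "1 \<le> d" "d \<le> int e - 1" for d
  proof -
    obtain n where n: "d = int n + 1" using d by (metis add.commute zle_iff_zadd)
    obtain m where m: "int e - 1 = int (n + m) + 1" using d unfolding n by (metis add.assoc add.commute of_nat_add zle_iff_zadd)
    have "3 \<le> hi d" using hi_mono[of n m] hi_e unfolding n m[symmetric] by simp
    moreover have "hi d \<le> 3" using hi_mono[of 0 n] hi_1 unfolding n by simp
    ultimately show ?thesis by simp
  qed
  have J_eq: "ideal_part I d = J d" if d: "2 \<le> d" "d \<le> int e - 1" for d
  proof -
    obtain n where n: "d = int n + 2" using d by (metis add.commute zle_iff_zadd)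
    have "kdim (ideal_part I d) \<le> kdim (J d)" using hi3[of d] J_lower[of n] d unfolding hi_def n by simp
    then show ?thesis using subspace_eqI_kdim[OF sJ sub_I _ Int_lower2, of d d] JI JR by blast
  qed
  have mult_J: "mult_part (J (d - 1)) = J d" if d: "3 \<le> d" for d
  proof
    show "mult_part (J (d - 1)) \<subseteq> J d"
    proof
      fix x assume "x \<in> mult_part (J (d - 1))"
      then obtain g0 g1 g2 where g: "g0 \<in> J (d - 1)" "g1 \<in> J (d - 1)" "g2 \<in> J (d - 1)" "x = X 0 * g0 + X 1 * g1 + X 2 * g2"
        unfolding mult_part_def by blast
      have "X i * g \<in> J d" if "g \<in> J (d - 1)" for i g using J_mult[OF hom_part_X that, of i] by simp
      then show "x \<in> J d" unfolding g(4) using g by (intro kspace.subspace_add[OF sJ]) auto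
    qed
    show "J d \<subseteq> mult_part (J (d - 1))"
    proof
      fix x assume "x \<in> J d"
      then obtain f1 f2 f3 where f: "f1 \<in> hom_part (d - 2)" "f2 \<in> hom_part (d - 2)" "f3 \<in> hom_part (d - 2)" "x = D1 * f1 + D2 * f2 + D3 * f3"
        using JmemE by blast
      have "\<exists>g0\<in>hom_part (d - 1 - 2). \<exists>g1\<in>hom_part (d - 1 - 2). \<exists>g2\<in>hom_part (d - 1 - 2). f = X 0 * g0 + X 1 * g1 + X 2 * g2"
        if "f \<in> hom_part (d - 2)" for f :: "'k poly3"
        using lspan_decompose[OF lspan_X that] d by (simp add: algebra_simps)
      then obtain a0 a1 a2 b0 b1 b2 c0 c1 c2 where a: "a0 \<in> hom_part (d - 1 - 2)" "a1 \<in> hom_part (d - 1 - 2)" "a2 \<in> hom_part (d - 1 - 2)"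
        "f1 = X 0 * a0 + X 1 * a1 + X 2 * a2" and b: "b0 \<in> hom_part (d - 1 - 2)" "b1 \<in> hom_part (d - 1 - 2)" "b2 \<in> hom_part (d - 1 - 2)"
        "f2 = X 0 * b0 + X 1 * b1 + X 2 * b2" and c: "c0 \<in> hom_part (d - 1 - 2)" "c1 \<in> hom_part (d - 1 - 2)" "c2 \<in> hom_part (d - 1 - 2)"
        "f3 = X 0 * c0 + X 1 * c1 + X 2 * c2" using f(1-3) by metis
      have "x = X 0 * (D1 * a0 + D2 * b0 + D3 * c0) + X 1 * (D1 * a1 + D2 * b1 + D3 * c1) + X 2 * (D1 * a2 + D2 * b2 + D3 * c2)"
        unfolding f(4) a(4) b(4) c(4) by (simp add: algebra_simps)
      then show "x \<in> mult_part (J (d - 1))"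
        unfolding mult_part_def using JmemI[OF a(1) b(1) c(1)] JmemI[OF a(2) b(2) c(2)] JmemI[OF a(3) b(3) c(3)] by blast
    qed
  qed
  show "num_gens I d = 0" if d: "3 \<le> d" "d \<le> int e - 1" for d
    unfolding num_gens_def using J_eq[of d] J_eq[of "d - 1"] mult_J[of d] d by simp
  \<comment> \<open>\<open>J_lower\<close> gives dimension at least 3 in degree 2, so the three
    quadrics are independent.\<close>
  have D13: "D1 \<noteq> 0" "D3 \<noteq> 0"
  proof -
    have gen: "False" if P: "J 2 \<subseteq> kspace.span {P, Q}" for P Q
    proof -
      have "kdim (J 2) \<le> kdim (kspace.span {P, Q})"
        using ks.dim_mono_fin_dim[OF sJ _ kspace.subspace_span P] ks.fin_dimI[of "{P, Q}"] by simp
      also have "\<dots> \<le> 2" using kdim_span_le[of "{P, Q}"] card_insert_le_m1[of 2 "{Q}" P] by fastforce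
      finally show False using J_lower[of 0] by (simp add: dimR_def)
    qed
    have el: "\<exists>r1 r2 r3. x = lcomb r1 r2 r3 D1 D2 D3" if x: "x \<in> J 2" for x
    proof -
      obtain f1 f2 f3 where f: "f1 \<in> hom_part 0" "f2 \<in> hom_part 0" "f3 \<in> hom_part 0" "x = D1 * f1 + D2 * f2 + D3 * f3"
        using JmemE[OF x] by auto
      show ?thesis unfolding f(4) lcomb_def
        using hom_part_0_const[OF f(1)] hom_part_0_const[OF f(2)] hom_part_0_const[OF f(3)] by (metis mult.commute)
    qed
    have sp2: "const3 r * P + const3 s * Q \<in> kspace.span {P, Q}" for r s P Q
      by (intro kspace.span_add kspace.span_scale kspace.span_base) auto
    show "D1 \<noteq> 0"
    proof
      assume "D1 = 0"
      then have "J 2 \<subseteq> kspace.span {D2, D3}" using el sp2[of _ D2 _ D3] by (auto simp: lcomb_def)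
      then show False by (rule gen)
    qed
    show "D3 \<noteq> 0"
    proof
      assume "D3 = 0"
      then have "J 2 \<subseteq> kspace.span {D1, D2}" using el sp2[of _ D1 _ D2] by (auto simp: lcomb_def)
      then show False by (rule gen)
    qed
  qed
  \<comment> \<open>The syzygies move all multiples of \<open>D2\<close> into
    \<open>(D1, D3)\<close> except those of \<open>v0 ^ n * D2\<close>, and the multiples of
    \<open>D1\<close> and \<open>D3\<close> overlap at least in those of \<open>D1 * D3\<close>. The
    count is \<open>2 * dimR n - dimR (n - 2) + 1\<close>.\<close>
  have J_upper: "kdim (J (int n + 2)) \<le> dimR (int n + 2) - 3" for n
  proof -
    let ?A = "D1 *\<^sub>s hom_part (int n)" and ?B = "D3 *\<^sub>s hom_part (int n)" and ?C = "kspace.span {v0 ^ n * D2}"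
    have AR: "?A \<subseteq> hom_part (int n + 2)" "?B \<subseteq> hom_part (int n + 2)" using DR[of "int n + 2"] by simp_all
    have CR: "?C \<subseteq> hom_part (int n + 2)"
      using hom_part_mult_le[OF hom_part_power[OF v1(1)] D2(2), of n] by (intro kspace.span_minimal subspace_hom_part) auto
    have "J (int n + 2) \<subseteq> ?A \<oplus>\<^sub>s ?B \<oplus>\<^sub>s ?C"
    proof
      fix x assume "x \<in> J (int n + 2)"
      then obtain f1 f2 f3 where f: "f1 \<in> hom_part (int n)" "f2 \<in> hom_part (int n)" "f3 \<in> hom_part (int n)" "x = D1 * f1 + D2 * f2 + D3 * f3"
        using JmemE by fastforce
      obtain r g1 g2 where g: "g1 \<in> hom_part (int n - 1)" "g2 \<in> hom_part (int n - 1)" "f2 = const3 r * v0 ^ n + v1 * g1 + v2 * g2"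
        using lspan_power_decompose[OF sp f(2)] by blast
      obtain a b where ab: "a \<in> hom_part 1" "b \<in> hom_part 1" "v1 * D2 = a * D1 + b * D3" using rel1 by blast
      obtain a' b' where ab': "a' \<in> hom_part 1" "b' \<in> hom_part 1" "v2 * D2 = a' * D1 + b' * D3" using rel2 by blast
      have "x = D1 * f1 + D3 * f3 + const3 r * (v0 ^ n * D2) + (v1 * D2) * g1 + (v2 * D2) * g2"
        unfolding f(4) g(3) by (simp add: algebra_simps)
      also have "\<dots> = D1 * (f1 + a * g1 + a' * g2) + D3 * (f3 + b * g1 + b' * g2) + const3 r * (v0 ^ n * D2)"
        unfolding ab(3) ab'(3) by (simp add: algebra_simps)
      finally have x: "x = D1 * (f1 + a * g1 + a' * g2) + D3 * (f3 + b * g1 + b' * g2) + const3 r * (v0 ^ n * D2)" .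
      have m: "y * g \<in> hom_part (int n)" if "y \<in> hom_part 1" "g \<in> hom_part (int n - 1)" for y g :: "'k poly3"
        using hom_part_mult_le[OF that] by simp
      have "f1 + a * g1 + a' * g2 \<in> hom_part (int n)" "f3 + b * g1 + b' * g2 \<in> hom_part (int n)"
        using f ab ab' g m by (auto intro!: hom_part_add)
      then show "x \<in> ?A \<oplus>\<^sub>s ?B \<oplus>\<^sub>s ?C"
        unfolding x by (intro set_addI imageI kspace.span_scale kspace.span_base) auto
    qed
    then have 1: "kdim (J (int n + 2)) \<le> kdim (?A \<oplus>\<^sub>s ?B \<oplus>\<^sub>s ?C)"
      by (intro kdim_mono[OF sJ, where d = "int n + 2"] ks.subspace_set_add sD kspace.subspace_span set_add_hom_part AR CR)
    have 2: "kdim (?A \<oplus>\<^sub>s ?B \<oplus>\<^sub>s ?C) \<le> kdim (?A \<oplus>\<^sub>s ?B) + kdim ?C"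
      using kdim_set_add[OF ks.subspace_set_add[OF sD sD] set_add_hom_part[OF AR] kspace.subspace_span CR] by linarith
    have 3: "kdim ?C \<le> 1" using kdim_span_le[of "{v0 ^ n * D2}"] by simp
    have 4: "kdim (?A \<oplus>\<^sub>s ?B) = 2 * dimR (int n) - kdim (?A \<inter> ?B)"
      using kdim_set_add[OF sD AR(1) sD AR(2)] kdim_mulset[OF D13(1) subspace_hom_part subset_refl, of "int n"]
        kdim_mulset[OF D13(2) subspace_hom_part subset_refl, of "int n"] by (simp add: dim_hom_part)
    have "(D1 * D3) *\<^sub>s hom_part (int n - 2) \<subseteq> ?A \<inter> ?B"
    proof
      fix x assume "x \<in> (D1 * D3) *\<^sub>s hom_part (int n - 2)"
      then obtain g where g: "g \<in> hom_part (int n - 2)" "x = (D1 * D3) * g" by blast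
      have "D3 * g \<in> hom_part (int n)" "D1 * g \<in> hom_part (int n)" "x = D1 * (D3 * g)" "x = D3 * (D1 * g)"
        using hom_part_mult_le[OF D2(1) g(1)] hom_part_mult_le[OF D2(3) g(1)] g(2) by (simp_all add: ac_simps)
      then show "x \<in> ?A \<inter> ?B" by blast
    qed
    then have "kdim ((D1 * D3) *\<^sub>s hom_part (int n - 2)) \<le> kdim (?A \<inter> ?B)"
      using AR by (intro kdim_mono[OF sD kspace.subspace_inter[OF sD sD]]) auto
    moreover have "kdim ((D1 * D3) *\<^sub>s hom_part (int n - 2) :: 'k poly3 set) = dimR (int n - 2)"
      using kdim_mulset[OF _ subspace_hom_part subset_refl, of "D1 * D3" "int n - 2"] D13 by (simp add: dim_hom_part)
    ultimately have "kdim (J (int n + 2)) \<le> 2 * dimR (int n) - dimR (int n - 2) + 1" using 1 2 3 4 by linarith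
    moreover have "2 * dimR (int n) - dimR (int n - 2) + 1 = dimR (int n + 2) - 3"
      using dimR_diff[of "int n + 2"] dimR_diff[of "int n + 1"] dimR_diff[of "int n"] dimR_diff[of "int n - 1"]
      by (auto simp: algebra_simps split: if_splits)
    ultimately show ?thesis by linarith
  qed
  obtain n where n: "int e = int n + 2" using e3 by (metis add.commute add_leD2 le_Suc_ex of_nat_add of_nat_numeral numeral_3_eq_3 add_2_eq_Suc' Suc_leD)
  have "mult_part (ideal_part I (int e - 1)) = J (int e)" using J_eq[of "int e - 1"] mult_J[of "int e"] e3 by simp
  then show "num_gens I (int e) = 1"
    unfolding num_gens_def using dim_e J_upper[of n] J_lower[of n] unfolding n by simp
qed

end

section \<open>Hilbert function and generators in the common factor case\<close>

context level_type2 begin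

text \<open>The Hilbert function of \<open>R/(I + (w))\<close>, for the linear form \<open>w\<close> of the common factor case.\<close>

definition factor_hilb :: "int \<Rightarrow> int" where
  "factor_hilb d = (if d < 0 then 0 else if d = 0 then 1 else hi d - 1)"

text \<open>From degree 3 to \<open>e\<close>, generators of \<open>I\<close> are counted as
  generators of \<open>W = I + (w)\<close> modulo \<open>w\<close>, an ideal in two variables
  \<open>s\<close>, \<open>t\<close>. Vanishing of the socle makes each relation between
  \<open>s W\<close> and \<open>t W\<close> come from \<open>W\<close> two degrees lower. This gives
  the second difference.\<close>

lemma common_factor_numbers:
  assumes common_factor_case
  shows "\<And>d. 3 \<le> d \<Longrightarrow> d \<le> int e \<Longrightarrow> num_gens I d = - (factor_hilb d - 2 * factor_hilb (d - 1) + factor_hilb (d - 2))"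
    and "factor_hilb 2 \<le> 3"
    and "num_gens I (int e + 1) = 1"
proof -
  obtain l k1 k2 w where lb: "lbasis l k1 k2" and w: "w \<in> hom_part 1" "w \<noteq> 0" "w * k1 \<in> I" "w * k2 \<in> I"
      "w * l ^ (e - 1) \<notin> I"
    and IeK: "\<forall>f\<in>ideal_part I (int e). \<exists>g1\<in>hom_part (int e - 1). \<exists>g2\<in>hom_part (int e - 1). f = k1 * g1 + k2 * g2"
    using assms unfolding common_factor_case_def by blast
  have sp: "lspan l k1 k2" by (rule lbasis_lspan[OF lb])
  have lk: "l \<in> hom_part 1" "k1 \<in> hom_part 1" "k2 \<in> hom_part 1" using lb unfolding lbasis_def by blast+
  have lb0: "r0 = 0 \<and> r1 = 0 \<and> r2 = 0" if "lcomb r0 r1 r2 l k1 k2 = 0" for r0 r1 r2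
    using lb that unfolding lbasis_def by blast
  have k0: "k1 \<noteq> 0" "k2 \<noteq> 0" using lb0[of 0 1 0] lb0[of 0 0 1] by (auto simp: lcomb_def const3_simps)
  have sD: "kspace.subspace (D *\<^sub>s hom_part d)" for D :: "'k poly3" and d by (rule subspace_mulset[OF subspace_hom_part])
  have m1: "v *\<^sub>s hom_part (d - 1) \<subseteq> hom_part d" if "v \<in> hom_part 1" for v :: "'k poly3" and d
    using hom_part_mult1[OF that] by auto
  have kdim_m: "kdim (v *\<^sub>s hom_part d) = dimR d" if "v \<noteq> 0" for v :: "'k poly3" and d
    using kdim_mulset[OF that subspace_hom_part subset_refl] by (simp add: dim_hom_part)

  \<comment> \<open>The ideal \<open>(k1, k2)\<close>; up to degree \<open>e - 1\<close> it turns
    out to be the ideal quotient of \<open>I\<close> by \<open>w\<close>.\<close>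
  define K where "K d = k1 *\<^sub>s hom_part (d - 1) \<oplus>\<^sub>s k2 *\<^sub>s hom_part (d - 1)" for d
  have sK: "kspace.subspace (K d)" for d unfolding K_def by (intro ks.subspace_set_add sD)
  have KR: "K d \<subseteq> hom_part d" for d unfolding K_def by (intro set_add_hom_part m1 lk)
  have Kmem: "k1 * g1 + k2 * g2 \<in> K d" if "g1 \<in> hom_part (d - 1)" "g2 \<in> hom_part (d - 1)" for g1 g2 d
    unfolding K_def using that by (intro set_addI) auto
  have KE: "\<exists>g1\<in>hom_part (d - 1). \<exists>g2\<in>hom_part (d - 1). x = k1 * g1 + k2 * g2" if "x \<in> K d" for x d
    using that unfolding K_def by (auto elim!: set_addE)
  have dimK: "kdim (K (int n)) = dimR (int n) - 1" for n
  proof -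
    let ?A = "k1 *\<^sub>s hom_part (int n - 1)" and ?B = "k2 *\<^sub>s hom_part (int n - 1)" and ?C = "kspace.span {l ^ n}"
    have AR: "?A \<subseteq> hom_part (int n)" "?B \<subseteq> hom_part (int n)" using m1 lk by auto
    have CR: "?C \<subseteq> hom_part (int n)"
      using hom_part_power[OF lk(1)] by (intro kspace.span_minimal subspace_hom_part) auto
    have "(k1 * k2) *\<^sub>s hom_part (int n - 2) \<subseteq> ?A \<inter> ?B"
    proof
      fix x assume "x \<in> (k1 * k2) *\<^sub>s hom_part (int n - 2)"
      then obtain g where g: "g \<in> hom_part (int n - 2)" "x = (k1 * k2) * g" by blast
      have "k2 * g \<in> hom_part (int n - 1)" "k1 * g \<in> hom_part (int n - 1)" "x = k1 * (k2 * g)" "x = k2 * (k1 * g)"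
        using hom_part_mult_le[OF lk(3) g(1), of "int n - 1"] hom_part_mult_le[OF lk(2) g(1), of "int n - 1"] g(2) by (simp_all add: ac_simps)
      then show "x \<in> ?A \<inter> ?B" by blast
    qed
    then have "kdim ((k1 * k2) *\<^sub>s hom_part (int n - 2)) \<le> kdim (?A \<inter> ?B)"
      using AR by (intro kdim_mono[OF sD kspace.subspace_inter[OF sD sD], where d = "int n"]) auto
    then have "kdim (K (int n)) \<le> 2 * dimR (int n - 1) - dimR (int n - 2)"
      unfolding K_def kdim_set_add[OF sD AR(1) sD AR(2)] using k0 by (simp add: kdim_m)
    also have "\<dots> = dimR (int n) - 1"
      using dimR_diff[of "int n"] dimR_diff[of "int n - 1"] by (auto split: if_splits)
    finally have le: "kdim (K (int n)) \<le> dimR (int n) - 1" .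
    have "hom_part (int n) \<subseteq> K (int n) \<oplus>\<^sub>s ?C"
    proof
      fix f :: "'k poly3" assume "f \<in> hom_part (int n)"
      then obtain r g1 g2 where g: "g1 \<in> hom_part (int n - 1)" "g2 \<in> hom_part (int n - 1)" "f = const3 r * l ^ n + k1 * g1 + k2 * g2"
        using lspan_power_decompose[OF sp] by blast
      have "f = (k1 * g1 + k2 * g2) + const3 r * l ^ n" unfolding g(3) by (simp add: ac_simps)
      then show "f \<in> K (int n) \<oplus>\<^sub>s ?C" using set_addI[OF Kmem[OF g(1,2)], of "const3 r * l ^ n" ?C]
        by (auto intro: kspace.span_scale kspace.span_base)
    qed
    then have "dimR (int n) \<le> kdim (K (int n) \<oplus>\<^sub>s ?C)"
      using kdim_mono[OF subspace_hom_part ks.subspace_set_add[OF sK kspace.subspace_span] _ set_add_hom_part[OF KR CR]]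
      by (simp add: dim_hom_part)
    also have "\<dots> \<le> kdim (K (int n)) + kdim ?C"
      using kdim_set_add[OF sK KR kspace.subspace_span CR] by linarith
    finally show ?thesis using le kdim_span_le[of "{l ^ n}"] by simp
  qed

  define Q where "Q d = w *\<^sub>s hom_part (d - 1)" for d
  have sQ: "kspace.subspace (Q d)" for d unfolding Q_def by (rule sD)
  have QR: "Q d \<subseteq> hom_part d" for d unfolding Q_def by (rule m1[OF w(1)])
  have dimQ: "kdim (Q d) = dimR (d - 1)" for d unfolding Q_def by (rule kdim_m[OF w(2)])
  define W where "W d = ideal_part I d \<oplus>\<^sub>s Q d" for d
  have sW: "kspace.subspace (W d)" for d unfolding W_def by (intro ks.subspace_set_add sub_I sQ)
  have WR: "W d \<subseteq> hom_part d" for d unfolding W_def by (intro set_add_hom_part QR Int_lower2)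
  have IW: "ideal_part I d \<subseteq> W d" and QW: "Q d \<subseteq> W d" for d
    unfolding W_def by (rule ks.set_add_upper1[OF sQ], rule ks.set_add_upper2[OF sub_I])
  have mW: "v *\<^sub>s W (d - 1) \<subseteq> hom_part d" if "v \<in> hom_part 1" for v d
    using m1[OF that] WR[of "d - 1"] by blast
  have WE: "\<exists>g\<in>ideal_part I d. \<exists>f\<in>hom_part (d - 1). x = g + w * f" if "x \<in> W d" for x d
    using that unfolding W_def Q_def by (auto elim!: set_addE)
  have wQ: "w * f \<in> Q d" if "f \<in> hom_part (d - 1)" for f d unfolding Q_def using that by blast
  have W_mult: "v * x \<in> W (d + 1)" if v: "v \<in> hom_part 1" and x: "x \<in> W d" for v x d
  proof -
    obtain g f where gf: "g \<in> ideal_part I d" "f \<in> hom_part (d - 1)" "x = g + w * f" using WE[OF x] by blast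
    have "v * x = v * g + w * (v * f)" unfolding gf(3) by (simp add: algebra_simps)
    moreover have "v * g \<in> ideal_part I (d + 1)"
      using gf(1) ideal_mult[OF ideal] hom_part_mult_le[OF v, of g d "d + 1"] by auto
    moreover have "w * (v * f) \<in> Q (d + 1)" using hom_part_mult_le[OF v gf(2), of d] by (intro wQ) simp
    ultimately show ?thesis unfolding W_def using set_addI by metis
  qed
  have wK: "w * x \<in> I" if x: "x \<in> K d" for x d
  proof -
    obtain g1 g2 where "x = k1 * g1 + k2 * g2" using KE[OF x] by blast
    then have "w * x = g1 * (w * k1) + g2 * (w * k2)" by (simp add: algebra_simps)
    then show ?thesis using ideal.subspace_add[OF ideal ideal_mult[OF ideal w(3)] ideal_mult[OF ideal w(4)]] by simp
  qed
  have wl: "w * l ^ n \<notin> I" if "n \<le> e - 1" for n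
  proof
    assume "w * l ^ n \<in> I"
    then have "l ^ (e - 1 - n) * (w * l ^ n) \<in> I" by (rule ideal_mult[OF ideal])
    moreover have "l ^ (e - 1 - n) * (w * l ^ n) = w * l ^ (e - 1 - n + n)"
      unfolding power_add by (rule mult.left_commute)
    moreover have "e - 1 - n + n = e - 1" using that by (rule le_add_diff_inverse2)
    ultimately have "w * l ^ (e - 1) \<in> I" by (simp only:)
    then show False using w(5) by blast
  qed
  \<comment> \<open>Modulo \<open>K\<close> only a multiple of \<open>l ^ n\<close> is left, and
    \<open>w * l ^ n\<close> in \<open>I\<close> would put \<open>w * l ^ (e - 1)\<close> into
    \<open>I\<close>.\<close>
  have wf: "f \<in> K (int n)" if f: "f \<in> hom_part (int n)" "w * f \<in> I" "n \<le> e - 1" for f n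
  proof -
    obtain r g1 g2 where g: "g1 \<in> hom_part (int n - 1)" "g2 \<in> hom_part (int n - 1)" "f = const3 r * l ^ n + k1 * g1 + k2 * g2"
      using lspan_power_decompose[OF sp f(1)] by blast
    have kk: "k1 * g1 + k2 * g2 \<in> K (int n)" by (rule Kmem[OF g(1,2)])
    have "r = 0"
    proof (rule ccontr)
      assume r: "r \<noteq> 0"
      have "w * f - w * (k1 * g1 + k2 * g2) \<in> I" using ideal.subspace_diff[OF ideal f(2) wK[OF kk]] .
      moreover have "w * f - w * (k1 * g1 + k2 * g2) = const3 r * (w * l ^ n)" unfolding g(3) by (simp add: algebra_simps)
      ultimately have "const3 (1 / r) * (const3 r * (w * l ^ n)) \<in> I" using ideal_mult[OF ideal] by simp
      moreover have "const3 (1 / r) * (const3 r * (w * l ^ n)) = w * l ^ n"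
        unfolding mult.assoc[symmetric, of _ "const3 r"] const3_simps(4)[symmetric] using r by (simp add: const3_simps(2))
      ultimately show False using wl[OF f(3)] by simp
    qed
    then show ?thesis using g(3) kk by (simp add: const3_simps)
  qed
  have IQ: "ideal_part I (int n + 1) \<inter> Q (int n + 1) = w *\<^sub>s K (int n)" if "n \<le> e - 1" for n
  proof
    show "ideal_part I (int n + 1) \<inter> Q (int n + 1) \<subseteq> w *\<^sub>s K (int n)"
      using wf[OF _ _ that] unfolding Q_def by auto
    show "w *\<^sub>s K (int n) \<subseteq> ideal_part I (int n + 1) \<inter> Q (int n + 1)"
    proof
      fix y assume "y \<in> w *\<^sub>s K (int n)"
      then obtain x where x: "x \<in> K (int n)" "y = w * x" by blast
      then have "y \<in> Q (int n + 1)" using KR[of "int n"] unfolding Q_def by auto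
      then show "y \<in> ideal_part I (int n + 1) \<inter> Q (int n + 1)" using wK[OF x(1)] QR[of "int n + 1"] x(2) by blast
    qed
  qed
  \<comment> \<open>Adding \<open>w\<close> enlarges \<open>I\<close> in degree \<open>d\<close> by
    the codimension of \<open>K\<close> in degree \<open>d - 1\<close>, which is 1 for
    \<open>d \<ge> 1\<close> and explains \<open>hi d - 1\<close>. In degree 0 nothing is added, so
    \<open>factor_hilb 0\<close> is set to 1.\<close>
  have bbW: "kdim (W d) = dimR d - factor_hilb d" if d: "d \<le> int e" for d
  proof -
    consider "d < 0" | "d = 0" | "d > 0" by linarith
    then show ?thesis
    proof cases
      case 1
      then have "W d = {0}" using WR[of d] kspace.subspace_0[OF sW, of d] hom_part_neg[of d] by auto
      then show ?thesis using 1 by (simp add: factor_hilb_def dimR_def)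
    next
      case 2
      have "hom_part (0 - 1) = ({0} :: 'k poly3 set)" by (rule hom_part_neg) simp
      then have "Q 0 = {0}" unfolding Q_def by simp
      then have "W 0 = {0}" unfolding W_def ideal_part_0 by (simp add: set_add_def)
      then show ?thesis using 2 by (simp add: factor_hilb_def dimR_def)
    next
      case 3
      define n where "n = nat (d - 1)"
      have n: "d = int n + 1" using 3 unfolding n_def by simp
      have "n \<le> e - 1" using d n by linarith
      have "kdim (w *\<^sub>s K (int n)) = dimR (int n) - 1"
        using kdim_mulset[OF w(2) sK KR, of "int n"] dimK[of n] by simp
      then have "kdim (W d) = kdim (ideal_part I d) + 1"
        unfolding W_def kdim_set_add[OF sub_I Int_lower2 sQ QR] n IQ[OF \<open>n \<le> e - 1\<close>] dimQ by simp
      then show ?thesis using 3 unfolding factor_hilb_def hi_def by simp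
    qed
  qed
  \<comment> \<open>Modulo \<open>I\<close> each \<open>v * u\<close> is a multiple of
    \<open>w * l ^ n\<close>. Hence \<open>k1 * u\<close> and \<open>k2 * u\<close> are killed by
    all linear forms modulo \<open>I\<close> and lie in \<open>I\<close>. Subtracting a multiple of
    \<open>w * l ^ (n - 1)\<close> from \<open>u\<close> then takes care of \<open>l\<close> as
    well, so that the difference lies in \<open>I\<close>.\<close>
  have soc: "u \<in> W i" if i: "i \<le> int e - 2" and u: "u \<in> hom_part i" and vu: "\<And>v. v \<in> hom_part 1 \<Longrightarrow> v * u \<in> W (i + 1)" for i u
  proof (cases "i < 0")
    case True
    then have "u = 0" using u hom_part_neg by blast
    then show ?thesis using kspace.subspace_0[OF sW] by simp
  next
    case False
    then obtain n where n: "i = int n" by (metis nat_0_le not_less)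
    have cv: "\<exists>c. v * u - const3 c * (w * l ^ n) \<in> I" if v: "v \<in> hom_part 1" for v
    proof -
      obtain g f where gf: "g \<in> ideal_part I (i + 1)" "f \<in> hom_part (int n)" "v * u = g + w * f"
        using WE[OF vu[OF v]] unfolding n by auto
      obtain r g1 g2 where g: "g1 \<in> hom_part (int n - 1)" "g2 \<in> hom_part (int n - 1)" "f = const3 r * l ^ n + k1 * g1 + k2 * g2"
        using lspan_power_decompose[OF sp gf(2)] by blast
      have "v * u - const3 r * (w * l ^ n) = g + w * (k1 * g1 + k2 * g2)" unfolding gf(3) g(3) by (simp add: algebra_simps)
      moreover have "g + w * (k1 * g1 + k2 * g2) \<in> I" using gf(1) wK[OF Kmem[OF g(1,2)]] ideal.subspace_add[OF ideal] by blast
      ultimately show ?thesis by metis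
    qed
    have ku: "k * u \<in> I" if k: "k \<in> {k1, k2}" for k
    proof -
      have k': "k \<in> hom_part 1" "w * k \<in> I" using k lk w by auto
      have vk: "v * (k * u) \<in> I" if v: "v \<in> hom_part 1" for v
      proof -
        obtain c where c: "v * u - const3 c * (w * l ^ n) \<in> I" using cv[OF v] by blast
        have "v * (k * u) = k * (v * u - const3 c * (w * l ^ n)) + (const3 c * l ^ n) * (w * k)" by (simp add: algebra_simps)
        then show ?thesis using ideal.subspace_add[OF ideal ideal_mult[OF ideal c] ideal_mult[OF ideal k'(2)]] by simp
      qed
      show ?thesis
        using socle_lspan[OF sp hom_part_mult[OF k'(1) u]] vk lk i by simp
    qed
    show ?thesis
    \<comment> \<open>In degree 0 there is no power \<open>l ^ (n - 1)\<close> to subtract; there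
      \<open>k1 * u\<close> is a linear form in \<open>I\<close>, so \<open>u = 0\<close>.\<close>
    proof (cases n)
      case 0
      have "k1 * u \<in> hom_part 1" using hom_part_mult[OF lk(2) u] n 0 by simp
      then have "k1 * u = 0" using ku[of k1] no_linear by blast
      then have "u = 0" using k0 by simp
      then show ?thesis using kspace.subspace_0[OF sW] by simp
    next
      case (Suc m)
      obtain c where c: "l * u - const3 c * (w * l ^ n) \<in> I" using cv[OF lk(1)] by blast
      define y where "y = const3 c * l ^ m"
      have y: "y \<in> hom_part (i - 1)" unfolding y_def n Suc using hom_part_scale[OF hom_part_power[OF lk(1)]] by simp
      have "u - w * y \<in> I"
      proof (rule socle_lspan[OF sp])
        show "u - w * y \<in> hom_part i" using hom_part_diff[OF u hom_part_mult1[OF w(1) y]] .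
        show "i < int e" using i by simp
        have "l * (u - w * y) = l * u - const3 c * (w * l ^ n)" unfolding y_def Suc by (simp add: algebra_simps)
        then show "l * (u - w * y) \<in> I" using c by simp
        have "k * (u - w * y) \<in> I" if k: "k \<in> {k1, k2}" for k
        proof -
          have "k * (u - w * y) = k * u - y * (w * k)" by (simp add: algebra_simps)
          moreover have "y * (w * k) \<in> I" using k w ideal_mult[OF ideal] by blast
          ultimately show ?thesis using ideal.subspace_diff[OF ideal ku[OF k]] by simp
        qed
        then show "k1 * (u - w * y) \<in> I" "k2 * (u - w * y) \<in> I" by auto
      qed
      then have "u - w * y \<in> ideal_part I i" using hom_part_diff[OF u hom_part_mult1[OF w(1) y]] by blast
      then have "(u - w * y) + w * y \<in> W i" unfolding W_def using wQ[OF y] by (rule set_addI)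
      then show ?thesis by simp
    qed
  qed

  \<comment> \<open>Modulo \<open>w\<close> the ring is polynomial in \<open>s\<close> and
    \<open>t\<close>; rather than passing to that ring, the subspace \<open>Q\<close> of multiples
    of \<open>w\<close> is added throughout.\<close>
  obtain s t where st: "lspan s t w" using lspan_extend[OF w(1,2)] by blast
  have s1: "s \<in> hom_part 1" "t \<in> hom_part 1" "koszul s t w" using lspanD[OF st] by blast+
  have stn: "s \<noteq> 0" "t \<noteq> 0"
  proof -
    have d2: "dimR 1 \<le> 2" if two: "\<exists>a b. \<forall>v\<in>hom_part 1. \<exists>x y. v = const3 x * a + const3 y * (b :: 'k poly3)"
    proof -
      obtain a b where ab: "\<forall>v\<in>hom_part 1. \<exists>x y. v = const3 x * a + const3 y * (b :: 'k poly3)" using two by blast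
      have "hom_part 1 \<subseteq> kspace.span {a, b}"
      proof
        fix v :: "'k poly3" assume "v \<in> hom_part 1"
        then obtain x y where "v = const3 x * a + const3 y * b" using ab by blast
        moreover have "const3 x * a + const3 y * b \<in> kspace.span {a, b}"
          by (intro kspace.span_add kspace.span_scale kspace.span_base) auto
        ultimately show "v \<in> kspace.span {a, b}" by simp
      qed
      then have "kdim (hom_part 1 :: 'k poly3 set) \<le> int (card {a, b})" using kspace.dim_le_card[of _ "{a, b}"] by simp
      moreover have "card {a, b} \<le> 2" by (simp add: card_insert_if)
      ultimately show ?thesis unfolding dim_hom_part by linarith
    qed
    have no: "\<not> (\<exists>a b. \<forall>v\<in>hom_part 1. \<exists>x y. v = const3 x * a + const3 y * (b :: 'k poly3))"
    proof
      assume "\<exists>a b. \<forall>v\<in>hom_part 1. \<exists>x y. v = const3 x * a + const3 y * (b :: 'k poly3)"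
      from d2[OF this] show False by (simp add: dimR_def)
    qed
    have st': "\<exists>r0 r1 r2. v = const3 r0 * s + const3 r1 * t + const3 r2 * w" if "v \<in> hom_part 1" for v
      using lspanD(5)[OF st that] unfolding lcomb_def .
    show "s \<noteq> 0"
    proof
      assume "s = 0"
      then have "\<exists>x y. v = const3 x * t + const3 y * w" if "v \<in> hom_part 1" for v using st'[OF that] by auto
      then show False using no by blast
    qed
    show "t \<noteq> 0"
    proof
      assume "t = 0"
      then have "\<exists>x y. v = const3 x * s + const3 y * w" if "v \<in> hom_part 1" for v using st'[OF that] by auto
      then show False using no by blast
    qed
  qed
  \<comment> \<open>As \<open>s\<close> and \<open>w\<close> are coprime and \<open>W\<close>
    contains all multiples of \<open>w\<close>, the two summands meet in the multiples of
    \<open>s * w\<close>.\<close>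
  have sWQ: "kdim (s *\<^sub>s W (d - 1) \<oplus>\<^sub>s Q d) = kdim (W (d - 1)) + dimR (d - 1) - dimR (d - 2)" for d
  proof -
    have A: "kspace.subspace (s *\<^sub>s W (d - 1))" "s *\<^sub>s W (d - 1) \<subseteq> hom_part d"
      by (rule subspace_mulset[OF sW], rule mW[OF s1(1)])
    have "s *\<^sub>s W (d - 1) \<inter> Q d = (s * w) *\<^sub>s hom_part (d - 2)"
    proof
      show "s *\<^sub>s W (d - 1) \<inter> Q d \<subseteq> (s * w) *\<^sub>s hom_part (d - 2)"
      proof
        fix x assume "x \<in> s *\<^sub>s W (d - 1) \<inter> Q d"
        then obtain f h where f: "f \<in> W (d - 1)" "h \<in> hom_part (d - 1)" "x = s * f" "x = w * h" unfolding Q_def by blast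
        then have fh: "f \<in> hom_part (d - 1)" "s * f = w * h" using WR[of "d - 1"] by auto
        obtain g where g: "g \<in> hom_part (d - 1 - 1)" "f = w * g" using koszul_coprime[OF s1(3,2) fh(1) f(2) fh(2)] by blast
        have "x = (s * w) * g" using f(3) g(2) by (simp add: mult.assoc)
        then show "x \<in> (s * w) *\<^sub>s hom_part (d - 2)" using g(1) by auto
      qed
      show "(s * w) *\<^sub>s hom_part (d - 2) \<subseteq> s *\<^sub>s W (d - 1) \<inter> Q d"
      proof
        fix x assume "x \<in> (s * w) *\<^sub>s hom_part (d - 2)"
        then obtain g where g: "g \<in> hom_part (d - 1 - 1)" "x = (s * w) * g" by auto
        have "w * g \<in> W (d - 1)" using wQ[OF g(1)] QW by blast
        moreover have "w * (s * g) \<in> Q d" using hom_part_mult1[OF s1(1) g(1)] by (rule wQ)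
        moreover have "x = s * (w * g)" "x = w * (s * g)" using g(2) by (simp_all add: ac_simps)
        ultimately show "x \<in> s *\<^sub>s W (d - 1) \<inter> Q d" by (intro IntI image_eqI[of x "(*) s"]) simp_all
      qed
    qed
    moreover have "kdim (s *\<^sub>s W (d - 1)) = kdim (W (d - 1))" by (rule kdim_mulset[OF stn(1) sW WR])
    ultimately show ?thesis unfolding kdim_set_add[OF A sQ QR] dimQ using kdim_m[of "s * w" "d - 2"] stn w(2) by simp
  qed
  have main: "num_gens I d = - (factor_hilb d - 2 * factor_hilb (d - 1) + factor_hilb (d - 2))" if d: "3 \<le> d" "d \<le> int e" for d
  proof -
    let ?M = "mult_part (ideal_part I (d - 1))"
    have sM: "kspace.subspace ?M" by (rule subspace_mult_part[OF sub_I])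
    have MR: "?M \<subseteq> hom_part d" by (rule mult_part_subset) auto
    have MI: "?M \<subseteq> ideal_part I d" by (rule mult_part_ideal_part)
    define n where "n = nat (d - 1)"
    have n: "d = int n + 1" "n \<le> e - 1" using d unfolding n_def by auto
    \<comment> \<open>The elements of \<open>I\<close> divisible by \<open>w\<close> come from the
      quadrics \<open>w * k1\<close> and \<open>w * k2\<close>. In degree at least 3 they are
      products of a variable with elements of \<open>I\<close>, so adding \<open>Q\<close> does not
      change the number of generators.\<close>
    have wKM: "w *\<^sub>s K (int n) \<subseteq> ?M"
    proof
      fix x assume "x \<in> w *\<^sub>s K (int n)"
      then obtain g1 g2 where g: "g1 \<in> hom_part (int n - 1)" "g2 \<in> hom_part (int n - 1)" "x = w * (k1 * g1 + k2 * g2)"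
        using KE[of _ "int n"] by blast
      have m: "(w * k) * g \<in> ?M" if k: "k \<in> {k1, k2}" and g: "g \<in> hom_part (int n - 1)" for k g
      proof -
        obtain h0 h1 h2 where h: "h0 \<in> hom_part (int n - 1 - 1)" "h1 \<in> hom_part (int n - 1 - 1)" "h2 \<in> hom_part (int n - 1 - 1)"
          "g = X 0 * h0 + X 1 * h1 + X 2 * h2" using lspan_decompose[OF lspan_X g] n d by auto
        have k': "w * k \<in> hom_part 2" "w * k \<in> I" using k w lk hom_part_mult_le[OF w(1), of k 1 2] by auto
        have "(w * k) * h \<in> ideal_part I (d - 1)" if "h \<in> hom_part (int n - 1 - 1)" for h
          using ideal_mult[OF ideal k'(2), of h] hom_part_mult_le[OF k'(1) that, of "d - 1"] n by (simp add: mult.commute)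
        moreover have "(w * k) * g = X 0 * ((w * k) * h0) + X 1 * ((w * k) * h1) + X 2 * ((w * k) * h2)"
          unfolding h(4) by (simp add: algebra_simps)
        ultimately show ?thesis unfolding mult_part_def using h(1-3) by blast
      qed
      have "x = (w * k1) * g1 + (w * k2) * g2" unfolding g(3) by (simp add: algebra_simps)
      then show "x \<in> ?M" using kspace.subspace_add[OF sM m[OF _ g(1)] m[OF _ g(2)], of k1 k2] by simp
    qed
    have "?M \<inter> Q d = ideal_part I d \<inter> Q d"
      using MI wKM IQ[OF n(2)] unfolding n(1)[symmetric] by blast
    then have ng: "num_gens I d = kdim (W d) - kdim (?M \<oplus>\<^sub>s Q d)"
      unfolding num_gens_def W_def kdim_set_add[OF sub_I Int_lower2 sQ QR] kdim_set_add[OF sM MR sQ QR] by simp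
    let ?A = "s *\<^sub>s W (d - 1) \<oplus>\<^sub>s Q d" and ?B = "t *\<^sub>s W (d - 1)"
    have A: "kspace.subspace ?A" "?A \<subseteq> hom_part d"
      by (rule ks.subspace_set_add[OF subspace_mulset[OF sW] sQ], rule set_add_hom_part[OF mW[OF s1(1)] QR])
    have B: "kspace.subspace ?B" "?B \<subseteq> hom_part d"
      by (rule subspace_mulset[OF sW], rule mW[OF s1(2)])
    have QA: "Q d \<subseteq> ?A" by (rule ks.set_add_upper2[OF subspace_mulset[OF sW]])
    have sA: "s * x \<in> ?A" if "x \<in> W (d - 1)" for x
      using ks.set_add_upper1[OF sQ, of "s *\<^sub>s W (d - 1)" d] that by blast
    have "?M \<oplus>\<^sub>s Q d = ?A \<oplus>\<^sub>s ?B"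
    proof
      have AB: "kspace.subspace (?A \<oplus>\<^sub>s ?B)" by (rule ks.subspace_set_add[OF A(1) B(1)])
      have AAB: "?A \<subseteq> ?A \<oplus>\<^sub>s ?B" "?B \<subseteq> ?A \<oplus>\<^sub>s ?B" by (rule ks.set_add_upper1[OF B(1)], rule ks.set_add_upper2[OF A(1)])
      have Xg: "X i * g \<in> ?A \<oplus>\<^sub>s ?B" if g: "g \<in> ideal_part I (d - 1)" for i g
      proof -
        obtain r0 r1 r2 where r: "X i = lcomb r0 r1 r2 s t w" using lspanD(5)[OF st hom_part_X] by blast
        have gW: "g \<in> W (d - 1)" using g IW by blast
        have "s * g \<in> ?A \<oplus>\<^sub>s ?B" using sA[OF gW] AAB by blast
        moreover have "t * g \<in> ?A \<oplus>\<^sub>s ?B" using gW AAB by blast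
        moreover have "w * g \<in> ?A \<oplus>\<^sub>s ?B" using wQ[of g d] g QA AAB by blast
        ultimately show ?thesis unfolding r lcomb_mult by (intro kspace.subspace_add[OF AB] kspace.subspace_scale[OF AB])
      qed
      show "?M \<oplus>\<^sub>s Q d \<subseteq> ?A \<oplus>\<^sub>s ?B"
      proof (rule ks.set_add_least[OF AB])
        show "?M \<subseteq> ?A \<oplus>\<^sub>s ?B"
          unfolding mult_part_def using Xg by (auto intro!: kspace.subspace_add[OF AB])
        show "Q d \<subseteq> ?A \<oplus>\<^sub>s ?B" using QA AAB by blast
      qed
      have MQ: "kspace.subspace (?M \<oplus>\<^sub>s Q d)" by (rule ks.subspace_set_add[OF sM sQ])
      have vW: "v *\<^sub>s W (d - 1) \<subseteq> ?M \<oplus>\<^sub>s Q d" if v: "v \<in> hom_part 1" for v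
      proof
        fix x assume "x \<in> v *\<^sub>s W (d - 1)"
        then obtain g f where g: "g \<in> ideal_part I (d - 1)" "f \<in> hom_part (d - 1 - 1)" "x = v * (g + w * f)"
          using WE[of _ "d - 1"] by blast
        have "x = v * g + w * (v * f)" unfolding g(3) by (simp add: algebra_simps)
        moreover have "v * g \<in> ?M" by (rule mult_part_linear[OF sub_I v g(1)])
        moreover have "w * (v * f) \<in> Q d" using hom_part_mult1[OF v g(2)] by (rule wQ)
        ultimately show "x \<in> ?M \<oplus>\<^sub>s Q d" using set_addI by metis
      qed
      show "?A \<oplus>\<^sub>s ?B \<subseteq> ?M \<oplus>\<^sub>s Q d"
        using vW[OF s1(1)] vW[OF s1(2)] ks.set_add_upper2[OF sM]
        by (intro ks.set_add_least[OF MQ]) auto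
    qed
    \<comment> \<open>An equation \<open>s * f + w * h = t * g\<close> is a Koszul relation, so
      modulo \<open>w\<close> it is given by one element \<open>w2\<close> with
      \<open>f = t * w2\<close> and \<open>g = s * w2\<close>. All linear multiples of
      \<open>w2\<close> lie in \<open>W\<close>, hence so does \<open>w2\<close> by
      \<open>soc\<close>, for which \<open>d - 2 \<le> e - 2\<close> is needed.\<close>
    moreover have "?A \<inter> ?B = t *\<^sub>s (s *\<^sub>s W (d - 1 - 1) \<oplus>\<^sub>s Q (d - 1))"
    proof
      show "?A \<inter> ?B \<subseteq> t *\<^sub>s (s *\<^sub>s W (d - 1 - 1) \<oplus>\<^sub>s Q (d - 1))"
      proof
        fix x assume "x \<in> ?A \<inter> ?B"
        then obtain f h g where f: "f \<in> W (d - 1)" "h \<in> hom_part (d - 1)" "g \<in> W (d - 1)" "x = s * f + w * h" "x = t * g"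
          unfolding Q_def by (auto elim!: set_addE)
        have "s * f + t * (- g) + w * h = 0" using f(4,5) by simp
        moreover have "f \<in> hom_part (d - 1)" "- g \<in> hom_part (d - 1)"
          using f(1,3) WR[of "d - 1"] by (auto intro: hom_part_uminus)
        ultimately obtain w0 w1 w2 where k: "w0 \<in> hom_part (d - 1 - 1)" "w1 \<in> hom_part (d - 1 - 1)" "w2 \<in> hom_part (d - 1 - 1)"
          "f = t * w2 - w * w1" "- g = w * w0 - s * w2"
          using koszulD[OF s1(3) _ _ f(2), of f "- g"] by metis
        have g: "g = s * w2 - w * w0" using k(5) by (metis minus_diff_eq minus_minus)
        have "w2 \<in> W (d - 1 - 1)"
        proof (rule soc)
          fix v :: "'k poly3" assume "v \<in> hom_part 1"
          then obtain r0 r1 r2 where v: "v = lcomb r0 r1 r2 s t w" using lspanD(5)[OF st] by blast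
          have wq: "w * y \<in> W (d - 1)" if "y \<in> hom_part (d - 1 - 1)" for y using wQ[OF that] QW by blast
          have "s * w2 = g + w * w0" "t * w2 = f + w * w1" using g k(4) by simp_all
          then have "s * w2 \<in> W (d - 1)" "t * w2 \<in> W (d - 1)" "w * w2 \<in> W (d - 1)"
            using kspace.subspace_add[OF sW f(3) wq[OF k(1)]] kspace.subspace_add[OF sW f(1) wq[OF k(2)]] wq[OF k(3)] by simp_all
          then show "v * w2 \<in> W (d - 1 - 1 + 1)"
            unfolding v lcomb_mult by (auto intro!: kspace.subspace_add[OF sW] kspace.subspace_scale[OF sW])
        qed (use d k in auto)
        moreover have "w * (- w0) \<in> Q (d - 1)" using hom_part_uminus[OF k(1)] by (rule wQ)
        ultimately have "s * w2 + w * (- w0) \<in> s *\<^sub>s W (d - 1 - 1) \<oplus>\<^sub>s Q (d - 1)" by (intro set_addI) auto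
        moreover have "s * w2 + w * (- w0) = g" using g by simp
        ultimately show "x \<in> t *\<^sub>s (s *\<^sub>s W (d - 1 - 1) \<oplus>\<^sub>s Q (d - 1))" unfolding f(5) by (metis imageI)
      qed
      show "t *\<^sub>s (s *\<^sub>s W (d - 1 - 1) \<oplus>\<^sub>s Q (d - 1)) \<subseteq> ?A \<inter> ?B"
      proof
        fix x assume "x \<in> t *\<^sub>s (s *\<^sub>s W (d - 1 - 1) \<oplus>\<^sub>s Q (d - 1))"
        then obtain y f where y: "y \<in> W (d - 1 - 1)" "f \<in> hom_part (d - 1 - 1)" "x = t * (s * y + w * f)"
          unfolding Q_def by (auto elim!: set_addE)
        have "s * y \<in> W (d - 1)" "t * y \<in> W (d - 1)" using W_mult[OF s1(1) y(1)] W_mult[OF s1(2) y(1)] by simp_all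
        moreover have "w * f \<in> W (d - 1)" using wQ[OF y(2)] QW by blast
        moreover have "w * (t * f) \<in> Q d" using hom_part_mult1[OF s1(2) y(2)] by (rule wQ)
        moreover have "x = s * (t * y) + w * (t * f)" unfolding y(3) by (simp add: algebra_simps)
        moreover have "s * (t * y) \<in> s *\<^sub>s W (d - 1)" using \<open>t * y \<in> W (d - 1)\<close> by (rule imageI)
        ultimately have "x \<in> ?A" using set_addI[of "s * (t * y)" "s *\<^sub>s W (d - 1)" "w * (t * f)" "Q d"] by simp
        moreover have "x \<in> ?B" unfolding y(3)
          using kspace.subspace_add[OF sW \<open>s * y \<in> W (d - 1)\<close> \<open>w * f \<in> W (d - 1)\<close>] by (rule imageI)
        ultimately show "x \<in> ?A \<inter> ?B" by simp
      qed
    qed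
    moreover have "kdim (t *\<^sub>s (s *\<^sub>s W (d - 1 - 1) \<oplus>\<^sub>s Q (d - 1))) = kdim (s *\<^sub>s W (d - 1 - 1) \<oplus>\<^sub>s Q (d - 1))"
    proof (rule kdim_mulset[OF stn(2)])
      show "kspace.subspace (s *\<^sub>s W (d - 1 - 1) \<oplus>\<^sub>s Q (d - 1))"
        by (intro ks.subspace_set_add subspace_mulset sW sQ)
      show "s *\<^sub>s W (d - 1 - 1) \<oplus>\<^sub>s Q (d - 1) \<subseteq> hom_part (d - 1)"
        by (intro set_add_hom_part QR mW s1(1))
    qed
    moreover have "kdim ?B = kdim (W (d - 1))" by (rule kdim_mulset[OF stn(2) sW WR])
    ultimately have "kdim (?M \<oplus>\<^sub>s Q d) = (kdim (W (d - 1)) + dimR (d - 1) - dimR (d - 2)) + kdim (W (d - 1))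
        - (kdim (W (d - 2)) + dimR (d - 2) - dimR (d - 3))"
      using kdim_set_add[OF A B] sWQ[of d] sWQ[of "d - 1"] by simp
    then show ?thesis
      using ng bbW[of d] bbW[of "d - 1"] bbW[of "d - 2"] dimR_third_difference[of d] d by simp
  qed
  then show "\<And>d. 3 \<le> d \<Longrightarrow> d \<le> int e \<Longrightarrow> num_gens I d = - (factor_hilb d - 2 * factor_hilb (d - 1) + factor_hilb (d - 2))" by blast
  \<comment> \<open>\<open>I\<close> contains the two-dimensional space spanned by
    \<open>w * k1\<close> and \<open>w * k2\<close>.\<close>
  show "factor_hilb 2 \<le> 3"
  proof -
    have "w *\<^sub>s K (int 1) \<subseteq> ideal_part I 2"
    proof -
      have "1 \<le> e - 1" using e3 by simp
      from IQ[OF this] show ?thesis by auto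
    qed
    then have "kdim (w *\<^sub>s K (int 1)) \<le> kdim (ideal_part I 2)"
      by (intro kdim_mono[OF subspace_mulset[OF sK] sub_I _ Int_lower2])
    moreover have "kdim (w *\<^sub>s K (int 1)) = 2"
      using kdim_mulset[OF w(2) sK KR, of "int 1"] dimK[of 1] by (simp add: dimR_def)
    ultimately show ?thesis unfolding factor_hilb_def hi_def by (simp add: dimR_def)
  qed
  \<comment> \<open>\<open>I\<^sub>e\<close> lies in \<open>K\<close>, so
    \<open>R\<^sub>1 I\<^sub>e\<close> lies in \<open>K\<close>, which has codimension 1 in degree
    \<open>e + 1\<close>.\<close>
  show "num_gens I (int e + 1) = 1"
  proof -
    have "mult_part (ideal_part I (int e)) \<subseteq> K (int e + 1)"
    proof
      fix x assume "x \<in> mult_part (ideal_part I (int e))"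
      then obtain g0 g1 g2 where g: "g0 \<in> ideal_part I (int e)" "g1 \<in> ideal_part I (int e)" "g2 \<in> ideal_part I (int e)"
        "x = X 0 * g0 + X 1 * g1 + X 2 * g2" unfolding mult_part_def by blast
      have "X i * g \<in> K (int e + 1)" if gI: "g \<in> ideal_part I (int e)" for i g
      proof -
        obtain h1 h2 where h: "h1 \<in> hom_part (int e - 1)" "h2 \<in> hom_part (int e - 1)" "g = k1 * h1 + k2 * h2"
          using IeK gI by blast
        have "X i * g = k1 * (X i * h1) + k2 * (X i * h2)" unfolding h(3) by (simp add: algebra_simps)
        moreover have "X i * h1 \<in> hom_part (int e + 1 - 1)" "X i * h2 \<in> hom_part (int e + 1 - 1)"
          using hom_part_mult1[OF hom_part_X h(1)] hom_part_mult1[OF hom_part_X h(2)] by simp_all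
        ultimately show ?thesis using Kmem by simp
      qed
      then show "x \<in> K (int e + 1)" unfolding g(4) using g(1-3) by (intro kspace.subspace_add[OF sK]) auto
    qed
    then have "kdim (mult_part (ideal_part I (int e))) \<le> kdim (K (int e + 1))"
      by (intro kdim_mono[OF subspace_mult_part[OF sub_I] sK _ KR])
    moreover have "kdim (K (int e + 1)) = dimR (int e + 1) - 1" using dimK[of "e + 1"] by (simp add: add.commute)
    moreover have "ideal_part I (int e + 1) = hom_part (int e + 1)" using above[of "int e + 1"] by auto
    then have "kdim (ideal_part I (int e + 1)) = dimR (int e + 1)" by (simp add: dim_hom_part)
    ultimately show ?thesis using num_gens_e1_le unfolding num_gens_def by simp
  qed
qed

end

section \<open>Minimal free resolutions\<close>

text \<open>Elements of free modules are functions on \<open>nat\<close> with pointwise operations,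
  so that all ranks live in one vector space and the dimension theory above applies.\<close>

interpretation fs: fd_space "\<lambda>c (u :: nat \<Rightarrow> 'k::field_char_0 poly3) i. const3 c * u i"
  by unfold_locales
    (auto simp: fun_eq_iff const3_simps distrib_left distrib_right mult.assoc)

interpretation fs_ks: fd_space_pair "\<lambda>c (u :: nat \<Rightarrow> 'k::field_char_0 poly3) i. const3 c * u i" "\<lambda>c (f :: 'k poly3). const3 c * f" ..

interpretation fs_fs: fd_space_pair "\<lambda>c (u :: nat \<Rightarrow> 'k::field_char_0 poly3) i. const3 c * u i" "\<lambda>c (u :: nat \<Rightarrow> 'k poly3) i. const3 c * u i" ..

lemma sum_fun_apply: "(\<Sum>c\<in>A. g c) i = (\<Sum>c\<in>A. g c i)"
  for g :: "'c \<Rightarrow> 'd \<Rightarrow> 'e::comm_monoid_add"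
  by (induction A rule: infinite_finite_induct) simp_all

abbreviation fdim :: "(nat \<Rightarrow> 'k::field_char_0 poly3) set \<Rightarrow> int" where
  "fdim V \<equiv> int (fs.dim V)"

text \<open>The values from \<open>n\<close> on are fixed to 0, so that distinct functions are
  distinct tuples and the dimension is right.\<close>

definition prod_space :: "nat \<Rightarrow> (nat \<Rightarrow> 'k::field_char_0 poly3 set) \<Rightarrow> (nat \<Rightarrow> 'k poly3) set" where
  "prod_space n V = {u. (\<forall>c<n. u c \<in> V c) \<and> (\<forall>c\<ge>n. u c = 0)}"

lemma subspace_prod_space:
  assumes "\<And>c. kspace.subspace (V c)"
  shows "fs.subspace (prod_space n V)"
  using kspace.subspace_0[OF assms] kspace.subspace_add[OF assms] kspace.subspace_scale[OF assms]
  unfolding fs.subspace_def prod_space_def by simp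

lemma linear_coordinate:
  "Vector_Spaces.linear (\<lambda>c (u :: nat \<Rightarrow> 'k::field_char_0 poly3) i. const3 c * u i) (\<lambda>c (f :: 'k poly3). const3 c * f) (\<lambda>u. u n)"
  unfolding Vector_Spaces.linear_iff by (simp add: kspace.vector_space_axioms fs.vector_space_axioms)

lemma fin_dim_prod_space:
  fixes V :: "nat \<Rightarrow> 'k::field_char_0 poly3 set"
  assumes "\<And>c. ks.fin_dim (V c)"
  shows "fs.fin_dim (prod_space n V)"
proof -
  obtain B where B: "\<And>c. finite (B c)" "\<And>c. V c \<subseteq> kspace.span (B c)"
    using assms unfolding ks.fin_dim_def by metis
  define e where "e c f = (\<lambda>i. if i = c then f else 0)" for c :: nat and f :: "'k poly3"
  let ?S = "\<Union>c<n. e c ` B c"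
  have esp: "e c f \<in> fs.span ?S" if "c < n" "f \<in> kspace.span (B c)" for c f
    using that(2)
  proof (induction rule: kspace.span_induct_alt)
    case base
    have "e c 0 = 0" by (auto simp: e_def fun_eq_iff)
    then show ?case by (simp only: fs.span_zero)
  next
    case (step r x y)
    have "e c (const3 r * x + y) = (\<lambda>i. const3 r * e c x i) + e c y" by (auto simp: e_def fun_eq_iff)
    moreover have "e c x \<in> fs.span ?S" using step(1) that(1) by (intro fs.span_base) auto
    ultimately show ?case by (simp only: fs.span_add[OF fs.span_scale step(2)])
  qed
  have "u \<in> fs.span ?S" if u: "u \<in> prod_space n V" for u
  proof -
    have "u = (\<Sum>c<n. e c (u c))"
    proof
      fix i
      have "(\<Sum>c<n. e c (u c)) i = (\<Sum>c<n. if c = i then u c else 0)"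
        unfolding sum_fun_apply by (rule sum.cong) (auto simp: e_def)
      also have "\<dots> = u i" using u by (auto simp: prod_space_def sum.delta)
      finally show "u i = (\<Sum>c<n. e c (u c)) i" by simp
    qed
    moreover have "e c (u c) \<in> fs.span ?S" if "c < n" for c
      using u B(2) that by (intro esp) (auto simp: prod_space_def)
    then have "(\<Sum>c<n. e c (u c)) \<in> fs.span ?S" by (intro fs.span_sum) auto
    ultimately show ?thesis by simp
  qed
  then show ?thesis using B(1) by (intro fs.fin_dimI[of ?S]) auto
qed

lemma dim_prod_space:
  fixes V :: "nat \<Rightarrow> 'k::field_char_0 poly3 set"
  assumes V: "\<And>c. kspace.subspace (V c)" "\<And>c. ks.fin_dim (V c)"
  shows "fdim (prod_space n V) = (\<Sum>c<n. kdim (V c))"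
proof (induction n)
  case 0
  have "prod_space 0 V = {0}" by (auto simp: prod_space_def fun_eq_iff)
  then show ?case using fs.dim_le_card[of "{0}" "{}"] by simp
next
  case (Suc n)
  have img: "(\<lambda>u. u n) ` prod_space (Suc n) V = V n"
  proof
    show "V n \<subseteq> (\<lambda>u. u n) ` prod_space (Suc n) V"
    proof
      fix f assume "f \<in> V n"
      then have "(\<lambda>i. if i = n then f else 0) \<in> prod_space (Suc n) V"
        using kspace.subspace_0[OF V(1)] by (auto simp: prod_space_def)
      then show "f \<in> (\<lambda>u. u n) ` prod_space (Suc n) V"
        by (intro image_eqI[of _ _ "\<lambda>i. if i = n then f else 0"]) simp_all
    qed
  qed (auto simp: prod_space_def)
  have ker: "{u \<in> prod_space (Suc n) V. u n = 0} = prod_space n V"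
  proof
    show "{u \<in> prod_space (Suc n) V. u n = 0} \<subseteq> prod_space n V"
      by (auto simp: prod_space_def) (metis Suc_leI le_neq_implies_less)
    show "prod_space n V \<subseteq> {u \<in> prod_space (Suc n) V. u n = 0}"
      using kspace.subspace_0[OF V(1)] by (auto simp: prod_space_def less_Suc_eq)
  qed
  show ?case
    using fs_ks.rank_nullity(1)[OF linear_coordinate[of n] subspace_prod_space[of V "Suc n", OF V(1)] fin_dim_prod_space[of V "Suc n", OF V(2)]]
    unfolding img ker using Suc by simp
qed

lemma lookup_0_mult: "lk f 0 = 0 \<Longrightarrow> lk (f * g) (0 :: expo) = 0"
proof (rule ccontr)
  assume f: "lk f 0 = 0" and "lk (f * g) 0 \<noteq> 0"
  then have "0 \<in> Poly_Mapping.keys (f * g)" by (simp add: in_keys_iff)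
  then obtain a b where ab: "0 = a + b" "a \<in> Poly_Mapping.keys f" using keys_mult by blast
  have "mdeg a + mdeg b = 0" unfolding mdeg_add[symmetric] ab(1)[symmetric] by simp
  then have "a = 0" by (simp add: mdeg_eq_0_iff)
  then show False using ab(2) f by (simp add: in_keys_iff)
qed

text \<open>Matrices and vectors are functions of their indices; only the values below \<open>n1\<close>, \<open>n2\<close>, \<open>n3\<close> matter.\<close>

locale resolution =
  fixes I :: "'k::field_char_0 poly3 set" and n1 n2 n3 :: nat and a1 a2 a3 :: "nat \<Rightarrow> int"
    and M1 :: "nat \<Rightarrow> 'k poly3" and M2 M3 :: "nat \<Rightarrow> nat \<Rightarrow> 'k poly3"
  assumes hom: "\<And>c. c < n1 \<Longrightarrow> M1 c \<in> hom_part (a1 c)"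
      "\<And>r c. r < n1 \<Longrightarrow> c < n2 \<Longrightarrow> M2 r c \<in> hom_part (a2 c - a1 r)"
      "\<And>r c. r < n2 \<Longrightarrow> c < n3 \<Longrightarrow> M3 r c \<in> hom_part (a3 c - a2 r)"
    and minimal: "\<And>c. c < n1 \<Longrightarrow> lk (M1 c) 0 = 0"
      "\<And>r c. r < n1 \<Longrightarrow> c < n2 \<Longrightarrow> lk (M2 r c) 0 = 0"
      "\<And>r c. r < n2 \<Longrightarrow> c < n3 \<Longrightarrow> lk (M3 r c) 0 = 0"
    and image: "\<And>f. f \<in> I \<longleftrightarrow> (\<exists>u. f = (\<Sum>c<n1. M1 c * u c))"
    and exact1: "\<And>u. (\<Sum>c<n1. M1 c * u c) = 0 \<Longrightarrow> \<exists>v. \<forall>r<n1. u r = (\<Sum>c<n2. M2 r c * v c)"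
    and complex1: "\<And>v. (\<Sum>r<n1. M1 r * (\<Sum>c<n2. M2 r c * v c)) = 0"
    and exact2: "\<And>u. (\<And>r. r < n1 \<Longrightarrow> (\<Sum>c<n2. M2 r c * u c) = 0) \<Longrightarrow> \<exists>v. \<forall>r<n2. u r = (\<Sum>c<n3. M3 r c * v c)"
    and complex2: "\<And>q v. q < n1 \<Longrightarrow> (\<Sum>r<n2. M2 q r * (\<Sum>c<n3. M3 r c * v c)) = 0"
    and exact3: "\<And>u c. (\<And>r. r < n2 \<Longrightarrow> (\<Sum>c<n3. M3 r c * u c) = 0) \<Longrightarrow> c < n3 \<Longrightarrow> u c = 0"
    and homI: "homogeneous_ideal I"
begin

lemma sum_delta: "c < (n :: nat) \<Longrightarrow> (\<Sum>i<n. f i * (if i = c then 1 else 0)) = (f c :: 'k poly3)"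
proof -
  assume c: "c < n"
  have "(\<Sum>i<n. f i * (if i = c then 1 else 0)) = (\<Sum>i<n. if i = c then f i else 0)"
    by (rule sum.cong) auto
  also have "\<dots> = f c" using c by (simp add: sum.delta)
  finally show ?thesis .
qed

lemma decompose_entries:
  assumes "\<And>r. r < n \<Longrightarrow> f r \<in> hom_part (d r)" "\<And>r. r < n \<Longrightarrow> lk (f r) 0 = 0"
  obtains U0 U1 U2 :: "nat \<Rightarrow> 'k poly3" where
    "\<And>r. r < n \<Longrightarrow> U0 r \<in> hom_part (d r - 1)" "\<And>r. r < n \<Longrightarrow> U1 r \<in> hom_part (d r - 1)"
    "\<And>r. r < n \<Longrightarrow> U2 r \<in> hom_part (d r - 1)" "\<And>r. r < n \<Longrightarrow> f r = X 0 * U0 r + X 1 * U1 r + X 2 * U2 r"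
proof -
  have "\<forall>r. \<exists>u0 u1 u2. r < n \<longrightarrow> u0 \<in> hom_part (d r - 1) \<and> u1 \<in> hom_part (d r - 1) \<and> u2 \<in> hom_part (d r - 1) \<and>
      f r = X 0 * u0 + X 1 * u1 + X 2 * u2"
  proof
    fix r
    show "\<exists>u0 u1 u2. r < n \<longrightarrow> u0 \<in> hom_part (d r - 1) \<and> u1 \<in> hom_part (d r - 1) \<and> u2 \<in> hom_part (d r - 1) \<and>
      f r = X 0 * u0 + X 1 * u1 + X 2 * u2"
    proof (cases "r < n")
      case True
      show ?thesis
      proof (rule X_decompose[OF assms(1)[OF True] assms(2)[OF True]])
        fix g :: "3 \<Rightarrow> 'k poly3"
        assume "\<And>i. g i \<in> hom_part (d r - 1)" "f r = X 0 * g 0 + X 1 * g 1 + X 2 * g 2"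
        then show ?thesis by (intro exI[of _ "g 0"] exI[of _ "g 1"] exI[of _ "g 2"]) simp
      qed
    qed simp
  qed
  then obtain U0 U1 U2 where "\<forall>r. r < n \<longrightarrow> U0 r \<in> hom_part (d r - 1) \<and> U1 r \<in> hom_part (d r - 1) \<and> U2 r \<in> hom_part (d r - 1) \<and>
      f r = X 0 * U0 r + X 1 * U1 r + X 2 * U2 r" unfolding choice_iff by blast
  then show thesis using that by blast
qed

lemma sum_X_expand: "(\<Sum>r<n. m r * (X 0 * f r + X 1 * g r + X 2 * h r)) =
    X 0 * (\<Sum>r<n. m r * f r) + X 1 * (\<Sum>r<n. m r * g r) + X 2 * (\<Sum>r<n. m r * (h r :: 'k poly3))"
  by (simp add: sum_distrib_left sum.distrib distrib_left mult.left_commute)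

lemma sum_X_diff: "X i * (\<Sum>r<n. m r * f r) - X j * (\<Sum>r<n. m r * g r) = (\<Sum>r<n. m r * (X i * f r - X j * (g r :: 'k poly3)))"
  by (simp add: sum_distrib_left sum_subtractf right_diff_distrib mult.left_commute)

lemma sum_diff: "(\<Sum>r<n. m r * (f r - g r)) = (\<Sum>r<n. m r * f r) - (\<Sum>r<n. m r * (g r :: 'k poly3))"
  by (simp add: sum_subtractf right_diff_distrib)

text \<open>Three Koszul steps, from \<open>F\<^sub>3\<close> down to \<open>R\<close>, turn the \<open>c\<close>-th basis element of \<open>F\<^sub>3\<close> into a socle
  element \<open>s\<close>. If \<open>s\<close> were in \<open>I\<close>, lifting it back would put the basis element into the maximal
  ideal times \<open>F\<^sub>3\<close>.\<close>

lemma socle_of_third_syzygy: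
  assumes c: "c < n3"
  obtains s where "s \<in> hom_part (a3 c - 3)" "\<And>i. X i * s \<in> I" "s \<notin> I"
proof -
  let ?l = "a3 c"
  obtain U0 U1 U2 where U: "\<And>r. r < n2 \<Longrightarrow> U0 r \<in> hom_part (?l - a2 r - 1)" "\<And>r. r < n2 \<Longrightarrow> U1 r \<in> hom_part (?l - a2 r - 1)"
      "\<And>r. r < n2 \<Longrightarrow> U2 r \<in> hom_part (?l - a2 r - 1)" "\<And>r. r < n2 \<Longrightarrow> M3 r c = X 0 * U0 r + X 1 * U1 r + X 2 * U2 r"
    using decompose_entries[of n2 "\<lambda>r. M3 r c" "\<lambda>r. ?l - a2 r"] hom(3) minimal(3) c by blast
  \<comment> \<open>Since the product of \<open>M2\<close> and \<open>M3\<close> is zero, applying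
    \<open>M2\<close> to the three parts of column \<open>c\<close> of \<open>M3\<close> gives a
    Koszul relation in every coordinate of \<open>F\<^sub>1\<close>.\<close>
  define Y where "Y U q = (\<Sum>r<n2. M2 q r * U r)" for U :: "nat \<Rightarrow> 'k poly3" and q
  have Yhom: "Y U q \<in> hom_part (?l - 1 - a1 q)" if "\<And>r. r < n2 \<Longrightarrow> U r \<in> hom_part (?l - a2 r - 1)" "q < n1" for U q
    unfolding Y_def using hom_part_mult_le[OF hom(2)[OF that(2)] that(1)] by (intro hom_part_sum) auto
  have Y0: "X 0 * Y U0 q + X 1 * Y U1 q + X 2 * Y U2 q = 0" if q: "q < n1" for q
  proof -
    have "(\<Sum>r<n2. M2 q r * (\<Sum>c'<n3. M3 r c' * (if c' = c then 1 else 0))) = 0" by (rule complex2[OF q])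
    then have "(\<Sum>r<n2. M2 q r * M3 r c) = 0" unfolding sum_delta[OF c] .
    also have "(\<Sum>r<n2. M2 q r * M3 r c) = (\<Sum>r<n2. M2 q r * (X 0 * U0 r + X 1 * U1 r + X 2 * U2 r))"
      using U(4) by (intro sum.cong) auto
    finally show ?thesis unfolding Y_def sum_X_expand .
  qed
  have "\<forall>q. \<exists>w0 w1 w2. q < n1 \<longrightarrow> w0 \<in> hom_part (?l - 1 - a1 q - 1) \<and> w1 \<in> hom_part (?l - 1 - a1 q - 1) \<and> w2 \<in> hom_part (?l - 1 - a1 q - 1) \<and>
      Y U0 q = X 1 * w2 - X 2 * w1 \<and> Y U1 q = X 2 * w0 - X 0 * w2 \<and> Y U2 q = X 0 * w1 - X 1 * w0"
  proof
    fix q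
    show "\<exists>w0 w1 w2. q < n1 \<longrightarrow> w0 \<in> hom_part (?l - 1 - a1 q - 1) \<and> w1 \<in> hom_part (?l - 1 - a1 q - 1) \<and> w2 \<in> hom_part (?l - 1 - a1 q - 1) \<and>
      Y U0 q = X 1 * w2 - X 2 * w1 \<and> Y U1 q = X 2 * w0 - X 0 * w2 \<and> Y U2 q = X 0 * w1 - X 1 * w0"
    proof (cases "q < n1")
      case True
      show ?thesis using koszulD[OF koszul_X Yhom[OF U(1) True] Yhom[OF U(2) True] Yhom[OF U(3) True] Y0[OF True]] by metis
    qed simp
  qed
  then obtain w0 w1 w2 where "\<forall>q. q < n1 \<longrightarrow> w0 q \<in> hom_part (?l - 1 - a1 q - 1) \<and> w1 q \<in> hom_part (?l - 1 - a1 q - 1) \<and> w2 q \<in> hom_part (?l - 1 - a1 q - 1) \<and>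
      Y U0 q = X 1 * w2 q - X 2 * w1 q \<and> Y U1 q = X 2 * w0 q - X 0 * w2 q \<and> Y U2 q = X 0 * w1 q - X 1 * w0 q"
    unfolding choice_iff by blast
  note w = this[rule_format]
  define S where "S w = (\<Sum>q<n1. M1 q * w q)" for w :: "nat \<Rightarrow> 'k poly3"
  have SY: "(\<Sum>q<n1. M1 q * Y U q) = 0" for U unfolding Y_def by (rule complex1)
  \<comment> \<open>Here the product of \<open>M1\<close> and \<open>M2\<close> vanishes, so the
    triple of the \<open>S w\<close> is proportional to the variables, and \<open>s\<close> is the
    factor.\<close>
  have rel: "X 1 * S w2 - X 2 * S w1 = 0" "X 2 * S w0 - X 0 * S w2 = 0" "X 0 * S w1 - X 1 * S w0 = 0"
  proof -
    have "X 1 * S w2 - X 2 * S w1 = (\<Sum>q<n1. M1 q * Y U0 q)" "X 2 * S w0 - X 0 * S w2 = (\<Sum>q<n1. M1 q * Y U1 q)"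
      "X 0 * S w1 - X 1 * S w0 = (\<Sum>q<n1. M1 q * Y U2 q)"
      unfolding S_def sum_X_diff using w by (auto intro!: sum.cong)
    then show "X 1 * S w2 - X 2 * S w1 = 0" "X 2 * S w0 - X 0 * S w2 = 0" "X 0 * S w1 - X 1 * S w0 = 0" unfolding SY .
  qed
  have "S w0 \<in> hom_part (?l - 2)"
    unfolding S_def using w by (intro hom_part_sum hom_part_mult_le[OF hom(1)]) auto
  moreover have "X 0 * S w1 = X 1 * S w0" "X 0 * S w2 = X 2 * S w0" using rel(2,3) by simp_all
  ultimately obtain s where s: "s \<in> hom_part (?l - 2 - 1)" "S w0 = X 0 * s" "S w1 = X 1 * s" "S w2 = X 2 * s"
    using koszul_first by blast
  have SI: "S w \<in> I" for w unfolding image S_def by blast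
  have Xs: "X i * s \<in> I" for i using exhaust_three[of i] SI[of w0] SI[of w1] SI[of w2] unfolding s(2-4) by auto
  have "s \<notin> I"
  proof
    assume "s \<in> I"
    then obtain t where t: "s = (\<Sum>q<n1. M1 q * t q)" unfolding image by blast
    have ex: "\<exists>z. \<forall>q<n1. w q - X i * t q = (\<Sum>r<n2. M2 q r * z r)" if "S w = X i * s" for w i
    proof (rule exact1)
      have "(\<Sum>q<n1. M1 q * (w q - X i * t q)) = S w - X i * s"
        unfolding S_def t by (simp add: sum_diff sum_distrib_left mult.left_commute)
      then show "(\<Sum>q<n1. M1 q * (w q - X i * t q)) = 0" using that by simp
    qed
    obtain z0 z1 z2 where z: "\<And>q. q < n1 \<Longrightarrow> w0 q - X 0 * t q = Y z0 q" "\<And>q. q < n1 \<Longrightarrow> w1 q - X 1 * t q = Y z1 q"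
      "\<And>q. q < n1 \<Longrightarrow> w2 q - X 2 * t q = Y z2 q"
      using ex[OF s(2)] ex[OF s(3)] ex[OF s(4)] unfolding Y_def by blast
    have wz: "w0 q = X 0 * t q + Y z0 q" "w1 q = X 1 * t q + Y z1 q" "w2 q = X 2 * t q + Y z2 q" if "q < n1" for q
      using z[OF that] by (simp_all add: diff_eq_eq add.commute)
    have ex2: "\<exists>y. \<forall>r<n2. U r - (X i * za r - X j * zb r) = (\<Sum>c<n3. M3 r c * y c)"
      if "\<And>q. q < n1 \<Longrightarrow> Y U q = X i * wa q - X j * wb q" "\<And>q. q < n1 \<Longrightarrow> wa q = X j * t q + Y za q" "\<And>q. q < n1 \<Longrightarrow> wb q = X i * t q + Y zb q"
      for U wa wb za zb i j
    proof (rule exact2)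
      fix q assume q: "q < n1"
      have "Y U q = X i * Y za q - X j * Y zb q"
        unfolding that(1)[OF q] that(2)[OF q] that(3)[OF q] by (simp add: algebra_simps)
      then show "(\<Sum>r<n2. M2 q r * (U r - (X i * za r - X j * zb r))) = 0"
        unfolding Y_def sum_X_diff sum_diff by simp
    qed
    obtain y0 where y0: "\<And>r. r < n2 \<Longrightarrow> U0 r - (X 1 * z2 r - X 2 * z1 r) = (\<Sum>c<n3. M3 r c * y0 c)"
      using ex2[of U0 1 w2 2 w1 z2 z1] w wz by blast
    obtain y1 where y1: "\<And>r. r < n2 \<Longrightarrow> U1 r - (X 2 * z0 r - X 0 * z2 r) = (\<Sum>c<n3. M3 r c * y1 c)"
      using ex2[of U1 2 w0 0 w2 z0 z2] w wz by blast
    obtain y2 where y2: "\<And>r. r < n2 \<Longrightarrow> U2 r - (X 0 * z1 r - X 1 * z0 r) = (\<Sum>c<n3. M3 r c * y2 c)"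
      using ex2[of U2 0 w1 1 w0 z1 z0] w wz by blast
    \<comment> \<open>\<open>M3\<close> maps the \<open>c\<close>-th basis element and
      \<open>p\<close> to the same vector, so injectivity gives \<open>p c = 1\<close>, although
      \<open>p c\<close> has no constant term.\<close>
    define p where "p c' = X 0 * y0 c' + X 1 * y1 c' + X 2 * y2 c'" for c'
    have "(\<Sum>c'<n3. M3 r c' * ((if c' = c then 1 else 0) - p c')) = 0" if r: "r < n2" for r
    proof -
      have "M3 r c = X 0 * (U0 r - (X 1 * z2 r - X 2 * z1 r)) + X 1 * (U1 r - (X 2 * z0 r - X 0 * z2 r)) + X 2 * (U2 r - (X 0 * z1 r - X 1 * z0 r))"
        unfolding U(4)[OF r] by (simp add: algebra_simps)
      also have "\<dots> = (\<Sum>c'<n3. M3 r c' * p c')" unfolding y0[OF r] y1[OF r] y2[OF r] p_def sum_X_expand ..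
      finally show ?thesis unfolding sum_diff sum_delta[OF c] by simp
    qed
    from exact3[OF this c] have "p c = 1" by simp
    moreover have "lk (p c) 0 = 0" unfolding p_def by (simp add: lookup_add lookup_X_mult_0)
    ultimately show False by simp
  qed
  then show thesis using that[of s] s(1) Xs by simp
qed

text \<open>Two Koszul steps turn column \<open>r\<close> of \<open>M2\<close> into three forms
  \<open>s0\<close>, \<open>s1\<close>, \<open>s2\<close> of degree \<open>a2 r - 2\<close>. If
  these lie in \<open>I\<close>, lifting them back shows that basis element \<open>r\<close> lies in
  the maximal ideal times \<open>F\<^sub>2\<close> plus the image of \<open>M3\<close>, which is in
  the maximal ideal times \<open>F\<^sub>2\<close> as well.\<close>

lemma second_syzygy_degree:
  assumes r: "r < n2" and high: "hom_part (a2 r - 2) \<subseteq> I"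
  shows False
proof -
  let ?l = "a2 r"
  obtain w0 w1 w2 where w: "\<And>q. q < n1 \<Longrightarrow> w0 q \<in> hom_part (?l - a1 q - 1)" "\<And>q. q < n1 \<Longrightarrow> w1 q \<in> hom_part (?l - a1 q - 1)"
      "\<And>q. q < n1 \<Longrightarrow> w2 q \<in> hom_part (?l - a1 q - 1)" "\<And>q. q < n1 \<Longrightarrow> M2 q r = X 0 * w0 q + X 1 * w1 q + X 2 * w2 q"
    using decompose_entries[of n1 "\<lambda>q. M2 q r" "\<lambda>q. ?l - a1 q"] hom(2) minimal(2) r by blast
  define S where "S w = (\<Sum>q<n1. M1 q * w q)" for w :: "nat \<Rightarrow> 'k poly3"
  have Sh: "S w \<in> hom_part (?l - 1)" if "\<And>q. q < n1 \<Longrightarrow> w q \<in> hom_part (?l - a1 q - 1)" for w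
    unfolding S_def using that by (intro hom_part_sum hom_part_mult_le[OF hom(1)]) auto
  have "X 0 * S w0 + X 1 * S w1 + X 2 * S w2 = 0"
  proof -
    have "(\<Sum>q<n1. M1 q * (\<Sum>r'<n2. M2 q r' * (if r' = r then 1 else 0))) = 0" by (rule complex1)
    then have "(\<Sum>q<n1. M1 q * M2 q r) = 0" unfolding sum_delta[OF r] .
    also have "(\<Sum>q<n1. M1 q * M2 q r) = (\<Sum>q<n1. M1 q * (X 0 * w0 q + X 1 * w1 q + X 2 * w2 q))"
      using w(4) by (intro sum.cong) auto
    finally show ?thesis unfolding S_def sum_X_expand .
  qed
  from koszulD[OF koszul_X Sh[OF w(1)] Sh[OF w(2)] Sh[OF w(3)] this] obtain s0 s1 s2
    where s: "s0 \<in> hom_part (?l - 1 - 1)" "s1 \<in> hom_part (?l - 1 - 1)" "s2 \<in> hom_part (?l - 1 - 1)"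
      "S w0 = X 1 * s2 - X 2 * s1" "S w1 = X 2 * s0 - X 0 * s2" "S w2 = X 0 * s1 - X 1 * s0" by metis
  have "s0 \<in> I" "s1 \<in> I" "s2 \<in> I" using s(1-3) high by auto
  then obtain t0 t1 t2 where t: "s0 = S t0" "s1 = S t1" "s2 = S t2" unfolding image S_def by blast
  have ex: "\<exists>z. \<forall>q<n1. wa q - (X i * ta q - X j * tb q) = (\<Sum>r<n2. M2 q r * z r)" if "S wa = X i * S ta - X j * S tb" for wa ta tb i j
    using that unfolding S_def sum_X_diff by (intro exact1) (simp add: sum_diff)
  obtain z0 where z0: "\<And>q. q < n1 \<Longrightarrow> w0 q - (X 1 * t2 q - X 2 * t1 q) = (\<Sum>r<n2. M2 q r * z0 r)" using ex[OF s(4)[unfolded t]] by blast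
  obtain z1 where z1: "\<And>q. q < n1 \<Longrightarrow> w1 q - (X 2 * t0 q - X 0 * t2 q) = (\<Sum>r<n2. M2 q r * z1 r)" using ex[OF s(5)[unfolded t]] by blast
  obtain z2 where z2: "\<And>q. q < n1 \<Longrightarrow> w2 q - (X 0 * t1 q - X 1 * t0 q) = (\<Sum>r<n2. M2 q r * z2 r)" using ex[OF s(6)[unfolded t]] by blast
  define p where "p r' = X 0 * z0 r' + X 1 * z1 r' + X 2 * z2 r'" for r'
  have "(\<Sum>r'<n2. M2 q r' * ((if r' = r then 1 else 0) - p r')) = 0" if q: "q < n1" for q
  proof -
    have "M2 q r = X 0 * (w0 q - (X 1 * t2 q - X 2 * t1 q)) + X 1 * (w1 q - (X 2 * t0 q - X 0 * t2 q)) + X 2 * (w2 q - (X 0 * t1 q - X 1 * t0 q))"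
      unfolding w(4)[OF q] by (simp add: algebra_simps)
    also have "\<dots> = (\<Sum>r'<n2. M2 q r' * p r')" unfolding z0[OF q] z1[OF q] z2[OF q] p_def sum_X_expand ..
    finally show ?thesis unfolding sum_diff sum_delta[OF r] by simp
  qed
  from exact2[OF this] obtain v where v: "\<forall>r'<n2. (if r' = r then 1 else 0) - p r' = (\<Sum>c<n3. M3 r' c * v c)" by blast
  then have "1 - p r = (\<Sum>c<n3. M3 r c * v c)" using r by auto
  then have "lk (1 - p r) 0 = (\<Sum>c<n3. lk (M3 r c * v c) 0)" by (simp add: lookup_sum)
  also have "\<dots> = 0" using minimal(3)[OF r] by (simp add: lookup_0_mult)
  finally have "lk (1 - p r) 0 = 0" .
  moreover have "lk (p r) 0 = 0" unfolding p_def by (simp add: lookup_add lookup_X_mult_0)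
  ultimately show False by (simp add: lookup_minus)
qed

end

section \<open>Betti numbers from dimensions of graded pieces\<close>

definition cnt :: "nat \<Rightarrow> (nat \<Rightarrow> int) \<Rightarrow> int \<Rightarrow> int" where
  "cnt n a l = (\<Sum>c<n. if a c = l then 1 else 0)"

definition hilbert_free :: "nat \<Rightarrow> (nat \<Rightarrow> int) \<Rightarrow> int \<Rightarrow> int" where
  "hilbert_free n a l = (\<Sum>c<n. dimR (l - a c))"

text \<open>Multiplying the Hilbert series of a graded free module by \<open>(1 - t) ^ 3\<close>
  leaves the generating function of its shifts.\<close>

lemma cnt_third_difference:
  "cnt n a l = hilbert_free n a l - 3 * hilbert_free n a (l - 1) + 3 * hilbert_free n a (l - 2) - hilbert_free n a (l - 3)"
proof -
  have "cnt n a l = (\<Sum>c<n. dimR (l - a c) - 3 * dimR (l - 1 - a c) + 3 * dimR (l - 2 - a c) - dimR (l - 3 - a c))"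
    unfolding cnt_def
  proof (rule sum.cong)
    fix c
    show "(if a c = l then 1 else 0) = dimR (l - a c) - 3 * dimR (l - 1 - a c) + 3 * dimR (l - 2 - a c) - dimR (l - 3 - a c)"
      using dimR_third_difference[of "l - a c"] by (simp add: algebra_simps)
  qed simp
  then show ?thesis unfolding hilbert_free_def by (simp add: sum_subtractf sum.distrib sum_distrib_left)
qed

lemma count_mset_cnt: "int (count (mset xs) l) = cnt (length xs) (\<lambda>c. xs ! c) l"
proof -
  have "int (count (mset xs) l) = (\<Sum>x\<leftarrow>xs. if x = l then 1 else 0)"
    by (induction xs) auto
  also have "\<dots> = (\<Sum>c<length xs. if xs ! c = l then 1 else 0)"
    by (simp add: sum_list_sum_nth atLeast0LessThan)
  finally show ?thesis unfolding cnt_def .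
qed

lemma cnt_eq_0_iff: "cnt n a l = 0 \<longleftrightarrow> (\<forall>c<n. a c \<noteq> l)"
proof -
  have "cnt n a l = 0 \<longleftrightarrow> (\<forall>c\<in>{..<n}. (if a c = l then 1 else 0) = (0::int))"
    unfolding cnt_def by (intro sum_nonneg_eq_0_iff) auto
  then show ?thesis by (auto split: if_splits)
qed

context resolution begin

definition F1 :: "int \<Rightarrow> (nat \<Rightarrow> 'k poly3) set" where "F1 l = prod_space n1 (\<lambda>c. hom_part (l - a1 c))"
definition F2 :: "int \<Rightarrow> (nat \<Rightarrow> 'k poly3) set" where "F2 l = prod_space n2 (\<lambda>c. hom_part (l - a2 c))"
definition F3 :: "int \<Rightarrow> (nat \<Rightarrow> 'k poly3) set" where "F3 l = prod_space n3 (\<lambda>c. hom_part (l - a3 c))"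

definition P1 :: "(nat \<Rightarrow> 'k poly3) \<Rightarrow> 'k poly3" where "P1 u = (\<Sum>c<n1. M1 c * u c)"
definition P2 :: "(nat \<Rightarrow> 'k poly3) \<Rightarrow> (nat \<Rightarrow> 'k poly3)" where
  "P2 u = (\<lambda>r. if r < n1 then (\<Sum>c<n2. M2 r c * u c) else 0)"
definition P3 :: "(nat \<Rightarrow> 'k poly3) \<Rightarrow> (nat \<Rightarrow> 'k poly3)" where
  "P3 u = (\<lambda>r. if r < n2 then (\<Sum>c<n3. M3 r c * u c) else 0)"

lemma F_space:
  "fs.subspace (F1 l)" "fs.subspace (F2 l)" "fs.subspace (F3 l)" "fs.fin_dim (F1 l)" "fs.fin_dim (F2 l)" "fs.fin_dim (F3 l)"
  "fdim (F1 l) = hilbert_free n1 a1 l" "fdim (F2 l) = hilbert_free n2 a2 l" "fdim (F3 l) = hilbert_free n3 a3 l"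
  unfolding F1_def F2_def F3_def hilbert_free_def
  by (simp_all add: subspace_prod_space subspace_hom_part fin_dim_prod_space fin_dim_hom_part dim_prod_space dim_hom_part)

lemma linear_P:
  "Vector_Spaces.linear (\<lambda>c (u :: nat \<Rightarrow> 'k poly3) i. const3 c * u i) (\<lambda>c (f :: 'k poly3). const3 c * f) P1"
  "Vector_Spaces.linear (\<lambda>c (u :: nat \<Rightarrow> 'k poly3) i. const3 c * u i) (\<lambda>c (u :: nat \<Rightarrow> 'k poly3) i. const3 c * u i) P2"
  "Vector_Spaces.linear (\<lambda>c (u :: nat \<Rightarrow> 'k poly3) i. const3 c * u i) (\<lambda>c (u :: nat \<Rightarrow> 'k poly3) i. const3 c * u i) P3"
  unfolding Vector_Spaces.linear_iff P1_def P2_def P3_def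
  by (auto simp: kspace.vector_space_axioms fs.vector_space_axioms fun_eq_iff distrib_left sum.distrib sum_distrib_left mult.left_commute)

lemma hcomp_sum_mult:
  assumes "\<And>c. c < (n::nat) \<Longrightarrow> m c \<in> hom_part (d c)"
  shows "hcomp l (\<Sum>c<n. m c * u c) = (\<Sum>c<n. m c * hcomp (l - d c) (u c))"
proof -
  have "hcomp l (m c * u c) = m c * hcomp (l - d c) (u c)" if "c < n" for c
    by (rule hcomp_mult'[OF assms[OF that]])
  then show ?thesis unfolding hcomp_setsum by simp
qed

text \<open>The exactness assumed in \<open>resolution\<close> is ungraded. A preimage of a form of
  degree \<open>l\<close> becomes homogeneous on replacing each coordinate by its component of
  degree \<open>l - a1 c\<close>; the same device is used for \<open>P2\<close> and
  \<open>P3\<close>.\<close>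

lemma P1_image: "P1 ` F1 l = ideal_part I l"
proof
  show "P1 ` F1 l \<subseteq> ideal_part I l"
  proof
    fix x assume "x \<in> P1 ` F1 l"
    then obtain u where u: "u \<in> F1 l" "x = P1 u" by blast
    have "M1 c * u c \<in> hom_part l" if "c < n1" for c
      using u(1) hom(1)[OF that] that unfolding F1_def prod_space_def by (auto intro: hom_part_mult_le)
    then have "P1 u \<in> hom_part l" unfolding P1_def by (intro hom_part_sum) auto
    then show "x \<in> ideal_part I l" using u(2) image unfolding P1_def by blast
  qed
  show "ideal_part I l \<subseteq> P1 ` F1 l"
  proof
    fix f assume f: "f \<in> ideal_part I l"
    then obtain u where u: "f = (\<Sum>c<n1. M1 c * u c)" using image by blast
    define u' where "u' c = (if c < n1 then hcomp (l - a1 c) (u c) else 0)" for c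
    have "f = hcomp l f" using f hcomp_id by force
    also have "\<dots> = (\<Sum>c<n1. M1 c * hcomp (l - a1 c) (u c))" unfolding u by (rule hcomp_sum_mult[OF hom(1)])
    also have "\<dots> = P1 u'" unfolding P1_def by (rule sum.cong) (simp_all add: u'_def)
    finally have "f = P1 u'" .
    moreover have "u' \<in> F1 l" unfolding F1_def prod_space_def u'_def using hcomp_in by auto
    ultimately show "f \<in> P1 ` F1 l" by blast
  qed
qed

lemma P1_kernel: "{u \<in> F1 l. P1 u = 0} = P2 ` F2 l"
proof
  show "P2 ` F2 l \<subseteq> {u \<in> F1 l. P1 u = 0}"
  proof
    fix x assume "x \<in> P2 ` F2 l"
    then obtain v where v: "v \<in> F2 l" "x = P2 v" by blast
    have "M2 r c * v c \<in> hom_part (l - a1 r)" if "r < n1" "c < n2" for r c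
      using v(1) hom(2)[OF that] that unfolding F2_def prod_space_def by (auto intro: hom_part_mult_le)
    then have "P2 v \<in> F1 l" unfolding P2_def F1_def prod_space_def by (auto intro!: hom_part_sum)
    moreover have "P1 (P2 v) = (\<Sum>r<n1. M1 r * (\<Sum>c<n2. M2 r c * v c))"
      unfolding P1_def P2_def by (rule sum.cong) auto
    ultimately show "x \<in> {u \<in> F1 l. P1 u = 0}" using v(2) complex1 by simp
  qed
  show "{u \<in> F1 l. P1 u = 0} \<subseteq> P2 ` F2 l"
  proof
    fix u assume u: "u \<in> {u \<in> F1 l. P1 u = 0}"
    then obtain v where v: "\<forall>r<n1. u r = (\<Sum>c<n2. M2 r c * v c)" using exact1 unfolding P1_def by blast
    define v' where "v' c = (if c < n2 then hcomp (l - a2 c) (v c) else 0)" for c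
    have "u r = P2 v' r" for r
    proof (cases "r < n1")
      case True
      then have "u r = hcomp (l - a1 r) (u r)" using u hcomp_id unfolding F1_def prod_space_def by force
      also have "\<dots> = (\<Sum>c<n2. M2 r c * hcomp (l - a1 r - (a2 c - a1 r)) (v c))"
        unfolding v[rule_format, OF True] by (rule hcomp_sum_mult[OF hom(2)[OF True]])
      also have "\<dots> = P2 v' r" unfolding P2_def using True by (auto simp: v'_def intro!: sum.cong)
      finally show ?thesis .
    next
      case False
      then show ?thesis using u unfolding P2_def F1_def prod_space_def by simp
    qed
    moreover have "v' \<in> F2 l" unfolding F2_def prod_space_def v'_def using hcomp_in by auto
    ultimately show "u \<in> P2 ` F2 l" by blast
  qed
qed

lemma P2_kernel: "{u \<in> F2 l. P2 u = 0} = P3 ` F3 l"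
proof
  show "P3 ` F3 l \<subseteq> {u \<in> F2 l. P2 u = 0}"
  proof
    fix x assume "x \<in> P3 ` F3 l"
    then obtain v where v: "v \<in> F3 l" "x = P3 v" by blast
    have "M3 r c * v c \<in> hom_part (l - a2 r)" if "r < n2" "c < n3" for r c
      using v(1) hom(3)[OF that] that unfolding F3_def prod_space_def by (auto intro: hom_part_mult_le)
    then have "P3 v \<in> F2 l" unfolding P3_def F2_def prod_space_def by (auto intro!: hom_part_sum)
    moreover have "P2 (P3 v) = 0"
    proof
     fix q show "P2 (P3 v) q = 0 q"
    proof (cases "q < n1")
      case True
      have "(\<Sum>r<n2. M2 q r * P3 v r) = (\<Sum>r<n2. M2 q r * (\<Sum>c<n3. M3 r c * v c))"
        unfolding P3_def by (rule sum.cong) auto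
      then show ?thesis using complex2[OF True] True unfolding P2_def by simp
    qed (simp add: P2_def)
    qed
    ultimately show "x \<in> {u \<in> F2 l. P2 u = 0}" using v(2) by simp
  qed
  show "{u \<in> F2 l. P2 u = 0} \<subseteq> P3 ` F3 l"
  proof
    fix u assume u: "u \<in> {u \<in> F2 l. P2 u = 0}"
    have "(\<Sum>c<n2. M2 r c * u c) = 0" if "r < n1" for r
    proof -
      have "P2 u r = 0" using u by simp
      then show ?thesis using that unfolding P2_def by simp
    qed
    then obtain v where v: "\<forall>r<n2. u r = (\<Sum>c<n3. M3 r c * v c)" using exact2 by blast
    define v' where "v' c = (if c < n3 then hcomp (l - a3 c) (v c) else 0)" for c
    have "u r = P3 v' r" for r
    proof (cases "r < n2")
      case True
      then have "u r = hcomp (l - a2 r) (u r)" using u hcomp_id unfolding F2_def prod_space_def by force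
      also have "\<dots> = (\<Sum>c<n3. M3 r c * hcomp (l - a2 r - (a3 c - a2 r)) (v c))"
        unfolding v[rule_format, OF True] by (rule hcomp_sum_mult[OF hom(3)[OF True]])
      also have "\<dots> = P3 v' r" unfolding P3_def using True by (auto simp: v'_def intro!: sum.cong)
      finally show ?thesis .
    next
      case False
      then show ?thesis using u unfolding P3_def F2_def prod_space_def by simp
    qed
    moreover have "v' \<in> F3 l" unfolding F3_def prod_space_def v'_def using hcomp_in by auto
    ultimately show "u \<in> P3 ` F3 l" by blast
  qed
qed

lemma P3_kernel: "{u \<in> F3 l. P3 u = 0} = {0}"
proof -
  have "u = 0" if u: "u \<in> F3 l" "P3 u = 0" for u
  proof
    fix c
    have "(\<Sum>c<n3. M3 r c * u c) = 0" if "r < n2" for r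
    proof -
      have "P3 u r = 0" using u by simp
      then show ?thesis using that unfolding P3_def by simp
    qed
    then have "u c = 0" if "c < n3" using exact3 that by blast
    then show "u c = 0 c" using u(1) unfolding F3_def prod_space_def by (cases "c < n3") auto
  qed
  moreover have "P3 0 = 0" unfolding P3_def by (auto simp: fun_eq_iff)
  ultimately show ?thesis using fs.subspace_0[OF F_space(3)] by blast
qed

lemma fdim_zero: "fdim {0} = 0"
  using fs.dim_le_card[of "{0}" "{}"] by simp

lemma euler: "kdim (ideal_part I l) = hilbert_free n1 a1 l - hilbert_free n2 a2 l + hilbert_free n3 a3 l"
proof -
  have "fdim (F1 l) = kdim (ideal_part I l) + fdim (P2 ` F2 l)"
    using fs_ks.rank_nullity(1)[OF linear_P(1) F_space(1,4), of l] unfolding P1_image P1_kernel by simp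
  moreover have "fdim (F2 l) = fdim (P2 ` F2 l) + fdim (P3 ` F3 l)"
    using fs_fs.rank_nullity(1)[OF linear_P(2) F_space(2,5), of l] unfolding P2_kernel by simp
  moreover have "fdim (F3 l) = fdim (P3 ` F3 l)"
    using fs_fs.rank_nullity(1)[OF linear_P(3) F_space(3,6), of l] fdim_zero unfolding P3_kernel by simp
  ultimately show ?thesis unfolding F_space(7-9) by linarith
qed

text \<open>Solved for \<open>F\<^sub>2\<close>, which is determined once \<open>F\<^sub>1\<close>,
  \<open>F\<^sub>3\<close> and the Hilbert function are known.\<close>

lemma betti_euler:
  "cnt n2 a2 l = cnt n1 a1 l + cnt n3 a3 l -
     (kdim (ideal_part I l) - 3 * kdim (ideal_part I (l - 1)) + 3 * kdim (ideal_part I (l - 2)) - kdim (ideal_part I (l - 3)))"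
  unfolding cnt_third_difference euler by (simp add: algebra_simps)

text \<open>Degree \<open>l\<close> of the maximal ideal times \<open>F\<^sub>1\<close>. The
  condition on the constant term has an effect only in the coordinates with \<open>a1 c = l\<close>,
  whose number is \<open>cnt n1 a1 l\<close>.\<close>

definition mF1 :: "int \<Rightarrow> (nat \<Rightarrow> 'k poly3) set" where
  "mF1 l = prod_space n1 (\<lambda>c. {f \<in> hom_part (l - a1 c). lk f 0 = 0})"

lemma subspace_max_part: "kspace.subspace {f \<in> hom_part d. lk f 0 = (0::'k)}"
  unfolding kspace.subspace_def by (auto simp: hom_part_add hom_part_scale lookup_add lookup_const3_mult)

lemma fin_dim_max_part: "ks.fin_dim {f \<in> hom_part d. lk f 0 = (0::'k)}"
  by (rule fin_dim_subset_hom_part) auto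

lemma dim_max_part: "kdim {f \<in> hom_part d. lk f 0 = (0::'k)} = dimR d - (if d = 0 then 1 else 0)"
proof (cases "d = 0")
  case True
  have "{f \<in> hom_part 0. lk f 0 = (0::'k)} = {0}"
  proof -
    have "f = 0" if "f \<in> hom_part 0" "lk f 0 = (0::'k)" for f using hom_part_0_const[OF that(1)] that(2) by simp
    then show ?thesis by auto
  qed
  then show ?thesis using True kspace.dim_le_card[of "{0 :: 'k poly3}" "{}"] by (simp add: dimR_def)
next
  case False
  have "{f \<in> hom_part d. lk f 0 = (0::'k)} = hom_part d"
    using False hom_partD[of _ d 0] by fastforce
  then show ?thesis using False by (simp add: dim_hom_part)
qed

lemma P1_mF1_image: "P1 ` mF1 l = mult_part (ideal_part I (l - 1))"
proof
  show "P1 ` mF1 l \<subseteq> mult_part (ideal_part I (l - 1))"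
  proof
    fix x assume "x \<in> P1 ` mF1 l"
    then obtain u where u: "u \<in> mF1 l" "x = P1 u" by blast
    then have "\<And>c. c < n1 \<Longrightarrow> u c \<in> hom_part (l - a1 c)" "\<And>c. c < n1 \<Longrightarrow> lk (u c) 0 = 0"
      unfolding mF1_def prod_space_def by auto
    then obtain U0 U1 U2 where U: "\<And>c. c < n1 \<Longrightarrow> U0 c \<in> hom_part (l - a1 c - 1)" "\<And>c. c < n1 \<Longrightarrow> U1 c \<in> hom_part (l - a1 c - 1)"
      "\<And>c. c < n1 \<Longrightarrow> U2 c \<in> hom_part (l - a1 c - 1)" "\<And>c. c < n1 \<Longrightarrow> u c = X 0 * U0 c + X 1 * U1 c + X 2 * U2 c"
      using decompose_entries[of n1 u "\<lambda>c. l - a1 c"] by blast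
    have "P1 u = (\<Sum>c<n1. M1 c * (X 0 * U0 c + X 1 * U1 c + X 2 * U2 c))"
      unfolding P1_def by (rule sum.cong) (use U(4) in auto)
    then have x: "x = X 0 * P1 U0 + X 1 * P1 U1 + X 2 * P1 U2" unfolding u(2) P1_def sum_X_expand .
    have "P1 U \<in> ideal_part I (l - 1)" if "\<And>c. c < n1 \<Longrightarrow> U c \<in> hom_part (l - a1 c - 1)" for U
    proof
      show "P1 U \<in> I" unfolding image P1_def by blast
      show "P1 U \<in> hom_part (l - 1)" unfolding P1_def using that by (auto intro!: hom_part_sum hom_part_mult_le[OF hom(1)])
    qed
    then show "x \<in> mult_part (ideal_part I (l - 1))" unfolding x mult_part_def using U(1-3) by blast
  qed
  show "mult_part (ideal_part I (l - 1)) \<subseteq> P1 ` mF1 l"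
  proof
    fix x assume "x \<in> mult_part (ideal_part I (l - 1))"
    then obtain g0 g1 g2 where g: "g0 \<in> P1 ` F1 (l - 1)" "g1 \<in> P1 ` F1 (l - 1)" "g2 \<in> P1 ` F1 (l - 1)" "x = X 0 * g0 + X 1 * g1 + X 2 * g2"
      unfolding mult_part_def P1_image by blast
    then obtain U0 U1 U2 where U: "U0 \<in> F1 (l - 1)" "U1 \<in> F1 (l - 1)" "U2 \<in> F1 (l - 1)" "g0 = P1 U0" "g1 = P1 U1" "g2 = P1 U2" by blast
    define u where "u c = X 0 * U0 c + X 1 * U1 c + X 2 * U2 c" for c
    have "x = P1 u" unfolding g(4) U(4-6) P1_def u_def sum_X_expand ..
    moreover have "X i * U c \<in> hom_part (l - a1 c)" if "U \<in> F1 (l - 1)" "c < n1" for i c U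
      using that hom_part_mult_le[OF hom_part_X, of "U c" "l - 1 - a1 c" "l - a1 c"] unfolding F1_def prod_space_def by auto
    then have "u \<in> mF1 l"
      unfolding mF1_def prod_space_def u_def using U(1-3)
      by (auto simp: lookup_add lookup_X_mult_0 F1_def prod_space_def intro!: hom_part_add)
    ultimately show "x \<in> P1 ` mF1 l" by blast
  qed
qed

lemma P1_mF1_kernel: "{u \<in> mF1 l. P1 u = 0} = {u \<in> F1 l. P1 u = 0}"
proof
  show "{u \<in> mF1 l. P1 u = 0} \<subseteq> {u \<in> F1 l. P1 u = 0}" unfolding mF1_def F1_def prod_space_def by auto
  show "{u \<in> F1 l. P1 u = 0} \<subseteq> {u \<in> mF1 l. P1 u = 0}"
  proof
    fix u assume u: "u \<in> {u \<in> F1 l. P1 u = 0}"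
    then obtain v where v: "\<forall>r<n1. u r = (\<Sum>c<n2. M2 r c * v c)" using exact1 unfolding P1_def by blast
    then have "lk (u r) 0 = 0" if "r < n1" for r
      using that minimal(2) by (simp add: lookup_sum lookup_0_mult)
    then show "u \<in> {u \<in> mF1 l. P1 u = 0}" using u unfolding mF1_def F1_def prod_space_def by auto
  qed
qed

lemma num_gens_eq: "num_gens I l = cnt n1 a1 l"
proof -
  have s: "fs.subspace (mF1 l)" "fs.fin_dim (mF1 l)"
    unfolding mF1_def by (simp_all add: subspace_prod_space subspace_max_part fin_dim_prod_space fin_dim_max_part)
  have "fdim (mF1 l) = (\<Sum>c<n1. dimR (l - a1 c) - (if l - a1 c = 0 then 1 else 0))"
    unfolding mF1_def dim_prod_space[OF subspace_max_part fin_dim_max_part] dim_max_part ..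
  also have "\<dots> = hilbert_free n1 a1 l - cnt n1 a1 l"
    unfolding hilbert_free_def cnt_def sum_subtractf[symmetric] by (rule sum.cong) auto
  finally show ?thesis
    using fs_ks.rank_nullity(1)[OF linear_P(1) F_space(1,4), of l] fs_ks.rank_nullity(1)[OF linear_P(1) s]
    unfolding P1_image P1_mF1_image P1_mF1_kernel num_gens_def F_space(7)[symmetric] by linarith
qed

end

section \<open>Translation between matrices and functions of indices\<close>

lemma mat_mult_vec: "D \<in> carrier_mat nr nc \<Longrightarrow> D *\<^sub>v vec nc u = vec nr (\<lambda>r. \<Sum>c<nc. D $$ (r, c) * u c)"
  by (rule eq_vecI) (auto simp: scalar_prod_def atLeast0LessThan intro!: sum.cong)

lemma vec_eq_iff': "vec n u = vec n v \<longleftrightarrow> (\<forall>r<n. u r = v r)"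
  by (auto simp: vec_eq_iff)

lemma carrier_vec_obtain:
  assumes "v \<in> carrier_vec n" obtains u where "v = vec n u"
  using that[of "\<lambda>i. v $ i"] assms by (auto simp: vec_eq_iff)

lemma mat_kernel_iff:
  assumes "D \<in> carrier_mat nr nc"
  shows "vec nc u \<in> mat_kernel D \<longleftrightarrow> (\<forall>r<nr. (\<Sum>c<nc. D $$ (r, c) * u c) = 0)"
proof -
  have "vec nc u \<in> mat_kernel D \<longleftrightarrow> D *\<^sub>v vec nc u = vec nr (\<lambda>_. 0)"
    using assms unfolding mat_kernel_def by (auto simp: zero_vec_def)
  then show ?thesis unfolding mat_mult_vec[OF assms] vec_eq_iff' .
qed

lemma mat_image_iff:
  assumes "D \<in> carrier_mat nr nc"
  shows "vec nr u \<in> mat_image D \<longleftrightarrow> (\<exists>v. \<forall>r<nr. u r = (\<Sum>c<nc. D $$ (r, c) * v c))"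
proof
  assume "vec nr u \<in> mat_image D"
  then obtain w where w: "w \<in> carrier_vec nc" "vec nr u = D *\<^sub>v w" using assms unfolding mat_image_def by auto
  obtain v where "w = vec nc v" using carrier_vec_obtain[OF w(1)] .
  then show "\<exists>v. \<forall>r<nr. u r = (\<Sum>c<nc. D $$ (r, c) * v c)"
    using w(2) mat_mult_vec[OF assms, of v] vec_eq_iff'[of nr u] by auto
next
  assume "\<exists>v. \<forall>r<nr. u r = (\<Sum>c<nc. D $$ (r, c) * v c)"
  then obtain v where "\<forall>r<nr. u r = (\<Sum>c<nc. D $$ (r, c) * v c)" by blast
  then have "vec nr u = D *\<^sub>v vec nc v" using mat_mult_vec[OF assms, of v] vec_eq_iff'[of nr u] by auto
  moreover have "vec nc v \<in> carrier_vec (dim_col D)" using assms by auto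
  ultimately show "vec nr u \<in> mat_image D" unfolding mat_image_def by blast
qed

lemma minimal_map_iff:
  assumes "D \<in> carrier_mat nr nc"
  shows "minimal_map D \<longleftrightarrow> (\<forall>r<nr. \<forall>c<nc. lk (D $$ (r, c)) 0 = 0)"
proof -
  have "elements_mat D = {D $$ (r, c) | r c. r < nr \<and> c < nc}"
  proof
    show "elements_mat D \<subseteq> {D $$ (r, c) | r c. r < nr \<and> c < nc}" using elements_matD[of _ D] assms by fastforce
    show "{D $$ (r, c) | r c. r < nr \<and> c < nc} \<subseteq> elements_mat D" using elements_matI[OF assms] by blast
  qed
  then have "minimal_map D \<longleftrightarrow> {D $$ (r, c) | r c. r < nr \<and> c < nc} \<subseteq> max_ideal" unfolding minimal_map_def by (rule arg_cong)
  moreover have "f \<in> max_ideal \<longleftrightarrow> lk f 0 = 0" for f :: "'a poly3"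
    using max_ideal_lookup_0 lookup_0_max_ideal by metis
  ultimately show ?thesis unfolding subset_eq by fastforce
qed

lemma minimal_free_resolution_imp_resolution:
  assumes homI: "homogeneous_ideal I" and R: "minimal_free_resolution I a1 a2 a3 D1 D2 D3"
  shows "resolution I (length a1) (length a2) (length a3) ((!) a1) ((!) a2) ((!) a3)
    (\<lambda>c. D1 $$ (0, c)) (\<lambda>r c. D2 $$ (r, c)) (\<lambda>r c. D3 $$ (r, c))"
proof -
  have D: "D1 \<in> carrier_mat 1 (length a1)" "D2 \<in> carrier_mat (length a1) (length a2)" "D3 \<in> carrier_mat (length a2) (length a3)"
    using R unfolding minimal_free_resolution_def graded_map_def by auto
  have im1: "mat_image D1 = {v \<in> carrier_vec 1. v $ 0 \<in> I}" and im2: "mat_image D2 = mat_kernel D1"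
    and im3: "mat_image D3 = mat_kernel D2" and k3: "mat_kernel D3 = {0\<^sub>v (length a3)}"
    using R unfolding minimal_free_resolution_def by auto
  have 1: "f \<in> I \<longleftrightarrow> (\<exists>u. f = (\<Sum>c<length a1. D1 $$ (0, c) * u c))" for f
  proof -
    have "f \<in> I \<longleftrightarrow> vec 1 (\<lambda>_. f) \<in> mat_image D1" unfolding im1 by simp
    then show ?thesis unfolding mat_image_iff[OF D(1)] by simp
  qed
  have 2: "(\<Sum>c<length a1. D1 $$ (0, c) * u c) = 0 \<longleftrightarrow> (\<exists>v. \<forall>r<length a1. u r = (\<Sum>c<length a2. D2 $$ (r, c) * v c))" for u
    using mat_kernel_iff[OF D(1), of u] mat_image_iff[OF D(2), of u] unfolding im2 by simp
  have 3: "(\<forall>r<length a1. (\<Sum>c<length a2. D2 $$ (r, c) * u c) = 0) \<longleftrightarrow> (\<exists>v. \<forall>r<length a2. u r = (\<Sum>c<length a3. D3 $$ (r, c) * v c))" for u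
    using mat_kernel_iff[OF D(2), of u] mat_image_iff[OF D(3), of u] unfolding im3 by simp
  have 4: "u c = 0" if "\<forall>r<length a2. (\<Sum>c<length a3. D3 $$ (r, c) * u c) = 0" "c < length a3" for u c
  proof -
    have "vec (length a3) u = 0\<^sub>v (length a3)" using mat_kernel_iff[OF D(3), of u] that(1) k3 by auto
    then have "vec (length a3) u $ c = 0\<^sub>v (length a3) $ c" by simp
    then show ?thesis using that(2) by simp
  qed
  show ?thesis
  proof
    show "\<And>c. c < length a1 \<Longrightarrow> D1 $$ (0, c) \<in> hom_part (a1 ! c)"
      "\<And>r c. r < length a1 \<Longrightarrow> c < length a2 \<Longrightarrow> D2 $$ (r, c) \<in> hom_part (a2 ! c - a1 ! r)"
      "\<And>r c. r < length a2 \<Longrightarrow> c < length a3 \<Longrightarrow> D3 $$ (r, c) \<in> hom_part (a3 ! c - a2 ! r)"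
      using R unfolding minimal_free_resolution_def graded_map_def by auto
    show "\<And>c. c < length a1 \<Longrightarrow> lk (D1 $$ (0, c)) 0 = 0"
      "\<And>r c. r < length a1 \<Longrightarrow> c < length a2 \<Longrightarrow> lk (D2 $$ (r, c)) 0 = 0"
      "\<And>r c. r < length a2 \<Longrightarrow> c < length a3 \<Longrightarrow> lk (D3 $$ (r, c)) 0 = 0"
      using R minimal_map_iff[OF D(1)] minimal_map_iff[OF D(2)] minimal_map_iff[OF D(3)]
      unfolding minimal_free_resolution_def by auto
    show "\<And>v. (\<Sum>r<length a1. D1 $$ (0, r) * (\<Sum>c<length a2. D2 $$ (r, c) * v c)) = 0" unfolding 2 by blast
    show "(\<Sum>r<length a2. D2 $$ (q, r) * (\<Sum>c<length a3. D3 $$ (r, c) * v c)) = 0" if q: "q < length a1" for q v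
    proof -
      have "\<forall>r<length a1. (\<Sum>c<length a2. D2 $$ (r, c) * (\<Sum>c'<length a3. D3 $$ (c, c') * v c')) = 0"
        unfolding 3 by (rule exI[of _ v]) simp
      then show ?thesis using q by blast
    qed
  qed (use 1 2 3 4 homI in blast)+
qed

lemma resolution_imp_minimal_free_resolution:
  assumes "resolution I n1 n2 n3 a1 a2 a3 M1 M2 M3"
  shows "minimal_free_resolution I (map a1 [0..<n1]) (map a2 [0..<n2]) (map a3 [0..<n3])
    (mat 1 n1 (\<lambda>(r, c). M1 c)) (mat n1 n2 (\<lambda>(r, c). M2 r c)) (mat n2 n3 (\<lambda>(r, c). M3 r c))"
proof -
  interpret resolution I n1 n2 n3 a1 a2 a3 M1 M2 M3 by fact
  let ?D1 = "mat 1 n1 (\<lambda>(r, c). M1 c)" and ?D2 = "mat n1 n2 (\<lambda>(r, c). M2 r c)" and ?D3 = "mat n2 n3 (\<lambda>(r, c). M3 r c)"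
  have D: "?D1 \<in> carrier_mat 1 n1" "?D2 \<in> carrier_mat n1 n2" "?D3 \<in> carrier_mat n2 n3" by auto
  have setI: "A = B" if "A \<subseteq> carrier_vec n" "B \<subseteq> carrier_vec n" "\<And>u. vec n u \<in> A \<longleftrightarrow> vec n u \<in> B" for A B :: "'a poly3 vec set" and n
    using that carrier_vec_obtain by (metis subsetD subsetI subset_antisym)
  have imc: "mat_image D \<subseteq> carrier_vec nr" if "D \<in> carrier_mat nr nc" for D :: "'a poly3 mat" and nr nc
    using that unfolding mat_image_def by auto
  have kc: "mat_kernel D \<subseteq> carrier_vec nc" if "D \<in> carrier_mat nr nc" for D :: "'a poly3 mat" and nr nc
    using that unfolding mat_kernel_def by auto
  have s1: "(\<Sum>c<n1. ?D1 $$ (0, c) * u c) = (\<Sum>c<n1. M1 c * u c)" for u by (rule sum.cong) auto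
  have s2: "(\<Sum>c<n2. ?D2 $$ (r, c) * u c) = (\<Sum>c<n2. M2 r c * u c)" if "r < n1" for u r by (rule sum.cong) (use that in auto)
  have s3: "(\<Sum>c<n3. ?D3 $$ (r, c) * u c) = (\<Sum>c<n3. M3 r c * u c)" if "r < n2" for u r by (rule sum.cong) (use that in auto)
  have e1: "mat_image ?D1 = {v \<in> carrier_vec 1. v $ 0 \<in> I}"
  proof (rule setI[of _ 1, OF imc[OF D(1)]])
    fix u
    have "vec 1 u \<in> mat_image ?D1 \<longleftrightarrow> u 0 \<in> I"
      unfolding mat_image_iff[OF D(1)] image by (simp add: s1[unfolded One_nat_def] del: index_mat)
    then show "vec 1 u \<in> mat_image ?D1 \<longleftrightarrow> vec 1 u \<in> {v \<in> carrier_vec 1. v $ 0 \<in> I}" by simp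
  qed auto
  have e2: "mat_image ?D2 = mat_kernel ?D1"
  proof (rule setI[of _ n1, OF imc[OF D(2)] kc[OF D(1)]])
    fix u
    have "(\<exists>v. \<forall>r<n1. u r = (\<Sum>c<n2. M2 r c * v c)) \<longleftrightarrow> (\<Sum>c<n1. M1 c * u c) = 0"
    proof
      assume "\<exists>v. \<forall>r<n1. u r = (\<Sum>c<n2. M2 r c * v c)"
      then obtain v where v: "\<forall>r<n1. u r = (\<Sum>c<n2. M2 r c * v c)" by blast
      have "(\<Sum>r<n1. M1 r * u r) = (\<Sum>r<n1. M1 r * (\<Sum>c<n2. M2 r c * v c))" by (rule sum.cong) (use v in auto)
      then show "(\<Sum>c<n1. M1 c * u c) = 0" using complex1 by simp
    qed (rule exact1)
    then show "vec n1 u \<in> mat_image ?D2 \<longleftrightarrow> vec n1 u \<in> mat_kernel ?D1"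
      unfolding mat_image_iff[OF D(2)] mat_kernel_iff[OF D(1)] by (simp add: s1[unfolded One_nat_def] s2 del: index_mat)
  qed
  have e3: "mat_image ?D3 = mat_kernel ?D2"
  proof (rule setI[of _ n2, OF imc[OF D(3)] kc[OF D(2)]])
    fix u
    have "(\<exists>v. \<forall>r<n2. u r = (\<Sum>c<n3. M3 r c * v c)) \<longleftrightarrow> (\<forall>r<n1. (\<Sum>c<n2. M2 r c * u c) = 0)"
    proof
      assume "\<exists>v. \<forall>r<n2. u r = (\<Sum>c<n3. M3 r c * v c)"
      then obtain v where v: "\<forall>r<n2. u r = (\<Sum>c<n3. M3 r c * v c)" by blast
      show "\<forall>q<n1. (\<Sum>c<n2. M2 q c * u c) = 0"
      proof (intro allI impI)
        fix q assume q: "q < n1"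
        have "(\<Sum>r<n2. M2 q r * u r) = (\<Sum>r<n2. M2 q r * (\<Sum>c<n3. M3 r c * v c))" by (rule sum.cong) (use v in auto)
        then show "(\<Sum>c<n2. M2 q c * u c) = 0" using complex2[OF q] by simp
      qed
    qed (use exact2 in blast)
    then show "vec n2 u \<in> mat_image ?D3 \<longleftrightarrow> vec n2 u \<in> mat_kernel ?D2"
      unfolding mat_image_iff[OF D(3)] mat_kernel_iff[OF D(2)] by (simp add: s2 s3 del: index_mat)
  qed
  have e4: "mat_kernel ?D3 = {0\<^sub>v n3}"
  proof (rule setI[of _ n3, OF kc[OF D(3)]])
    show "{0\<^sub>v n3} \<subseteq> carrier_vec n3" by auto
    fix u
    have "(\<forall>r<n2. (\<Sum>c<n3. M3 r c * u c) = 0) \<longleftrightarrow> (\<forall>c<n3. u c = 0)"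
    proof
      assume z: "\<forall>r<n2. (\<Sum>c<n3. M3 r c * u c) = 0"
      show "\<forall>c<n3. u c = 0"
      proof (intro allI impI)
        fix c assume "c < n3"
        show "u c = 0" by (rule exact3[OF _ \<open>c < n3\<close>]) (use z in blast)
      qed
    qed simp
    moreover have "vec n3 u \<in> {0\<^sub>v n3} \<longleftrightarrow> (\<forall>c<n3. u c = 0)" by (auto simp: vec_eq_iff)
    ultimately show "vec n3 u \<in> mat_kernel ?D3 \<longleftrightarrow> vec n3 u \<in> {0\<^sub>v n3}"
      unfolding mat_kernel_iff[OF D(3)] by (simp add: s3 del: index_mat)
  qed
  have m: "minimal_map ?D1" "minimal_map ?D2" "minimal_map ?D3"
    unfolding minimal_map_iff[OF D(1)] minimal_map_iff[OF D(2)] minimal_map_iff[OF D(3)] using minimal by auto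
  have g: "graded_map [0] (map a1 [0..<n1]) ?D1" "graded_map (map a1 [0..<n1]) (map a2 [0..<n2]) ?D2" "graded_map (map a2 [0..<n2]) (map a3 [0..<n3]) ?D3"
    unfolding graded_map_def using hom by auto
  show ?thesis
    unfolding minimal_free_resolution_def by (intro conjI g e1 e2 e3 m) (simp add: e4)
qed

lemma cnt_const:
  assumes "\<And>c. c < n \<Longrightarrow> a c = b"
  shows "cnt n a l = (if l = b then int n else 0)"
proof -
  have "cnt n a l = (\<Sum>c<n. if l = b then 1 else 0)" unfolding cnt_def using assms by (intro sum.cong) auto
  then show ?thesis by simp
qed

section \<open>Betti numbers of level ideals\<close>

context level_type2 begin

lemma hi_low: "d < 0 \<Longrightarrow> hi d = 0" "hi 0 = 1"
  unfolding hi_def by (simp_all add: ideal_part_low dimR_def)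

lemma hi_high: "d > int e \<Longrightarrow> hi d = 0"
proof -
  assume "d > int e"
  then have "ideal_part I d = hom_part d" using above by blast
  then show ?thesis unfolding hi_def by (simp add: dim_hom_part)
qed

text \<open>The socle element produced from basis element \<open>c\<close> has degree
  \<open>a3 c - 3\<close> and is not in \<open>I\<close>, so levelness forces that degree to be
  \<open>e\<close>.\<close>

lemma resolution_third_shift:
  assumes "resolution I n1 n2 n3 a1 a2 a3 M1 M2 M3" and "c < n3"
  shows "a3 c = int e + 3"
proof -
  interpret resolution I n1 n2 n3 a1 a2 a3 M1 M2 M3 by fact
  obtain s where s: "s \<in> hom_part (a3 c - 3)" "\<And>i. X i * s \<in> I" "s \<notin> I"
    using socle_of_third_syzygy[OF \<open>c < n3\<close>] by blast
  have "\<not> a3 c - 3 > int e" using s above by blast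
  moreover have nn: "a3 c - 3 \<ge> 0"
  proof (rule ccontr)
    assume "\<not> a3 c - 3 \<ge> 0"
    then have "s = 0" using s(1) by (simp add: hom_part_neg)
    then show False using s(3) ideal.subspace_0[OF ideal] by simp
  qed
  moreover have "\<not> nat (a3 c - 3) < e"
  proof
    assume "nat (a3 c - 3) < e"
    moreover have "s \<in> hom_part (int (nat (a3 c - 3)))" using s(1) nn by simp
    ultimately show False using socle_below s(2,3) by blast
  qed
  ultimately show ?thesis by linarith
qed

lemma resolution_second_shift:
  assumes "resolution I n1 n2 n3 a1 a2 a3 M1 M2 M3" and "r < n2"
  shows "a2 r \<le> int e + 2"
proof (rule ccontr)
  interpret resolution I n1 n2 n3 a1 a2 a3 M1 M2 M3 by fact
  assume "\<not> a2 r \<le> int e + 2"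
  then have "hom_part (a2 r - 2) \<subseteq> I" by (intro above) simp
  from second_syzygy_degree[OF \<open>r < n2\<close> this] show False .
qed

text \<open>Only the rank of \<open>F\<^sub>3\<close> is missing. In degree \<open>e + 3\<close>
  neither \<open>F\<^sub>1\<close> nor \<open>F\<^sub>2\<close> has a generator, so the Euler
  characteristic there reduces to \<open>cnt n3 a3 (int e + 3) = hi (int e)\<close>.\<close>

lemma resolution_counts:
  assumes "resolution I n1 n2 n3 a1 a2 a3 M1 M2 M3"
  shows "cnt n1 a1 l = num_gens I l"
    and "cnt n3 a3 l = (if l = int e + 3 then 2 else 0)"
    and "cnt n2 a2 l = num_gens I l + (if l = int e + 3 then 2 else 0) - (if l = 0 then 1 else 0)
           + (hi l - 3 * hi (l - 1) + 3 * hi (l - 2) - hi (l - 3))"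
proof -
  interpret resolution I n1 n2 n3 a1 a2 a3 M1 M2 M3 by fact
  show 1: "cnt n1 a1 l = num_gens I l" for l by (rule num_gens_eq[symmetric])
  have k: "kdim (ideal_part I l) = dimR l - hi l" for l unfolding hi_def by simp
  have 2: "cnt n2 a2 l = num_gens I l + cnt n3 a3 l - (if l = 0 then 1 else 0)
           + (hi l - 3 * hi (l - 1) + 3 * hi (l - 2) - hi (l - 3))" for l
  proof -
    have gen: "n + c - ((A - a) - 3 * (B - b) + 3 * (C - g) - (D - d)) = n + c - t + (a - 3 * b + 3 * g - d)"
      if "A - 3 * B + 3 * C - D = t" for n c A B C D a b g d t :: int
      unfolding that[symmetric] by (simp add: algebra_simps)
    show ?thesis unfolding betti_euler[of l] 1 k by (rule gen[OF dimR_third_difference])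
  qed
  have "cnt n2 a2 (int e + 3) = 0"
    unfolding cnt_eq_0_iff using resolution_second_shift[OF assms] by fastforce
  then have "cnt n3 a3 (int e + 3) = 2"
    using 2[of "int e + 3"] num_gens_high[of "int e + 3"] hi_high[of "int e + 3"] hi_high[of "int e + 3 - 1"] hi_high[of "int e + 3 - 2"] hi_e
    by simp
  then show 3: "cnt n3 a3 l = (if l = int e + 3 then 2 else 0)" for l
    using cnt_const[of n3 a3, OF resolution_third_shift[OF assms]] by (metis (full_types))
  show "cnt n2 a2 l = num_gens I l + (if l = int e + 3 then 2 else 0) - (if l = 0 then 1 else 0)
           + (hi l - 3 * hi (l - 1) + 3 * hi (l - 2) - hi (l - 3))"
    unfolding 2 3 ..
qed

end

lemma level_type2I:
  assumes "level_algebra I" and "h_vector I = h" and "3 \<le> e" and "length h = e + 1"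
    and "h ! (e - 1) = 3" and "h ! e = 2"
  shows "level_type2 I e" and "\<And>i. i \<le> e \<Longrightarrow> level_type2.hi I (int i) = int (h ! i)"
proof -
  have A: "artinian_algebra I" and soc: "\<And>i. i < socle_degree I \<Longrightarrow> socle_dim I i = 0"
    using assms(1) unfolding level_algebra_def by auto
  have I: "ideal.subspace I" using A homogeneous_ideal_subspace unfolding artinian_algebra_def by blast
  have sd: "socle_degree I = e" using assms(2,4) unfolding h_vector_def by auto
  have hilb: "hilb I i = h ! i" if "i \<le> e" for i
  proof -
    have "h ! i = map (hilb I) [0..<Suc e] ! i" using assms(2) unfolding h_vector_def sd by simp
    also have "\<dots> = hilb I i" using that by (simp del: upt_Suc)
    finally show ?thesis by simp
  qed
  show L: "level_type2 I e"
  proof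
    show "I \<inter> hom_part 1 = {0}" using A unfolding artinian_algebra_def by blast
    show "hom_part d \<subseteq> I" if d: "d > int e" for d
    proof -
      have "hilb I (nat d) = 0" using hilb_above_socle_degree[OF A, of "nat d"] d unfolding sd by linarith
      then show ?thesis using hilb_eq_0_iff[OF I, of "nat d"] d by simp
    qed
    show "f \<in> I" if "i < e" "f \<in> hom_part (int i)" "\<And>j. X j * f \<in> I" for i f
    proof -
      have "socle_dim I i = 0" using soc that(1) unfolding sd by blast
      then show ?thesis unfolding socle_dim_0_iff[OF I] using that(2,3) by blast
    qed
    show "kdim (ideal_part I (int e)) = dimR (int e) - 2"
      using int_hilb[OF I, of e] hilb[of e] assms(6) by simp
    have "int (e - 1) = int e - 1" using assms(3) by simp
    then show "kdim (ideal_part I (int e - 1)) = dimR (int e - 1) - 3"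
      using int_hilb[OF I, of "e - 1"] hilb[of "e - 1"] assms(5) by simp
  qed (use I assms(3) in auto)
  show "level_type2.hi I (int i) = int (h ! i)" if "i \<le> e" for i
    unfolding level_type2.hi_def[OF L] using int_hilb[OF I, of i] hilb[OF that] by simp
qed

lemma antitone_threshold:
  assumes "\<And>d. 1 \<le> d \<Longrightarrow> d < e \<Longrightarrow> P (Suc d) \<Longrightarrow> P d"
  shows "\<exists>p\<le>e. \<forall>d. 1 \<le> d \<and> d \<le> e \<longrightarrow> (P d \<longleftrightarrow> d \<le> (p::nat))"
  using assms
proof (induction e)
  case 0
  then show ?case by auto
next
  case (Suc e)
  have "\<exists>p\<le>e. \<forall>d. 1 \<le> d \<and> d \<le> e \<longrightarrow> (P d \<longleftrightarrow> d \<le> p)"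
    by (rule Suc.IH) (use Suc.prems in auto)
  then obtain p where p: "p \<le> e" "\<And>d. 1 \<le> d \<Longrightarrow> d \<le> e \<Longrightarrow> P d \<longleftrightarrow> d \<le> p" by blast
  show ?case
  proof (cases "P (Suc e)")
    case True
    have "e = 0 \<or> P e" using Suc.prems[of e] True by (cases e) auto
    then have "p = e" using p by (cases e) auto
    then have "\<forall>d. 1 \<le> d \<and> d \<le> Suc e \<longrightarrow> (P d \<longleftrightarrow> d \<le> Suc e)" using p True by (auto simp: le_Suc_eq)
    then show ?thesis by blast
  next
    case False
    then have "\<forall>d. 1 \<le> d \<and> d \<le> Suc e \<longrightarrow> (P d \<longleftrightarrow> d \<le> p)" using p by (auto simp: le_Suc_eq)
    then show ?thesis using p(1) by (intro exI[of _ p]) auto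
  qed
qed

text \<open>The increments decrease weakly from 1 to -1, so they are a block of 1, a block of 0 and
  a block of -1; \<open>p\<close> and \<open>q\<close> mark the ends of the first two.\<close>

lemma concave_sequence:
  fixes b :: "nat \<Rightarrow> int"
  assumes concave: "\<And>d. 1 \<le> d \<Longrightarrow> d < e \<Longrightarrow> b (Suc d) - b d \<le> b d - b (d - 1)"
    and b: "b 0 = 1" "b 1 = 2" "b e = 1" "b (e - 1) = 2" and e: "3 \<le> e"
  shows "\<exists>p\<ge>1. 2 * p \<le> e \<and> (\<forall>d\<le>e. b d = 1 + min (int d) (int p) - max 0 (int d - int (e - p)))"
proof -
  define g where "g d = b d - b (d - 1)" for d
  have g1: "g 1 = 1" and ge: "g e = -1" unfolding g_def using b by simp_all
  have mono: "g (Suc d) \<le> g d" if "1 \<le> d" "d < e" for d unfolding g_def using concave[OF that] by simp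
  have "\<exists>p\<le>e. \<forall>d. 1 \<le> d \<and> d \<le> e \<longrightarrow> (g d \<ge> 1 \<longleftrightarrow> d \<le> p)"
    by (rule antitone_threshold) (use mono in force)
  then obtain p where p: "p \<le> e" "\<And>d. 1 \<le> d \<Longrightarrow> d \<le> e \<Longrightarrow> g d \<ge> 1 \<longleftrightarrow> d \<le> p" by blast
  have "\<exists>q\<le>e. \<forall>d. 1 \<le> d \<and> d \<le> e \<longrightarrow> (g d \<ge> 0 \<longleftrightarrow> d \<le> q)"
    by (rule antitone_threshold) (use mono in force)
  then obtain q where q: "q \<le> e" "\<And>d. 1 \<le> d \<Longrightarrow> d \<le> e \<Longrightarrow> g d \<ge> 0 \<longleftrightarrow> d \<le> q" by blast
  have up: "g d \<le> 1" if "1 \<le> d" "d \<le> e" for d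
    using that
  proof (induction d rule: dec_induct)
    case base then show ?case using g1 by simp
  next
    case (step n) then show ?case using mono[of n] by simp
  qed
  have low: "g d \<ge> -1" if "1 \<le> d" "d \<le> e" for d
    using that(2,1)
  proof (induction d rule: inc_induct)
    case base then show ?case using ge by simp
  next
    case (step n) then show ?case using mono[of n] by simp
  qed
  have gd: "g d = (if d \<le> p then 1 else 0) - (if d \<le> q then 0 else 1)" if "1 \<le> d" "d \<le> e" for d
    using up[OF that] low[OF that] p(2)[OF that] q(2)[OF that] by auto
  have bd: "b d = 1 + min (int d) (int p) - max 0 (int d - int q)" if "d \<le> e" for d
    using that
  proof (induction d)
    case 0 then show ?case using b by simp
  next
    case (Suc d)
    have "b (Suc d) = b d + g (Suc d)" unfolding g_def by simp
    then show ?case using Suc gd[of "Suc d"] by auto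
  qed
  have p1: "1 \<le> p" using p(2)[of 1] g1 e by simp
  \<comment> \<open>Since \<open>b\<close> returns to its initial value 1, there are as many steps
    down as up.\<close>
  have qe: "q = e - p" using bd[of e] b(3) p(1) q(1) by auto
  have "p \<le> q" using p1 p q by force
  then have "2 * p \<le> e" using qe p(1) by simp
  then show ?thesis using p1 bd unfolding qe by blast
qed

lemma count_eq_mset_eq:
  assumes "\<And>l. int (count A l) = int (count B l)"
  shows "A = B"
  using assms by (intro multiset_eqI) simp

section \<open>The possible Hilbert functions and generator degrees\<close>

context level_type2 begin

text \<open>Concavity comes from \<open>factor_hilb 2 \<le> 3\<close> in degree 2 and from
  \<open>num_gens_nonneg\<close> afterwards. The trapezoid has its bends at \<open>p\<close> and
  \<open>e - p\<close>, and the second difference sees them one degree later; for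
  \<open>p = 1\<close> the bend in degree 2 shows up as a third quadric.\<close>

lemma common_factor_shape:
  assumes common_factor_case
  shows "\<exists>p\<ge>1. 2 * p \<le> e \<and>
    (\<forall>d. 1 \<le> d \<longrightarrow> d \<le> e \<longrightarrow> hi (int d) = 2 + min (int d) (int p) - max 0 (int d - int (e - p))) \<and>
    (\<forall>l. num_gens I l = int (count {#2, 2, int p + 1, int (e - p) + 1, int e + 1#} l))"
proof -
  note num = common_factor_numbers[OF assms]
  have b: "factor_hilb 0 = 1" "factor_hilb 1 = 2" "factor_hilb (int e) = 1" "factor_hilb (int e - 1) = 2"
    unfolding factor_hilb_def using hi_1 hi_e e3 by auto
  have concave: "factor_hilb d - factor_hilb (d - 1) \<le> factor_hilb (d - 1) - factor_hilb (d - 2)" if d: "2 \<le> d" "d \<le> int e" for d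
  proof (cases "d = 2")
    case True
    then show ?thesis using num(2) b by simp
  next
    case False
    then show ?thesis using num(1)[of d] num_gens_nonneg[of d] d by simp
  qed
  have "\<exists>p\<ge>1. 2 * p \<le> e \<and> (\<forall>d\<le>e. factor_hilb (int d) = 1 + min (int d) (int p) - max 0 (int d - int (e - p)))"
  proof (rule concave_sequence[of e "\<lambda>d. factor_hilb (int d)"])
    show "factor_hilb (int (Suc d)) - factor_hilb (int d) \<le> factor_hilb (int d) - factor_hilb (int (d - 1))" if "1 \<le> d" "d < e" for d
      using concave[of "int d + 1"] that by (simp add: of_nat_diff add.commute)
    show "factor_hilb (int (e - 1)) = 2" using b(4) e3 by (simp add: of_nat_diff)
  qed (use b e3 in auto)
  then obtain p where p: "1 \<le> p" "2 * p \<le> e"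
    "\<And>d. d \<le> e \<Longrightarrow> factor_hilb (int d) = 1 + min (int d) (int p) - max 0 (int d - int (e - p))" by blast
  have bi: "factor_hilb d = 1 + min d (int p) - max 0 (d - (int e - int p))" if "0 \<le> d" "d \<le> int e" for d
    using p(3)[of "nat d"] p(2) that by (simp add: of_nat_diff)
  have "num_gens I l = int (count {#2, 2, int p + 1, int (e - p) + 1, int e + 1#} l)" for l
  proof -
    have ep: "int (e - p) = int e - int p" using p(2) by simp
    consider "l \<le> 1" | "l = 2" | "3 \<le> l" "l \<le> int e" | "l = int e + 1" | "l \<ge> int e + 2" by linarith
    then show ?thesis
    proof cases
      case 1
      then show ?thesis using num_gens_low[OF 1] p e3 by auto
    next
      case 2
      have "hi 2 = factor_hilb 2 + 1" unfolding factor_hilb_def by simp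
      also have "\<dots> = 2 + min 2 (int p) - max 0 (2 - (int e - int p))" using bi[of 2] e3 by simp
      finally show ?thesis using num_gens_2 2 p e3 unfolding ep by auto
    next
      case 3
      have "num_gens I l = - (factor_hilb l - 2 * factor_hilb (l - 1) + factor_hilb (l - 2))" by (rule num(1)[OF 3])
      also have "\<dots> = (if l = int p + 1 then 1 else 0) + (if l = int e - int p + 1 then 1 else 0)"
        using bi[of l] bi[of "l - 1"] bi[of "l - 2"] 3 p by (auto simp: min_def max_def)
      also have "\<dots> = int (count {#2, 2, int p + 1, int (e - p) + 1, int e + 1#} l)"
        unfolding ep using 3 by auto
      finally show ?thesis .
    next
      case 4
      then show ?thesis using num(3) p e3 unfolding ep by auto
    next
      case 5
      then show ?thesis using num_gens_high[OF 5] p e3 unfolding ep by auto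
    qed
  qed
  moreover have "hi (int d) = 2 + min (int d) (int p) - max 0 (int d - int (e - p))" if "1 \<le> d" "d \<le> e" for d
    using p(3)[OF that(2)] that(1) unfolding factor_hilb_def by simp
  ultimately show ?thesis using p(1,2) by blast
qed

lemma three_quadrics_shape:
  assumes three_quadrics_case
  shows "(\<forall>d. 1 \<le> d \<longrightarrow> d \<le> e - 1 \<longrightarrow> hi (int d) = 3) \<and>
    (\<exists>\<gamma>\<in>{0, 1}. \<forall>l. num_gens I l = int (count ({#2, 2, 2, int e#} + replicate_mset \<gamma> (int e + 1)) l))"
proof -
  note num = three_quadrics_numbers[OF assms]
  define \<gamma> where "\<gamma> = nat (num_gens I (int e + 1))"
  have \<gamma>: "num_gens I (int e + 1) = int \<gamma>" "\<gamma> \<in> {0, 1}"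
    using num_gens_nonneg[of "int e + 1"] num_gens_e1_le unfolding \<gamma>_def by auto
  have h2: "hi 2 = 3" using num(1)[of 2] e3 by simp
  have "num_gens I l = int (count ({#2, 2, 2, int e#} + replicate_mset \<gamma> (int e + 1)) l)" for l
  proof -
    consider "l \<le> 1" | "l = 2" | "3 \<le> l" "l \<le> int e - 1" | "l = int e" | "l = int e + 1" | "l \<ge> int e + 2" by linarith
    then show ?thesis
    proof cases
      case 1
      then show ?thesis using num_gens_low[OF 1] e3 by auto
    next
      case 2
      then show ?thesis using num_gens_2 h2 e3 by auto
    next
      case 3
      then show ?thesis using num(2)[OF 3] by auto
    next
      case 4
      then show ?thesis using num(3) e3 by auto
    next
      case 5
      then show ?thesis using \<gamma>(1) e3 by auto
    next
      case 6
      then show ?thesis using num_gens_high[OF 6] e3 by auto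
    qed
  qed
  moreover have "hi (int d) = 3" if "1 \<le> d" "d \<le> e - 1" for d
    using num(1)[of "int d"] that by simp
  ultimately show ?thesis using \<gamma>(2) by blast
qed

definition mid :: int where "mid = hi (int (e div 2))"

text \<open>The three quadrics case is excluded because it gives 3 in the middle. As
  \<open>p \<le> e div 2 \<le> e - p\<close>, the middle degree lies on the plateau, so
  \<open>mid = p + 2\<close>, and the bends become \<open>mid - 1\<close> and
  \<open>e - mid + 3\<close>.\<close>

lemma shape_large:
  assumes "mid > 3"
  shows "\<exists>p\<ge>1. 2 * p \<le> e \<and> mid = int p + 2"
    and "\<And>d. 1 \<le> d \<Longrightarrow> d \<le> e \<Longrightarrow> hi (int d) = 2 + min (int d) (mid - 2) - max 0 (int d - (int e - (mid - 2)))"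
    and "\<And>l. num_gens I l = int (count {#2, 2, mid - 1, int e - mid + 3, int e + 1#} l)"
proof -
  have m: "1 \<le> e div 2" "e div 2 \<le> e - 1" using e3 by auto
  have "\<not> three_quadrics_case"
  proof
    assume three_quadrics_case
    then have "mid = 3" unfolding mid_def using three_quadrics_shape m by simp
    then show False using assms by simp
  qed
  then have common_factor_case using dichotomy by blast
  then obtain p where p: "1 \<le> p" "2 * p \<le> e"
    "\<And>d. 1 \<le> d \<Longrightarrow> d \<le> e \<Longrightarrow> hi (int d) = 2 + min (int d) (int p) - max 0 (int d - int (e - p))"
    "\<And>l. num_gens I l = int (count {#2, 2, int p + 1, int (e - p) + 1, int e + 1#} l)"
    using common_factor_shape by blast
  have "p \<le> e div 2" "e div 2 \<le> e - p" "e div 2 \<le> e" using p(2) by auto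
  then have mid_eq: "mid = int p + 2" unfolding mid_def using p(3)[OF m(1)] by simp
  show "\<exists>p\<ge>1. 2 * p \<le> e \<and> mid = int p + 2" using p mid_eq by blast
  show "hi (int d) = 2 + min (int d) (mid - 2) - max 0 (int d - (int e - (mid - 2)))" if "1 \<le> d" "d \<le> e" for d
    using p(3)[OF that] p(2) unfolding mid_eq by (simp add: of_nat_diff)
  show "num_gens I l = int (count {#2, 2, mid - 1, int e - mid + 3, int e + 1#} l)" for l
  proof -
    have "mid - 1 = int p + 1" "int e - mid + 3 = int (e - p) + 1" using mid_eq p(2) by auto
    then show ?thesis using p(4)[of l] by (simp only:)
  qed
qed

text \<open>Both cases occur here. In the common factor case \<open>p = 1\<close>, the generator of
  degree \<open>p + 1\<close> is a quadric, that of degree \<open>e - p + 1\<close> has degree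
  \<open>e\<close>, and \<open>\<gamma> = 1\<close>.\<close>

lemma shape_small:
  assumes "mid \<le> 3"
  shows "\<And>d. 1 \<le> d \<Longrightarrow> d \<le> e - 1 \<Longrightarrow> hi (int d) = 3"
    and "\<exists>\<gamma>\<in>{0, 1}. \<forall>l. num_gens I l = int (count ({#2, 2, 2, int e#} + replicate_mset \<gamma> (int e + 1)) l)"
proof -
  have m: "1 \<le> e div 2" "e div 2 \<le> e - 1" using e3 by auto
  have "(\<forall>d. 1 \<le> d \<longrightarrow> d \<le> e - 1 \<longrightarrow> hi (int d) = 3) \<and>
    (\<exists>\<gamma>\<in>{0, 1}. \<forall>l. num_gens I l = int (count ({#2, 2, 2, int e#} + replicate_mset \<gamma> (int e + 1)) l))"
    using dichotomy
  proof
    assume three_quadrics_case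
    then show ?thesis by (rule three_quadrics_shape)
  next
    assume common_factor_case
    then obtain p where p: "1 \<le> p" "2 * p \<le> e"
      "\<And>d. 1 \<le> d \<Longrightarrow> d \<le> e \<Longrightarrow> hi (int d) = 2 + min (int d) (int p) - max 0 (int d - int (e - p))"
      "\<And>l. num_gens I l = int (count {#2, 2, int p + 1, int (e - p) + 1, int e + 1#} l)"
      using common_factor_shape by blast
    have "p \<le> e div 2" "e div 2 \<le> e - p" "e div 2 \<le> e" using p(2) by auto
    then have "mid = int p + 2" unfolding mid_def using p(3)[OF m(1)] by simp
    then have p1: "p = 1" using assms p(1) by simp
    have "num_gens I l = int (count ({#2, 2, 2, int e#} + replicate_mset 1 (int e + 1)) l)" for l
      using p(4)[of l] e3 unfolding p1 by (simp add: of_nat_diff)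
    moreover have "hi (int d) = 3" if "1 \<le> d" "d \<le> e - 1" for d
      using p(3)[of d] that unfolding p1 by (auto simp: of_nat_diff)
    ultimately show ?thesis by blast
  qed
  then show "\<And>d. 1 \<le> d \<Longrightarrow> d \<le> e - 1 \<Longrightarrow> hi (int d) = 3"
    "\<exists>\<gamma>\<in>{0, 1}. \<forall>l. num_gens I l = int (count ({#2, 2, 2, int e#} + replicate_mset \<gamma> (int e + 1)) l)" by blast+
qed

end

section \<open>Monomial ideals\<close>

text \<open>The ideal is given by the predicate of belonging to it on monomials, so membership of a
  polynomial is tested on its support; \<open>monomial_ideal\<close> supplies closure under
  multiplication.\<close>

definition monideal :: "(expo \<Rightarrow> bool) \<Rightarrow> 'k::field_char_0 poly3 set" where
  "monideal P = {f. \<forall>m. lk f m \<noteq> 0 \<longrightarrow> P m}"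

locale monomial_ideal =
  fixes P :: "expo \<Rightarrow> bool"
  assumes up: "P m \<Longrightarrow> P (n + m)"
begin

lemma subspace: "ideal.subspace (monideal P :: 'k::field_char_0 poly3 set)"
  unfolding ideal.subspace_def
proof (intro conjI ballI allI)
  show "0 \<in> monideal P" by (simp add: monideal_def)
next
  fix f g :: "'k poly3" assume fg: "f \<in> monideal P" "g \<in> monideal P"
  have "P m" if "lk (f + g) m \<noteq> 0" for m
  proof -
    have "lk f m \<noteq> 0 \<or> lk g m \<noteq> 0" using that by (auto simp: lookup_add)
    then show ?thesis using fg unfolding monideal_def by blast
  qed
  then show "f + g \<in> monideal P" unfolding monideal_def by simp
next
  fix f g :: "'k poly3" assume f: "f \<in> monideal P"
  have "P m" if "lk (g * f) m \<noteq> 0" for m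
  proof -
    have "m \<in> Poly_Mapping.keys (g * f)" using that by (simp add: in_keys_iff)
    then obtain a b where ab: "m = a + b" "b \<in> Poly_Mapping.keys f" using keys_mult by blast
    then show ?thesis using f up unfolding monideal_def by (simp add: in_keys_iff)
  qed
  then show "g * f \<in> monideal P" unfolding monideal_def by simp
qed

lemma mono_in_iff: "(mon m :: 'k::field_char_0 poly3) \<in> monideal P \<longleftrightarrow> P m"
  unfolding monideal_def by (auto simp: lookup_mono)

lemma span: "(monideal P :: 'k::field_char_0 poly3 set) = ideal.span (mon ` Collect P)"
proof
  show "ideal.span (mon ` Collect P) \<subseteq> (monideal P :: 'k poly3 set)"
    by (rule ideal.span_minimal[OF _ subspace]) (auto simp: mono_in_iff)
  show "(monideal P :: 'k poly3 set) \<subseteq> ideal.span (mon ` Collect P)"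
  proof
    fix f :: "'k poly3" assume f: "f \<in> monideal P"
    have "(\<Sum>m\<in>Poly_Mapping.keys f. const3 (lk f m) * mon m) \<in> ideal.span (mon ` Collect P)"
    proof (intro ideal.span_sum ideal.span_scale ideal.span_base imageI)
      fix m assume "m \<in> Poly_Mapping.keys f"
      then show "m \<in> Collect P" using f unfolding monideal_def by (simp add: in_keys_iff)
    qed
    moreover have "(\<Sum>m\<in>Poly_Mapping.keys f. const3 (lk f m) * mon m) = f"
      by (rule expand_monset) (simp_all add: in_keys_iff)
    ultimately show "f \<in> ideal.span (mon ` Collect P)" by simp
  qed
qed

lemma homogeneous: "homogeneous_ideal (monideal P :: 'k::field_char_0 poly3 set)"
  unfolding homogeneous_ideal_def
proof (intro exI conjI)
  show "mon ` Collect P \<subseteq> (\<Union>d. hom_part d :: 'k poly3 set)" using hom_part_mono by blast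
qed (rule span)

lemma generated:
  assumes "\<And>c. c < (n::nat) \<Longrightarrow> M c = mon (g c)" "\<And>m. P m \<longleftrightarrow> (\<exists>c<n. \<exists>k. m = g c + k)"
  shows "(f :: 'k::field_char_0 poly3) \<in> monideal P \<longleftrightarrow> (\<exists>u. f = (\<Sum>c<n. M c * u c))"
proof
  assume "f \<in> monideal P"
  then have "f \<in> ideal.span (mon ` Collect P)" by (simp add: span)
  then show "\<exists>u. f = (\<Sum>c<n. M c * u c)"
  proof (induction rule: ideal.span_induct_alt)
    case base
    show ?case by (rule exI[of _ "\<lambda>_. 0"]) simp
  next
    case (step h x y)
    obtain m where m: "x = mon m" "P m" using step(1) by blast
    then obtain c k where c: "c < n" "m = g c + k" using assms(2) by blast
    obtain u where u: "y = (\<Sum>c<n. M c * u c)" using step.IH by blast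
    have "(\<Sum>i<n. M i * ((if i = c then h * mon k else 0) + u i)) = (\<Sum>i<n. if i = c then M i * (h * mon k) else 0) + y"
      unfolding u sum.distrib[symmetric] by (rule sum.cong) (auto simp: distrib_left)
    also have "(\<Sum>i<n. if i = c then M i * (h * mon k) else 0) = M c * (h * mon k)" using c(1) by (simp add: sum.delta)
    also have "\<dots> = h * x" unfolding m(1) c(2) mono_add assms(1)[OF c(1)] by (simp only: mult.left_commute mult.commute)
    finally show ?case by (intro exI[of _ "\<lambda>i. (if i = c then h * mon k else 0) + u i"]) (rule sym)
  qed
next
  assume "\<exists>u. f = (\<Sum>c<n. M c * u c)"
  then obtain u where u: "f = (\<Sum>c<n. M c * u c)" by blast
  have "M c * u c \<in> monideal P" if "c < n" for c
  proof -
    have "P (g c)" using assms(2) that by (metis add.right_neutral)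
    then have "M c \<in> monideal P" unfolding assms(1)[OF that] mono_in_iff .
    then show ?thesis using ideal_mult[OF subspace, of "M c" "u c"] by (simp add: mult.commute)
  qed
  then show "f \<in> monideal P" unfolding u by (intro ideal.subspace_sum[OF subspace]) auto
qed

lemma hom_part_subset:
  assumes "\<And>m. mdeg m = d \<Longrightarrow> P m"
  shows "hom_part (int d) \<subseteq> monideal P"
  using assms hom_partD unfolding monideal_def by fastforce

lemma hilb: "hilb (monideal P :: 'k::field_char_0 poly3 set) d = card {m \<in> monset d. \<not> P m}"
proof -
  let ?V = "hom_part (int d) :: 'k poly3 set" and ?I = "monideal P :: 'k poly3 set"
  let ?S = "{m \<in> monset d. \<not> P m}"
  let ?B = "mon ` ?S :: 'k poly3 set"
  have fS: "finite ?S" using finite_monset by simp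
  have W: "kspace.subspace (ideal_part ?I (int d))" by (rule subspace_ideal_part[OF subspace])
  have "quot_basis ?V (ideal_part ?I (int d)) ?B"
    unfolding quot_basis_def
  proof (intro conjI allI impI ballI)
    show "?B \<subseteq> ?V" using hom_part_mono[where 'a = 'k] by (auto simp: monset_def)
    show "?V \<subseteq> kspace.span (?B \<union> ideal_part ?I (int d))"
    proof
      fix f assume f: "f \<in> ?V"
      have "(\<Sum>m\<in>monset d. const3 (lk f m) * mon m) = f"
      proof (rule expand_monset[OF finite_monset])
        fix m assume "lk f m \<noteq> 0"
        then have "int (mdeg m) = int d" by (rule hom_partD[OF f])
        then show "m \<in> monset d" by (simp add: monset_def)
      qed
      moreover have "(\<Sum>m\<in>monset d. const3 (lk f m) * mon m) \<in> kspace.span (?B \<union> ideal_part ?I (int d))"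
      proof (intro kspace.span_sum kspace.span_scale kspace.span_base)
        fix m assume m: "m \<in> monset d"
        then have "(mon m :: 'k poly3) \<in> ?V" using hom_part_mono[of m] by (simp add: monset_def)
        then show "mon m \<in> ?B \<union> ideal_part ?I (int d)" using m mono_in_iff[of m] by auto
      qed
      ultimately show "f \<in> kspace.span (?B \<union> ideal_part ?I (int d))" by simp
    qed
    fix c :: "'k poly3 \<Rightarrow> 'k" and b
    assume c: "(\<Sum>b\<in>?B. const3 (c b) * b) \<in> ideal_part ?I (int d)" and "b \<in> ?B"
    then obtain m where m: "b = mon m" "m \<in> ?S" by blast
    have inj: "inj_on (mon :: expo \<Rightarrow> 'k poly3) ?S" using inj_mono inj_on_subset by blast
    have "lk (\<Sum>b\<in>?B. const3 (c b) * b) m = (\<Sum>n\<in>?S. if n = m then c (mon n) else 0)"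
      unfolding sum.reindex[OF inj] lookup_sum o_def by (rule sum.cong) (auto simp: lookup_const3_mult lookup_mono)
    also have "\<dots> = c b" using m fS by simp
    finally have "lk (\<Sum>b\<in>?B. const3 (c b) * b) m = c b" .
    moreover have "lk (\<Sum>b\<in>?B. const3 (c b) * b) m = 0"
    proof (rule ccontr)
      assume "lk (\<Sum>b\<in>?B. const3 (c b) * b) m \<noteq> 0"
      then have "P m" using IntD1[OF c] unfolding monideal_def by blast
      then show False using m(2) by simp
    qed
    ultimately show "c b = 0" by simp
  qed
  then have "card ?B + kspace.dim (ideal_part ?I (int d)) = kspace.dim ?V"
    using quot_basis_card[OF subspace_hom_part fin_dim_hom_part W] fS by blast
  moreover have "card ?B = card ?S" using card_image[of mon ?S] inj_on_subset[OF inj_mono] by blast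
  moreover have "kdim ?V = dimR (int d)" by (rule dim_hom_part)
  moreover have "int (hilb ?I d) = dimR (int d) - kdim (ideal_part ?I (int d))" by (rule int_hilb[OF subspace])
  ultimately show ?thesis by linarith
qed

text \<open>All ideals of the chain contain the monomials of degree above \<open>e\<close>, so each
  is determined by its intersection with the finite-dimensional span \<open>V\<close> of the
  others.\<close>

lemma artinian:
  assumes high: "\<And>m. mdeg m > e \<Longrightarrow> P m"
  shows "artinian_quotient (monideal P :: 'k::field_char_0 poly3 set)"
  unfolding artinian_quotient_def
proof (intro allI impI)
  fix J :: "nat \<Rightarrow> 'k poly3 set"
  assume J: "\<forall>n. ideal.subspace (J n) \<and> monideal P \<subseteq> J n \<and> J (Suc n) \<subseteq> J n"
  define V where "V = kspace.span (mon ` (\<Union>d\<le>e. monset d) :: 'k poly3 set)"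
  have fV: "ks.fin_dim V" unfolding V_def by (rule ks.fin_dimI[of "mon ` (\<Union>d\<le>e. monset d)"]) (auto simp: finite_monset)
  have sV: "kspace.subspace V" unfolding V_def by (rule kspace.subspace_span)
  have sJ: "kspace.subspace (J n \<inter> V)" for n
    using J ideal_kspace_subspace sV by (intro kspace.subspace_inter) auto
  have fJ: "ks.fin_dim (J n \<inter> V)" for n by (rule ks.fin_dim_subset[OF fV]) auto
  have anti: "J n \<subseteq> J m" if "m \<le> n" for m n
    using lift_Suc_antimono_le[of J] J that by blast
  \<comment> \<open>From an index of minimal dimension on, the intersections with \<open>V\<close>
    cannot shrink any further.\<close>
  define N where "N = (ARG_MIN (\<lambda>n. kspace.dim (J n \<inter> V)) n. True)"
  have N: "kspace.dim (J N \<inter> V) \<le> kspace.dim (J n \<inter> V)" for n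
    unfolding N_def by (rule arg_min_nat_le) simp
  have dec: "\<exists>g\<in>V. f - g \<in> monideal P" for f :: "'k poly3"
  proof
    let ?g = "restr (\<lambda>m. mdeg m \<le> e) f"
    have "finite (\<Union>d\<le>e. monset d)" by (simp add: finite_monset)
    then have "(\<Sum>m\<in>(\<Union>d\<le>e. monset d). const3 (lk ?g m) * mon m) = ?g"
      by (rule expand_monset) (auto simp: lookup_restr monset_def split: if_splits)
    moreover have "(\<Sum>m\<in>(\<Union>d\<le>e. monset d). const3 (lk ?g m) * mon m) \<in> V"
      unfolding V_def by (intro kspace.span_sum kspace.span_scale kspace.span_base imageI)
    ultimately show "?g \<in> V" by simp
    have "P m" if "lk (f - ?g) m \<noteq> 0" for m
      using that high[of m] by (auto simp: lookup_minus lookup_restr split: if_splits)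
    then show "f - ?g \<in> monideal P" unfolding monideal_def by simp
  qed
  have "J n = J N" if "n \<ge> N" for n
  proof
    show "J n \<subseteq> J N" by (rule anti[OF that])
    have "J n \<inter> V = J N \<inter> V"
      by (rule ks.subspace_eqI_dim[OF sJ fJ sJ]) (use anti[OF that] N in auto)
    then have JV: "g \<in> J n" if "g \<in> J N" "g \<in> V" for g using that by blast
    show "J N \<subseteq> J n"
    proof
      fix f assume f: "f \<in> J N"
      obtain g where g: "g \<in> V" "f - g \<in> monideal P" using dec by blast
      have S: "ideal.subspace (J N)" "ideal.subspace (J n)" "f - g \<in> J N" "f - g \<in> J n" using J g(2) by blast+
      have "f - (f - g) \<in> J N" by (rule ideal.subspace_diff[OF S(1) f S(3)])
      then have "g \<in> J n" using JV g(1) by simp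
      then have "f - g + g \<in> J n" by (rule ideal.subspace_add[OF S(2,4)])
      then show "f \<in> J n" by simp
    qed
  qed
  then show "\<exists>N. \<forall>n\<ge>N. J n = J N" by blast
qed

lemma level:
  assumes high: "\<And>m. mdeg m > e \<Longrightarrow> P m" and low: "\<And>m. mdeg m = 1 \<Longrightarrow> \<not> P m"
    and soc: "\<And>m. mdeg m < e \<Longrightarrow> (\<And>i. P (Poly_Mapping.single i 1 + m)) \<Longrightarrow> P m"
    and top: "mdeg m0 = e" "\<not> P m0"
  shows "level_algebra (monideal P :: 'k::field_char_0 poly3 set)"
    and "h_vector (monideal P :: 'k::field_char_0 poly3 set) = map (\<lambda>d. card {m \<in> monset d. \<not> P m}) [0..<Suc e]"
proof -
  let ?I = "monideal P :: 'k poly3 set"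
  have "f = 0" if f: "f \<in> ?I" "f \<in> hom_part 1" for f
  proof (rule poly_mapping_eqI)
    fix m
    have "mdeg m = 1 \<and> P m" if "lk f m \<noteq> 0" using f(1) hom_partD[OF f(2) that] that unfolding monideal_def by simp
    then show "lk f m = lk 0 m" using low by auto
  qed
  then have "?I \<inter> hom_part 1 = {0}" using ideal.subspace_0[OF subspace] by auto
  then have A: "artinian_algebra ?I" unfolding artinian_algebra_def using homogeneous artinian[OF high] by blast
  have h0: "hilb ?I i = 0" if "i > e" for i
    unfolding hilb_eq_0_iff[OF subspace] by (rule hom_part_subset) (use high that in auto)
  have he: "hilb ?I e > 0"
    unfolding hilb card_gt_0_iff using top finite_monset by (auto simp: monset_def)
  have sd: "socle_degree ?I = e"
    unfolding socle_degree_def using he h0 by (intro Greatest_equality) (auto simp: not_less[symmetric])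
  show "level_algebra ?I"
    unfolding level_algebra_def sd socle_dim_0_iff[OF subspace]
  proof (intro conjI A allI impI ballI)
    fix i and f :: "'k poly3" assume i: "i < e" and f: "f \<in> hom_part (int i)" "\<forall>j. X j * f \<in> ?I"
    have "P m" if m: "lk f m \<noteq> 0" for m
    proof (rule soc)
      show "mdeg m < e" using hom_partD[OF f(1) m] i by simp
      fix i :: 3
      have "lk (X i * f) (Poly_Mapping.single i 1 + m) \<noteq> 0" unfolding lookup_X_mult by (rule m)
      then show "P (Poly_Mapping.single i 1 + m)" using f(2) unfolding monideal_def by blast
    qed
    then show "f \<in> ?I" unfolding monideal_def by simp
  qed
  show "h_vector ?I = map (\<lambda>d. card {m \<in> monset d. \<not> P m}) [0..<Suc e]"
    unfolding h_vector_def sd hilb ..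
qed

end

section \<open>Koszul relations of powers of the variables\<close>

lemma X_power: "X i ^ n = mon (Poly_Mapping.single i n)"
  by (induction n) (simp_all add: mono_0 X_mono mono_add[symmetric] single_add[symmetric])

lemma lookup_X_power_mult:
  "lk (X i ^ n * f) m \<noteq> 0 \<Longrightarrow> n \<le> lk m i"
proof (rule ccontr)
  assume m: "lk (X i ^ n * f) m \<noteq> 0" and n: "\<not> n \<le> lk m i"
  have "lk (X i ^ n * f) m = 0"
    unfolding X_power mon_def by (rule lookup_single_mult_outside) (use n in \<open>auto simp: lookup_add\<close>)
  then show False using m by simp
qed

lemma X_power_dvd:
  assumes "\<And>m. lk f m \<noteq> 0 \<Longrightarrow> n \<le> lk m i"
  shows "\<exists>g. f = X i ^ n * g"
proof
  show "f = X i ^ n * mdiv (Poly_Mapping.single i n) f"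
    unfolding X_power
  proof (rule mono_mdiv[symmetric])
    fix m assume "lk f m \<noteq> 0"
    then show "\<exists>k. m = Poly_Mapping.single i n + k"
      unfolding expo_dvd_iff using assms by (auto simp: lookup_single when_def)
  qed
qed

lemma lookup_X_power_mult_shift: "lk (X i ^ n * f) (Poly_Mapping.single i n + m) = lk f m"
  unfolding X_power by (rule lookup_mono_mult)

lemma X_power_split:
  "\<exists>f1 f0. f = X i ^ n * f1 + f0 \<and> (\<forall>m. lk f0 m \<noteq> 0 \<longrightarrow> lk m i < n)"
proof -
  have "\<exists>f1. restr (\<lambda>m. n \<le> lk m i) f = X i ^ n * f1"
    by (rule X_power_dvd) (auto simp: lookup_restr split: if_splits)
  then obtain f1 where "restr (\<lambda>m. n \<le> lk m i) f = X i ^ n * f1" by blast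
  then have "f = X i ^ n * f1 + restr (\<lambda>m. \<not> n \<le> lk m i) f" using restr_split[of f "\<lambda>m. n \<le> lk m i"] by simp
  moreover have "\<forall>m. lk (restr (\<lambda>m. \<not> n \<le> lk m i) f) m \<noteq> 0 \<longrightarrow> lk m i < n" by (auto simp: lookup_restr)
  ultimately show ?thesis by blast
qed

lemma X_power_coprime:
  assumes "i \<noteq> j" "X i ^ a * f = X j ^ b * (g :: 'k::field_char_0 poly3)"
  shows "\<exists>w. f = X j ^ b * w \<and> g = X i ^ a * w"
proof -
  obtain w where w: "f = X j ^ b * w"
  proof -
    have "b \<le> lk m j" if "lk f m \<noteq> 0" for m
    proof -
      have "lk (X j ^ b * g) (Poly_Mapping.single i a + m) \<noteq> 0"
        using that assms(2) lookup_X_power_mult_shift[of i a f m] by simp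
      then have "b \<le> lk (Poly_Mapping.single i a + m) j" by (rule lookup_X_power_mult)
      then show ?thesis using assms(1) by (simp add: lookup_add lookup_single)
    qed
    then show thesis using X_power_dvd that by blast
  qed
  have "X j ^ b * (X i ^ a * w) = X j ^ b * g" using assms(2) unfolding w by (simp add: ac_simps)
  then have "g = X i ^ a * w" unfolding X_power[of j] mono_mult_left_cancel by simp
  then show ?thesis using w by blast
qed

text \<open>Reduce \<open>g\<close> and \<open>h\<close> modulo the power of \<open>X i\<close>. The
  remainders combine to a multiple of \<open>X i ^ a\<close> all of whose terms have exponent below
  \<open>a\<close> in that variable, so the combination is zero and \<open>X_power_coprime\<close>
  applies. Unlike \<open>koszul\<close>, this handles powers with different exponents and no
  grading.\<close>

lemma X_power_koszul:
  assumes ij: "i \<noteq> j" "i \<noteq> k" "j \<noteq> k"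
    and eq: "X i ^ a * f + X j ^ b * g + X k ^ c * (h :: 'k::field_char_0 poly3) = 0"
  obtains w0 w1 w2 where "f = X j ^ b * w2 - X k ^ c * w1" "g = X k ^ c * w0 - X i ^ a * w2" "h = X i ^ a * w1 - X j ^ b * w0"
proof -
  obtain g1 g0 where g: "g = X i ^ a * g1 + g0" "\<And>m. lk g0 m \<noteq> 0 \<Longrightarrow> lk m i < a"
    using X_power_split[of g i a] by blast
  obtain h1 h0 where h: "h = X i ^ a * h1 + h0" "\<And>m. lk h0 m \<noteq> 0 \<Longrightarrow> lk m i < a"
    using X_power_split[of h i a] by blast
  have low: "lk m i < a" if "lk (X l ^ d * r) m \<noteq> 0" "i \<noteq> l" "\<And>m. lk r m \<noteq> 0 \<Longrightarrow> lk m i < a" for l d r m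
  proof -
    have "\<forall>i'. lk (Poly_Mapping.single l d) i' \<le> lk m i'"
      using lookup_X_power_mult[OF that(1)] by (auto simp: lookup_single when_def)
    then obtain m' where m': "m = Poly_Mapping.single l d + m'" using expo_dvd_iff by blast
    then have "lk r m' \<noteq> 0" using that(1) lookup_X_power_mult_shift by metis
    then show ?thesis using that(3) that(2) unfolding m' by (simp add: lookup_add lookup_single)
  qed
  let ?s = "X j ^ b * g0 + X k ^ c * h0"
  have s: "X i ^ a * (f + X j ^ b * g1 + X k ^ c * h1) = - ?s"
  proof -
    have "X i ^ a * (f + X j ^ b * g1 + X k ^ c * h1) + ?s = X i ^ a * f + X j ^ b * g + X k ^ c * h"
      unfolding g(1) h(1) by (simp add: algebra_simps)
    then show ?thesis unfolding eq by (simp only: eq_neg_iff_add_eq_0)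
  qed
  have s0: "?s = 0"
  proof (rule poly_mapping_eqI)
    fix m
    have "lk ?s m = 0"
    proof (rule ccontr)
      assume n: "lk ?s m \<noteq> 0"
      then have "lk (X j ^ b * g0) m \<noteq> 0 \<or> lk (X k ^ c * h0) m \<noteq> 0" by (auto simp: lookup_add)
      then have "lk m i < a" using low[of j b g0 m] low[of k c h0 m] g(2) h(2) ij by blast
      moreover have "lk (X i ^ a * (f + X j ^ b * g1 + X k ^ c * h1)) m \<noteq> 0"
        unfolding s using n lookup_minus[of 0 ?s m] by simp
      then have "a \<le> lk m i" by (rule lookup_X_power_mult)
      ultimately show False by simp
    qed
    then show "lk ?s m = lk 0 m" by simp
  qed
  then have "X j ^ b * g0 = X k ^ c * (- h0)" by (simp add: eq_neg_iff_add_eq_0)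
  then obtain w where w: "g0 = X k ^ c * w" "- h0 = X j ^ b * w" using X_power_coprime[OF ij(3)] by blast
  have "X i ^ a * (f + X j ^ b * g1 + X k ^ c * h1) = X i ^ a * 0" using s s0 by simp
  then have "f + X j ^ b * g1 + X k ^ c * h1 = 0" unfolding X_power[of i] mono_mult_left_cancel .
  then have "f = - (X j ^ b * g1 + X k ^ c * h1)" by (simp only: eq_neg_iff_add_eq_0 add.assoc)
  then have "f = X j ^ b * (- g1) - X k ^ c * h1" by simp
  moreover have "g = X k ^ c * w - X i ^ a * (- g1)" unfolding g(1) w(1) by simp
  moreover have "h0 = - (X j ^ b * w)" using w(2) by (metis minus_minus)
  then have "h = X i ^ a * h1 - X j ^ b * w" unfolding h(1) by simp
  ultimately show thesis by (rule that)
qed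

section \<open>Two families of level monomial ideals\<close>

abbreviation "x_var \<equiv> X (0::3)"
abbreviation "y_var \<equiv> X (1::3)"
abbreviation "z_var \<equiv> X (2::3)"

lemma three_neq: "(0::3) \<noteq> 1" "(0::3) \<noteq> 2" "(1::3) \<noteq> 2" "(1::3) \<noteq> 0" "(2::3) \<noteq> 0" "(2::3) \<noteq> 1"
  by simp_all

lemma mono_expo: "mon (expo_of p q r) = x_var ^ p * y_var ^ q * z_var ^ r"
  unfolding expo_of_def mono_add X_power ..

lemma lookup_mono_0: "lk (mon (expo_of p q r)) 0 = (if p = 0 \<and> q = 0 \<and> r = 0 then 1 else 0)"
  by (simp add: lookup_mono expo_eq_iff)

lemma sums:
  "(\<Sum>c<4. f c) = f 0 + f 1 + f 2 + f (3::nat)"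
  "(\<Sum>c<5. f c) = f 0 + f 1 + f 2 + f 3 + f (4::nat)"
  "(\<Sum>c<6. f c) = f 0 + f 1 + f 2 + f 3 + f 4 + f (5::nat)"
  "(\<Sum>c<2. f c) = f 0 + f (1::nat)"
  for f :: "nat \<Rightarrow> 'a::comm_monoid_add"
  by (simp_all add: eval_nat_numeral)

lemma less_cases:
  "c < 2 \<longleftrightarrow> c = 0 \<or> c = (1::nat)"
  "c < 4 \<longleftrightarrow> c = 0 \<or> c = 1 \<or> c = 2 \<or> c = (3::nat)"
  "c < 5 \<longleftrightarrow> c = 0 \<or> c = 1 \<or> c = 2 \<or> c = 3 \<or> c = (4::nat)"
  "c < 6 \<longleftrightarrow> c = 0 \<or> c = 1 \<or> c = 2 \<or> c = 3 \<or> c = 4 \<or> c = (5::nat)"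
  by auto

abbreviation mterm :: "nat \<Rightarrow> nat \<Rightarrow> nat \<Rightarrow> 'k::field_char_0 poly3" where
  "mterm p q r \<equiv> mon (expo_of p q r)"

lemma mterm_hom: "int (p + q + r) = d \<Longrightarrow> mterm p q r \<in> hom_part d" "int (p + q + r) = d \<Longrightarrow> - mterm p q r \<in> hom_part d"
  using hom_part_mono[of "expo_of p q r"] hom_part_uminus by auto

lemma divides_iff: "(\<exists>k. m = expo_of p q r + k) \<longleftrightarrow> p \<le> lk m 0 \<and> q \<le> lk m 1 \<and> r \<le> lk m 2"
  unfolding expo_dvd_iff forall_three by simp

lemma lookup_single_three:
  "lk (Poly_Mapping.single (0::3) n) 0 = n" "lk (Poly_Mapping.single (0::3) n) 1 = 0" "lk (Poly_Mapping.single (0::3) n) 2 = 0"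
  "lk (Poly_Mapping.single (1::3) n) 0 = 0" "lk (Poly_Mapping.single (1::3) n) 1 = n" "lk (Poly_Mapping.single (1::3) n) 2 = 0"
  "lk (Poly_Mapping.single (2::3) n) 0 = 0" "lk (Poly_Mapping.single (2::3) n) 1 = 0" "lk (Poly_Mapping.single (2::3) n) 2 = n"
  by (simp_all add: lookup_single)

text \<open>Outside the ideal lie the powers of x up to \<open>p + q\<close> and the monomials in y
  and z with exponents at most \<open>p\<close> and \<open>q\<close>. Both parts end in degree
  \<open>p + q\<close>, so the socle is spanned by \<open>x ^ (p + q)\<close> and
  \<open>y ^ p * z ^ q\<close>.\<close>

definition corner_mon :: "nat \<Rightarrow> nat \<Rightarrow> expo \<Rightarrow> bool" where
  "corner_mon p q m \<longleftrightarrow> (1 \<le> lk m 0 \<and> 1 \<le> lk m 1) \<or> (1 \<le> lk m 0 \<and> 1 \<le> lk m 2) \<or> p < lk m 1 \<or> q < lk m 2 \<or> p + q < lk m 0"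

text \<open>Outside the ideal lie the products of 1, x or y with a power of z below
  \<open>e\<close>; the socle is spanned by \<open>x * z ^ (e - 1)\<close> and
  \<open>y * z ^ (e - 1)\<close>.\<close>

definition square_mon :: "nat \<Rightarrow> expo \<Rightarrow> bool" where
  "square_mon e m \<longleftrightarrow> 2 \<le> lk m 0 \<or> (1 \<le> lk m 0 \<and> 1 \<le> lk m 1) \<or> 2 \<le> lk m 1 \<or> e \<le> lk m 2"

lemma monset_split_card:
  fixes A :: "expo set"
  assumes "\<And>m. m \<in> A \<Longrightarrow> lk m 0 + lk m 1 + lk m 2 = d"
  shows "card A = card ((\<lambda>m. (lk m 0, lk m 1)) ` A)"
proof -
  have "inj_on (\<lambda>m. (lk m 0, lk m 1)) A"
  proof (rule inj_onI)
    fix m n assume "m \<in> A" "n \<in> A" "(lk m 0, lk m 1) = (lk n 0, lk n 1)"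
    then show "m = n" using assms[of m] assms[of n] unfolding expo_eq_iff by auto
  qed
  then show ?thesis by (rule card_image[symmetric])
qed

lemma monset_image_iff:
  "(\<lambda>m. (lk m 0, lk m 1)) ` {m \<in> monset d. Q (lk m 0) (lk m 1) (lk m 2)} = {(s, t). s + t \<le> d \<and> Q s t (d - s - t)}"
proof
  show "(\<lambda>m. (lk m 0, lk m 1)) ` {m \<in> monset d. Q (lk m 0) (lk m 1) (lk m 2)} \<subseteq> {(s, t). s + t \<le> d \<and> Q s t (d - s - t)}"
    by (auto simp: monset_def mdeg_three)
  show "{(s, t). s + t \<le> d \<and> Q s t (d - s - t)} \<subseteq> (\<lambda>m. (lk m 0, lk m 1)) ` {m \<in> monset d. Q (lk m 0) (lk m 1) (lk m 2)}"
  proof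
    fix v assume v: "v \<in> {(s, t). s + t \<le> d \<and> Q s t (d - s - t)}"
    then obtain s t where st: "v = (s, t)" "s + t \<le> d" "Q s t (d - s - t)" by blast
    show "v \<in> (\<lambda>m. (lk m 0, lk m 1)) ` {m \<in> monset d. Q (lk m 0) (lk m 1) (lk m 2)}"
      by (rule image_eqI[of _ _ "expo_of s t (d - s - t)"]) (use st in \<open>auto simp: monset_def\<close>)
  qed
qed

lemma card_monset_filter:
  "card {m \<in> monset d. Q (lk m 0) (lk m 1) (lk m 2)} = card {(s, t). s + t \<le> d \<and> Q s t (d - s - t)}"
  unfolding monset_image_iff[symmetric]
  by (rule monset_split_card[of _ d]) (simp add: monset_def mdeg_three)

text \<open>In degree \<open>d\<close> the surviving monomials are \<open>x ^ d\<close> and the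
  \<open>y ^ t * z ^ (d - t)\<close> with \<open>d - q \<le> t \<le> min d p\<close>. They are
  recorded by their exponents of x and y.\<close>

lemma card_corner:
  assumes pq: "1 \<le> p" "p \<le> q" and d: "1 \<le> d" "d \<le> p + q"
  shows "int (card {m \<in> monset d. \<not> corner_mon p q m}) = 2 + min (int d) (int p) - max 0 (int d - int q)"
proof -
  have "{(s, t). s + t \<le> d \<and> \<not> ((1 \<le> s \<and> 1 \<le> t) \<or> (1 \<le> s \<and> 1 \<le> d - s - t) \<or> p < t \<or> q < d - s - t \<or> p + q < s)}
      = insert (d, 0) (Pair 0 ` {d - q..min d p})" (is "?L = ?R")
  proof
    show "?L \<subseteq> ?R" using d by (auto simp: image_iff)
    show "?R \<subseteq> ?L" using d pq by auto
  qed
  moreover have "card (insert (d, 0) (Pair (0::nat) ` {d - q..min d p})) = Suc (card {d - q..min d p})"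
    using d(1) by (subst card_insert_disjoint) (auto simp: card_image inj_on_def)
  ultimately show ?thesis
    unfolding corner_mon_def card_monset_filter[where Q = "\<lambda>s t r. \<not> ((1 \<le> s \<and> 1 \<le> t) \<or> (1 \<le> s \<and> 1 \<le> r) \<or> p < t \<or> q < r \<or> p + q < s)"]
    using d pq by (simp add: min_def max_def of_nat_diff)
qed

lemma card_square:
  assumes e: "2 \<le> e" and d: "1 \<le> d" "d < e"
  shows "card {m \<in> monset d. \<not> square_mon e m} = 3" and "card {m \<in> monset e. \<not> square_mon e m} = 2"
proof -
  have "{(s, t). s + t \<le> d \<and> \<not> (2 \<le> s \<or> (1 \<le> s \<and> 1 \<le> t) \<or> 2 \<le> t \<or> e \<le> d - s - t)} = {(0, 0), (1, 0), (0, 1)}"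
    using d by auto
  then show "card {m \<in> monset d. \<not> square_mon e m} = 3"
    unfolding square_mon_def card_monset_filter[where Q = "\<lambda>s t r. \<not> (2 \<le> s \<or> (1 \<le> s \<and> 1 \<le> t) \<or> 2 \<le> t \<or> e \<le> r)"] by simp
  have "{(s, t). s + t \<le> e \<and> \<not> (2 \<le> s \<or> (1 \<le> s \<and> 1 \<le> t) \<or> 2 \<le> t \<or> e \<le> e - s - t)} = {(1, 0), (0, 1)}"
    using e by auto
  then show "card {m \<in> monset e. \<not> square_mon e m} = 2"
    unfolding square_mon_def card_monset_filter[where Q = "\<lambda>s t r. \<not> (2 \<le> s \<or> (1 \<le> s \<and> 1 \<le> t) \<or> 2 \<le> t \<or> e \<le> r)"] by simp
qed

interpretation corner_mon: monomial_ideal "corner_mon p q" for p q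
  by unfold_locales (auto simp: corner_mon_def lookup_add)

interpretation square_mon: monomial_ideal "square_mon e" for e
  by unfold_locales (auto simp: square_mon_def lookup_add)

lemma level_corner:
  assumes "1 \<le> p" "p \<le> q"
  shows "level_algebra (monideal (corner_mon p q) :: 'k::field_char_0 poly3 set)"
    and "h_vector (monideal (corner_mon p q) :: 'k::field_char_0 poly3 set) = map (\<lambda>d. card {m \<in> monset d. \<not> corner_mon p q m}) [0..<Suc (p + q)]"
proof -
  have 1: "corner_mon p q m" if "mdeg m > p + q" for m using that unfolding corner_mon_def mdeg_three by linarith
  have 2: "\<not> corner_mon p q m" if "mdeg m = 1" for m using that assms unfolding corner_mon_def mdeg_three by linarith
  have 3: "corner_mon p q m" if "mdeg m < p + q" "\<And>i. corner_mon p q (Poly_Mapping.single i 1 + m)" for m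
    using that(1) that(2)[of 0] that(2)[of 1] that(2)[of 2] assms
    unfolding corner_mon_def mdeg_three lookup_add lookup_single_three by linarith
  have 4: "mdeg (expo_of (p + q) 0 0) = p + q" "\<not> corner_mon p q (expo_of (p + q) 0 0)" by (simp_all add: corner_mon_def)
  show "level_algebra (monideal (corner_mon p q) :: 'k poly3 set)" by (rule corner_mon.level(1)[OF 1 2 3 4])
  show "h_vector (monideal (corner_mon p q) :: 'k poly3 set) = map (\<lambda>d. card {m \<in> monset d. \<not> corner_mon p q m}) [0..<Suc (p + q)]"
    by (rule corner_mon.level(2)[OF 1 2 3 4])
qed

lemma level_square:
  assumes "2 \<le> e"
  shows "level_algebra (monideal (square_mon e) :: 'k::field_char_0 poly3 set)"
    and "h_vector (monideal (square_mon e) :: 'k::field_char_0 poly3 set) = map (\<lambda>d. card {m \<in> monset d. \<not> square_mon e m}) [0..<Suc e]"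
proof -
  have 1: "square_mon e m" if "mdeg m > e" for m using that unfolding square_mon_def mdeg_three by linarith
  have 2: "\<not> square_mon e m" if "mdeg m = 1" for m using that assms unfolding square_mon_def mdeg_three by linarith
  have 3: "square_mon e m" if "mdeg m < e" "\<And>i. square_mon e (Poly_Mapping.single i 1 + m)" for m
    using that(1) that(2)[of 0] that(2)[of 1] that(2)[of 2] assms
    unfolding square_mon_def mdeg_three lookup_add lookup_single_three by linarith
  have 4: "mdeg (expo_of 1 0 (e - 1)) = e" "\<not> square_mon e (expo_of 1 0 (e - 1))" using assms by (auto simp: square_mon_def)
  show "level_algebra (monideal (square_mon e) :: 'k poly3 set)" by (rule square_mon.level(1)[OF 1 2 3 4])
  show "h_vector (monideal (square_mon e) :: 'k poly3 set) = map (\<lambda>d. card {m \<in> monset d. \<not> square_mon e m}) [0..<Suc e]"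
    by (rule square_mon.level(2)[OF 1 2 3 4])
qed

text \<open>The columns of the second matrix are the parameters left over when a relation is solved
  by two Koszul steps, one for \<open>x\<close>, \<open>y ^ (p + 1)\<close>,
  \<open>z ^ (q + 1)\<close> and one for \<open>x ^ (p + q)\<close>, \<open>y\<close>,
  \<open>z\<close>.\<close>

lemma resolution_corner:
  assumes "1 \<le> p" "p \<le> q"
  shows "resolution (monideal (corner_mon p q) :: 'k::field_char_0 poly3 set) 5 6 2
    ((!) [2, 2, int p + 1, int q + 1, int (p + q) + 1])
    ((!) [3, int p + 2, int q + 2, int (p + q) + 2, int (p + q) + 2, int (p + q) + 2])
    ((!) [int (p + q) + 3, int (p + q) + 3])
    ((!) [mterm 1 1 0, mterm 1 0 1, mterm 0 (p + 1) 0, mterm 0 0 (q + 1), mterm (p + q + 1) 0 0])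
    (\<lambda>r c. [[mterm 0 0 1, mterm 0 p 0, 0, mterm (p + q) 0 0, 0, 0],
           [- mterm 0 1 0, 0, mterm 0 0 q, 0, mterm (p + q) 0 0, 0],
           [0, - mterm 1 0 0, 0, 0, 0, mterm 0 0 (q + 1)],
           [0, 0, - mterm 1 0 0, 0, 0, - mterm 0 (p + 1) 0],
           [0, 0, 0, - mterm 0 1 0, - mterm 0 0 1, 0]] ! r ! c)
    (\<lambda>r c. [[mterm (p + q) 0 0, mterm 0 p q], [0, - mterm 0 0 (q + 1)], [0, mterm 0 (p + 1) 0],
           [- mterm 0 0 1, 0], [mterm 0 1 0, 0], [0, - mterm 1 0 0]] ! r ! c)"
    (is "resolution ?I 5 6 2 ?a1 ?a2 ?a3 ?M1 ?M2 ?M3")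
proof
  fix r c :: nat
  show "c < 5 \<Longrightarrow> ?M1 c \<in> hom_part (?a1 c)"
    unfolding less_cases by (elim disjE; simp add: mterm_hom)
  show "r < 5 \<Longrightarrow> c < 6 \<Longrightarrow> ?M2 r c \<in> hom_part (?a2 c - ?a1 r)"
    unfolding less_cases by (elim disjE; simp add: mterm_hom)
  show "r < 6 \<Longrightarrow> c < 2 \<Longrightarrow> ?M3 r c \<in> hom_part (?a3 c - ?a2 r)"
    unfolding less_cases by (elim disjE; simp add: mterm_hom)
  show "c < 5 \<Longrightarrow> lk (?M1 c) 0 = 0"
    unfolding less_cases by (elim disjE; simp add: lookup_mono_0)
  show "r < 5 \<Longrightarrow> c < 6 \<Longrightarrow> lk (?M2 r c) 0 = 0"
    unfolding less_cases using assms by (elim disjE; simp add: lookup_mono_0)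
  show "r < 6 \<Longrightarrow> c < 2 \<Longrightarrow> lk (?M3 r c) 0 = 0"
    unfolding less_cases using assms by (elim disjE; simp add: lookup_mono_0)
next
  fix f :: "'k poly3"
  let ?g = "(!) [expo_of 1 1 0, expo_of 1 0 1, expo_of 0 (p + 1) 0, expo_of 0 0 (q + 1), expo_of (p + q + 1) 0 0]"
  have "?M1 c = mon (?g c)" if "c < 5" for c using that unfolding less_cases by (elim disjE; simp)
  moreover have "corner_mon p q m \<longleftrightarrow> (\<exists>c<5. \<exists>k. m = ?g c + k)" for m
  proof -
    have "(\<exists>c<5. \<exists>k. m = ?g c + k) \<longleftrightarrow> (\<exists>k. m = expo_of 1 1 0 + k) \<or> (\<exists>k. m = expo_of 1 0 1 + k) \<or>
      (\<exists>k. m = expo_of 0 (p + 1) 0 + k) \<or> (\<exists>k. m = expo_of 0 0 (q + 1) + k) \<or> (\<exists>k. m = expo_of (p + q + 1) 0 0 + k)"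
      unfolding less_cases by (simp add: conj_disj_distribR ex_disj_distrib)
    then show ?thesis unfolding divides_iff corner_mon_def by auto
  qed
  ultimately show "f \<in> ?I \<longleftrightarrow> (\<exists>u. f = (\<Sum>c<5. ?M1 c * u c))" by (rule corner_mon.generated)
next
  fix u :: "nat \<Rightarrow> 'k poly3"
  assume "(\<Sum>c<5. ?M1 c * u c) = 0"
  then have "x_var * y_var * u 0 + x_var * z_var * u 1 + y_var ^ (p + 1) * u 2 + z_var ^ (q + 1) * u 3 + x_var ^ (p + q + 1) * u 4 = 0"
    by (simp add: sums mono_expo)
  \<comment> \<open>Three of the five generators are divisible by x; collecting them leaves a
    relation between powers of the three variables.\<close>
  then have "x_var ^ 1 * (y_var * u 0 + z_var * u 1 + x_var ^ (p + q) * u 4) + y_var ^ (p + 1) * u 2 + z_var ^ (q + 1) * u 3 = 0"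
    by (simp add: algebra_simps)
  then obtain w0 w1 w2 where w: "y_var * u 0 + z_var * u 1 + x_var ^ (p + q) * u 4 = y_var ^ (p + 1) * w2 - z_var ^ (q + 1) * w1"
    "u 2 = z_var ^ (q + 1) * w0 - x_var ^ 1 * w2" "u 3 = x_var ^ 1 * w1 - y_var ^ (p + 1) * w0"
    by (rule X_power_koszul[OF three_neq(1-3)])
  have "x_var ^ (p + q) * u 4 + y_var ^ 1 * (u 0 - y_var ^ p * w2) + z_var ^ 1 * (u 1 + z_var ^ q * w1) = 0"
    using w(1) by (simp add: algebra_simps)
  then obtain v0 v1 v2 where v: "u 4 = y_var ^ 1 * v2 - z_var ^ 1 * v1" "u 0 - y_var ^ p * w2 = z_var ^ 1 * v0 - x_var ^ (p + q) * v2"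
    "u 1 + z_var ^ q * w1 = x_var ^ (p + q) * v1 - y_var ^ 1 * v0"
    by (rule X_power_koszul[OF three_neq(1-3)])
  have u: "u 0 = z_var * v0 - x_var ^ (p + q) * v2 + y_var ^ p * w2" "u 1 = x_var ^ (p + q) * v1 - y_var * v0 - z_var ^ q * w1"
    using v(2,3) by (simp_all add: algebra_simps)
  have "\<forall>r<5. u r = (\<Sum>c<6. ?M2 r c * [v0, w2, - w1, - v2, v1, w0] ! c)"
    unfolding less_cases sums using u v(1) w(2,3) by (auto simp: mono_expo)
  then show "\<exists>v. \<forall>r<5. u r = (\<Sum>c<6. ?M2 r c * v c)" by blast
next
  fix v :: "nat \<Rightarrow> 'k poly3"
  show "(\<Sum>r<5. ?M1 r * (\<Sum>c<6. ?M2 r c * v c)) = 0"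
    unfolding sums by (simp add: mono_expo algebra_simps)
next
  fix u :: "nat \<Rightarrow> 'k poly3"
  assume "\<And>r. r < 5 \<Longrightarrow> (\<Sum>c<6. ?M2 r c * u c) = 0"
  note eq = this
  have neg: "a = b" if "- a - b' = 0" "b = - b'" for a b b' :: "'k poly3"
    using that by (metis add.inverse_inverse eq_iff_diff_eq_0)
  \<comment> \<open>Rows 2, 3 and 4 involve only two unknowns each, so coprimality yields common
    factors \<open>t\<close> of \<open>u 1\<close>, \<open>u 2\<close>, \<open>u 5\<close> and
    \<open>s\<close> of \<open>u 3\<close>, \<open>u 4\<close>; row 0 then fixes
    \<open>u 0\<close>.\<close>
  have e: "z_var * u 0 + y_var ^ p * u 1 + x_var ^ (p + q) * u 3 = 0" "z_var ^ (q + 1) * u 5 = x_var ^ 1 * u 1"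
    using eq[of 0] eq[of 2] by (simp_all add: sums mono_expo add_eq_0_iff)
  have e3: "x_var ^ 1 * u 2 = y_var ^ (p + 1) * (- u 5)"
    by (rule neg[of _ "y_var ^ (p + 1) * u 5"]) (use eq[of 3] in \<open>simp_all add: sums mono_expo\<close>)
  have e4: "y_var ^ 1 * u 3 = z_var ^ 1 * (- u 4)"
    by (rule neg[of _ "z_var ^ 1 * u 4"]) (use eq[of 4] in \<open>simp_all add: sums mono_expo\<close>)
  obtain t where t: "u 5 = x_var ^ 1 * t" "u 1 = z_var ^ (q + 1) * t"
    using X_power_coprime[OF _ e(2)] by auto
  have "x_var * u 2 = x_var * (- (y_var ^ (p + 1) * t))" using e3 unfolding t(1) by (simp add: algebra_simps)
  then have t2: "u 2 = - (y_var ^ (p + 1) * t)" unfolding X_mult_left_cancel .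
  obtain s where s: "u 3 = z_var ^ 1 * s" "- u 4 = y_var ^ 1 * s"
    using X_power_coprime[OF _ e4] by auto
  have s2: "u 4 = - (y_var * s)" using s(2) by (metis minus_minus power_one_right)
  have "z_var * u 0 = z_var * (- (y_var ^ p * z_var ^ q * t) - x_var ^ (p + q) * s)"
  proof -
    have "z_var * u 0 - z_var * (- (y_var ^ p * z_var ^ q * t) - x_var ^ (p + q) * s) =
        z_var * u 0 + y_var ^ p * u 1 + x_var ^ (p + q) * u 3"
      unfolding t(2) s(1) by (simp add: algebra_simps)
    then show ?thesis unfolding e(1) by (simp only: eq_iff_diff_eq_0[symmetric])
  qed
  then have u0: "u 0 = - (y_var ^ p * z_var ^ q * t) - x_var ^ (p + q) * s" unfolding X_mult_left_cancel .
  have "\<forall>r<6. u r = (\<Sum>c<2. ?M3 r c * [- s, - t] ! c)"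
    unfolding less_cases sums using u0 t t2 s(1) s2 by (auto simp: mono_expo)
  then show "\<exists>v. \<forall>r<6. u r = (\<Sum>c<2. ?M3 r c * v c)" by blast
next
  fix r :: nat and v :: "nat \<Rightarrow> 'k poly3"
  assume "r < 5"
  then show "(\<Sum>c<6. ?M2 r c * (\<Sum>d<2. ?M3 c d * v d)) = 0"
    unfolding less_cases sums by (elim disjE; simp add: mono_expo algebra_simps)
next
  fix u :: "nat \<Rightarrow> 'k poly3" and c :: nat
  assume u: "\<And>r. r < 6 \<Longrightarrow> (\<Sum>c<2. ?M3 r c * u c) = 0" and c: "c < 2"
  \<comment> \<open>Rows 3 and 1 of the last matrix have a single nonzero entry, in different
    columns.\<close>
  have "u 0 = 0" "u 1 = 0" using u[of 3] u[of 1] by (simp_all add: sums)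
  then show "u c = 0" using c unfolding less_cases by auto
qed (rule corner_mon.homogeneous)

text \<open>The matrices form the tensor product of the resolution of \<open>(x, y) ^ 2\<close> with
  multiplication by \<open>z ^ e\<close>.\<close>

lemma resolution_square:
  assumes "1 \<le> e"
  shows "resolution (monideal (square_mon e) :: 'k::field_char_0 poly3 set) 4 5 2
    ((!) [2, 2, 2, int e])
    ((!) [3, 3, int e + 2, int e + 2, int e + 2])
    ((!) [int e + 3, int e + 3])
    ((!) [mterm 2 0 0, mterm 1 1 0, mterm 0 2 0, mterm 0 0 e])
    (\<lambda>r c. [[mterm 0 1 0, 0, mterm 0 0 e, 0, 0],
           [- mterm 1 0 0, mterm 0 1 0, 0, mterm 0 0 e, 0],
           [0, - mterm 1 0 0, 0, 0, mterm 0 0 e],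
           [0, 0, - mterm 2 0 0, - mterm 1 1 0, - mterm 0 2 0]] ! r ! c)
    (\<lambda>r c. [[mterm 0 0 e, 0], [0, mterm 0 0 e], [- mterm 0 1 0, 0],
           [mterm 1 0 0, - mterm 0 1 0], [0, mterm 1 0 0]] ! r ! c)"
    (is "resolution ?I 4 5 2 ?a1 ?a2 ?a3 ?M1 ?M2 ?M3")
proof
  fix r c :: nat
  show "c < 4 \<Longrightarrow> ?M1 c \<in> hom_part (?a1 c)"
    unfolding less_cases by (elim disjE; simp add: mterm_hom)
  show "r < 4 \<Longrightarrow> c < 5 \<Longrightarrow> ?M2 r c \<in> hom_part (?a2 c - ?a1 r)"
    unfolding less_cases by (elim disjE; simp add: mterm_hom)
  show "r < 5 \<Longrightarrow> c < 2 \<Longrightarrow> ?M3 r c \<in> hom_part (?a3 c - ?a2 r)"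
    unfolding less_cases by (elim disjE; simp add: mterm_hom)
  show "c < 4 \<Longrightarrow> lk (?M1 c) 0 = 0"
    unfolding less_cases using assms by (elim disjE; simp add: lookup_mono_0)
  show "r < 4 \<Longrightarrow> c < 5 \<Longrightarrow> lk (?M2 r c) 0 = 0"
    unfolding less_cases using assms by (elim disjE; simp add: lookup_mono_0)
  show "r < 5 \<Longrightarrow> c < 2 \<Longrightarrow> lk (?M3 r c) 0 = 0"
    unfolding less_cases using assms by (elim disjE; simp add: lookup_mono_0)
next
  fix f :: "'k poly3"
  let ?g = "(!) [expo_of 2 0 0, expo_of 1 1 0, expo_of 0 2 0, expo_of 0 0 e]"
  have "?M1 c = mon (?g c)" if "c < 4" for c using that unfolding less_cases by (elim disjE; simp)
  moreover have "square_mon e m \<longleftrightarrow> (\<exists>c<4. \<exists>k. m = ?g c + k)" for m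
  proof -
    have "(\<exists>c<4. \<exists>k. m = ?g c + k) \<longleftrightarrow> (\<exists>k. m = expo_of 2 0 0 + k) \<or> (\<exists>k. m = expo_of 1 1 0 + k) \<or>
      (\<exists>k. m = expo_of 0 2 0 + k) \<or> (\<exists>k. m = expo_of 0 0 e + k)"
      unfolding less_cases by (simp add: conj_disj_distribR ex_disj_distrib)
    then show ?thesis unfolding divides_iff square_mon_def by auto
  qed
  ultimately show "f \<in> ?I \<longleftrightarrow> (\<exists>u. f = (\<Sum>c<4. ?M1 c * u c))" by (rule square_mon.generated)
next
  fix u :: "nat \<Rightarrow> 'k poly3"
  assume "(\<Sum>c<4. ?M1 c * u c) = 0"
  then have "x_var ^ 2 * u 0 + x_var * y_var * u 1 + y_var ^ 2 * u 2 + z_var ^ e * u 3 = 0"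
    by (simp add: sums mono_expo)
  then have "x_var ^ 1 * (x_var * u 0 + y_var * u 1) + y_var ^ 2 * u 2 + z_var ^ e * u 3 = 0"
    by (simp add: algebra_simps power2_eq_square)
  then obtain w0 w1 w2 where w: "x_var * u 0 + y_var * u 1 = y_var ^ 2 * w2 - z_var ^ e * w1"
    "u 2 = z_var ^ e * w0 - x_var ^ 1 * w2" "u 3 = x_var ^ 1 * w1 - y_var ^ 2 * w0"
    by (rule X_power_koszul[OF three_neq(1-3)])
  \<comment> \<open>The first Koszul step leaves a relation for \<open>x\<close>, \<open>y\<close>,
    \<open>z ^ e\<close> in which the parameter \<open>w1\<close> is itself an unknown, so it is
    replaced by the new parameters as well.\<close>
  have "x_var ^ 1 * u 0 + y_var ^ 1 * (u 1 - y_var * w2) + z_var ^ e * w1 = 0"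
    using w(1) by (simp add: algebra_simps power2_eq_square)
  then obtain v0 v1 v2 where v: "u 0 = y_var ^ 1 * v2 - z_var ^ e * v1" "u 1 - y_var * w2 = z_var ^ e * v0 - x_var ^ 1 * v2"
    "w1 = x_var ^ 1 * v1 - y_var ^ 1 * v0"
    by (rule X_power_koszul[OF three_neq(1-3)])
  have u: "u 1 = z_var ^ e * v0 - x_var * v2 + y_var * w2" using v(2) by (simp add: algebra_simps)
  have u3: "u 3 = x_var ^ 2 * v1 - x_var * y_var * v0 - y_var ^ 2 * w0" using w(3) unfolding v(3) by (simp add: algebra_simps power2_eq_square)
  have "\<forall>r<4. u r = (\<Sum>c<5. ?M2 r c * [v2, w2, - v1, v0, w0] ! c)"
    unfolding less_cases sums using u v(1) w(2) u3 by (auto simp: mono_expo)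
  then show "\<exists>v. \<forall>r<4. u r = (\<Sum>c<5. ?M2 r c * v c)" by blast
next
  fix v :: "nat \<Rightarrow> 'k poly3"
  show "(\<Sum>r<4. ?M1 r * (\<Sum>c<5. ?M2 r c * v c)) = 0"
    unfolding sums by (simp add: mono_expo algebra_simps power2_eq_square)
next
  fix u :: "nat \<Rightarrow> 'k poly3"
  assume "\<And>r. r < 4 \<Longrightarrow> (\<Sum>c<5. ?M2 r c * u c) = 0"
  from this[of 0] this[of 1] this[of 2]
  have e: "z_var ^ e * u 2 = y_var ^ 1 * (- u 0)" "y_var * u 1 + z_var ^ e * u 3 = x_var * u 0" "z_var ^ e * u 4 = x_var ^ 1 * u 1"
    by (simp_all add: sums mono_expo add_eq_0_iff)
  obtain s where s: "u 2 = y_var ^ 1 * s" "- u 0 = z_var ^ e * s"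
    using X_power_coprime[OF _ e(1)] by auto
  have u0: "u 0 = z_var ^ e * (- s)" using s(2) by (metis minus_minus mult_minus_right)
  obtain t where t: "u 4 = x_var ^ 1 * t" "u 1 = z_var ^ e * t"
    using X_power_coprime[OF _ e(3)] by auto
  have "z_var ^ e * u 3 = z_var ^ e * (x_var * (- s) - y_var * t)"
    using e(2) unfolding u0 t(2) by (simp add: algebra_simps)
  then have u3: "u 3 = x_var * (- s) - y_var * t" unfolding X_power[of 2] mono_mult_left_cancel .
  have "\<forall>r<5. u r = (\<Sum>c<2. ?M3 r c * [- s, t] ! c)"
    unfolding less_cases sums using u0 t s(1) u3 by (auto simp: mono_expo)
  then show "\<exists>v. \<forall>r<5. u r = (\<Sum>c<2. ?M3 r c * v c)" by blast
next
  fix r :: nat and v :: "nat \<Rightarrow> 'k poly3"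
  assume "r < 4"
  then show "(\<Sum>c<5. ?M2 r c * (\<Sum>d<2. ?M3 c d * v d)) = 0"
    unfolding less_cases sums by (elim disjE; simp add: mono_expo algebra_simps power2_eq_square)
next
  fix u :: "nat \<Rightarrow> 'k poly3" and c :: nat
  assume u: "\<And>r. r < 5 \<Longrightarrow> (\<Sum>c<2. ?M3 r c * u c) = 0" and c: "c < 2"
  have "u 0 = 0" "u 1 = 0" using u[of 2] u[of 4] by (simp_all add: sums)
  then show "u c = 0" using c unfolding less_cases by auto
qed (rule square_mon.homogeneous)

section \<open>From ideals to the set of resolutions\<close>

lemma level_resolutionsE:
  assumes F: "F \<in> level_resolutions TYPE('k::field_char_0) h"
    and h: "3 \<le> e" "length h = e + 1" "h ! (e - 1) = 3" "h ! e = 2"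
  obtains I :: "'k::field_char_0 poly3 set" where "level_type2 I e" "\<And>i. i \<le> e \<Longrightarrow> level_type2.hi I (int i) = int (h ! i)"
    "\<And>l. int (count (fst F) l) = num_gens I l"
    "snd (snd F) = {#int e + 3, int e + 3#}"
    "\<And>l. int (count (fst (snd F)) l) = num_gens I l + (if l = int e + 3 then 2 else 0) - (if l = 0 then 1 else 0)
           + (level_type2.hi I l - 3 * level_type2.hi I (l - 1) + 3 * level_type2.hi I (l - 2) - level_type2.hi I (l - 3))"
proof -
  obtain a1 a2 a3 and I :: "'k poly3 set" and D1 D2 D3 where F: "F = (mset a1, mset a2, mset a3)"
    and I: "level_algebra I" "h_vector I = h" and R: "minimal_free_resolution I a1 a2 a3 D1 D2 D3"
    using F unfolding level_resolutions_def by blast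
  note L = level_type2I[OF I h]
  have "homogeneous_ideal I" using I(1) unfolding level_algebra_def artinian_algebra_def by blast
  note counts = level_type2.resolution_counts[OF L(1) minimal_free_resolution_imp_resolution[OF this R]]
  have "int (count (mset a3) l) = int (count {#int e + 3, int e + 3#} l)" for l
    unfolding count_mset_cnt counts(2) by simp
  then have "mset a3 = {#int e + 3, int e + 3#}" by (rule count_eq_mset_eq)
  then show thesis
    using that[OF L] counts(1,3) unfolding F fst_conv snd_conv count_mset_cnt by blast
qed

lemma resolution_in_level_resolutions:
  assumes "level_algebra (I :: 'k::field_char_0 poly3 set)" "h_vector I = h"
    and "resolution I n1 n2 n3 ((!) a1) ((!) a2) ((!) a3) M1 M2 M3"
    and "length a1 = n1" "length a2 = n2" "length a3 = n3"
  shows "(mset a1, mset a2, mset a3) \<in> level_resolutions TYPE('k) h"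
  using resolution_imp_minimal_free_resolution[OF assms(3)] assms(1,2)
  unfolding level_resolutions_def assms(4-6)[symmetric] map_nth by blast

text \<open>With \<open>p = 1\<close> the example also covers \<open>h = (1, 3, ..., 3, 2)\<close>,
  where it provides the resolution with \<open>\<gamma> = 1\<close>.\<close>

lemma level_resolutions_example_1:
  assumes p: "1 \<le> p" "2 * p \<le> e" and h: "length h = e + 1" "h ! 0 = 1"
    and hi: "\<And>d. 1 \<le> d \<Longrightarrow> d \<le> e \<Longrightarrow> int (h ! d) = 2 + min (int d) (int p) - max 0 (int d - (int e - int p))"
  shows "\<exists>F\<in>level_resolutions TYPE('k::field_char_0) h. fst F = {#2, 2, int p + 1, int e - int p + 1, int e + 1#}"
proof -
  define q where "q = e - p"
  have q: "e = p + q" "p \<le> q" using p unfolding q_def by auto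
  have c0: "card {m \<in> monset 0. \<not> corner_mon p q m} = 1"
  proof -
    have "{m \<in> monset 0. \<not> corner_mon p q m} = {0}" by (auto simp: monset_def mdeg_eq_0_iff corner_mon_def)
    then show ?thesis by simp
  qed
  have "map (\<lambda>d. card {m \<in> monset d. \<not> corner_mon p q m}) [0..<Suc (p + q)] = h"
  proof (rule nth_equalityI)
    fix d assume "d < length (map (\<lambda>d. card {m \<in> monset d. \<not> corner_mon p q m}) [0..<Suc (p + q)])"
    then have d: "d \<le> p + q" by simp
    have "card {m \<in> monset d. \<not> corner_mon p q m} = h ! d"
    proof (cases "d = 0")
      case True
      then show ?thesis using c0 h by simp
    next
      case False
      then have "int (card {m \<in> monset d. \<not> corner_mon p q m}) = int (h ! d)"
        using card_corner[OF p(1) q(2), of d] hi[of d] d q(1) by simp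
      then show ?thesis by simp
    qed
    then show "map (\<lambda>d. card {m \<in> monset d. \<not> corner_mon p q m}) [0..<Suc (p + q)] ! d = h ! d"
      using d by (simp del: upt_Suc)
  qed (use h q in simp)
  then have "h_vector (monideal (corner_mon p q) :: 'k poly3 set) = h" using level_corner(2)[OF p(1) q(2)] by simp
  from resolution_in_level_resolutions[OF level_corner(1)[OF p(1) q(2)] this resolution_corner[OF p(1) q(2)]]
  show ?thesis by (rule bexI[rotated]) (simp_all add: q(1))
qed

lemma level_resolutions_example_2:
  assumes e: "3 \<le> e" and h: "length h = e + 1" "h ! 0 = 1" "h ! e = 2"
    and hi: "\<And>d. 1 \<le> d \<Longrightarrow> d < e \<Longrightarrow> h ! d = 3"
  shows "\<exists>F\<in>level_resolutions TYPE('k::field_char_0) h. fst F = {#2, 2, 2, int e#}"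
proof -
  have c0: "card {m \<in> monset 0. \<not> square_mon e m} = 1"
  proof -
    have "{m \<in> monset 0. \<not> square_mon e m} = {0}" using e by (auto simp: monset_def mdeg_eq_0_iff square_mon_def)
    then show ?thesis by simp
  qed
  have e2: "2 \<le> e" "1 \<le> e" using e by auto
  have "map (\<lambda>d. card {m \<in> monset d. \<not> square_mon e m}) [0..<Suc e] = h"
  proof (rule nth_equalityI)
    fix d assume "d < length (map (\<lambda>d. card {m \<in> monset d. \<not> square_mon e m}) [0..<Suc e])"
    then have d: "d \<le> e" by simp
    consider "d = 0" | "1 \<le> d" "d < e" | "d = e" using d by linarith
    then have "card {m \<in> monset d. \<not> square_mon e m} = h ! d"
    proof cases
      case 1
      then show ?thesis using c0 h by simp
    next
      case 2
      then show ?thesis using card_square(1)[OF e2(1) 2] hi[OF 2] by simp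
    next
      case 3
      then show ?thesis using card_square(2)[OF e2(1), of 1] h(3) e by simp
    qed
    then show "map (\<lambda>d. card {m \<in> monset d. \<not> square_mon e m}) [0..<Suc e] ! d = h ! d"
      using d by (simp del: upt_Suc)
  qed (use h in simp)
  then have "h_vector (monideal (square_mon e) :: 'k poly3 set) = h" using level_square(2)[OF e2(1)] by simp
  from resolution_in_level_resolutions[OF level_square(1)[OF e2(1)] this resolution_square[OF e2(2)]]
  show ?thesis by (rule bexI[rotated]) simp_all
qed

theorem theorem4p4:
  fixes e :: nat and h :: "nat list" and j :: int
  assumes "e \<ge> 3"
    and "level_h_vector TYPE('k::field_char_0) h"
    and "length h = e + 1"
    and "h ! 0 = 1" and "h ! 1 = 3" and "h ! (e - 1) = 3" and "h ! e = 2"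
    and "j = int (h ! (e div 2))"
  shows "(j > 3 \<longrightarrow>
            (\<exists>!F. F \<in> level_resolutions TYPE('k) h) \<and>
            (\<forall>F \<in> level_resolutions TYPE('k) h.
               fst F = {#2, 2, j - 1, int e - j + 3, int e + 1#}))
       \<and> (j = 3 \<longleftrightarrow> (\<forall>i. 1 \<le> i \<and> i \<le> e - 1 \<longrightarrow> h ! i = 3))
       \<and> (j = 3 \<longrightarrow>
            card (level_resolutions TYPE('k) h) = 2 \<and>
            fst ` level_resolutions TYPE('k) h =
              (\<lambda>\<gamma>. {#2, 2, 2, int e#} + replicate_mset \<gamma> (int e + 1)) ` {0, 1})"
proof -
  let ?R = "level_resolutions TYPE('k) h"
  note h = assms(1,3,6,7)
  have m: "1 \<le> e div 2" "e div 2 \<le> e - 1" "e div 2 \<le> e" using assms(1) by auto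
  have jj: "level_type2.mid I e = j" if "level_type2 I e" "\<And>i. i \<le> e \<Longrightarrow> level_type2.hi I (int i) = int (h ! i)" for I :: "'k poly3 set"
    unfolding level_type2.mid_def[OF that(1)] assms(8) using that(2)[OF m(3)] .
  \<comment> \<open>One level algebra with this \<open>h\<close>-vector reveals the values of
    \<open>h\<close> between its ends; they are needed to match the monomial examples.\<close>
  obtain I0 :: "'k poly3 set" where I0: "level_algebra I0" "h_vector I0 = h"
    using assms(2) unfolding level_h_vector_def by blast
  note L0 = level_type2I[OF I0 h]
  have j0: "level_type2.mid I0 e = j" by (rule jj[OF L0])
  have large_h: "\<exists>p\<ge>1. 2 * p \<le> e \<and> j = int p + 2"
      "\<And>d. 1 \<le> d \<Longrightarrow> d \<le> e \<Longrightarrow> int (h ! d) = 2 + min (int d) (j - 2) - max 0 (int d - (int e - (j - 2)))" if "j > 3"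
    using level_type2.shape_large(1,2)[OF L0(1), unfolded j0] L0(2) that by auto
  have small_h: "h ! d = 3" if "j = 3" "1 \<le> d" "d \<le> e - 1" for d
    using level_type2.shape_small(1)[OF L0(1), unfolded j0, of d] L0(2)[of d] that by simp
  have small_iff: "j = 3 \<longleftrightarrow> (\<forall>i. 1 \<le> i \<and> i \<le> e - 1 \<longrightarrow> h ! i = 3)"
    using small_h m assms(8) by auto
  have large_fst: "fst F = {#2, 2, j - 1, int e - j + 3, int e + 1#}" if j: "j > 3" and F: "F \<in> ?R" for F
  proof (rule level_resolutionsE[OF F h])
    fix I :: "'k poly3 set"
    assume I: "level_type2 I e" "\<And>i. i \<le> e \<Longrightarrow> level_type2.hi I (int i) = int (h ! i)"
      "\<And>l. int (count (fst F) l) = num_gens I l"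
    have "level_type2.mid I e = j" by (rule jj[OF I(1,2)])
    from level_type2.shape_large(3)[OF I(1), unfolded this, OF j]
    show ?thesis by (intro count_eq_mset_eq) (simp only: I(3))
  qed
  have small_fst: "fst F \<in> (\<lambda>\<gamma>. {#2, 2, 2, int e#} + replicate_mset \<gamma> (int e + 1)) ` {0, 1}" if j: "j = 3" and F: "F \<in> ?R" for F
  proof (rule level_resolutionsE[OF F h])
    fix I :: "'k poly3 set"
    assume I: "level_type2 I e" "\<And>i. i \<le> e \<Longrightarrow> level_type2.hi I (int i) = int (h ! i)"
      "\<And>l. int (count (fst F) l) = num_gens I l"
    have "level_type2.mid I e = j" by (rule jj[OF I(1,2)])
    then have "level_type2.mid I e \<le> 3" using j by simp
    from level_type2.shape_small(2)[OF I(1) this]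
    obtain \<gamma> where \<gamma>: "\<gamma> \<in> {0, 1}" "\<forall>l. num_gens I l = int (count ({#2, 2, 2, int e#} + replicate_mset \<gamma> (int e + 1)) l)"
      by (rule bexE)
    have "fst F = {#2, 2, 2, int e#} + replicate_mset \<gamma> (int e + 1)"
      by (rule count_eq_mset_eq) (simp only: I(3) \<gamma>(2)[rule_format])
    then show ?thesis using \<gamma>(1) by (rule image_eqI)
  qed
  \<comment> \<open>\<open>F\<^sub>3\<close> is always the same and \<open>F\<^sub>2\<close> is a
    function of \<open>F\<^sub>1\<close> and \<open>h\<close>, so counting resolutions amounts to
    counting the possible \<open>F\<^sub>1\<close>.\<close>
  have inj: "F = F'" if F: "F \<in> ?R" and F': "F' \<in> ?R" and eq: "fst F = fst F'" for F F'
  proof (rule level_resolutionsE[OF F h], rule level_resolutionsE[OF F' h])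
    fix I I' :: "'k poly3 set"
    assume I: "level_type2 I e" "\<And>i. i \<le> e \<Longrightarrow> level_type2.hi I (int i) = int (h ! i)"
      "\<And>l. int (count (fst F) l) = num_gens I l" "snd (snd F) = {#int e + 3, int e + 3#}"
      "\<And>l. int (count (fst (snd F)) l) = num_gens I l + (if l = int e + 3 then 2 else 0) - (if l = 0 then 1 else 0)
           + (level_type2.hi I l - 3 * level_type2.hi I (l - 1) + 3 * level_type2.hi I (l - 2) - level_type2.hi I (l - 3))"
    assume I': "level_type2 I' e" "\<And>i. i \<le> e \<Longrightarrow> level_type2.hi I' (int i) = int (h ! i)"
      "\<And>l. int (count (fst F') l) = num_gens I' l" "snd (snd F') = {#int e + 3, int e + 3#}"
      "\<And>l. int (count (fst (snd F')) l) = num_gens I' l + (if l = int e + 3 then 2 else 0) - (if l = 0 then 1 else 0)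
           + (level_type2.hi I' l - 3 * level_type2.hi I' (l - 1) + 3 * level_type2.hi I' (l - 2) - level_type2.hi I' (l - 3))"
    have hi: "level_type2.hi I d = level_type2.hi I' d" for d
    proof -
      consider "d < 0" | "0 \<le> d" "d \<le> int e" | "d > int e" by linarith
      then show ?thesis
      proof cases
        case 1
        then show ?thesis using level_type2.hi_low(1)[OF I(1)] level_type2.hi_low(1)[OF I'(1)] by simp
      next
        case 2
        then show ?thesis using I(2)[of "nat d"] I'(2)[of "nat d"] by simp
      next
        case 3
        then show ?thesis using level_type2.hi_high[OF I(1)] level_type2.hi_high[OF I'(1)] by simp
      qed
    qed
    have ng: "num_gens I l = num_gens I' l" for l unfolding I(3)[symmetric] I'(3)[symmetric] eq ..
    have "fst (snd F) = fst (snd F')"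
      by (rule count_eq_mset_eq) (simp only: I(5) I'(5) hi ng)
    then show "F = F'" using eq I(4) I'(4) by (simp add: prod_eq_iff)
  qed
  have "(\<exists>!F. F \<in> ?R)" if j: "j > 3"
  proof -
    obtain p where p: "p \<ge> 1" "2 * p \<le> e" "j = int p + 2" using large_h(1)[OF j] by blast
    have "\<exists>F\<in>?R. fst F = {#2, 2, int p + 1, int e - int p + 1, int e + 1#}"
      using large_h(2)[OF j] unfolding p(3)
      by (intro level_resolutions_example_1[OF p(1,2) assms(3,4)]) simp
    then show ?thesis using inj large_fst[OF j] by metis
  qed
  moreover have "fst ` ?R = (\<lambda>\<gamma>. {#2, 2, 2, int e#} + replicate_mset \<gamma> (int e + 1)) ` {0, 1}" if j: "j = 3"
  proof
    \<comment> \<open>The value 3 up to degree \<open>e - 1\<close> and 2 in degree \<open>e\<close>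
      is the trapezoid with \<open>p = 1\<close>.\<close>
    have "int (h ! d) = 2 + min (int d) (int 1) - max 0 (int d - (int e - int 1))" if "1 \<le> d" "d \<le> e" for d
      using small_h[OF j that(1)] that assms(7) by (cases "d = e") auto
    then have "\<exists>F\<in>?R. fst F = {#2, 2, int 1 + 1, int e - int 1 + 1, int e + 1#}"
      using assms(1) by (intro level_resolutions_example_1[OF _ _ assms(3,4)]) simp_all
    then have 1: "{#2, 2, 2, int e, int e + 1#} \<in> fst ` ?R" by force
    have "\<exists>F\<in>?R. fst F = {#2, 2, 2, int e#}"
      by (rule level_resolutions_example_2[OF assms(1,3,4,7)]) (use small_h[OF j] in simp)
    then have 2: "{#2, 2, 2, int e#} \<in> fst ` ?R" by force
    show "(\<lambda>\<gamma>. {#2, 2, 2, int e#} + replicate_mset \<gamma> (int e + 1)) ` {0, 1} \<subseteq> fst ` ?R"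
      using 1 2 by (simp add: add_mset_commute)
    show "fst ` ?R \<subseteq> (\<lambda>\<gamma>. {#2, 2, 2, int e#} + replicate_mset \<gamma> (int e + 1)) ` {0, 1}"
      using small_fst[OF j] by blast
  qed
  moreover have "card ?R = 2" if "fst ` ?R = (\<lambda>\<gamma>. {#2, 2, 2, int e#} + replicate_mset \<gamma> (int e + 1)) ` {0, 1}"
  proof -
    have "inj_on fst ?R" using inj by (auto intro!: inj_onI)
    then have "card ?R = card (fst ` ?R)" by (rule card_image[symmetric])
    also have "\<dots> = 2" unfolding that by simp
    finally show ?thesis .
  qed
  ultimately show ?thesis using large_fst small_iff by blast
qed

end
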